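(* There is a universal constant $\delta_0>0$ such that for every $q=5^k$ with $k\in\mathbb{N}^+$, the complexes $\mathfrak{LB}_3^{\mathrm{sm}}(\mathbb{F}_q[x]_{\le1})$ and $\mathfrak{LB}_3^{\mathrm{lg}}(\mathbb{F}_q[x]_{\le1})$ (the vertex-links of the $B_3$-type coset complex $\mathfrak{B}^3_q(m)$ for $m\ge6$) are $2$-dimensional $\delta_0$-coboundary expanders; that is, each has $j$-coboundary expansion at least $\delta_0$ for $j=0$ and $j=1$.
   Context: **The complexes.** Let $q$ be an odd prime power, $m\ge 6$, $p(x)\in\mathbb{F}_q[x]$ irreducible of degree $m$, and $\mathfrak{F}=\mathbb{F}_q[x]/(p(x))\cong\mathbb{F}_{q^m}$. The root system $B_3$ consists of all integer vectors in $\mathbb{R}^3$ of length $1$ or $\sqrt2$. Put $\alpha=(1,-1,0)$, $\beta=(0,1,-1)$, $\psi=(0,0,1)$, $\omega=-(\alpha+\beta+\psi)=(-1,0,0)$. Let $B_3(\mathfrak{F})$ be the universal Chevalley group of type $B_3$ over $\mathfrak{F}$ with its usual root elements $x_\zeta(t)$ ($\zeta\in B_3$, $t\in\mathfrak{F}$), which satisfy $x_\zeta(t)x_\zeta(u)=x_\zeta(t+u)$ and the Chevalley commutator relations. For linearly independent $I\subset B_3$ let $U_I(\mathbb{F}_q[x]_{\le1})$ be the subgroup of $B_3(\mathfrak{F})$ generated by all $x_\zeta(a+bx)$, $\zeta\in I$, $a,b\in\mathbb{F}_q$ (up to isomorphism, for $m\ge6$, the groups used here do not depend on $m$ or $p$).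 For a group $\Gamma$ with subgroups $K_0,K_1,K_2$, the coset complex $\mathcal{CC}(\Gamma;\{K_0,K_1,K_2\})$ is the $2$-dimensional simplicial complex on the vertex set $\Gamma/K_0\sqcup\Gamma/K_1\sqcup\Gamma/K_2$ (left cosets) whose maximal faces are the triples $\{gK_0,gK_1,gK_2\}$, $g\in\Gamma$. For a $3$-element linearly independent $I$, put $\mathfrak{L}_I=\mathcal{CC}\bigl(U_I(\mathbb{F}_q[x]_{\le1});\{U_{I\setminus\{\zeta\}}(\mathbb{F}_q[x]_{\le1}):\zeta\in I\}\bigr)$. Then $\mathfrak{LB}_3^{\mathrm{sm}}(\mathbb{F}_q[x]_{\le1})=\mathfrak{L}_{\{\beta,\psi,\omega\}}$ and $\mathfrak{LB}_3^{\mathrm{lg}}(\mathbb{F}_q[x]_{\le1})=\mathfrak{L}_{\{\alpha,\beta,\psi\}}$. Both are weighted by the uniform distribution on triangles. ($\mathfrak{B}^3_q(m)$ is the analogous $3$-dimensional coset complex of the group $B_3(\mathfrak{F})$ with respect to the four subgroups $U_{\mathcal{S}\setminus\{\eta\}}(\mathbb{F}_q[x]_{\le1})$, $\eta\in\mathcal{S}=\{\alpha,\beta,\psi,\omega\}$.) **Expansion.** Let $X$ be a pure $d$-dimensional simplicial complex with a probability distribution $\pi_d$ on $X(d)$, where $X(j)$ is the set of faces of cardinality $j+1$ ($X(-1)=\{\emptyset\}$). For $j<d$, $\pi_j$ is the law of a uniformly random $(j+1)$-subset of a face drawn from $\pi_d$. A $j$-chain is a function $f:X(j)\to\mathbb{F}_2$;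 $\mathrm{dist}(f,f')=\Pr_{\sigma\sim\pi_j}[f(\sigma)\ne f'(\sigma)]$, and the distance to a set of chains is the minimum. The coboundary is $\delta_jf(\tau)=\sum_{\sigma\subset\tau,\ \sigma\in X(j)}f(\sigma)$ for $\tau\in X(j+1)$; $Z^j=\ker\delta_j$, $B^j=\mathrm{Im}\,\delta_{j-1}$. $X$ has $j$-cocycle expansion at least $\varepsilon$ if for every $v\ge0$ and every $j$-chain $f$ with $\mathrm{dist}(f,Z^j)>v$ one has $\mathrm{dist}(\delta_jf,0)>\varepsilon v$. It has $j$-coboundary expansion at least $\varepsilon$ if it has $j$-cocycle expansion at least $\varepsilon$ and $Z^j=B^j$. *)

theory Defs
  imports
    "HOL-Probability.Probability_Mass_Function"
    "HOL-Library.Z2"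
    "HOL-Library.Product_Plus"
    "HOL-Algebra.Generated_Groups"
    "HOL-Algebra.Polynomial_Divisibility"
begin

section \<open>The root system \<open>B\<^sub>3\<close> and the spin representation\<close>

type_synonym vec3 = "int \<times> int \<times> int"

fun ip :: "vec3 \<Rightarrow> vec3 \<Rightarrow> int" where
  "ip (a, b, c) (a', b', c') = a * a' + b * b' + c * c'"

definition B3_roots :: "vec3 set" where
  "B3_roots = {\<zeta>. ip \<zeta> \<zeta> \<in> {1, 2}}"

definition root_alpha :: vec3 where "root_alpha = (1, -1, 0)"
definition root_beta :: vec3 where "root_beta = (0, 1, -1)"
definition root_psi :: vec3 where "root_psi = (0, 0, 1)"
definition root_omega :: vec3 where "root_omega = - (root_alpha + root_beta + root_psi)"

text \<open>
  We use Steinberg's construction of a Chevalley group from a faithful representation of the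
  complex simple Lie algebra: the group over a field \<open>K\<close> is generated by the exponentials
  \<open>x\<^sub>\<zeta>(t) = exp (t X\<^sub>\<zeta>)\<close> of the root vectors of a Chevalley basis, acting on an admissible lattice
  tensored with \<open>K\<close>. It is the universal one iff the weights of the representation span the full
  weight lattice. For \<open>B\<^sub>3\<close> we take the 8-dimensional spin representation, whose weights
  \<open>(\<plusminus>1/2, \<plusminus>1/2, \<plusminus>1/2)\<close> span the full weight lattice.

  The set \<open>spin_weights\<close> contains the weights multiplied by 2. The root vector \<open>X\<^sub>\<zeta>\<close> sends the basis
  vector of weight \<open>\<nu>\<close> to \<open>\<plusminus>\<close> the one of weight \<open>\<nu> + \<zeta>\<close> if the latter is a weight, and to 0
  otherwise. The sign is the product of the \<open>\<nu>\<^sub>k\<close> over those \<open>k\<close> with \<open>\<zeta>\<^sub>k = 0\<close> for which an odd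
  number of \<open>l < k\<close> have \<open>\<zeta>\<^sub>l \<noteq> 0\<close>; these are, up to the sign of each \<open>X\<^sub>\<zeta>\<close>, the signs of the
  Clifford action on the exterior algebra of a 3-dimensional space. The lemmas
  \<open>root_vector_opposite\<close>, \<open>root_vector_bracket\<close> and \<open>root_vector_commute\<close> say that the \<open>X\<^sub>\<zeta>\<close> are the
  root vectors of a Chevalley basis, and \<open>root_vector_square\<close> gives \<open>exp (t X\<^sub>\<zeta>) = 1 + t X\<^sub>\<zeta>\<close>.
\<close>

definition spin_weights :: "vec3 set" where
  "spin_weights = {-1, 1} \<times> {-1, 1} \<times> {-1, 1}"

fun spin_sign :: "vec3 \<Rightarrow> vec3 \<Rightarrow> int" where
  "spin_sign (a, b, c) (n1, n2, n3) =
     (if a \<noteq> 0 \<and> b = 0 then n2 else 1) * (if (a = 0) \<noteq> (b = 0) \<and> c = 0 then n3 else 1)"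

text \<open>In a matrix, the first index (here \<open>\<mu>\<close>) is the row and the second one (here \<open>\<nu>\<close>) the column.\<close>

definition root_vector :: "vec3 \<Rightarrow> vec3 \<Rightarrow> vec3 \<Rightarrow> int" where
  "root_vector \<zeta> \<mu> \<nu> = (if \<mu> = \<nu> + \<zeta> + \<zeta> then spin_sign \<zeta> \<nu> else 0)"

definition rv_prod :: "vec3 \<Rightarrow> vec3 \<Rightarrow> vec3 \<Rightarrow> vec3 \<Rightarrow> int" where
  "rv_prod \<zeta> \<eta> \<mu> \<nu> = (\<Sum>\<kappa>\<in>spin_weights. root_vector \<zeta> \<mu> \<kappa> * root_vector \<eta> \<kappa> \<nu>)"

definition rv_bracket :: "vec3 \<Rightarrow> vec3 \<Rightarrow> vec3 \<Rightarrow> vec3 \<Rightarrow> int" where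
  "rv_bracket \<zeta> \<eta> \<mu> \<nu> = rv_prod \<zeta> \<eta> \<mu> \<nu> - rv_prod \<eta> \<zeta> \<mu> \<nu>"

definition weight_list :: "vec3 list" where
  "weight_list = List.product [-1, 1] (List.product [-1, 1] [-1, 1])"

definition root_list :: "vec3 list" where
  "root_list = [(1,0,0), (-1,0,0), (0,1,0), (0,-1,0), (0,0,1), (0,0,-1),
    (1,1,0), (1,-1,0), (-1,1,0), (-1,-1,0), (1,0,1), (1,0,-1), (-1,0,1), (-1,0,-1),
    (0,1,1), (0,1,-1), (0,-1,1), (0,-1,-1)]"

lemma set_weight_list: "set weight_list = spin_weights"
  by (auto simp: weight_list_def spin_weights_def)

lemma set_root_list: "set root_list = B3_roots"
proof
  show "set root_list \<subseteq> B3_roots" by (simp add: root_list_def B3_roots_def)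
next
  have sq: "y = -1 \<or> y = 0 \<or> y = 1" if "y * y \<le> 2" for y :: int
  proof -
    have "\<bar>y\<bar> < 2"
    proof (rule ccontr)
      assume "\<not> \<bar>y\<bar> < 2"
      then have "2 * 2 \<le> \<bar>y\<bar> * \<bar>y\<bar>" by (intro mult_mono) auto
      with that show False by simp
    qed
    then show ?thesis by auto
  qed
  show "B3_roots \<subseteq> set root_list"
  proof
    fix \<zeta> assume "\<zeta> \<in> B3_roots"
    obtain a b c where z: "\<zeta> = (a, b, c)" by (cases \<zeta>)
    have n: "a * a + b * b + c * c = 1 \<or> a * a + b * b + c * c = 2"
      using \<open>\<zeta> \<in> B3_roots\<close> by (simp add: z B3_roots_def)
    have nn: "0 \<le> a * a" "0 \<le> b * b" "0 \<le> c * c" by auto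
    have "a * a \<le> 2" "b * b \<le> 2" "c * c \<le> 2" using n nn by linarith+
    note this[THEN sq]
    then show "\<zeta> \<in> set root_list" using n by (elim disjE) (simp_all add: z root_list_def)
  qed
qed

definition rv_entry :: "vec3 \<Rightarrow> vec3 \<Rightarrow> vec3 \<Rightarrow> int" where
  "rv_entry \<zeta> \<eta> \<nu> = (if List.member weight_list (\<nu> + \<eta> + \<eta>)
     then spin_sign \<zeta> (\<nu> + \<eta> + \<eta>) * spin_sign \<eta> \<nu> else 0)"

lemma rv_prod_eq:
  assumes "\<mu> \<in> spin_weights"
  shows "rv_prod \<zeta> \<eta> \<mu> \<nu> = (if \<mu> = \<nu> + \<eta> + \<eta> + \<zeta> + \<zeta> then rv_entry \<zeta> \<eta> \<nu> else 0)"
proof -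
  have "rv_prod \<zeta> \<eta> \<mu> \<nu> =
      (\<Sum>\<kappa>\<in>spin_weights. if \<kappa> = \<nu> + \<eta> + \<eta> then root_vector \<zeta> \<mu> \<kappa> * spin_sign \<eta> \<nu> else 0)"
    unfolding rv_prod_def root_vector_def by (intro sum.cong) auto
  also have "\<dots> = (if \<nu> + \<eta> + \<eta> \<in> spin_weights
      then root_vector \<zeta> \<mu> (\<nu> + \<eta> + \<eta>) * spin_sign \<eta> \<nu> else 0)"
    by (subst sum.delta) (auto simp: spin_weights_def)
  finally show ?thesis
    by (simp add: root_vector_def rv_entry_def set_weight_list List.member_iff)
qed

lemma rv_bracket_eq:
  assumes "\<mu> \<in> spin_weights"
  shows "rv_bracket \<zeta> \<eta> \<mu> \<nu> =
    (if \<mu> = \<nu> + (\<zeta> + \<eta>) + (\<zeta> + \<eta>) then rv_entry \<zeta> \<eta> \<nu> - rv_entry \<eta> \<zeta> \<nu> else 0)"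
  unfolding rv_bracket_def rv_prod_eq[OF assms] by (auto simp: algebra_simps)

lemma root_vector_square:
  assumes "\<zeta> \<in> B3_roots" "\<mu> \<in> spin_weights" "\<nu> \<in> spin_weights"
  shows "rv_prod \<zeta> \<zeta> \<mu> \<nu> = 0"
proof -
  have "list_all (\<lambda>\<zeta>. list_all (\<lambda>\<nu>.
      List.member weight_list (\<nu> + \<zeta> + \<zeta> + \<zeta> + \<zeta>) \<longrightarrow> rv_entry \<zeta> \<zeta> \<nu> = 0) weight_list) root_list"
    by code_simp
  then show ?thesis
    using assms by (auto simp: list_all_iff set_root_list set_weight_list List.member_iff rv_prod_eq)
qed

lemma root_vector_opposite:
  assumes "\<zeta> \<in> B3_roots" "\<mu> \<in> spin_weights" "\<nu> \<in> spin_weights"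
  shows "ip \<zeta> \<zeta> * rv_bracket \<zeta> (- \<zeta>) \<mu> \<nu> = (if \<mu> = \<nu> then ip \<nu> \<zeta> else 0)"
proof -
  have "list_all (\<lambda>\<zeta>. list_all (\<lambda>\<nu>.
      ip \<zeta> \<zeta> * (rv_entry \<zeta> (- \<zeta>) \<nu> - rv_entry (- \<zeta>) \<zeta> \<nu>) = ip \<nu> \<zeta>) weight_list) root_list"
    by code_simp
  then show ?thesis
    using assms by (simp add: list_all_iff set_root_list set_weight_list rv_bracket_eq)
qed

definition bracket_ok :: "vec3 \<Rightarrow> vec3 \<Rightarrow> int \<Rightarrow> vec3 \<Rightarrow> bool" where
  "bracket_ok \<zeta> \<eta> s \<nu> =
    (if List.member weight_list (\<nu> + (\<zeta> + \<eta>) + (\<zeta> + \<eta>))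
     then rv_entry \<zeta> \<eta> \<nu> - rv_entry \<eta> \<zeta> \<nu> =
       s * (if ip \<zeta> \<zeta> = 1 \<and> ip \<eta> \<eta> = 1 then 2 else 1) * spin_sign (\<zeta> + \<eta>) \<nu>
     else True)"

definition brackets_ok :: "vec3 \<Rightarrow> vec3 \<Rightarrow> bool" where
  "brackets_ok \<zeta> \<eta> =
    (if ip (\<zeta> + \<eta>) (\<zeta> + \<eta>) = 1 \<or> ip (\<zeta> + \<eta>) (\<zeta> + \<eta>) = 2
     then list_all (bracket_ok \<zeta> \<eta> 1) weight_list \<or> list_all (bracket_ok \<zeta> \<eta> (-1)) weight_list
     else if \<zeta> + \<eta> = (0, 0, 0) then True
     else list_all (bracket_ok \<zeta> \<eta> 0) weight_list)"

lemma brackets_ok: "\<zeta> \<in> B3_roots \<Longrightarrow> \<eta> \<in> B3_roots \<Longrightarrow> brackets_ok \<zeta> \<eta>"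
proof -
  have "list_all (\<lambda>\<zeta>. list_all (brackets_ok \<zeta>) root_list) root_list"
    by code_simp
  then show "\<zeta> \<in> B3_roots \<Longrightarrow> \<eta> \<in> B3_roots \<Longrightarrow> brackets_ok \<zeta> \<eta>"
    by (simp add: list_all_iff set_root_list)
qed

lemma rv_bracket_ok:
  assumes "list_all (bracket_ok \<zeta> \<eta> s) weight_list" "\<mu> \<in> spin_weights" "\<nu> \<in> spin_weights"
  shows "rv_bracket \<zeta> \<eta> \<mu> \<nu> =
    s * (if ip \<zeta> \<zeta> = 1 \<and> ip \<eta> \<eta> = 1 then 2 else 1) * root_vector (\<zeta> + \<eta>) \<mu> \<nu>"
proof (cases "\<mu> = \<nu> + (\<zeta> + \<eta>) + (\<zeta> + \<eta>)")
  case True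
  have "bracket_ok \<zeta> \<eta> s \<nu>"
    using assms(1,3) by (simp add: list_all_iff set_weight_list)
  moreover have "List.member weight_list (\<nu> + (\<zeta> + \<eta>) + (\<zeta> + \<eta>))"
    using True assms(2) by (simp only: List.member_iff set_weight_list)
  ultimately show ?thesis
    unfolding rv_bracket_eq[OF assms(2)] root_vector_def bracket_ok_def by (simp only: True if_True simp_thms)
next
  case False
  then show ?thesis
    unfolding rv_bracket_eq[OF assms(2)] root_vector_def by (simp only: if_False mult_zero_right)
qed

lemma root_vector_bracket:
  assumes "\<zeta> \<in> B3_roots" "\<eta> \<in> B3_roots" "\<zeta> + \<eta> \<in> B3_roots"
  shows "\<exists>s\<in>{1, -1}. \<forall>\<mu>\<in>spin_weights. \<forall>\<nu>\<in>spin_weights. rv_bracket \<zeta> \<eta> \<mu> \<nu> =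
    s * (if ip \<zeta> \<zeta> = 1 \<and> ip \<eta> \<eta> = 1 then 2 else 1) * root_vector (\<zeta> + \<eta>) \<mu> \<nu>"
proof -
  have "ip (\<zeta> + \<eta>) (\<zeta> + \<eta>) = 1 \<or> ip (\<zeta> + \<eta>) (\<zeta> + \<eta>) = 2"
    using assms(3) by (simp add: B3_roots_def)
  then have "list_all (bracket_ok \<zeta> \<eta> 1) weight_list \<or> list_all (bracket_ok \<zeta> \<eta> (-1)) weight_list"
    using brackets_ok[OF assms(1,2)] unfolding brackets_ok_def by (simp only: if_True)
  then obtain s where "s \<in> {1, -1}" "list_all (bracket_ok \<zeta> \<eta> s) weight_list" by blast
  then show ?thesis using rv_bracket_ok by blast
qed

lemma root_vector_commute:
  assumes "\<zeta> \<in> B3_roots" "\<eta> \<in> B3_roots" "\<zeta> + \<eta> \<notin> B3_roots" "\<zeta> + \<eta> \<noteq> 0"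
    "\<mu> \<in> spin_weights" "\<nu> \<in> spin_weights"
  shows "rv_bracket \<zeta> \<eta> \<mu> \<nu> = 0"
proof -
  have n: "\<not> (ip (\<zeta> + \<eta>) (\<zeta> + \<eta>) = 1 \<or> ip (\<zeta> + \<eta>) (\<zeta> + \<eta>) = 2)" "\<not> \<zeta> + \<eta> = (0, 0, 0)"
    using assms(3,4) by (simp_all add: B3_roots_def zero_prod_def)
  have "list_all (bracket_ok \<zeta> \<eta> 0) weight_list"
    using brackets_ok[OF assms(1,2)] unfolding brackets_ok_def by (simp only: n if_False)
  from rv_bracket_ok[OF this assms(5,6)] show ?thesis by simp
qed


section \<open>The universal Chevalley group of type \<open>B\<^sub>3\<close>\<close>

definition mat_monoid :: "('a, 'b) ring_scheme \<Rightarrow> 'i set \<Rightarrow> ('i \<times> 'i \<Rightarrow> 'a) monoid" where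
  "mat_monoid R W =
     \<lparr>carrier = W \<times> W \<rightarrow>\<^sub>E carrier R,
      mult = (\<lambda>A B. \<lambda>(i, j)\<in>W \<times> W. \<Oplus>\<^bsub>R\<^esub>k\<in>W. A (i, k) \<otimes>\<^bsub>R\<^esub> B (k, j)),
      one = (\<lambda>(i, j)\<in>W \<times> W. if i = j then \<one>\<^bsub>R\<^esub> else \<zero>\<^bsub>R\<^esub>)\<rparr>"

definition GL :: "('a, 'b) ring_scheme \<Rightarrow> 'i set \<Rightarrow> ('i \<times> 'i \<Rightarrow> 'a) monoid" where
  "GL R W = units_of (mat_monoid R W)"

definition root_elem :: "('a, 'b) ring_scheme \<Rightarrow> vec3 \<Rightarrow> 'a \<Rightarrow> (vec3 \<times> vec3 \<Rightarrow> 'a)" where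
  "root_elem R \<zeta> t =
     (\<lambda>(\<mu>, \<nu>)\<in>spin_weights \<times> spin_weights.
        (if \<mu> = \<nu> then \<one>\<^bsub>R\<^esub> else \<zero>\<^bsub>R\<^esub>) \<oplus>\<^bsub>R\<^esub> [root_vector \<zeta> \<mu> \<nu>] \<cdot>\<^bsub>R\<^esub> t)"

definition chevalley_B3 :: "('a, 'b) ring_scheme \<Rightarrow> (vec3 \<times> vec3 \<Rightarrow> 'a) monoid" where
  "chevalley_B3 R = (GL R spin_weights)
     \<lparr>carrier := generate (GL R spin_weights)
        {root_elem R \<zeta> t | \<zeta> t. \<zeta> \<in> B3_roots \<and> t \<in> carrier R}\<rparr>"

text \<open>
  Here \<open>F\<close> plays the role of the field with \<open>q\<close> elements and \<open>p\<close> is a polynomial over \<open>F\<close>; the field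
  \<open>F[x]/(p)\<close> is \<open>Rupt\<^bsub>F\<^esub> (carrier F) p\<close>. The set \<open>linear_classes F p\<close> consists of the classes of the
  polynomials \<open>a + b x\<close> (the library's degree of the zero polynomial is 0).

  The main statement chooses its universal constant before the field. HOL cannot quantify over
  types inside a formula, so there \<open>F\<close> ranges over the fields whose carrier is a set of natural
  numbers; every finite field is isomorphic to such a field.
\<close>

definition linear_classes :: "('a, 'b) ring_scheme \<Rightarrow> 'a list \<Rightarrow> 'a list set set" where
  "linear_classes F p =
     {(PIdl\<^bsub>(carrier F)[X]\<^bsub>F\<^esub>\<^esub> p) +>\<^bsub>(carrier F)[X]\<^bsub>F\<^esub>\<^esub> f | f.
        f \<in> carrier ((carrier F)[X]\<^bsub>F\<^esub>) \<and> Polynomials.degree f \<le> 1}"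

definition root_subgroup ::
  "('a, 'b) ring_scheme \<Rightarrow> 'a list \<Rightarrow> vec3 set \<Rightarrow> (vec3 \<times> vec3 \<Rightarrow> 'a list set) set" where
  "root_subgroup F p I =
     generate (chevalley_B3 (Rupt\<^bsub>F\<^esub> (carrier F) p))
       {root_elem (Rupt\<^bsub>F\<^esub> (carrier F) p) \<zeta> t | \<zeta> t. \<zeta> \<in> I \<and> t \<in> linear_classes F p}"


section \<open>Coset complexes\<close>

text \<open>
  A simplicial complex is given by the set of all its faces, including the empty one. The vertices
  of a coset complex are tagged with the index of the subgroup, so that their union is disjoint.
\<close>

definition coset_complex ::
  "('g, 'b) monoid_scheme \<Rightarrow> 'i set \<Rightarrow> ('i \<Rightarrow> 'g set) \<Rightarrow> ('i \<times> 'g set) set set" where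
  "coset_complex G I K =
     {\<sigma>. \<exists>g\<in>carrier G. \<sigma> \<subseteq> {(i, g <#\<^bsub>G\<^esub> K i) | i. i \<in> I}}"

definition link_complex ::
  "('a, 'b) ring_scheme \<Rightarrow> 'a list \<Rightarrow> vec3 set
     \<Rightarrow> (vec3 \<times> (vec3 \<times> vec3 \<Rightarrow> 'a list set) set) set set" where
  "link_complex F p I =
     coset_complex
       ((chevalley_B3 (Rupt\<^bsub>F\<^esub> (carrier F) p))\<lparr>carrier := root_subgroup F p I\<rparr>)
       I (\<lambda>\<zeta>. root_subgroup F p (I - {\<zeta>}))"

definition LB3_sm ::
  "('a, 'b) ring_scheme \<Rightarrow> 'a list \<Rightarrow> (vec3 \<times> (vec3 \<times> vec3 \<Rightarrow> 'a list set) set) set set" where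
  "LB3_sm F p = link_complex F p {root_beta, root_psi, root_omega}"

definition LB3_lg ::
  "('a, 'b) ring_scheme \<Rightarrow> 'a list \<Rightarrow> (vec3 \<times> (vec3 \<times> vec3 \<Rightarrow> 'a list set) set) set set" where
  "LB3_lg F p = link_complex F p {root_alpha, root_beta, root_psi}"


section \<open>Coboundary expansion\<close>

text \<open>
  \<open>faces S j\<close> is the set of faces of cardinality \<open>j + 1\<close>, so \<open>j\<close> ranges over the integers \<open>\<ge> -1\<close>.
  Chains are functions with values in the field with two elements (type \<open>bit\<close>) that are extensional,
  that is, undefined outside of \<open>faces S j\<close>.
\<close>

definition faces :: "'v set set \<Rightarrow> int \<Rightarrow> 'v set set" where
  "faces S j = {\<sigma> \<in> S. finite \<sigma> \<and> int (card \<sigma>) = j + 1}"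

definition face_pmf :: "'v set pmf \<Rightarrow> int \<Rightarrow> 'v set pmf" where
  "face_pmf \<pi> j = bind_pmf \<pi> (\<lambda>\<tau>. pmf_of_set {\<sigma>. \<sigma> \<subseteq> \<tau> \<and> int (card \<sigma>) = j + 1})"

definition chains :: "'v set set \<Rightarrow> int \<Rightarrow> ('v set \<Rightarrow> bit) set" where
  "chains S j = faces S j \<rightarrow>\<^sub>E UNIV"

definition zero_chain :: "'v set set \<Rightarrow> int \<Rightarrow> 'v set \<Rightarrow> bit" where
  "zero_chain S j = (\<lambda>\<sigma>\<in>faces S j. 0)"

definition coboundary :: "'v set set \<Rightarrow> int \<Rightarrow> ('v set \<Rightarrow> bit) \<Rightarrow> 'v set \<Rightarrow> bit" where
  "coboundary S j f = (\<lambda>\<tau>\<in>faces S (j + 1). \<Sum>\<sigma> | \<sigma> \<in> faces S j \<and> \<sigma> \<subset> \<tau>. f \<sigma>)"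

definition cocycles :: "'v set set \<Rightarrow> int \<Rightarrow> ('v set \<Rightarrow> bit) set" where
  "cocycles S j = {f \<in> chains S j. coboundary S j f = zero_chain S (j + 1)}"

definition coboundaries :: "'v set set \<Rightarrow> int \<Rightarrow> ('v set \<Rightarrow> bit) set" where
  "coboundaries S j = coboundary S (j - 1) ` chains S (j - 1)"

definition chain_dist ::
  "'v set pmf \<Rightarrow> int \<Rightarrow> ('v set \<Rightarrow> bit) \<Rightarrow> ('v set \<Rightarrow> bit) \<Rightarrow> real" where
  "chain_dist \<pi> j f f' = measure_pmf.prob (face_pmf \<pi> j) {\<sigma>. f \<sigma> \<noteq> f' \<sigma>}"

definition chain_setdist ::
  "'v set pmf \<Rightarrow> int \<Rightarrow> ('v set \<Rightarrow> bit) \<Rightarrow> ('v set \<Rightarrow> bit) set \<Rightarrow> real" where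
  "chain_setdist \<pi> j f Z = (INF f'\<in>Z. chain_dist \<pi> j f f')"

definition cocycle_expansion_at_least ::
  "'v set set \<Rightarrow> 'v set pmf \<Rightarrow> int \<Rightarrow> real \<Rightarrow> bool" where
  "cocycle_expansion_at_least S \<pi> j \<epsilon> \<longleftrightarrow>
     (\<forall>v\<ge>0. \<forall>f\<in>chains S j. chain_setdist \<pi> j f (cocycles S j) > v \<longrightarrow>
        chain_dist \<pi> (j + 1) (coboundary S j f) (zero_chain S (j + 1)) > \<epsilon> * v)"

definition coboundary_expansion_at_least ::
  "'v set set \<Rightarrow> 'v set pmf \<Rightarrow> int \<Rightarrow> real \<Rightarrow> bool" where
  "coboundary_expansion_at_least S \<pi> j \<epsilon> \<longleftrightarrow>
     cocycle_expansion_at_least S \<pi> j \<epsilon> \<and> cocycles S j = coboundaries S j"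

definition triangle_pmf :: "'v set set \<Rightarrow> 'v set pmf" where
  "triangle_pmf S = pmf_of_set (faces S 2)"

end

theory Submission
  imports Defs
begin

text \<open>
  Let \<open>G\<close> be the group of the link, generated by three root groups \<open>A\<close>, \<open>B\<close>, \<open>C\<close>. On the triangle \<open>g\<close> a
  1-chain \<open>f\<close> has three values, and the two values \<open>e\<^sub>2 g\<close> and \<open>e\<^sub>3 g\<close> on the edges at the vertex of
  type \<open>\<langle>B, C\<rangle>\<close> determine the third one unless the triangle violates the cocycle condition. With \<open>e\<^sub>1 = 0\<close>,
  right translation by \<open>k\<close> lifts to the wreath product of the group of order 2 with the permutations of \<open>G\<close>
  as the pair \<open>T\<^sub>j k\<close> of the translation and the function \<open>h \<mapsto> e\<^sub>j h + e\<^sub>j (h k)\<close>. Up to errors at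
  a number of points that is linear in the number of violated triangles, the three lifts agree on the
  root groups that they share. So the root groups generate a group that maps to \<open>G\<close>, and \<open>f\<close> is close to
  a coboundary if this map is injective, again up to such errors.

  The kernel is an abelian group of exponent 2, whereas the root groups have exponent 5. Therefore
  a commutator of lifts that is trivial in \<open>G\<close> vanishes as soon as it commutes with one of its
  arguments, and with this all relations that are needed lift from the subgroups \<open>\<langle>A, B\<rangle>\<close>, \<open>\<langle>A, C\<rangle>\<close>,
  \<open>\<langle>B, C\<rangle>\<close>. They make the generated group a 5-group, so the kernel is trivial. Working with families
  indexed by all fields and all chains at once, instead of with a single one, turns the vanishing of the
  kernel into a constant that is uniform in the field, because \<open>G\<close> is boundedly generated by
  the root groups, with a bound that comes from counting dimensions over the field with \<open>q\<close> elements.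
\<close>

section \<open>Commutator calculus in groups\<close>

text \<open>The obstacle is formed by the relations that involve all three root groups: they hold in
  the link group, but are not among those of its rank-2 subgroups, so they need not hold for the
  lifts. Coprimality replaces their derivation. Chains take values in the field with two elements,
  so the kernel has exponent 2. A known relation holds for the lifts up to a kernel element; if this
  element is a commutator [a, b] that commutes with a, then its fifth power is [a^5, b] = 1, and it
  is trivial. To make it commute with a, one finds two elements that commute with it and have
  product a^2, usually a^v and a^(v^-1); a^2 generates the same group as a. The prime 5 enters once
  more in the small link: the product of the conjugates of a by b^0, ..., b^4 is trivial, because
  its exponents 5, 10 and 10 (sums of binomial coefficients) are divisible by 5. No derivation is
  counted, so the constant is not explicit. If the bounds were not uniform, the worst instances at
  all indices would form a single family that contradicts the trivial kernel.\<close>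

class group_mult = monoid_mult + inverse +
  assumes inverse_mult_self: "inverse a * a = 1"
begin

lemma inverse_mult_cancel: "inverse a * (a * b) = b"
  by (simp add: mult.assoc[symmetric] inverse_mult_self)

lemma mult_left_eq_iff: "a * b = a * c \<longleftrightarrow> b = c"
  by (metis inverse_mult_cancel)

lemma mult_inverse_self: "a * inverse a = 1"
  by (metis inverse_mult_cancel inverse_mult_self mult_1_right)

lemma mult_inverse_cancel: "a * (inverse a * b) = b"
  by (simp add: mult.assoc[symmetric] mult_inverse_self)

lemma inverse_unique_left: "a * b = 1 \<Longrightarrow> inverse a = b"
  by (metis inverse_mult_cancel mult_1_right)

lemma inverse_involutive: "inverse (inverse a) = a"
  by (rule inverse_unique_left) (rule inverse_mult_self)

lemma inverse_mult_rev: "inverse (a * b) = inverse b * inverse a"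
  by (rule inverse_unique_left) (simp add: mult.assoc mult_inverse_cancel mult_inverse_self)

lemma inverse_one: "inverse 1 = 1"
  by (rule inverse_unique_left) simp

lemmas group_simps = mult.assoc inverse_mult_self inverse_mult_cancel mult_inverse_self
  mult_inverse_cancel inverse_involutive inverse_mult_rev inverse_one

definition commutes :: "'a \<Rightarrow> 'a \<Rightarrow> bool" where
  "commutes x y \<longleftrightarrow> x * y = y * x"

definition conjug :: "'a \<Rightarrow> 'a \<Rightarrow> 'a" where
  "conjug x y = inverse y * x * y"

definition commut :: "'a \<Rightarrow> 'a \<Rightarrow> 'a" where
  "commut x y = inverse x * inverse y * x * y"

lemma commutes_sym: "commutes x y \<Longrightarrow> commutes y x"
  by (simp add: commutes_def)

lemma commutes_refl: "commutes x x"
  by (simp add: commutes_def)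

lemma commutes_one: "commutes x 1"
  by (simp add: commutes_def)

lemma commutes_mult: "commutes x y \<Longrightarrow> commutes x z \<Longrightarrow> commutes x (y * z)"
  unfolding commutes_def by (metis mult.assoc)

lemma commutes_inverse: "commutes x y \<Longrightarrow> commutes x (inverse y)"
  unfolding commutes_def by (metis group_simps(3) group_simps(4) mult.assoc mult_1_right)

lemma commutes_power: "commutes x y \<Longrightarrow> commutes x (y ^ n)"
  by (induction n) (auto intro: commutes_mult commutes_one)

lemma conjug_eq_iff_commutes: "conjug x y = x \<longleftrightarrow> commutes x y"
  unfolding commutes_def conjug_def by (metis mult.assoc mult_inverse_cancel inverse_mult_cancel)

lemma conjug_mult: "conjug (x * y) z = conjug x z * conjug y z"
  by (simp add: conjug_def group_simps)

lemma conjug_inverse: "conjug (inverse x) y = inverse (conjug x y)"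
  by (simp add: conjug_def group_simps)

lemma conjug_one: "conjug 1 x = 1"
  by (simp add: conjug_def group_simps)

lemma conjug_by_one: "conjug x 1 = x"
  by (simp add: conjug_def group_simps)

lemma conjug_power: "conjug (x ^ n) y = conjug x y ^ n"
  by (induction n) (simp_all add: conjug_mult conjug_one)

lemma conjug_conjug: "conjug (conjug x y) z = conjug x (y * z)"
  by (simp add: conjug_def group_simps)

lemma conjug_inverse_cancel: "conjug (conjug x y) (inverse y) = x" "conjug (conjug x (inverse y)) y = x"
  by (simp_all add: conjug_def group_simps)

lemma commutes_conjug_iff: "commutes (conjug x z) (conjug y z) \<longleftrightarrow> commutes x y"
  unfolding commutes_def by (metis conjug_mult conjug_inverse_cancel(1))

lemma commutes_conjug: "commutes x y \<Longrightarrow> commutes x z \<Longrightarrow> commutes x (conjug y z)"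
  by (simp add: conjug_def commutes_mult commutes_inverse)

lemma commutes_commut: "commutes x y \<Longrightarrow> commutes x z \<Longrightarrow> commutes x (commut y z)"
  by (simp add: commut_def commutes_mult commutes_inverse)

lemma commut_conjug: "commut (conjug x z) (conjug y z) = conjug (commut x y) z"
  by (simp add: commut_def conjug_def group_simps)

lemma commut_eq: "commut x y = inverse x * conjug x y"
  by (simp add: commut_def conjug_def group_simps)

lemma conjug_eq: "conjug x y = x * commut x y"
  by (simp add: commut_def conjug_def group_simps)

lemma commut_eq_one_iff: "commut x y = 1 \<longleftrightarrow> commutes x y"
  by (metis commut_eq conjug_eq conjug_eq_iff_commutes inverse_mult_self mult_1_right)

lemma mult_power_commutes: "commutes x y \<Longrightarrow> (x * y) ^ n = x ^ n * y ^ n"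
proof (induction n)
  case (Suc n)
  have "commutes y (x ^ n)" by (rule commutes_power[OF commutes_sym[OF Suc.prems]])
  then have "(x * y) * (x ^ n * y ^ n) = x * x ^ n * (y * y ^ n)"
    unfolding commutes_def by (metis mult.assoc)
  with Suc show ?case by simp
qed simp

lemma power_inverse_group: "inverse x ^ n = inverse (x ^ n)"
  by (induction n) (simp_all add: inverse_one inverse_mult_rev[symmetric] power_commutes)

lemma commut_mult_commutes:
  assumes "commutes x z" "commutes y z"
  shows "commut x (y * z) = commut x y"
proof -
  have c: "commutes z (x * commut x y)"
    by (intro commutes_mult commutes_commut; rule commutes_sym; rule assms)
  have "conjug x (y * z) = conjug (conjug x y) z" by (simp add: conjug_conjug)
  also have "\<dots> = conjug (x * commut x y) z" by (simp add: conjug_eq)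
  also have "\<dots> = x * commut x y"
    by (rule conjug_eq_iff_commutes[THEN iffD2, OF commutes_sym[OF c]])
  finally show ?thesis by (simp add: commut_eq[of x "y * z"] inverse_mult_cancel)
qed

text \<open>With \<open>commut a v\<close> central in the group of \<open>a\<close> and
  \<open>v\<close>, conjugation by \<open>v\<close> and by \<open>inverse v\<close> multiplies
  \<open>a\<close> by this element and by its inverse, and the two factors cancel. This is the
  source of the pairs with product \<open>a * a\<close>.\<close>

lemma conjug_inverse_commuting:
  assumes "commutes (commut a v) a" "commutes (commut a v) v"
  shows "conjug a (inverse v) = a * inverse (commut a v)"
    and "conjug a v * conjug a (inverse v) = a * a"
proof -
  let ?y = "commut a v"
  have "conjug (a * inverse ?y) v = conjug a v * inverse (conjug ?y v)"
    by (simp add: conjug_mult conjug_inverse)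
  also have "conjug ?y v = ?y" using assms(2) by (simp add: conjug_eq_iff_commutes)
  also have "conjug a v * inverse ?y = a" by (simp add: conjug_eq group_simps)
  finally show *: "conjug a (inverse v) = a * inverse ?y"
    by (metis conjug_inverse_cancel(1))
  have "?y * (a * inverse ?y) = a * (?y * inverse ?y)"
    using assms(1) by (simp add: commutes_def mult.assoc[symmetric])
  then show "conjug a v * conjug a (inverse v) = a * a"
    unfolding * conjug_eq[of a v] by (simp add: mult.assoc mult_inverse_self)
qed

text \<open>The right side is the commutator of \<open>a ^ n\<close> and \<open>v\<close>, so
  \<open>a ^ n = 1\<close> makes the n-th power of the commutator trivial.\<close>

lemma commut_power_commuting:
  assumes "commutes (commut a v) a"
  shows "commut a v ^ n = inverse (a ^ n) * conjug (a ^ n) v"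
proof -
  have "conjug a v ^ n = a ^ n * commut a v ^ n"
    unfolding conjug_eq by (rule mult_power_commutes[OF commutes_sym[OF assms]])
  then show ?thesis by (simp add: conjug_power inverse_mult_cancel)
qed

end

section \<open>Generated subgroups and towers of elementary abelian layers\<close>

inductive_set gen :: "'a::group_mult set \<Rightarrow> 'a set" for S where
  one: "1 \<in> gen S"
| mult: "x \<in> S \<Longrightarrow> y \<in> gen S \<Longrightarrow> x * y \<in> gen S"
| inverse_mult: "x \<in> S \<Longrightarrow> y \<in> gen S \<Longrightarrow> inverse x * y \<in> gen S"

lemma gen_incl: "x \<in> S \<Longrightarrow> x \<in> gen S"
  using gen.mult[OF _ gen.one] by fastforce

lemma gen_closed: "x \<in> gen S \<Longrightarrow> y \<in> gen S \<Longrightarrow> x * y \<in> gen S"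
  by (induction rule: gen.induct) (auto simp: mult.assoc intro: gen.intros)

lemma gen_inverse: "x \<in> gen S \<Longrightarrow> inverse x \<in> gen S"
proof (induction rule: gen.induct)
  case (mult x y)
  have "inverse x \<in> gen S" using gen.inverse_mult[OF mult(1) gen.one] by simp
  from gen_closed[OF mult(3) this] show ?case by (simp add: inverse_mult_rev)
next
  case (inverse_mult x y)
  from gen_closed[OF inverse_mult(3) gen_incl[OF inverse_mult(1)]]
  show ?case by (simp add: inverse_mult_rev inverse_involutive)
qed (simp add: gen.one inverse_one)

lemma gen_mono_induct:
  assumes "x \<in> gen S" "\<And>y. y \<in> S \<Longrightarrow> y \<in> gen T"
  shows "x \<in> gen T"
  using assms(1) by induction (auto intro: gen.one gen_closed gen_inverse assms(2))

lemma gen_commutes: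
  assumes "y \<in> gen S" "\<And>z. z \<in> S \<Longrightarrow> commutes x z"
  shows "commutes x y"
  using assms(1) by induction (auto intro: commutes_one commutes_mult commutes_inverse assms(2))

lemma gen_conjug:
  assumes "x \<in> gen S" "\<And>y. y \<in> S \<Longrightarrow> conjug y k \<in> gen S"
  shows "conjug x k \<in> gen S"
  using assms(1)
  by induction (auto simp: conjug_one conjug_mult conjug_inverse intro: gen.one gen_closed gen_inverse assms(2))

lemma gen_conjug_gen:
  assumes "x \<in> gen S" "k \<in> gen T" "\<And>y k. y \<in> S \<Longrightarrow> k \<in> T \<Longrightarrow> conjug y k \<in> gen S"
    "\<And>y k. y \<in> S \<Longrightarrow> k \<in> T \<Longrightarrow> conjug y (inverse k) \<in> gen S"
  shows "conjug x k \<in> gen S"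
  using assms(2,1)
proof (induction arbitrary: x)
  case one
  then show ?case by (simp add: conjug_by_one)
next
  case (mult k l)
  then have "conjug x k \<in> gen S" by (auto intro: gen_conjug assms(3))
  then show ?case using mult(3) by (simp add: conjug_conjug[symmetric])
next
  case (inverse_mult k l)
  then have "conjug x (inverse k) \<in> gen S" by (auto intro: gen_conjug assms(4))
  then show ?case using inverse_mult(3) by (simp add: conjug_conjug[symmetric])
qed

lemma gen_commuting_power:
  assumes "x \<in> gen S" "\<And>y. y \<in> S \<Longrightarrow> y ^ n = 1" "\<And>y z. y \<in> S \<Longrightarrow> z \<in> S \<Longrightarrow> commutes y z"
  shows "x ^ n = 1"
  using assms(1)
proof induction
  case one
  show ?case by simp
next
  case (mult x y)
  then have "commutes x y" by (auto intro: gen_commutes assms(3))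
  with mult assms(2) show ?case by (simp add: mult_power_commutes)
next
  case (inverse_mult x y)
  then have "commutes x y" by (auto intro: gen_commutes assms(3))
  then have "commutes (inverse x) y" by (rule commutes_sym[OF commutes_inverse[OF commutes_sym]])
  with inverse_mult assms(2) show ?case
    by (simp add: mult_power_commutes power_inverse_group inverse_one)
qed

text \<open>Modulo the layer normalized by \<open>k\<close>, the powers of \<open>m * k\<close> are
  those of \<open>k\<close>. If \<open>k ^ n = 1\<close>, the n-th power falls into
  \<open>gen M\<close>; so exponents multiply along a tower.\<close>

lemma gen_semidirect_power:
  fixes m k :: "'h::group_mult"
  assumes "m \<in> gen M" "\<And>x. x \<in> gen M \<Longrightarrow> conjug x (inverse k) \<in> gen M"
  shows "\<exists>m'\<in>gen M. (m * k) ^ n = m' * k ^ n"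
proof (induction n)
  case 0
  show ?case using gen.one by fastforce
next
  case (Suc n)
  then obtain m' where m': "m' \<in> gen M" "(m * k) ^ n = m' * k ^ n" by blast
  have "(m * k) ^ Suc n = m * conjug m' (inverse k) * k ^ Suc n"
    by (simp add: m'(2) conjug_def group_simps)
  moreover have "m * conjug m' (inverse k) \<in> gen M" by (intro gen_closed assms m'(1))
  ultimately show ?case by blast
qed

text \<open>A group that is a tower \<open>M\<close>, \<open>E\<close>, \<open>C\<close> of elementary abelian layers has exponent dividing \<open>5\<^sup>3\<close>.\<close>

lemma gen_tower_torsion:
  fixes M E C :: "'h::group_mult set"
  assumes MM: "\<And>x y. x \<in> M \<Longrightarrow> y \<in> M \<Longrightarrow> commutes x y" and M5: "\<And>x. x \<in> M \<Longrightarrow> x ^ 5 = 1"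
    and EE: "\<And>x y. x \<in> E \<Longrightarrow> y \<in> E \<Longrightarrow> commutes x y" and E5: "\<And>x. x \<in> E \<Longrightarrow> x ^ 5 = 1"
    and CC: "\<And>x y. x \<in> C \<Longrightarrow> y \<in> C \<Longrightarrow> commutes x y" and C5: "\<And>x. x \<in> C \<Longrightarrow> x ^ 5 = 1"
    and ME: "\<And>m k. m \<in> M \<Longrightarrow> k \<in> E \<Longrightarrow> conjug m k \<in> gen M \<and> conjug m (inverse k) \<in> gen M"
    and MC: "\<And>m k. m \<in> M \<Longrightarrow> k \<in> C \<Longrightarrow> conjug m k \<in> gen M \<and> conjug m (inverse k) \<in> gen M"
    and EC: "\<And>m k. m \<in> E \<Longrightarrow> k \<in> C \<Longrightarrow> conjug m k \<in> gen E \<and> conjug m (inverse k) \<in> gen E"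
    and h: "h \<in> gen (M \<union> E \<union> C)"
  shows "h ^ 125 = 1"
proof -
  have gME: "conjug m k \<in> gen M" if "m \<in> gen M" "k \<in> gen E" for m k
    by (rule gen_conjug_gen[OF that]) (use ME in auto)
  have gMC: "conjug m k \<in> gen M" if "m \<in> gen M" "k \<in> gen C" for m k
    by (rule gen_conjug_gen[OF that]) (use MC in auto)
  have gEC: "conjug m k \<in> gen E" if "m \<in> gen E" "k \<in> gen C" for m k
    by (rule gen_conjug_gen[OF that]) (use EC in auto)
  \<comment> \<open>Products in this order are closed under left multiplication by every generator,
    because each layer is normalized by the later ones. So they exhaust the generated group.\<close>
  define Q where "Q = {m * e * c | m e c. m \<in> gen M \<and> e \<in> gen E \<and> c \<in> gen C}"
  have memQ: "m * e * c \<in> Q" if "m \<in> gen M" "e \<in> gen E" "c \<in> gen C" for m e c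
    using that unfolding Q_def by blast
  have QM: "x * y \<in> Q" if x: "x \<in> gen M" and y: "y \<in> Q" for x y
  proof -
    obtain m e c where mec: "y = m * e * c" "m \<in> gen M" "e \<in> gen E" "c \<in> gen C"
      using y unfolding Q_def by blast
    have "x * y = (x * m) * e * c" by (simp add: mec mult.assoc)
    with mec x show ?thesis by (simp add: memQ gen_closed)
  qed
  have QE: "x * y \<in> Q" if x: "x \<in> gen E" and y: "y \<in> Q" for x y
  proof -
    obtain m e c where mec: "y = m * e * c" "m \<in> gen M" "e \<in> gen E" "c \<in> gen C"
      using y unfolding Q_def by blast
    have "x * y = conjug m (inverse x) * (x * e) * c" by (simp add: mec conjug_def group_simps)
    with mec x show ?thesis by (simp add: memQ gen_closed gME gen_inverse)
  qed
  have QC: "x * y \<in> Q" if x: "x \<in> gen C" and y: "y \<in> Q" for x y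
  proof -
    obtain m e c where mec: "y = m * e * c" "m \<in> gen M" "e \<in> gen E" "c \<in> gen C"
      using y unfolding Q_def by blast
    have "x * y = conjug m (inverse x) * conjug e (inverse x) * (x * c)"
      by (simp add: mec conjug_def group_simps)
    with mec x show ?thesis by (simp add: memQ gen_closed gMC gEC gen_inverse)
  qed
  have "h \<in> Q"
    using h
  proof induction
    case one
    show ?case using memQ[OF gen.one gen.one gen.one] by simp
  next
    case (mult x y)
    then show ?case using QM QE QC gen_incl by blast
  next
    case (inverse_mult x y)
    then show ?case using QM QE QC gen_incl gen_inverse by blast
  qed
  then obtain m e c where mec: "h = m * e * c" "m \<in> gen M" "e \<in> gen E" "c \<in> gen C"
    unfolding Q_def by blast
  have m5: "x ^ 5 = 1" if "x \<in> gen M" for x using gen_commuting_power[OF that M5 MM] .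
  have e5: "x ^ 5 = 1" if "x \<in> gen E" for x using gen_commuting_power[OF that E5 EE] .
  have c5: "c ^ 5 = 1" using gen_commuting_power[OF mec(4) C5 CC] .
  \<comment> \<open>Each fifth power removes the last factor of the normal form, first
    \<open>c\<close>, then \<open>e\<close>, then \<open>m\<close>.\<close>
  obtain e' where e': "e' \<in> gen E" "(e * c) ^ 5 = e'"
    using gen_semidirect_power[OF mec(3), of c 5] gEC gen_inverse[OF mec(4)] c5 by auto
  have "conjug x (inverse (e * c)) \<in> gen M" if "x \<in> gen M" for x
    using gMC[OF that gen_inverse[OF mec(4)]] gME[OF _ gen_inverse[OF mec(3)]]
    by (simp add: inverse_mult_rev conjug_conjug[symmetric])
  from gen_semidirect_power[OF mec(2) this, of 5] obtain m1 where
    m1: "m1 \<in> gen M" "h ^ 5 = m1 * e'" using e'(2) by (auto simp: mec(1) mult.assoc)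
  obtain m2 where m2: "m2 \<in> gen M" "(h ^ 5) ^ 5 = m2"
    using gen_semidirect_power[OF m1(1), of e' 5] gME[OF _ gen_inverse[OF e'(1)]] e5[OF e'(1)] m1(2) by auto
  have "h ^ 125 = ((h ^ 5) ^ 5) ^ 5" by (simp add: power_mult[symmetric])
  also have "\<dots> = 1" using m2 m5 by simp
  finally show ?thesis .
qed

text \<open>\<open>a\<close> is the cube of \<open>a * a\<close>, since a^6 = a.\<close>

lemma commutes_square:
  fixes a x :: "'h::group_mult"
  assumes "commutes x (a * a)" "a ^ 5 = 1"
  shows "commutes x a"
proof -
  have "(a * a) ^ 3 = a ^ 5 * a" by (simp add: power2_eq_square[symmetric] power_mult[symmetric] power_Suc2[symmetric] del: power_Suc)
  with assms(2) have "(a * a) ^ 3 = a" by simp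
  with commutes_power[OF assms(1), of 3] show ?thesis by simp
qed

lemma commutes_mult_cancel_left:
  fixes x y z :: "'h::group_mult"
  assumes "commutes x y" "commutes x (y * z)"
  shows "commutes x z"
  using commutes_mult[OF commutes_inverse[OF assms(1)] assms(2)] by (simp add: group_simps)

section \<open>Triviality of the kernel\<close>

text \<open>
  \<open>D\<close> plays the role of the kernel of a homomorphism to the group in which the relations are known.
  As \<open>D\<close> has exponent 2 while everything else has order a power of 5, a commutator that lies in
  \<open>D\<close> vanishes as soon as it commutes with one of its arguments.
\<close>

locale two_kernel =
  fixes D :: "'h::group_mult set"
  assumes D_square: "d \<in> D \<Longrightarrow> d * d = 1"
    and D_mult: "c \<in> D \<Longrightarrow> d \<in> D \<Longrightarrow> c * d \<in> D"
begin

lemma D_commutes: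
  assumes "c \<in> D" "d \<in> D"
  shows "commutes c d"
proof -
  have "inverse x = x" if "x \<in> D" for x using inverse_unique_left[OF D_square[OF that]] .
  from this[OF D_mult[OF assms]] this[OF assms(1)] this[OF assms(2)]
  show ?thesis by (simp add: commutes_def inverse_mult_rev)
qed

lemma D_trivial:
  assumes "d \<in> D" "d ^ n = 1" "odd n"
  shows "d = 1"
proof -
  obtain k where "n = 2 * k + 1" using assms(3) by (rule oddE)
  then have "d ^ n = d" using D_square[OF assms(1)] by (simp add: power_mult power2_eq_square)
  with assms(2) show ?thesis by simp
qed

lemma D_commutes_trivial:
  assumes "commut a b \<in> D" "commutes (commut a b) a" "a ^ 5 = 1"
  shows "commutes a b"
proof -
  have "commut a b ^ 5 = 1"
    using commut_power_commuting[OF assms(2), of 5] assms(3) by (simp add: conjug_one inverse_one)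
  from D_trivial[OF assms(1) this] show ?thesis by (simp add: commut_eq_one_iff)
qed

text \<open>
  The commutator \<open>P\<close> of \<open>a\<close> and \<open>b\<^sup>v\<^sup>w\<close> does not change when \<open>v\<close> and \<open>w\<close> are both inverted, so it
  commutes with \<open>a\<^sup>v\<close> and with \<open>a\<close> conjugated by the inverse of \<open>v\<close>, whose product is \<open>a\<^sup>2\<close>.
\<close>

lemma commutes_conjug_mult:
  assumes vw: "commutes v w" and a5: "a ^ 5 = 1"
    and av: "commutes a (conjug a v)" "commutes a (conjug a (inverse v))"
      "conjug a v * conjug a (inverse v) = a * a"
    and ab: "commutes a (conjug b v)" "commutes a (conjug b w)" "commutes a (conjug b (inverse w))"
    and b: "commutes b (conjug b v)" "commutes b (conjug b w)"
      "conjug b v * conjug b (inverse v) = b * b" "conjug b w * conjug b (inverse w) = b * b"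
    and D: "commut a (conjug b (v * w)) \<in> D"
  shows "commutes a (conjug b (v * w))"
proof -
  define x where "x = conjug b (v * w)"
  define t where "t = conjug b v * conjug b v"
  define u where "u = conjug b (inverse w) * conjug b (inverse w)"
  define x' where "x' = conjug b (inverse v * inverse w)"
  have wv: "w * v = v * w" "inverse w * v = v * inverse w"
    using vw commutes_inverse[OF vw] by (simp_all add: commutes_def)
  have bv: "conjug b (inverse v) = inverse (conjug b v) * (b * b)"
    by (simp add: b(3)[symmetric] inverse_mult_cancel)
  have bw: "conjug b (inverse w) = inverse (conjug b w) * (b * b)"
    by (simp add: b(4)[symmetric] inverse_mult_cancel)
  \<comment> \<open>This is the relation b^w b^(w^-1) = b^2 conjugated by \<open>v\<close>: the
    first factor becomes \<open>x\<close> and the right side \<open>t\<close>. Likewise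
    \<open>x2\<close> comes from the relation for \<open>v\<close>, conjugated by the inverse of
    \<open>w\<close>.\<close>
  have x1: "conjug b (v * inverse w) = inverse x * t"
    using arg_cong[OF bw, of "\<lambda>y. conjug y v"]
    by (simp add: conjug_mult conjug_inverse conjug_conjug wv x_def t_def)
  have x2: "x' = inverse (inverse x * t) * u"
    using arg_cong[OF bv, of "\<lambda>y. conjug y (inverse w)"]
    by (simp add: conjug_mult conjug_inverse conjug_conjug x1 x'_def u_def)
  have at: "commutes a t" "commutes a u" unfolding t_def u_def by (intro commutes_mult ab)+
  have "commutes (conjug b v) x"
    using b(2) commutes_conjug_iff[of b v "conjug b w"] by (simp add: x_def conjug_conjug wv)
  then have xt: "commutes x t" unfolding t_def using commutes_sym commutes_mult by blast
  have "commutes (conjug b (inverse w)) (conjug b (v * inverse w))"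
    using b(1) commutes_conjug_iff[of b "inverse w" "conjug b v"] by (simp add: conjug_conjug)
  from commutes_inverse[OF this] have "commutes (conjug b (inverse w)) (inverse t * x)"
    by (simp add: x1 inverse_mult_rev inverse_involutive)
  then have xu: "commutes (inverse t * x) u"
    unfolding u_def using commutes_sym commutes_mult by blast
  \<comment> \<open>Inverting both \<open>v\<close> and \<open>w\<close> changes \<open>x\<close>
    only by the factors \<open>t\<close> and \<open>u\<close>; they commute with \<open>a\<close>
    and with what they are multiplied by, and so drop out of the commutator.\<close>
  have "commut a x' = commut a (inverse t * x)"
    unfolding x2 using commut_mult_commutes[OF at(2) xu] by (simp add: group_simps)
  also have "\<dots> = commut a (x * inverse t)"
    using commutes_inverse[OF xt] by (simp add: commutes_def)
  also have "\<dots> = commut a x"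
    by (rule commut_mult_commutes) (intro commutes_inverse at xt)+
  finally have P: "commut a x' = commut a x" .
  have "commutes (conjug a v) x"
    using ab(2) commutes_conjug_iff[of a v "conjug b w"] by (simp add: x_def conjug_conjug wv)
  then have P1: "commutes (conjug a v) (commut a x)"
    by (intro commutes_commut commutes_sym[OF av(1)])
  have "inverse w * inverse v = inverse v * inverse w"
    using wv(1) by (metis inverse_mult_rev)
  then have "commutes (conjug a (inverse v)) x'"
    using ab(3) commutes_conjug_iff[of a "inverse v" "conjug b (inverse w)"]
    by (simp add: x'_def conjug_conjug)
  then have "commutes (conjug a (inverse v)) (commut a x')"
    by (intro commutes_commut commutes_sym[OF av(2)])
  with P1 have "commutes (commut a x) (a * a)"
    unfolding P av(3)[symmetric] using commutes_sym commutes_mult by blast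
  from D_commutes_trivial[OF D[folded x_def] commutes_square[OF this a5] a5]
  show ?thesis by (simp add: x_def)
qed

lemma commutes_conjug_of_commut:
  assumes "commutes p q" "commutes p (commut q s)"
  shows "commutes p (conjug q s)"
  unfolding conjug_eq[of q s] by (rule commutes_mult[OF assms])

text \<open>By \<open>commutes_conjug_mult\<close>, p commutes with q^(sr) = q^r [q, s]^r, and with
  the first factor, hence with [q, s]^r. Conjugating by r^-1 gives that p^(r^-1) commutes with
  [q, s]; with r replaced by its inverse, p^r = p [p, r], where p can be cancelled. Only this one
  passage through \<open>D\<close> is needed, and the lemma can be applied again with commutators in
  the place of \<open>A\<close>.\<close>

lemma commutators_commute:
  assumes VV: "\<And>v w. v \<in> V \<Longrightarrow> w \<in> V \<Longrightarrow> commutes v w"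
    and Vinv: "\<And>v. v \<in> V \<Longrightarrow> inverse v \<in> V"
    and AA: "\<And>a b. a \<in> A \<Longrightarrow> b \<in> A \<Longrightarrow> commutes a b"
    and A5: "\<And>a. a \<in> A \<Longrightarrow> a ^ 5 = 1"
    and comm: "\<And>a b v. a \<in> A \<Longrightarrow> b \<in> A \<Longrightarrow> v \<in> V \<Longrightarrow> commutes a (commut b v)"
    and comm': "\<And>a v. a \<in> A \<Longrightarrow> v \<in> V \<Longrightarrow> commutes v (commut a v)"
    and D: "\<And>a b v w. a \<in> A \<Longrightarrow> b \<in> A \<Longrightarrow> v \<in> V \<Longrightarrow> w \<in> V \<Longrightarrow> commut a (conjug b (v * w)) \<in> D"
    and mem: "a \<in> A" "b \<in> A" "v \<in> V" "w \<in> V"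
  shows "commutes (commut a v) (commut b w)"
proof -
  have cc: "commutes p (conjug q s)" if "p \<in> A" "q \<in> A" "s \<in> V" for p q s
    using that by (intro commutes_conjug_of_commut AA comm)
  have ap: "conjug q s * conjug q (inverse s) = q * q" if "q \<in> A" "s \<in> V" for q s
    using that by (intro conjug_inverse_commuting(2) commutes_sym[OF comm] commutes_sym[OF comm'])
  have key: "commutes (commut q s) (conjug p (inverse r))" if "p \<in> A" "q \<in> A" "s \<in> V" "r \<in> V" for p q s r
  proof -
    have "commutes p (conjug q (s * r))"
      using that by (intro commutes_conjug_mult VV A5 cc ap Vinv D)
    moreover have "conjug q (s * r) = conjug q r * conjug (commut q s) r"
      by (simp add: conjug_conjug[symmetric] conjug_eq[of q s] conjug_mult)
    ultimately have "commutes p (conjug (commut q s) r)"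
      using commutes_mult_cancel_left[OF cc] that by metis
    then have "commutes (conjug p (inverse r)) (commut q s)"
      using commutes_conjug_iff[of p "inverse r" "conjug (commut q s) r"] by (simp add: conjug_inverse_cancel)
    then show ?thesis by (rule commutes_sym)
  qed
  have "commutes (commut a v) (conjug b (inverse (inverse w)))"
    using mem by (intro key Vinv)
  then have "commutes (commut a v) (b * commut b w)"
    by (simp add: inverse_involutive conjug_eq)
  moreover have "commutes (commut a v) b" using mem by (intro commutes_sym[OF comm])
  ultimately show ?thesis by (rule commutes_mult_cancel_left[rotated])
qed

text \<open>Expand the conjugate of \<open>a\<close> by \<open>v * w\<close> and by
  \<open>w * v\<close> into \<open>a\<close>, simple and double commutators, and cancel.\<close>

lemma double_commut_swap:
  assumes "commutes v w" "commutes (commut a v) (commut a w)"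
  shows "commut (commut a v) w = commut (commut a w) v"
proof -
  have "conjug a (v * w) = a * commut a w * commut a v * commut (commut a v) w" for v w
    by (simp add: conjug_conjug[symmetric] conjug_eq[of a v] conjug_mult conjug_eq[of a w]
        conjug_eq[of "commut a v" w] mult.assoc)
  from this[of v w] this[of w v] assms show ?thesis
    unfolding commutes_def by (metis mult.assoc mult_left_eq_iff)
qed

text \<open>\<open>A\<close>, \<open>B\<close>, \<open>C\<close> are the lifted root groups of
  \<alpha>, \<beta>, \<psi>. The commutative set \<open>V\<close> of conjugates of \<open>B\<close>
  acts on \<open>A\<close>, its commutators and its double commutators. These must be shown to
  commute and to be followed by nothing further, although \<open>D1\<close>, \<open>D2\<close>,
  \<open>D3\<close> give this only up to \<open>D\<close>; then they form the lowest layer of a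
  tower with \<open>V\<close> and \<open>C\<close> above it.\<close>

theorem kernel_trivial_lg:
  assumes AA: "\<And>x y. x \<in> A \<Longrightarrow> y \<in> A \<Longrightarrow> commutes x y" and A5: "\<And>x. x \<in> A \<Longrightarrow> x ^ 5 = 1"
    and B5: "\<And>x. x \<in> B \<Longrightarrow> x ^ 5 = 1" and Binv: "\<And>x. x \<in> B \<Longrightarrow> inverse x \<in> B"
    and CC: "\<And>x y. x \<in> C \<Longrightarrow> y \<in> C \<Longrightarrow> commutes x y" and C5: "\<And>x. x \<in> C \<Longrightarrow> x ^ 5 = 1"
    and Cone: "1 \<in> C" and Cmult: "\<And>x y. x \<in> C \<Longrightarrow> y \<in> C \<Longrightarrow> x * y \<in> C"
    and Cinv: "\<And>x. x \<in> C \<Longrightarrow> inverse x \<in> C"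
    and AC: "\<And>a c. a \<in> A \<Longrightarrow> c \<in> C \<Longrightarrow> commutes a c"
    and AB: "\<And>a a' b. a \<in> A \<Longrightarrow> a' \<in> A \<Longrightarrow> b \<in> B \<Longrightarrow> commutes a' (commut a b)"
    and AB': "\<And>a b. a \<in> A \<Longrightarrow> b \<in> B \<Longrightarrow> commutes b (commut a b)"
    and BC: "\<And>b b' c. b \<in> B \<Longrightarrow> b' \<in> B \<Longrightarrow> c \<in> C \<Longrightarrow> commutes b (conjug b' c)"
    and V: "V = {conjug b c | b c. b \<in> B \<and> c \<in> C}"
    and D1: "\<And>a a' v w. a \<in> A \<Longrightarrow> a' \<in> A \<Longrightarrow> v \<in> V \<Longrightarrow> w \<in> V \<Longrightarrow> commut a (conjug a' (v * w)) \<in> D"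
    and D2: "\<And>a u v w. a \<in> A \<Longrightarrow> u \<in> V \<Longrightarrow> v \<in> V \<Longrightarrow> w \<in> V \<Longrightarrow>
      commut (commut a u) (conjug (commut a u) (v * w)) \<in> D"
    and D3: "\<And>a u v w. a \<in> A \<Longrightarrow> u \<in> V \<Longrightarrow> v \<in> V \<Longrightarrow> w \<in> V \<Longrightarrow> commut (commut (commut a u) v) w \<in> D"
    and h: "h \<in> gen (A \<union> B \<union> C)" "h \<in> D"
  shows "h = 1"
proof -
  have VI: "conjug b c \<in> V" if "b \<in> B" "c \<in> C" for b c using that V by blast
  have Vinv: "inverse v \<in> V" if v: "v \<in> V" for v
  proof -
    obtain b c where "v = conjug b c" "b \<in> B" "c \<in> C" using v V by blast
    then show ?thesis using VI[OF Binv] by (simp add: conjug_inverse[symmetric])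
  qed
  have Vconj: "conjug v c \<in> V" if v: "v \<in> V" "c \<in> C" for v c
  proof -
    obtain b c' where "v = conjug b c'" "b \<in> B" "c' \<in> C" using v V by blast
    then show ?thesis using VI[OF _ Cmult] v by (simp add: conjug_conjug)
  qed
  have BV: "b \<in> V" if "b \<in> B" for b using VI[OF that Cone] by (simp add: conjug_by_one)
  have VV: "commutes v w" if vw: "v \<in> V" "w \<in> V" for v w
  proof -
    obtain b c b' c' where *: "v = conjug b c" "w = conjug b' c'" "b \<in> B" "b' \<in> B" "c \<in> C" "c' \<in> C"
      using vw V by blast
    then have "commutes b (conjug b' (c' * inverse c))" by (intro BC Cmult Cinv)
    then show ?thesis
      using commutes_conjug_iff[of b c "conjug b' (c' * inverse c)"] by (simp add: * conjug_conjug group_simps)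
  qed
  have V5: "v ^ 5 = 1" if "v \<in> V" for v
    using that V B5 by (auto simp: conjug_power[symmetric] conjug_one)
  have Afix: "conjug a c = a" if "a \<in> A" "c \<in> C" for a c
    using AC[OF that] by (simp add: conjug_eq_iff_commutes)
  \<comment> \<open>As \<open>c\<close> fixes \<open>a\<close>, conjugation by \<open>c\<close>
    carries the relations between \<open>A\<close> and \<open>B\<close> over to \<open>A\<close> and
    \<open>V\<close>.\<close>
  have av: "commut a (conjug b c) = conjug (commut a b) c" if "a \<in> A" "b \<in> B" "c \<in> C" for a b c
    using that by (simp add: commut_conjug[symmetric] Afix)
  have aV: "commutes a' (commut a v)" if mem: "a \<in> A" "a' \<in> A" "v \<in> V" for a a' v
  proof -
    obtain b c where *: "v = conjug b c" "b \<in> B" "c \<in> C" using mem(3) V by blast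
    have "commutes (conjug a' c) (conjug (commut a b) c)"
      using AB[OF mem(1,2) *(2)] by (simp add: commutes_conjug_iff)
    then show ?thesis by (simp add: * av Afix mem)
  qed
  have Vv: "commutes v (commut a v)" if mem: "a \<in> A" "v \<in> V" for a v
  proof -
    obtain b c where *: "v = conjug b c" "b \<in> B" "c \<in> C" using mem(2) V by blast
    have "commutes (conjug b c) (conjug (commut a b) c)"
      using AB'[OF mem(1) *(2)] by (simp add: commutes_conjug_iff)
    then show ?thesis by (simp add: * av mem)
  qed
  have yy: "commutes (commut a v) (commut a' w)" if "a \<in> A" "a' \<in> A" "v \<in> V" "w \<in> V" for a a' v w
    by (rule commutators_commute[of V A]) (use that VV Vinv AA A5 aV Vv D1 in auto)
  have swap: "commut (commut a v) w = commut (commut a w) v" if "a \<in> A" "v \<in> V" "w \<in> V" for a v w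
    using that by (intro double_commut_swap VV yy)
  have Rw: "commutes w (commut (commut a v) w)" "commutes v (commut (commut a v) w)"
    if "a \<in> A" "v \<in> V" "w \<in> V" for a v w
  proof -
    \<comment> \<open>\<open>v\<close> commutes with \<open>commut a v\<close> and with
      \<open>w\<close>. The double commutator is symmetric by \<open>swap\<close>, which gives the
      same for \<open>w\<close>.\<close>
    have *: "commutes v (commut (commut a v) w)" if "v \<in> V" "w \<in> V" for v w
      using that \<open>a \<in> A\<close> by (intro commutes_commut Vv VV)
    show "commutes v (commut (commut a v) w)" using that(2,3) by (rule *)
    show "commutes w (commut (commut a v) w)" using *[OF that(3,2)] by (simp add: swap[OF that])
  qed
  have Ra: "commutes a' (commut (commut a v) w)" if mem: "a \<in> A" "a' \<in> A" "v \<in> V" "w \<in> V" for a a' v w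
  proof -
    \<comment> \<open>The conjugation is moved to the other argument:
      \<open>conjug a' (inverse w)\<close> is \<open>a'\<close> times a simple commutator, and
      \<open>commut a v\<close> commutes with both by \<open>aV\<close> and \<open>yy\<close>.
      Conjugating by \<open>w\<close> returns to the claim.\<close>
    have "commutes (commut a v) (conjug a' (inverse w))"
      using mem Vinv by (intro commutes_conjug_of_commut commutes_sym[OF aV] yy)
    then have "commutes (conjug (commut a v) w) a'"
      using commutes_conjug_iff[of "commut a v" w "conjug a' (inverse w)"] by (simp add: conjug_inverse_cancel)
    from commutes_sym[OF this] show ?thesis
      unfolding commut_eq[of "commut a v"] by (intro commutes_mult commutes_inverse aV mem)
  qed
  have y5: "commut a v ^ 5 = 1" if "a \<in> A" "v \<in> V" for a v
    using commut_power_commuting[OF commutes_sym[OF aV[OF that(1,1,2)]], of 5] that A5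
    by (simp add: conjug_one inverse_one)
  have Ry: "commutes (commut a' u) (commut (commut a v) w)"
    if "a \<in> A" "a' \<in> A" "u \<in> V" "v \<in> V" "w \<in> V" "commutes u (commut (commut a v) w)" for a a' u v w
    by (rule commutes_sym[OF commutes_commut[OF commutes_sym[OF Ra[OF that(1,2,4,5)]] commutes_sym[OF that(6)]]])
  \<comment> \<open>The same argument one level up, with the single element
    \<open>commut a v\<close> in the place of \<open>A\<close>; so \<open>a\<close> and
    \<open>v\<close> are the same on both sides.\<close>
  have RR: "commutes (commut (commut a v) w) (commut (commut a v) w')"
    if "a \<in> A" "v \<in> V" "w \<in> V" "w' \<in> V" for a v w w'
    by (rule commutators_commute[of V "{commut a v}"])
       (use that VV Vinv y5 Ry Rw D2 commutes_refl in auto)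
  have R5: "commut (commut a v) w ^ 5 = 1" if "a \<in> A" "v \<in> V" "w \<in> V" for a v w
  proof -
    have "commutes (commut (commut a v) w) (commut a v)"
      using that by (intro commutes_sym[OF Ry] Rw)
    from commut_power_commuting[OF this, of 5] y5[OF that(1,2)] show ?thesis
      by (simp add: conjug_one inverse_one)
  qed
  have RV: "commutes (commut (commut a v) w) w'" if mem: "a \<in> A" "v \<in> V" "w \<in> V" "w' \<in> V" for a v w w'
  proof (rule D_commutes_trivial)
    show "commut (commut (commut a v) w) w' \<in> D" using mem by (rule D3)
    \<comment> \<open>After the swap the triple commutator is formed from
      \<open>commut (commut a v) w'\<close> and \<open>w\<close>, both of which commute with
      \<open>commut (commut a v) w\<close>. So it commutes with its own first argument, as
      \<open>D_commutes_trivial\<close> demands.\<close>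
    have "commut (commut (commut a v) w) w' = commut (commut (commut a v) w') w"
      using mem by (intro double_commut_swap VV RR)
    also have "commutes (commut (commut a v) w) \<dots>"
      using mem by (intro commutes_commut RR commutes_sym[OF Rw(1)])
    finally show "commutes (commut (commut (commut a v) w) w') (commut (commut a v) w)"
      by (rule commutes_sym)
    show "commut (commut a v) w ^ 5 = 1" using mem(1-3) by (rule R5)
  qed
  \<comment> \<open>Double commutators end the list, because \<open>V\<close> fixes them by
    \<open>RV\<close>.\<close>
  define M where "M = A \<union> {commut a v | a v. a \<in> A \<and> v \<in> V} \<union>
    {commut (commut a v) w | a v w. a \<in> A \<and> v \<in> V \<and> w \<in> V}"
  have My: "commut a v \<in> M" if "a \<in> A" "v \<in> V" for a v using that unfolding M_def by blast
  have MR: "commut (commut a v) w \<in> M" if "a \<in> A" "v \<in> V" "w \<in> V" for a v w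
    using that unfolding M_def by blast
  have RRa: "commutes (commut (commut a v) w) (commut (commut a' v') w')"
    if "a \<in> A" "v \<in> V" "w \<in> V" "a' \<in> A" "v' \<in> V" "w' \<in> V" for a v w a' v' w'
    using that by (intro commutes_commut RV commutes_sym[OF Ra])
  have MM: "commutes x y" if "x \<in> M" "y \<in> M" for x y
  proof -
    have Rya: "commutes (commut a' u) (commut (commut a v) w)"
      if "a \<in> A" "a' \<in> A" "u \<in> V" "v \<in> V" "w \<in> V" for a a' u v w
      using that by (intro Ry commutes_sym[OF RV])
    have "commutes a y" if "a \<in> A" for a
      using \<open>y \<in> M\<close> that AA aV Ra unfolding M_def by auto
    moreover have "commutes (commut a v) y" if "a \<in> A" "v \<in> V" for a v
      using \<open>y \<in> M\<close> that yy commutes_sym[OF aV[OF that(1) _ that(2)]] Rya unfolding M_def by auto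
    moreover have "commutes (commut (commut a v) w) y" if "a \<in> A" "v \<in> V" "w \<in> V" for a v w
      using \<open>y \<in> M\<close> that RRa commutes_sym[OF Ra[OF that(1) _ that(2,3)]] commutes_sym[OF Rya[OF that(1) _ _ that(2,3)]]
      unfolding M_def by auto
    ultimately show ?thesis using \<open>x \<in> M\<close> unfolding M_def by auto
  qed
  have M5: "x ^ 5 = 1" if "x \<in> M" for x using that A5 y5 R5 unfolding M_def by auto
  have MV: "conjug m v \<in> gen M" if mem: "m \<in> M" "v \<in> V" for m v
  proof -
    consider "m \<in> A" | a u where "m = commut a u" "a \<in> A" "u \<in> V"
      | a u w where "m = commut (commut a u) w" "a \<in> A" "u \<in> V" "w \<in> V"
      using mem(1) unfolding M_def by blast
    then show ?thesis
    proof cases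
      case 1
      then show ?thesis using mem unfolding conjug_eq[of m v] by (intro gen_closed gen_incl My)
    next
      case 2
      then show ?thesis using mem unfolding conjug_eq[of m v] by (auto intro: gen_closed gen_incl My MR)
    next
      case 3
      then have "conjug m v = m" using mem RV by (simp add: conjug_eq_iff_commutes)
      then show ?thesis using mem by (simp add: gen_incl)
    qed
  qed
  have MC: "conjug m c \<in> gen M" if mem: "m \<in> M" "c \<in> C" for m c
  proof -
    consider "m \<in> A" | a u where "m = commut a u" "a \<in> A" "u \<in> V"
      | a u w where "m = commut (commut a u) w" "a \<in> A" "u \<in> V" "w \<in> V"
      using mem(1) unfolding M_def by blast
    then show ?thesis
    proof cases
      case 1
      then show ?thesis using mem by (simp add: Afix gen_incl)
    next
      case 2
      then show ?thesis using mem by (simp add: commut_conjug[symmetric] Afix gen_incl My Vconj)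
    next
      case 3
      then show ?thesis using mem by (simp add: commut_conjug[symmetric] Afix gen_incl MR Vconj)
    qed
  qed
  have "h \<in> gen (M \<union> V \<union> C)"
    using h(1) by (rule gen_mono_induct) (use BV in \<open>auto simp: M_def intro: gen_incl\<close>)
  moreover have "conjug m k \<in> gen M \<and> conjug m (inverse k) \<in> gen M" if "m \<in> M" "k \<in> V" for m k
    using that MV Vinv by blast
  moreover have "conjug m k \<in> gen M \<and> conjug m (inverse k) \<in> gen M" if "m \<in> M" "k \<in> C" for m k
    using that MC Cinv by blast
  moreover have "conjug v c \<in> gen V \<and> conjug v (inverse c) \<in> gen V" if "v \<in> V" "c \<in> C" for v c
    using that Vconj Cinv gen_incl by metis
  ultimately have "h ^ 125 = 1"
    using gen_tower_torsion[OF MM M5 VV V5 CC C5] by blast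
  then show ?thesis using D_trivial[OF h(2)] by simp
qed

text \<open>\<open>A\<close>, \<open>B\<close>, \<open>C\<close> are the lifted root groups of
  \<beta>, \<psi>, \<omega>. The commutators \<open>Z\<close> are central in the group of
  \<open>B\<close> and \<open>C\<close>. What has to be shown is that all conjugates of
  \<open>A\<close> by this group commute; the relations between \<open>A\<close> and
  \<open>Z\<close> are extracted from those between \<open>A\<close> and \<open>B\<close> by
  conjugating with \<open>C\<close>, which centralizes \<open>A\<close>.\<close>

theorem kernel_trivial_sm:
  assumes A5: "\<And>x. x \<in> A \<Longrightarrow> x ^ 5 = 1"
    and BB: "\<And>x y. x \<in> B \<Longrightarrow> y \<in> B \<Longrightarrow> commutes x y" and B5: "\<And>x. x \<in> B \<Longrightarrow> x ^ 5 = 1"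
    and Bone: "1 \<in> B" and Bmult: "\<And>x y. x \<in> B \<Longrightarrow> y \<in> B \<Longrightarrow> x * y \<in> B"
    and Binv: "\<And>x. x \<in> B \<Longrightarrow> inverse x \<in> B"
    and CC: "\<And>x y. x \<in> C \<Longrightarrow> y \<in> C \<Longrightarrow> commutes x y" and C5: "\<And>x. x \<in> C \<Longrightarrow> x ^ 5 = 1"
    and Cone: "1 \<in> C" and Cmult: "\<And>x y. x \<in> C \<Longrightarrow> y \<in> C \<Longrightarrow> x * y \<in> C"
    and Cinv: "\<And>x. x \<in> C \<Longrightarrow> inverse x \<in> C"
    and AC: "\<And>a c. a \<in> A \<Longrightarrow> c \<in> C \<Longrightarrow> commutes a c"
    and BC: "\<And>b b' c. b \<in> B \<Longrightarrow> b' \<in> B \<Longrightarrow> c \<in> C \<Longrightarrow> commutes b' (commut b c)"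
    and BC': "\<And>b c c'. b \<in> B \<Longrightarrow> c \<in> C \<Longrightarrow> c' \<in> C \<Longrightarrow> commutes c' (commut b c)"
    and AB: "\<And>a a' b. a \<in> A \<Longrightarrow> a' \<in> A \<Longrightarrow> b \<in> B \<Longrightarrow> commutes a (conjug a' b)"
    and AB5: "\<And>a b. a \<in> A \<Longrightarrow> b \<in> B \<Longrightarrow>
      a * (conjug a b * conjug a (b ^ 2) * conjug a (b ^ 3) * conjug a (b ^ 4)) = 1"
    and Z: "Z = {commut b c | b c. b \<in> B \<and> c \<in> C}"
    and D1: "\<And>a a' s t. a \<in> A \<Longrightarrow> a' \<in> A \<Longrightarrow> s \<in> gen (B \<union> C) \<Longrightarrow> t \<in> gen (B \<union> C) \<Longrightarrow>
      commut (conjug a s) (conjug a' t) \<in> D"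
    and D2: "\<And>a z. a \<in> A \<Longrightarrow> z \<in> Z \<Longrightarrow> commut (commut a z) z \<in> D"
    and D3: "\<And>a z b. a \<in> A \<Longrightarrow> z \<in> Z \<Longrightarrow> b \<in> B \<Longrightarrow> commut (commut a z) b \<in> D"
    and h: "h \<in> gen (A \<union> B \<union> C)" "h \<in> D"
  shows "h = 1"
proof -
  have ZI: "commut b c \<in> Z" if "b \<in> B" "c \<in> C" for b c using that Z by blast
  have bZ: "commutes b z" if "b \<in> B" "z \<in> Z" for b z using that BC Z by blast
  have cZ: "commutes c z" if "c \<in> C" "z \<in> Z" for c z using that BC' Z by blast
  have Bpow: "b ^ n \<in> B" if "b \<in> B" for b n by (induction n) (auto intro: Bone Bmult that)
  have Cpow: "c ^ n \<in> C" if "c \<in> C" for c n by (induction n) (auto intro: Cone Cmult that)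
  have bcpow: "conjug b (c ^ n) = b * commut b c ^ n" if mem: "b \<in> B" "c \<in> C" for b c n
  proof (induction n)
    case (Suc n)
    have "conjug (commut b c) (c ^ n) = commut b c"
      using commutes_sym[OF cZ[OF Cpow[OF mem(2)] ZI[OF mem]]] by (simp add: conjug_eq_iff_commutes)
    with Suc show ?case
      by (simp add: conjug_conjug[symmetric] conjug_eq[of b c] conjug_mult mult.assoc power_commutes)
  qed (simp add: conjug_by_one)
  have z5: "z ^ 5 = 1" if z: "z \<in> Z" for z
  proof -
    obtain b c where *: "z = commut b c" "b \<in> B" "c \<in> C" using z Z by blast
    then have "commutes (commut b c) b" using bZ[OF _ z] commutes_sym by blast
    from commut_power_commuting[OF this, of 5] * B5 show ?thesis by (simp add: conjug_one inverse_one)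
  qed
  have Zinv: "inverse z \<in> Z" if z: "z \<in> Z" for z
  proof -
    obtain b c where *: "z = commut b c" "b \<in> B" "c \<in> C" using z Z by blast
    have "z * z ^ 4 = 1" using z5[OF z] by (simp add: eval_nat_numeral)
    then have "inverse z = z ^ 4" by (rule inverse_unique_left)
    also have "\<dots> = commut b (c ^ 4)" by (simp add: commut_eq[of b] bcpow * inverse_mult_cancel)
    finally show ?thesis using * ZI Cpow by simp
  qed
  have Afix: "conjug a c = a" if "a \<in> A" "c \<in> C" for a c
    using AC[OF that] by (simp add: conjug_eq_iff_commutes)
  \<comment> \<open>The number \<open>i\<close> inverts \<open>m\<close> modulo 5. Conjugation by
    \<open>c ^ i\<close> fixes \<open>a\<close> and \<open>a'\<close> and turns b^m into b^m z^(im)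
    = b^m z with z = [b, c].\<close>
  have line: "commutes a (conjug a' (b ^ m * commut b c))"
    if mem: "a \<in> A" "a' \<in> A" "b \<in> B" "c \<in> C" and im: "i * m = 5 * l + 1" for a a' b c i m l
  proof -
    have "commutes (conjug a (c ^ i)) (conjug (conjug a' (b ^ m)) (c ^ i))"
      using AB[OF mem(1,2) Bpow[OF mem(3)]] by (simp add: commutes_conjug_iff)
    moreover have "conjug (conjug a' (b ^ m)) (c ^ i) = conjug (conjug a' (c ^ i)) (conjug (b ^ m) (c ^ i))"
      by (simp add: conjug_def group_simps)
    moreover have "conjug (b ^ m) (c ^ i) = b ^ m * commut b c ^ (i * m)"
      using mem by (simp add: conjug_power bcpow mult_power_commutes commutes_power bZ ZI power_mult)
    moreover have "commut b c ^ (i * m) = commut b c"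
      using z5[OF ZI[OF mem(3,4)]] unfolding im by (simp add: power_add power_mult)
    ultimately show ?thesis using mem by (simp add: Afix Cpow)
  qed
  have aZ: "commutes a (conjug a' z)" if mem: "a \<in> A" "a' \<in> A" "z \<in> Z" for a a' z
  proof -
    obtain b c where *: "z = commut b c" "b \<in> B" "c \<in> C" using mem(3) Z by blast
    \<comment> \<open>\<open>line\<close> with exponent \<open>5 - j\<close>, conjugated by
      \<open>b ^ j\<close>, leaves only \<open>z\<close> because b^5 = 1. This reaches j = 1, ...,
      4; for j = 0 the exponent is not invertible modulo 5.\<close>
    have shift: "commutes (conjug a' z) (conjug a (b ^ j))"
      if im: "i * (5 - j) = 5 * l + 1" and j: "j \<le> 5" for i j l
    proof -
      have "commutes (conjug a (b ^ j)) (conjug (conjug a' (b ^ (5 - j) * z)) (b ^ j))"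
        using line[OF mem(1,2) *(2,3) im] by (simp add: commutes_conjug_iff *)
      moreover have "b ^ (5 - j) * z * b ^ j = b ^ (5 - j + j) * z"
        using bZ[OF Bpow[OF *(2)] mem(3), of j] by (simp add: commutes_def mult.assoc power_add)
      ultimately have "commutes (conjug a (b ^ j)) (conjug a' z)"
        using j B5[OF *(2)] by (simp add: conjug_conjug)
      then show ?thesis by (rule commutes_sym)
    qed
    \<comment> \<open>The missing case j = 0 is the wanted one. \<open>AB5\<close> supplies it, as
      it writes \<open>inverse a\<close> as a product over exactly the cases j = 1, ..., 4.\<close>
    have "inverse a = conjug a b * conjug a (b ^ 2) * conjug a (b ^ 3) * conjug a (b ^ 4)"
      using AB5[OF mem(1) *(2)] by (rule inverse_unique_left)
    moreover have "commutes (conjug a' z) (conjug a b * conjug a (b ^ 2) * conjug a (b ^ 3) * conjug a (b ^ 4))"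
      using shift[of 4 1 3] shift[of 2 2 1] shift[of 3 3 1] shift[of 1 4 0]
      by (intro commutes_mult) simp_all
    ultimately have "commutes (conjug a' z) (inverse a)" by simp
    from commutes_inverse[OF this] show ?thesis
      by (simp add: inverse_involutive commutes_sym)
  qed
  have AA: "commutes a a'" if "a \<in> A" "a' \<in> A" for a a'
    using AB[OF that Bone] by (simp add: conjug_by_one)
  have aT: "commutes a' (commut a z)" if "a \<in> A" "a' \<in> A" "z \<in> Z" for a a' z
    unfolding commut_eq using that by (intro commutes_mult commutes_inverse AA aZ)
  have zz: "commutes z z'" if zz: "z \<in> Z" "z' \<in> Z" for z z'
  proof -
    obtain b c where "z' = commut b c" "b \<in> B" "c \<in> C" using zz Z by blast
    then show ?thesis
      using commutes_commut[OF commutes_sym[OF bZ] commutes_sym[OF cZ]] zz by blast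
  qed
  have abelian_trivial: "x = 1"
    if "x \<in> D" "x \<in> gen S" "\<And>y. y \<in> S \<Longrightarrow> y ^ 5 = 1" "\<And>y z. y \<in> S \<Longrightarrow> z \<in> S \<Longrightarrow> commutes y z" for x S
    using D_trivial[OF that(1) gen_commuting_power[OF that(2-4)]] by simp
  have cj5: "conjug a k ^ 5 = 1" if "a \<in> A" for a k
    using that A5 by (simp add: conjug_power[symmetric] conjug_one)
  have zT: "commutes z (commut a z)" if mem: "a \<in> A" "z \<in> Z" for a z
  proof -
    \<comment> \<open>The iterated commutator is a word in these elements, which commute and have
      trivial fifth powers. So its own fifth power is trivial, and as an element of \<open>D\<close>
      it vanishes.\<close>
    define S where "S = {a, conjug a z, conjug a (z * z)}"
    have "commutes (conjug a z) (conjug a (z * z))" "commutes a (conjug a (z * z))"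
    proof -
      show *: "commutes (conjug a z) (conjug a (z * z))"
        using aZ[OF mem(1) mem] commutes_conjug_iff[of a z "conjug a z"] by (simp add: conjug_conjug)
      obtain b c where bc: "z = commut b c" "b \<in> B" "c \<in> C" using mem(2) Z by blast
      have "commut b (c ^ 2) = z * z"
        unfolding commut_eq[of b "c ^ 2"] bcpow[OF bc(2,3)] bc(1) by (simp add: inverse_mult_cancel power2_eq_square)
      with bc ZI[OF bc(2) Cpow[OF bc(3), of 2]] have "z * z \<in> Z" by simp
      with mem aZ show "commutes a (conjug a (z * z))" by blast
    qed
    with aZ[OF mem(1) mem] have "commutes x y" if "x \<in> S" "y \<in> S" for x y
      using that commutes_refl commutes_sym unfolding S_def by blast
    moreover have "commut (commut a z) z \<in> gen S"
      unfolding commut_eq[of _ z] conjug_mult conjug_inverse conjug_conjug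
      by (intro gen_closed gen_inverse gen_incl) (auto simp: S_def)
    moreover have "y ^ 5 = 1" if "y \<in> S" for y
      using that A5[OF mem(1)] cj5[OF mem(1)] unfolding S_def by blast
    ultimately have "commut (commut a z) z = 1"
      by (metis (no_types, lifting) abelian_trivial D2 mem)
    then show ?thesis by (simp add: commut_eq_one_iff commutes_sym)
  qed
  have ap: "conjug a z * conjug a (inverse z) = a * a" if "a \<in> A" "z \<in> Z" for a z
    using that by (intro conjug_inverse_commuting commutes_sym[OF aT] commutes_sym[OF zT])
  have gZ: "z \<in> gen (B \<union> C)" if "z \<in> Z" for z
    using that unfolding Z commut_def by (auto intro!: gen_closed gen_inverse intro: gen_incl)
  have gB: "b \<in> gen (B \<union> C)" if "b \<in> B" for b using that by (intro gen_incl) simp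
  have abz: "commutes a (conjug a' (b * z))" if mem: "a \<in> A" "a' \<in> A" "b \<in> B" "z \<in> Z" for a a' b z
  proof -
    define x where "x = conjug a' (b * z)"
    define u where "u = conjug a' b * conjug a' b"
    define P where "P = commut a x"
    have P: "P \<in> D" unfolding P_def x_def
      using D1[OF mem(1,2) gen.one gen_closed[OF gB gZ]] mem by (simp add: conjug_by_one)
    have bz: "b * z = z * b" using bZ mem by (simp add: commutes_def)
    \<comment> \<open>A conjugate of the relation between \<open>a\<close> and
      \<open>conjug a' b\<close>. It is used for \<open>z\<close> and for its inverse, whose
      conjugates of \<open>a\<close> have product \<open>a * a\<close>.\<close>
    have side: "commutes (conjug a y) (commut a (conjug a' (b * y)))" if y: "y \<in> Z" for y
    proof (intro commutes_commut)
      show "commutes (conjug a y) a" using mem y by (intro commutes_sym[OF aZ])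
      show "commutes (conjug a y) (conjug a' (b * y))"
        using AB[OF mem(1-3)] commutes_conjug_iff[of a y "conjug a' b"] by (simp add: conjug_conjug)
    qed
    have "x * conjug a' (b * inverse z) = u"
      using arg_cong[OF ap[OF mem(2,4)], of "\<lambda>y. conjug y b"] bZ[OF mem(3) Zinv[OF mem(4)]]
      by (simp add: conjug_mult conjug_conjug bz x_def u_def commutes_def)
    then have x': "conjug a' (b * inverse z) = inverse x * u"
      by (metis inverse_mult_cancel)
    have "commutes (conjug a' b) x"
      using aZ[OF mem(2,2,4)] commutes_conjug_iff[of a' b "conjug a' z"] by (simp add: x_def conjug_conjug bz)
    then have xu: "commutes x u" unfolding u_def using commutes_sym commutes_mult by blast
    have au: "commutes a u" unfolding u_def using mem by (intro commutes_mult AB)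
    \<comment> \<open>Inverting \<open>z\<close> turns \<open>x\<close> into
      \<open>inverse x * u\<close>, and hence the commutator into a conjugate of
      \<open>inverse P\<close>. Undoing the conjugation by \<open>x\<close> changes
      \<open>conjug a (inverse z)\<close> only by a commutator in \<open>D\<close>, which commutes
      with \<open>P\<close>.\<close>
    have "commut a (inverse x * u) = commut a (inverse x)"
      by (rule commut_mult_commutes[OF au commutes_sym[OF commutes_inverse[OF commutes_sym[OF xu]]]])
    also have "\<dots> = conjug (inverse P) (inverse x)"
      by (simp add: P_def commut_def conjug_def group_simps)
    finally have "commutes (conjug a (inverse z)) (conjug (inverse P) (inverse x))"
      using side[OF Zinv[OF mem(4)]] by (simp add: x')
    then have "commutes (conjug (conjug a (inverse z)) x) (inverse P)"
      using commutes_conjug_iff[of "conjug a (inverse z)" x "conjug (inverse P) (inverse x)"]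
      by (simp add: conjug_inverse_cancel)
    then have "commutes P (conjug (conjug a (inverse z)) x)"
      using commutes_inverse[of _ "inverse P"] commutes_sym by (fastforce simp: inverse_involutive)
    moreover have "commut (conjug a (inverse z)) x \<in> D"
      unfolding x_def using mem by (intro D1 gen_closed gB gZ Zinv)
    then have "commutes P (inverse (commut (conjug a (inverse z)) x))"
      by (intro commutes_inverse D_commutes P)
    ultimately have "commutes P (conjug (conjug a (inverse z)) x * inverse (commut (conjug a (inverse z)) x))"
      by (rule commutes_mult)
    then have "commutes P (conjug a (inverse z))"
      by (simp add: conjug_eq[of "conjug a (inverse z)"] group_simps)
    moreover have "commutes P (conjug a z)"
      using side[OF mem(4)] unfolding P_def x_def by (rule commutes_sym)
    ultimately have "commutes P (a * a)"
      unfolding ap[OF mem(1,4), symmetric] by (intro commutes_mult)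
    from D_commutes_trivial[OF P[unfolded P_def] commutes_square[OF this A5, unfolded P_def] A5] mem
    show ?thesis by (simp add: x_def)
  qed
  have bT: "commutes b (commut a z)" if mem: "a \<in> A" "z \<in> Z" "b \<in> B" for a z b
  proof -
    \<comment> \<open>As for \<open>zT\<close>, now that \<open>abz\<close> makes the four
      conjugates commute pairwise.\<close>
    define S where "S = {a, conjug a z, conjug a b, conjug a (b * z)}"
    have bz: "b * z = z * b" "b * inverse z = inverse z * b"
      using bZ[OF mem(3,2)] bZ[OF mem(3) Zinv[OF mem(2)]] by (simp_all add: commutes_def)
    have "commutes (conjug a z) (conjug a b)"
      using abz[OF mem(1,1,3) Zinv[OF mem(2)]] commutes_conjug_iff[of a z "conjug a (b * inverse z)"]
      by (simp add: conjug_conjug group_simps)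
    moreover have "commutes (conjug a z) (conjug a (b * z))"
      using AB[OF mem(1,1,3)] commutes_conjug_iff[of a z "conjug a b"] by (simp add: conjug_conjug)
    moreover have "commutes (conjug a b) (conjug a (b * z))"
      using aZ[OF mem(1,1,2)] commutes_conjug_iff[of a b "conjug a z"] by (simp add: conjug_conjug bz)
    ultimately have "commutes x y" if "x \<in> S" "y \<in> S" for x y
      using that commutes_refl commutes_sym aZ[OF mem(1,1,2)] AB[OF mem(1,1,3)] abz[OF mem(1,1,3,2)]
      unfolding S_def by blast
    moreover have "commut (commut a z) b \<in> gen S"
      unfolding commut_eq conjug_mult conjug_inverse conjug_conjug bz(1)[symmetric]
      by (intro gen_closed gen_inverse gen_incl) (auto simp: S_def)
    moreover have "y ^ 5 = 1" if "y \<in> S" for y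
      using that A5[OF mem(1)] cj5[OF mem(1)] unfolding S_def by blast
    ultimately have "commut (commut a z) b = 1"
      by (metis (no_types, lifting) abelian_trivial D3 mem)
    then show ?thesis by (simp add: commut_eq_one_iff commutes_sym)
  qed
  have cT: "commutes c (commut a z)" if "a \<in> A" "z \<in> Z" "c \<in> C" for a z c
    using that by (intro commutes_commut commutes_sym[OF AC] cZ)
  have zT': "commutes z' (commut a z)" if mem: "a \<in> A" "z \<in> Z" "z' \<in> Z" for a z z'
  proof -
    obtain b c where *: "z' = commut b c" "b \<in> B" "c \<in> C" using mem(3) Z by blast
    have "commutes (commut a z) (commut b c)"
      using mem * by (intro commutes_commut commutes_sym[OF bT] commutes_sym[OF cT])
    then show ?thesis unfolding * by (rule commutes_sym)
  qed
  \<comment> \<open>Conjugates by \<open>b * z\<close> are products of two elements of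
    \<open>M\<close>, as \<open>bz\<close> shows, so this set generates all conjugates of
    \<open>A\<close> by the group of \<open>B\<close> and \<open>C\<close>.\<close>
  define M where "M = {conjug a b | a b. a \<in> A \<and> b \<in> B} \<union> {commut a z | a z. a \<in> A \<and> z \<in> Z}"
  have Mb: "conjug a b \<in> M" if "a \<in> A" "b \<in> B" for a b using that unfolding M_def by blast
  have MT: "commut a z \<in> M" if "a \<in> A" "z \<in> Z" for a z using that unfolding M_def by blast
  have bb: "commutes (conjug a b) (conjug a' b')" if mem: "a \<in> A" "a' \<in> A" "b \<in> B" "b' \<in> B" for a a' b b'
  proof -
    have "commutes a (conjug a' (b' * inverse b))" using mem by (intro AB Bmult Binv)
    then show ?thesis
      using commutes_conjug_iff[of a b "conjug a' (b' * inverse b)"] by (simp add: conjug_conjug group_simps)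
  qed
  have bTj: "commutes (conjug a' b) (commut a z)" if "a \<in> A" "a' \<in> A" "b \<in> B" "z \<in> Z" for a a' b z
    using that by (intro commutes_sym[OF commutes_conjug] commutes_sym[OF aT] commutes_sym[OF bT])
  have TT: "commutes (commut a z) (commut a' z')" if "a \<in> A" "a' \<in> A" "z \<in> Z" "z' \<in> Z" for a a' z z'
    using that by (intro commutes_commut commutes_sym[OF aT] commutes_sym[OF zT'])
  have MM: "commutes x y" if "x \<in> M" "y \<in> M" for x y
    using that unfolding M_def
    by (elim UnE CollectE exE conjE; hypsubst) (blast intro: bb bTj commutes_sym[OF bTj] TT)+
  have T5: "commut a z ^ 5 = 1" if "a \<in> A" "z \<in> Z" for a z
    using commut_power_commuting[OF commutes_sym[OF aT[OF that(1,1,2)]], of 5] that A5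
    by (simp add: conjug_one inverse_one)
  have M5: "x ^ 5 = 1" if "x \<in> M" for x using that cj5 T5 unfolding M_def by auto
  have Mfix: "conjug (commut a z) k = commut a z" if "a \<in> A" "z \<in> Z" "k \<in> B \<union> C \<union> Z" for a z k
    using that by (auto simp: conjug_eq_iff_commutes intro: commutes_sym[OF bT] commutes_sym[OF cT] commutes_sym[OF zT'])
  have bz: "conjug a (b * z) \<in> gen M" if mem: "a \<in> A" "b \<in> B" "z \<in> Z" for a b z
  proof -
    have "conjug a (b * z) = conjug (conjug a z) b"
      using bZ[OF mem(2,3)] by (simp add: conjug_conjug commutes_def)
    also have "\<dots> = conjug a b * commut a z"
      using mem by (simp add: conjug_eq[of a z] conjug_mult Mfix)
    finally show ?thesis using mem by (simp add: gen_closed gen_incl Mb MT)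
  qed
  have Mk: "conjug m k \<in> gen M" if mem: "m \<in> M" "k \<in> B \<union> C \<union> Z" for m k
  proof -
    consider a b where "m = conjug a b" "a \<in> A" "b \<in> B" | a z where "m = commut a z" "a \<in> A" "z \<in> Z"
      using mem(1) unfolding M_def by blast
    then show ?thesis
    proof cases
      case 1
      consider "k \<in> B" | "k \<in> C" | "k \<in> Z" using mem(2) by blast
      then show ?thesis
      proof cases
        case 1
        with \<open>m = conjug a b\<close> \<open>a \<in> A\<close> \<open>b \<in> B\<close> show ?thesis by (simp add: conjug_conjug gen_incl Mb Bmult)
      next
        case 2
        have "conjug m k = conjug (conjug a k) (conjug b k)"
          by (simp add: \<open>m = conjug a b\<close> conjug_def group_simps)
        also have "\<dots> = conjug a (b * commut b k)"
          using \<open>a \<in> A\<close> 2 by (simp add: Afix conjug_eq[of b])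
        finally show ?thesis using bz ZI 2 \<open>a \<in> A\<close> \<open>b \<in> B\<close> by simp
      next
        case 3
        with \<open>m = conjug a b\<close> \<open>a \<in> A\<close> \<open>b \<in> B\<close> show ?thesis by (simp add: conjug_conjug bz)
      qed
    next
      case 2
      then show ?thesis using Mfix mem by (simp add: gen_incl)
    qed
  qed
  have EC: "conjug e c \<in> gen (B \<union> Z)" if "e \<in> B \<union> Z" "c \<in> C" for e c
  proof (cases "e \<in> B")
    case True
    then show ?thesis unfolding conjug_eq[of e c] using ZI that by (intro gen_closed gen_incl) auto
  next
    case False
    then have "conjug e c = e" using that cZ commutes_sym by (auto simp: conjug_eq_iff_commutes)
    then show ?thesis using that gen_incl[of e "B \<union> Z"] by simp
  qed
  have AM: "a \<in> M" if "a \<in> A" for a using Mb[OF that Bone] by (simp add: conjug_by_one)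
  have EE: "commutes x y" if "x \<in> B \<union> Z" "y \<in> B \<union> Z" for x y
    using that BB bZ zz commutes_sym by blast
  have "h \<in> gen (M \<union> (B \<union> Z) \<union> C)"
    using h(1) by (rule gen_mono_induct) (use AM in \<open>auto intro: gen_incl\<close>)
  moreover have "conjug m k \<in> gen M \<and> conjug m (inverse k) \<in> gen M" if "m \<in> M" "k \<in> B \<union> Z" for m k
    using that Mk Binv Zinv by blast
  moreover have "conjug m k \<in> gen M \<and> conjug m (inverse k) \<in> gen M" if "m \<in> M" "k \<in> C" for m k
    using that Mk Cinv by blast
  moreover have "conjug e c \<in> gen (B \<union> Z) \<and> conjug e (inverse c) \<in> gen (B \<union> Z)"
    if "e \<in> B \<union> Z" "c \<in> C" for e c
    using that EC Cinv by blast
  moreover have "x ^ 5 = 1" if "x \<in> B \<union> Z" for x using that B5 z5 by blast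
  ultimately have "h ^ 125 = 1"
    using gen_tower_torsion[OF MM M5 EE _ CC C5] by blast
  then show ?thesis using D_trivial[OF h(2)] by simp
qed

end

section \<open>Families of lifts up to small errors\<close>

lemma bit_add_self: "(x :: bit) + x = 0"
  by (cases x) simp_all

type_synonym ('m, 'p) lift_fam = "nat \<times> 'p \<Rightarrow> ('m \<Rightarrow> 'm) \<times> ('m \<Rightarrow> bit)"

text \<open>Finiteness is part of the relation because \<open>card\<close> is 0 on infinite sets.
  Only families of bijections are related to themselves: bijections preserve the number of errors,
  so that products and inverses respect the relation.\<close>

definition fam_rel :: "('m, 'p) lift_fam \<Rightarrow> ('m, 'p) lift_fam \<Rightarrow> bool" where
  "fam_rel x y \<longleftrightarrow> (\<forall>i. bij (fst (x i)) \<and> fst (y i) = fst (x i)) \<and>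
    (\<exists>C. \<forall>i. finite {g. snd (x i) g \<noteq> snd (y i) g} \<and> card {g. snd (x i) g \<noteq> snd (y i) g} \<le> C * fst i)"

lemma fam_relI:
  assumes "\<And>i. bij (fst (x i))" "\<And>i. fst (y i) = fst (x i)"
    "\<And>i. finite {g. snd (x i) g \<noteq> snd (y i) g}"
    "\<And>i. card {g. snd (x i) g \<noteq> snd (y i) g} \<le> C * fst i"
  shows "fam_rel x y"
  using assms unfolding fam_rel_def by blast

lemma fam_relD:
  assumes "fam_rel x y"
  shows "bij (fst (x i))" "fst (y i) = fst (x i)"
  using assms unfolding fam_rel_def by blast+

lemmas fam_rel_bij = fam_relD(1)[of x x for x]

lemma fam_rel_refl_iff: "fam_rel x x \<longleftrightarrow> (\<forall>i. bij (fst (x i)))"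
  unfolding fam_rel_def by simp

lemma fam_rel_eqI: "(\<And>i. bij (fst (x i))) \<Longrightarrow> x = y \<Longrightarrow> fam_rel x y"
  by (simp add: fam_rel_refl_iff)

lemma fam_rel_sym: "fam_rel x y \<Longrightarrow> fam_rel y x"
  unfolding fam_rel_def by (simp add: eq_commute[of "snd (x _) _"])

lemma fam_rel_trans:
  assumes "fam_rel x y" "fam_rel y z"
  shows "fam_rel x z"
proof -
  obtain C where C: "\<And>i. finite {g. snd (x i) g \<noteq> snd (y i) g}"
    "\<And>i. card {g. snd (x i) g \<noteq> snd (y i) g} \<le> C * fst i"
    using assms(1) unfolding fam_rel_def by blast
  obtain C' where C': "\<And>i. finite {g. snd (y i) g \<noteq> snd (z i) g}"
    "\<And>i. card {g. snd (y i) g \<noteq> snd (z i) g} \<le> C' * fst i"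
    using assms(2) unfolding fam_rel_def by blast
  have sub: "{g. snd (x i) g \<noteq> snd (z i) g} \<subseteq>
    {g. snd (x i) g \<noteq> snd (y i) g} \<union> {g. snd (y i) g \<noteq> snd (z i) g}" for i by auto
  show ?thesis
  proof (rule fam_relI)
    fix i
    show "finite {g. snd (x i) g \<noteq> snd (z i) g}"
      using finite_subset[OF sub] C(1) C'(1) by blast
    have "card {g. snd (x i) g \<noteq> snd (z i) g} \<le>
      card ({g. snd (x i) g \<noteq> snd (y i) g} \<union> {g. snd (y i) g \<noteq> snd (z i) g})"
      using C(1) C'(1) by (intro card_mono[OF _ sub]) blast
    also have "\<dots> \<le> card {g. snd (x i) g \<noteq> snd (y i) g} + card {g. snd (y i) g \<noteq> snd (z i) g}"
      by (rule card_Un_le)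
    also have "\<dots> \<le> (C + C') * fst i" using add_mono[OF C(2) C'(2)] by (simp add: algebra_simps)
    finally show "card {g. snd (x i) g \<noteq> snd (z i) g} \<le> (C + C') * fst i" .
  qed (simp_all only: fam_relD[OF assms(1)] fam_relD[OF assms(2)])
qed

text \<open>
  The index of a family consists of a weight and a parameter. Two families of elements of wreath
  products with the group of order 2 are identified if they induce the same permutations and the
  number of points at which they differ is bounded by a constant multiple of the weight.
\<close>

quotient_type ('m, 'p) lift = "('m, 'p) lift_fam" / partial: fam_rel
proof (rule part_equivpI)
  show "\<exists>x. fam_rel x x" by (rule exI[of _ "\<lambda>_. (id, \<lambda>_. 0)"]) (simp add: fam_rel_refl_iff)
  show "symp fam_rel" by (rule sympI) (rule fam_rel_sym)
  show "transp fam_rel" by (rule transpI) (rule fam_rel_trans)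
qed

instantiation lift :: (type, type) group_mult
begin

lift_definition one_lift :: "('a, 'b) lift" is "\<lambda>_. (id, \<lambda>_. 0)"
  by (simp add: fam_rel_refl_iff)

text \<open>The first factor acts first. Thus right translations multiply in the order of the group,
  while permutations compose in the opposite one.\<close>

lift_definition times_lift :: "('a, 'b) lift \<Rightarrow> ('a, 'b) lift \<Rightarrow> ('a, 'b) lift" is
  "\<lambda>x y i. (fst (y i) \<circ> fst (x i), \<lambda>g. snd (x i) g + snd (y i) (fst (x i) g))"
proof -
  fix x x' y y' :: "('a, 'b) lift_fam"
  assume x: "fam_rel x x'" and y: "fam_rel y y'"
  obtain C where C: "\<And>i. finite {g. snd (x i) g \<noteq> snd (x' i) g}"
    "\<And>i. card {g. snd (x i) g \<noteq> snd (x' i) g} \<le> C * fst i"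
    using x unfolding fam_rel_def by blast
  obtain C' where C': "\<And>i. finite {g. snd (y i) g \<noteq> snd (y' i) g}"
    "\<And>i. card {g. snd (y i) g \<noteq> snd (y' i) g} \<le> C' * fst i"
    using y unfolding fam_rel_def by blast
  have b: "bij (fst (x i))" "fst (x' i) = fst (x i)" "bij (fst (y i))" "fst (y' i) = fst (y i)" for i
    using x y by (simp_all add: fam_relD)
  let ?N = "\<lambda>i. {g. snd (x i) g + snd (y i) (fst (x i) g) \<noteq> snd (x' i) g + snd (y' i) (fst (x' i) g)}"
  have sub: "?N i \<subseteq> {g. snd (x i) g \<noteq> snd (x' i) g} \<union> fst (x i) -` {g. snd (y i) g \<noteq> snd (y' i) g}" for i
    by (auto simp: b)
  have fin: "finite (fst (x i) -` {g. snd (y i) g \<noteq> snd (y' i) g})" for i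
    using C'(1) b(1) by (intro finite_vimageI bij_is_inj)
  show "fam_rel (\<lambda>i. (fst (y i) \<circ> fst (x i), \<lambda>g. snd (x i) g + snd (y i) (fst (x i) g)))
    (\<lambda>i. (fst (y' i) \<circ> fst (x' i), \<lambda>g. snd (x' i) g + snd (y' i) (fst (x' i) g)))"
  proof (rule fam_relI)
    fix i
    show "finite {g. snd (fst (y i) \<circ> fst (x i), \<lambda>g. snd (x i) g + snd (y i) (fst (x i) g)) g \<noteq>
      snd (fst (y' i) \<circ> fst (x' i), \<lambda>g. snd (x' i) g + snd (y' i) (fst (x' i) g)) g}"
      using finite_subset[OF sub] C(1) fin by simp
    have "card (?N i) \<le> card ({g. snd (x i) g \<noteq> snd (x' i) g} \<union> fst (x i) -` {g. snd (y i) g \<noteq> snd (y' i) g})"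
      using C(1) fin by (intro card_mono[OF _ sub]) blast
    also have "\<dots> \<le> card {g. snd (x i) g \<noteq> snd (x' i) g} + card (fst (x i) -` {g. snd (y i) g \<noteq> snd (y' i) g})"
      by (rule card_Un_le)
    also have "card (fst (x i) -` {g. snd (y i) g \<noteq> snd (y' i) g}) = card {g. snd (y i) g \<noteq> snd (y' i) g}"
      using bij_is_inj[OF b(1)[of i]] bij_is_surj[OF b(1)[of i]] by (intro card_vimage_inj) simp_all
    also have "card {g. snd (x i) g \<noteq> snd (x' i) g} + \<dots> \<le> (C + C') * fst i"
      using add_mono[OF C(2) C'(2)] by (simp add: algebra_simps)
    finally show "card {g. snd (fst (y i) \<circ> fst (x i), \<lambda>g. snd (x i) g + snd (y i) (fst (x i) g)) g \<noteq>
      snd (fst (y' i) \<circ> fst (x' i), \<lambda>g. snd (x' i) g + snd (y' i) (fst (x' i) g)) g} \<le> (C + C') * fst i"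
      by simp
  qed (use b in \<open>auto intro: bij_comp\<close>)
qed

lift_definition inverse_lift :: "('a, 'b) lift \<Rightarrow> ('a, 'b) lift" is
  "\<lambda>x i. (inv_into UNIV (fst (x i)), \<lambda>g. snd (x i) (inv_into UNIV (fst (x i)) g))"
proof -
  fix x x' :: "('a, 'b) lift_fam"
  assume x: "fam_rel x x'"
  obtain C where C: "\<And>i. finite {g. snd (x i) g \<noteq> snd (x' i) g}"
    "\<And>i. card {g. snd (x i) g \<noteq> snd (x' i) g} \<le> C * fst i"
    using x unfolding fam_rel_def by blast
  have b: "bij (fst (x i))" "fst (x' i) = fst (x i)" for i
    using x by (simp_all add: fam_relD)
  have eq: "{g. snd (x i) (inv_into UNIV (fst (x i)) g) \<noteq> snd (x' i) (inv_into UNIV (fst (x' i)) g)} =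
    inv_into UNIV (fst (x i)) -` {g. snd (x i) g \<noteq> snd (x' i) g}" for i by (simp add: b vimage_def)
  have ib: "bij (inv_into UNIV (fst (x i)))" for i using b by (simp add: bij_imp_bij_inv)
  show "fam_rel (\<lambda>i. (inv_into UNIV (fst (x i)), \<lambda>g. snd (x i) (inv_into UNIV (fst (x i)) g)))
    (\<lambda>i. (inv_into UNIV (fst (x' i)), \<lambda>g. snd (x' i) (inv_into UNIV (fst (x' i)) g)))"
  proof (rule fam_relI)
    fix i
    show "finite {g. snd (inv_into UNIV (fst (x i)), \<lambda>g. snd (x i) (inv_into UNIV (fst (x i)) g)) g \<noteq>
      snd (inv_into UNIV (fst (x' i)), \<lambda>g. snd (x' i) (inv_into UNIV (fst (x' i)) g)) g}"
      using C(1) ib by (simp only: snd_conv eq) (intro finite_vimageI bij_is_inj)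
    show "card {g. snd (inv_into UNIV (fst (x i)), \<lambda>g. snd (x i) (inv_into UNIV (fst (x i)) g)) g \<noteq>
      snd (inv_into UNIV (fst (x' i)), \<lambda>g. snd (x' i) (inv_into UNIV (fst (x' i)) g)) g} \<le> C * fst i"
      using C(2)[of i] bij_is_inj[OF ib] bij_is_surj[OF ib]
      by (simp only: snd_conv eq) (subst card_vimage_inj, auto)
  qed (use b ib in auto)
qed

definition divide_lift :: "('a, 'b) lift \<Rightarrow> ('a, 'b) lift \<Rightarrow> ('a, 'b) lift" where
  "divide_lift x y = x * inverse y"

instance
proof
  fix a b c :: "('a, 'b) lift"
  show "a * b * c = a * (b * c)"
    by transfer (rule fam_rel_eqI, simp add: fam_rel_bij bij_comp,
        simp only: fst_conv snd_conv comp_assoc comp_apply add.assoc)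
  show "1 * a = a"
    by transfer (rule fam_rel_eqI, simp add: fam_rel_bij,
        simp only: fst_conv snd_conv comp_id id_apply add_0_left prod.collapse)
  show "a * 1 = a"
    by transfer (rule fam_rel_eqI, simp add: fam_rel_bij,
        simp only: fst_conv snd_conv id_comp id_apply add_0_right prod.collapse)
  show "inverse a * a = 1"
    by transfer (rule fam_rel_eqI, simp add: fam_rel_bij bij_comp bij_imp_bij_inv,
        simp only: fst_conv snd_conv bit_add_self surj_iff[THEN iffD1, OF bij_is_surj] fam_rel_bij)
qed

end

lift_definition shadow :: "('m, 'p) lift \<Rightarrow> nat \<times> 'p \<Rightarrow> 'm \<Rightarrow> 'm" is "\<lambda>x i. fst (x i)"
  by (rule ext) (simp add: fam_relD(2))

lemma shadow_mult: "shadow (x * y) i = shadow y i \<circ> shadow x i"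
  by transfer simp

lemma shadow_one: "shadow 1 i = id"
  by transfer simp

lemma shadow_inverse: "shadow (inverse x) i = inv_into UNIV (shadow x i)"
  by transfer simp

definition shadow_kernel :: "('m, 'p) lift set" where
  "shadow_kernel = {h. \<forall>i. shadow h i = id}"

text \<open>Over the identity permutation the product is pointwise addition of values in the field
  with two elements.\<close>

interpretation lift: two_kernel "shadow_kernel :: ('m, 'p) lift set"
proof
  fix c d :: "('m, 'p) lift"
  assume d: "d \<in> shadow_kernel"
  have "d * d = 1" if "\<forall>i. shadow d i = id"
    using that
  proof transfer
    fix d :: "('m, 'p) lift_fam"
    assume d: "fam_rel d d" "\<forall>i. fst (d i) = id"
    have "(\<lambda>i. (fst (d i) \<circ> fst (d i), \<lambda>g. snd (d i) g + snd (d i) (fst (d i) g))) = (\<lambda>_. (id, \<lambda>_. 0))"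
      by (simp only: d(2)[THEN spec] id_comp id_apply bit_add_self)
    then show "fam_rel (\<lambda>i. (fst (d i) \<circ> fst (d i), \<lambda>g. snd (d i) g + snd (d i) (fst (d i) g)))
      (\<lambda>_. (id, \<lambda>_. 0))"
      by (simp only:) (rule fam_rel_eqI, simp_all)
  qed
  with d show "d * d = 1" by (simp add: shadow_kernel_def)
  assume "c \<in> shadow_kernel"
  with d show "c * d \<in> shadow_kernel" by (simp add: shadow_kernel_def shadow_mult)
qed

lemma abs_lift_eq_iff:
  assumes "\<And>i. bij (fst (x i))" "\<And>i. bij (fst (y i))"
  shows "abs_lift x = abs_lift y \<longleftrightarrow> fam_rel x y"
proof -
  have "fam_rel x x" "fam_rel y y" using assms by (simp_all add: fam_rel_refl_iff)
  with Quotient_rel[OF Quotient_lift, of x y] show ?thesis by blast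
qed

section \<open>Relations of the link groups and bounded products\<close>

definition gcomm :: "('g, 'b) monoid_scheme \<Rightarrow> 'g \<Rightarrow> 'g \<Rightarrow> bool" where
  "gcomm G x y \<longleftrightarrow> x \<otimes>\<^bsub>G\<^esub> y = y \<otimes>\<^bsub>G\<^esub> x"

definition gconj :: "('g, 'b) monoid_scheme \<Rightarrow> 'g \<Rightarrow> 'g \<Rightarrow> 'g" where
  "gconj G x y = inv\<^bsub>G\<^esub> y \<otimes>\<^bsub>G\<^esub> x \<otimes>\<^bsub>G\<^esub> y"

definition gcommut :: "('g, 'b) monoid_scheme \<Rightarrow> 'g \<Rightarrow> 'g \<Rightarrow> 'g" where
  "gcommut G x y = inv\<^bsub>G\<^esub> x \<otimes>\<^bsub>G\<^esub> inv\<^bsub>G\<^esub> y \<otimes>\<^bsub>G\<^esub> x \<otimes>\<^bsub>G\<^esub> y"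

primrec bounded_products :: "('g, 'b) monoid_scheme \<Rightarrow> 'g set \<Rightarrow> nat \<Rightarrow> 'g set" where
  "bounded_products G S 0 = {\<one>\<^bsub>G\<^esub>}"
| "bounded_products G S (Suc n) = {x \<otimes>\<^bsub>G\<^esub> s | x s. x \<in> bounded_products G S n \<and> s \<in> S}"

definition common_rel :: "('g, 'b) monoid_scheme \<Rightarrow> 'g set \<Rightarrow> 'g set \<Rightarrow> 'g set \<Rightarrow> bool" where
  "common_rel G A B C \<longleftrightarrow> group G \<and> finite (carrier G) \<and> subgroup A G \<and> subgroup B G \<and> subgroup C G \<and>
    (\<forall>x\<in>A \<union> B \<union> C. x [^]\<^bsub>G\<^esub> (5::nat) = \<one>\<^bsub>G\<^esub>) \<and>
    (\<forall>x\<in>A. \<forall>y\<in>A. gcomm G x y) \<and> (\<forall>x\<in>B. \<forall>y\<in>B. gcomm G x y) \<and> (\<forall>x\<in>C. \<forall>y\<in>C. gcomm G x y) \<and>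
    (\<forall>x\<in>A. \<forall>y\<in>C. gcomm G x y)"

definition conjugates :: "('g, 'b) monoid_scheme \<Rightarrow> 'g set \<Rightarrow> 'g set \<Rightarrow> 'g set" where
  "conjugates G U Y = {gconj G x y | x y. x \<in> U \<and> y \<in> Y}"

definition lg_rel :: "('g, 'b) monoid_scheme \<Rightarrow> 'g set \<Rightarrow> 'g set \<Rightarrow> 'g set \<Rightarrow> bool" where
  "lg_rel G A B C \<longleftrightarrow> common_rel G A B C \<and>
    (\<forall>a\<in>A. \<forall>a'\<in>A. \<forall>b\<in>B. gcomm G a' (gcommut G a b)) \<and>
    (\<forall>a\<in>A. \<forall>b\<in>B. gcomm G b (gcommut G a b)) \<and>
    (\<forall>b\<in>B. \<forall>b'\<in>B. \<forall>c\<in>C. gcomm G b (gconj G b' c)) \<and>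
    (\<forall>a\<in>A. \<forall>a'\<in>A. \<forall>v\<in>conjugates G B C. \<forall>w\<in>conjugates G B C.
      gcomm G a (gconj G a' (v \<otimes>\<^bsub>G\<^esub> w))) \<and>
    (\<forall>a\<in>A. \<forall>u\<in>conjugates G B C. \<forall>v\<in>conjugates G B C. \<forall>w\<in>conjugates G B C.
      gcomm G (gcommut G a u) (gconj G (gcommut G a u) (v \<otimes>\<^bsub>G\<^esub> w))) \<and>
    (\<forall>a\<in>A. \<forall>u\<in>conjugates G B C. \<forall>v\<in>conjugates G B C. \<forall>w\<in>conjugates G B C.
      gcommut G (gcommut G (gcommut G a u) v) w = \<one>\<^bsub>G\<^esub>)"

text \<open>The four clauses after \<open>common_rel\<close> involve only \<open>B\<close> and
  \<open>C\<close>, or only \<open>A\<close> and \<open>B\<close>. The last three mix all root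
  groups and serve only to place commutators in the kernel.\<close>

definition sm_rel :: "('g, 'b) monoid_scheme \<Rightarrow> 'g set \<Rightarrow> 'g set \<Rightarrow> 'g set \<Rightarrow> bool" where
  "sm_rel G A B C \<longleftrightarrow> common_rel G A B C \<and>
    (\<forall>b\<in>B. \<forall>b'\<in>B. \<forall>c\<in>C. gcomm G b' (gcommut G b c)) \<and>
    (\<forall>b\<in>B. \<forall>c\<in>C. \<forall>c'\<in>C. gcomm G c' (gcommut G b c)) \<and>
    (\<forall>a\<in>A. \<forall>a'\<in>A. \<forall>b\<in>B. gcomm G a (gconj G a' b)) \<and>
    (\<forall>a\<in>A. \<forall>b\<in>B. a \<otimes>\<^bsub>G\<^esub> (gconj G a b \<otimes>\<^bsub>G\<^esub> gconj G a (b [^]\<^bsub>G\<^esub> (2::nat)) \<otimes>\<^bsub>G\<^esub>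
      gconj G a (b [^]\<^bsub>G\<^esub> (3::nat)) \<otimes>\<^bsub>G\<^esub> gconj G a (b [^]\<^bsub>G\<^esub> (4::nat))) = \<one>\<^bsub>G\<^esub>) \<and>
    (\<forall>a\<in>A. \<forall>a'\<in>A. \<forall>s\<in>generate G (B \<union> C). \<forall>t\<in>generate G (B \<union> C). gcomm G (gconj G a s) (gconj G a' t)) \<and>
    (\<forall>a\<in>A. \<forall>b\<in>B. \<forall>c\<in>C. gcommut G (gcommut G a (gcommut G b c)) (gcommut G b c) = \<one>\<^bsub>G\<^esub>) \<and>
    (\<forall>a\<in>A. \<forall>b\<in>B. \<forall>c\<in>C. \<forall>b'\<in>B. gcommut G (gcommut G a (gcommut G b c)) b' = \<one>\<^bsub>G\<^esub>)"

lemma lg_relD: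
  assumes "lg_rel G A B C"
  shows "common_rel G A B C"
    and "a \<in> A \<Longrightarrow> a' \<in> A \<Longrightarrow> b \<in> B \<Longrightarrow> gcomm G a' (gcommut G a b)"
    and "a \<in> A \<Longrightarrow> b \<in> B \<Longrightarrow> gcomm G b (gcommut G a b)"
    and "b \<in> B \<Longrightarrow> b' \<in> B \<Longrightarrow> c \<in> C \<Longrightarrow> gcomm G b (gconj G b' c)"
    and "a \<in> A \<Longrightarrow> a' \<in> A \<Longrightarrow> v \<in> conjugates G B C \<Longrightarrow> w \<in> conjugates G B C \<Longrightarrow> gcomm G a (gconj G a' (v \<otimes>\<^bsub>G\<^esub> w))"
    and "a \<in> A \<Longrightarrow> u \<in> conjugates G B C \<Longrightarrow> v \<in> conjugates G B C \<Longrightarrow> w \<in> conjugates G B C \<Longrightarrow> gcomm G (gcommut G a u) (gconj G (gcommut G a u) (v \<otimes>\<^bsub>G\<^esub> w))"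
    and "a \<in> A \<Longrightarrow> u \<in> conjugates G B C \<Longrightarrow> v \<in> conjugates G B C \<Longrightarrow> w \<in> conjugates G B C \<Longrightarrow> gcommut G (gcommut G (gcommut G a u) v) w = \<one>\<^bsub>G\<^esub>"
proof -
  show "common_rel G A B C" using assms unfolding lg_rel_def by (elim conjE)
  have "\<forall>a\<in>A. \<forall>a'\<in>A. \<forall>b\<in>B. gcomm G a' (gcommut G a b)" using assms unfolding lg_rel_def by (elim conjE)
  then show "a \<in> A \<Longrightarrow> a' \<in> A \<Longrightarrow> b \<in> B \<Longrightarrow> gcomm G a' (gcommut G a b)" by blast
  have "\<forall>a\<in>A. \<forall>b\<in>B. gcomm G b (gcommut G a b)" using assms unfolding lg_rel_def by (elim conjE)
  then show "a \<in> A \<Longrightarrow> b \<in> B \<Longrightarrow> gcomm G b (gcommut G a b)" by blast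
  have "\<forall>b\<in>B. \<forall>b'\<in>B. \<forall>c\<in>C. gcomm G b (gconj G b' c)" using assms unfolding lg_rel_def by (elim conjE)
  then show "b \<in> B \<Longrightarrow> b' \<in> B \<Longrightarrow> c \<in> C \<Longrightarrow> gcomm G b (gconj G b' c)" by blast
  have "\<forall>a\<in>A. \<forall>a'\<in>A. \<forall>v\<in>conjugates G B C. \<forall>w\<in>conjugates G B C. gcomm G a (gconj G a' (v \<otimes>\<^bsub>G\<^esub> w))" using assms unfolding lg_rel_def by (elim conjE)
  then show "a \<in> A \<Longrightarrow> a' \<in> A \<Longrightarrow> v \<in> conjugates G B C \<Longrightarrow> w \<in> conjugates G B C \<Longrightarrow> gcomm G a (gconj G a' (v \<otimes>\<^bsub>G\<^esub> w))" by blast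
  have "\<forall>a\<in>A. \<forall>u\<in>conjugates G B C. \<forall>v\<in>conjugates G B C. \<forall>w\<in>conjugates G B C. gcomm G (gcommut G a u) (gconj G (gcommut G a u) (v \<otimes>\<^bsub>G\<^esub> w))" using assms unfolding lg_rel_def by (elim conjE)
  then show "a \<in> A \<Longrightarrow> u \<in> conjugates G B C \<Longrightarrow> v \<in> conjugates G B C \<Longrightarrow> w \<in> conjugates G B C \<Longrightarrow> gcomm G (gcommut G a u) (gconj G (gcommut G a u) (v \<otimes>\<^bsub>G\<^esub> w))" by blast
  have "\<forall>a\<in>A. \<forall>u\<in>conjugates G B C. \<forall>v\<in>conjugates G B C. \<forall>w\<in>conjugates G B C. gcommut G (gcommut G (gcommut G a u) v) w = \<one>\<^bsub>G\<^esub>" using assms unfolding lg_rel_def by (elim conjE)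
  then show "a \<in> A \<Longrightarrow> u \<in> conjugates G B C \<Longrightarrow> v \<in> conjugates G B C \<Longrightarrow> w \<in> conjugates G B C \<Longrightarrow> gcommut G (gcommut G (gcommut G a u) v) w = \<one>\<^bsub>G\<^esub>" by blast
qed

lemma sm_relD:
  assumes "sm_rel G A B C"
  shows "common_rel G A B C"
    and "b \<in> B \<Longrightarrow> b' \<in> B \<Longrightarrow> c \<in> C \<Longrightarrow> gcomm G b' (gcommut G b c)"
    and "b \<in> B \<Longrightarrow> c \<in> C \<Longrightarrow> c' \<in> C \<Longrightarrow> gcomm G c' (gcommut G b c)"
    and "a \<in> A \<Longrightarrow> a' \<in> A \<Longrightarrow> b \<in> B \<Longrightarrow> gcomm G a (gconj G a' b)"
    and "a \<in> A \<Longrightarrow> b \<in> B \<Longrightarrow> a \<otimes>\<^bsub>G\<^esub> (gconj G a b \<otimes>\<^bsub>G\<^esub> gconj G a (b [^]\<^bsub>G\<^esub> (2::nat)) \<otimes>\<^bsub>G\<^esub> gconj G a (b [^]\<^bsub>G\<^esub> (3::nat)) \<otimes>\<^bsub>G\<^esub> gconj G a (b [^]\<^bsub>G\<^esub> (4::nat))) = \<one>\<^bsub>G\<^esub>"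
    and "a \<in> A \<Longrightarrow> a' \<in> A \<Longrightarrow> s \<in> generate G (B \<union> C) \<Longrightarrow> t \<in> generate G (B \<union> C) \<Longrightarrow> gcomm G (gconj G a s) (gconj G a' t)"
    and "a \<in> A \<Longrightarrow> b \<in> B \<Longrightarrow> c \<in> C \<Longrightarrow> gcommut G (gcommut G a (gcommut G b c)) (gcommut G b c) = \<one>\<^bsub>G\<^esub>"
    and "a \<in> A \<Longrightarrow> b \<in> B \<Longrightarrow> c \<in> C \<Longrightarrow> b' \<in> B \<Longrightarrow> gcommut G (gcommut G a (gcommut G b c)) b' = \<one>\<^bsub>G\<^esub>"
proof -
  show "common_rel G A B C" using assms unfolding sm_rel_def by (elim conjE)
  have "\<forall>b\<in>B. \<forall>b'\<in>B. \<forall>c\<in>C. gcomm G b' (gcommut G b c)" using assms unfolding sm_rel_def by (elim conjE)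
  then show "b \<in> B \<Longrightarrow> b' \<in> B \<Longrightarrow> c \<in> C \<Longrightarrow> gcomm G b' (gcommut G b c)" by blast
  have "\<forall>b\<in>B. \<forall>c\<in>C. \<forall>c'\<in>C. gcomm G c' (gcommut G b c)" using assms unfolding sm_rel_def by (elim conjE)
  then show "b \<in> B \<Longrightarrow> c \<in> C \<Longrightarrow> c' \<in> C \<Longrightarrow> gcomm G c' (gcommut G b c)" by blast
  have "\<forall>a\<in>A. \<forall>a'\<in>A. \<forall>b\<in>B. gcomm G a (gconj G a' b)" using assms unfolding sm_rel_def by (elim conjE)
  then show "a \<in> A \<Longrightarrow> a' \<in> A \<Longrightarrow> b \<in> B \<Longrightarrow> gcomm G a (gconj G a' b)" by blast
  have "\<forall>a\<in>A. \<forall>b\<in>B. a \<otimes>\<^bsub>G\<^esub> (gconj G a b \<otimes>\<^bsub>G\<^esub> gconj G a (b [^]\<^bsub>G\<^esub> (2::nat)) \<otimes>\<^bsub>G\<^esub> gconj G a (b [^]\<^bsub>G\<^esub> (3::nat)) \<otimes>\<^bsub>G\<^esub> gconj G a (b [^]\<^bsub>G\<^esub> (4::nat))) = \<one>\<^bsub>G\<^esub>" using assms unfolding sm_rel_def by (elim conjE)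
  then show "a \<in> A \<Longrightarrow> b \<in> B \<Longrightarrow> a \<otimes>\<^bsub>G\<^esub> (gconj G a b \<otimes>\<^bsub>G\<^esub> gconj G a (b [^]\<^bsub>G\<^esub> (2::nat)) \<otimes>\<^bsub>G\<^esub> gconj G a (b [^]\<^bsub>G\<^esub> (3::nat)) \<otimes>\<^bsub>G\<^esub> gconj G a (b [^]\<^bsub>G\<^esub> (4::nat))) = \<one>\<^bsub>G\<^esub>" by blast
  have "\<forall>a\<in>A. \<forall>a'\<in>A. \<forall>s\<in>generate G (B \<union> C). \<forall>t\<in>generate G (B \<union> C). gcomm G (gconj G a s) (gconj G a' t)" using assms unfolding sm_rel_def by (elim conjE)
  then show "a \<in> A \<Longrightarrow> a' \<in> A \<Longrightarrow> s \<in> generate G (B \<union> C) \<Longrightarrow> t \<in> generate G (B \<union> C) \<Longrightarrow> gcomm G (gconj G a s) (gconj G a' t)" by blast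
  have "\<forall>a\<in>A. \<forall>b\<in>B. \<forall>c\<in>C. gcommut G (gcommut G a (gcommut G b c)) (gcommut G b c) = \<one>\<^bsub>G\<^esub>" using assms unfolding sm_rel_def by (elim conjE)
  then show "a \<in> A \<Longrightarrow> b \<in> B \<Longrightarrow> c \<in> C \<Longrightarrow> gcommut G (gcommut G a (gcommut G b c)) (gcommut G b c) = \<one>\<^bsub>G\<^esub>" by blast
  have "\<forall>a\<in>A. \<forall>b\<in>B. \<forall>c\<in>C. \<forall>b'\<in>B. gcommut G (gcommut G a (gcommut G b c)) b' = \<one>\<^bsub>G\<^esub>" using assms unfolding sm_rel_def by (elim conjE)
  then show "a \<in> A \<Longrightarrow> b \<in> B \<Longrightarrow> c \<in> C \<Longrightarrow> b' \<in> B \<Longrightarrow> gcommut G (gcommut G a (gcommut G b c)) b' = \<one>\<^bsub>G\<^esub>" by blast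
qed

lemma (in group) gcommut_eq_one_iff:
  assumes "x \<in> carrier G" "y \<in> carrier G"
  shows "gcommut G x y = \<one> \<longleftrightarrow> gcomm G x y"
proof -
  have "gcommut G x y = inv (y \<otimes> x) \<otimes> (x \<otimes> y)"
    using assms by (simp add: gcommut_def inv_mult_group m_assoc)
  also have "\<dots> = \<one> \<longleftrightarrow> x \<otimes> y = y \<otimes> x"
    using assms by (metis inv_closed inv_equality inv_inv l_inv m_closed)
  finally show ?thesis by (simp add: gcomm_def)
qed

lemma (in group) bounded_products_closed: "S \<subseteq> carrier G \<Longrightarrow> bounded_products G S n \<subseteq> carrier G"
  by (induction n) auto

text \<open>
  For an index \<open>i\<close>, the number of triangles at which the 1-chain violates the cocycle condition is \<open>fst i\<close>,
  and \<open>e2 i h\<close>, \<open>e3 i h\<close> are its values on two edges of the triangle \<open>h\<close>. Indices that are not \<open>ok\<close> are junk.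
\<close>

locale lift_system =
  fixes G :: "nat \<times> 'p \<Rightarrow> 'm monoid" and A B C :: "nat \<times> 'p \<Rightarrow> 'm set"
    and e2 e3 :: "nat \<times> 'p \<Rightarrow> 'm \<Rightarrow> bit" and ok :: "nat \<times> 'p \<Rightarrow> bool"
  assumes common: "ok i \<Longrightarrow> common_rel (G i) (A i) (B i) (C i)"
    and e2: "ok i \<Longrightarrow> h \<in> carrier (G i) \<Longrightarrow> x \<in> C i \<Longrightarrow> e2 i (h \<otimes>\<^bsub>G i\<^esub> x) = e2 i h"
    and e3: "ok i \<Longrightarrow> h \<in> carrier (G i) \<Longrightarrow> x \<in> B i \<Longrightarrow> e3 i (h \<otimes>\<^bsub>G i\<^esub> x) = e3 i h"
    and e23: "ok i \<Longrightarrow> x \<in> A i \<Longrightarrow> card {h \<in> carrier (G i).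
      e2 i (h \<otimes>\<^bsub>G i\<^esub> x) + e3 i (h \<otimes>\<^bsub>G i\<^esub> x) \<noteq> e2 i h + e3 i h} \<le> 2 * fst i"
begin

declare split_paired_All [simp del] add_bit_eq_xor [simp del]

lemma grp: "ok i \<Longrightarrow> group (G i)" and fin: "ok i \<Longrightarrow> finite (carrier (G i))"
  and subA: "ok i \<Longrightarrow> subgroup (A i) (G i)" and subB: "ok i \<Longrightarrow> subgroup (B i) (G i)"
  and subC: "ok i \<Longrightarrow> subgroup (C i) (G i)"
  using common unfolding common_rel_def by blast+

lemmas G_closed = group.inv_closed[OF grp] group.is_monoid[OF grp, THEN monoid.m_closed]
  group.is_monoid[OF grp, THEN monoid.one_closed] group.is_monoid[OF grp, THEN monoid.nat_pow_closed]
lemmas G_assoc = group.is_monoid[OF grp, THEN monoid.m_assoc]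
lemmas G_one = group.is_monoid[OF grp, THEN monoid.r_one] group.is_monoid[OF grp, THEN monoid.l_one]

definition Fam :: "(nat \<times> 'p \<Rightarrow> 'm set) \<Rightarrow> (nat \<times> 'p \<Rightarrow> 'm) set" where
  "Fam U = {k. \<forall>i. ok i \<longrightarrow> k i \<in> U i}"

abbreviation Fams :: "(nat \<times> 'p \<Rightarrow> 'm) set" where "Fams \<equiv> Fam (\<lambda>i. carrier (G i))"

text \<open>The identity outside the carrier makes it a bijection of the whole type; likewise
  \<open>raw\<close> is trivial at junk indices.\<close>

definition rmul :: "nat \<times> 'p \<Rightarrow> 'm \<Rightarrow> 'm \<Rightarrow> 'm" where
  "rmul i k h = (if h \<in> carrier (G i) then h \<otimes>\<^bsub>G i\<^esub> k else h)"

definition raw :: "(nat \<times> 'p \<Rightarrow> 'm \<Rightarrow> bit) \<Rightarrow> (nat \<times> 'p \<Rightarrow> 'm) \<Rightarrow> ('m, 'p) lift_fam" where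
  "raw s k i = (if ok i then (rmul i (k i), \<lambda>h. if h \<in> carrier (G i) then s i h else 0) else (id, \<lambda>_. 0))"

definition S :: "(nat \<times> 'p \<Rightarrow> 'm \<Rightarrow> bit) \<Rightarrow> (nat \<times> 'p \<Rightarrow> 'm) \<Rightarrow> ('m, 'p) lift" where
  "S s k = abs_lift (raw s k)"

definition T :: "(nat \<times> 'p \<Rightarrow> 'm \<Rightarrow> bit) \<Rightarrow> (nat \<times> 'p \<Rightarrow> 'm) \<Rightarrow> ('m, 'p) lift" where
  "T e k = S (\<lambda>i h. e i h + e i (h \<otimes>\<^bsub>G i\<^esub> k i)) k"

lemma rmul_comp: "ok i \<Longrightarrow> k \<in> carrier (G i) \<Longrightarrow> l \<in> carrier (G i) \<Longrightarrow>
    rmul i l \<circ> rmul i k = rmul i (k \<otimes>\<^bsub>G i\<^esub> l)"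
  by (rule ext) (simp add: rmul_def G_assoc G_closed)

lemma rmul_one: "ok i \<Longrightarrow> rmul i \<one>\<^bsub>G i\<^esub> = id"
  by (rule ext) (simp add: rmul_def G_one)

lemma rmul_inverse:
  assumes "ok i" "k \<in> carrier (G i)"
  shows "rmul i k \<circ> rmul i (inv\<^bsub>G i\<^esub> k) = id" "rmul i (inv\<^bsub>G i\<^esub> k) \<circ> rmul i k = id"
  using assms by (simp_all add: rmul_comp G_closed rmul_one group.l_inv[OF grp] group.r_inv[OF grp])

lemma bij_rmul: "ok i \<Longrightarrow> k \<in> carrier (G i) \<Longrightarrow> bij (rmul i k)"
  using o_bij[OF rmul_inverse(2,1)] .

lemma bij_raw: "k \<in> Fams \<Longrightarrow> bij (fst (raw s k i))"
  by (simp add: raw_def Fam_def bij_rmul)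

lemma raw_rel: "k \<in> Fams \<Longrightarrow> fam_rel (raw s k) (raw s k)"
  by (intro fam_rel_eqI bij_raw) simp_all

lemma S_mult:
  assumes "k \<in> Fams" "l \<in> Fams"
  shows "S s k * S t l = S (\<lambda>i h. s i h + t i (h \<otimes>\<^bsub>G i\<^esub> k i)) (\<lambda>i. k i \<otimes>\<^bsub>G i\<^esub> l i)"
proof -
  have "S s k * S t l = abs_lift (\<lambda>i. (fst (raw t l i) \<circ> fst (raw s k i),
      \<lambda>g. snd (raw s k i) g + snd (raw t l i) (fst (raw s k i) g)))"
    unfolding S_def by (intro times_lift.abs_eq raw_rel assms)
  also have "(\<lambda>i. (fst (raw t l i) \<circ> fst (raw s k i),
      \<lambda>g. snd (raw s k i) g + snd (raw t l i) (fst (raw s k i) g))) =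
    raw (\<lambda>i h. s i h + t i (h \<otimes>\<^bsub>G i\<^esub> k i)) (\<lambda>i. k i \<otimes>\<^bsub>G i\<^esub> l i)"
    using assms by (intro ext) (auto simp: raw_def Fam_def rmul_comp rmul_def G_closed fun_eq_iff)
  finally show ?thesis by (simp add: S_def)
qed

lemma S_eqI:
  assumes "k \<in> Fams" "\<And>i. ok i \<Longrightarrow> k i = l i"
    and N: "\<And>i. ok i \<Longrightarrow> card {h \<in> carrier (G i). s i h \<noteq> t i h} \<le> N * fst i"
  shows "S s k = S t l"
proof -
  have eq: "{g. snd (raw s k i) g \<noteq> snd (raw t l i) g} = (if ok i then {h \<in> carrier (G i). s i h \<noteq> t i h} else {})" for i
    by (auto simp: raw_def)
  have "fam_rel (raw s k) (raw t l)"
  proof (rule fam_relI)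
    fix i
    show "bij (fst (raw s k i))" using assms(1) by (rule bij_raw)
    show "fst (raw t l i) = fst (raw s k i)" using assms(2) by (simp add: raw_def)
    show "finite {g. snd (raw s k i) g \<noteq> snd (raw t l i) g}" by (simp add: eq fin)
    show "card {g. snd (raw s k i) g \<noteq> snd (raw t l i) g} \<le> N * fst i" using N by (simp add: eq)
  qed
  moreover have "l \<in> Fams" using assms(1,2) by (simp add: Fam_def)
  ultimately show ?thesis
    unfolding S_def using assms(1) by (simp add: abs_lift_eq_iff bij_raw)
qed

lemma S_cong:
  assumes "k \<in> Fams" "\<And>i. ok i \<Longrightarrow> k i = l i" "\<And>i h. ok i \<Longrightarrow> h \<in> carrier (G i) \<Longrightarrow> s i h = t i h"
  shows "S s k = S t l"
proof (rule S_eqI[OF assms(1,2), where N = 0])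
  fix i assume "ok i"
  then have "{h \<in> carrier (G i). s i h \<noteq> t i h} = {}" using assms(3) by blast
  then show "card {h \<in> carrier (G i). s i h \<noteq> t i h} \<le> 0 * fst i" by (simp only: card.empty)
qed

text \<open>The way back from an equality in the quotient to a numerical bound. The number
  \<open>N\<close> depends on the families, but not on the index.\<close>

lemma S_eqD:
  assumes "k \<in> Fams" "l \<in> Fams" "S s k = S t l"
  shows "\<exists>N. \<forall>i. ok i \<longrightarrow> card {h \<in> carrier (G i). s i h \<noteq> t i h} \<le> N * fst i"
proof -
  have "fam_rel (raw s k) (raw t l)"
    using assms by (simp add: S_def abs_lift_eq_iff bij_raw)
  then obtain N where N: "\<And>i. card {g. snd (raw s k i) g \<noteq> snd (raw t l i) g} \<le> N * fst i"
    unfolding fam_rel_def by blast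
  have eq: "{g. snd (raw s k i) g \<noteq> snd (raw t l i) g} = {h \<in> carrier (G i). s i h \<noteq> t i h}" if "ok i" for i
    using that by (auto simp: raw_def)
  show ?thesis
  proof (intro exI allI impI)
    fix i assume "ok i"
    then show "card {h \<in> carrier (G i). s i h \<noteq> t i h} \<le> N * fst i"
      using N[of i] by (simp only: eq)
  qed
qed

lemma shadow_S: "k \<in> Fams \<Longrightarrow> shadow (S s k) i = (if ok i then rmul i (k i) else id)"
  by (simp add: S_def shadow.abs_eq[OF raw_rel] raw_def)

definition rep :: "('m, 'p) lift \<Rightarrow> (nat \<times> 'p \<Rightarrow> 'm) \<Rightarrow> bool" where
  "rep h k \<longleftrightarrow> k \<in> Fams \<and> (\<forall>i. shadow h i = (if ok i then rmul i (k i) else id))"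

lemma rep_S: "k \<in> Fams \<Longrightarrow> rep (S s k) k"
  by (simp add: rep_def shadow_S)

lemma rep_T: "k \<in> Fams \<Longrightarrow> rep (T e k) k"
  by (simp add: T_def rep_S)

lemma rep_mult: "rep x k \<Longrightarrow> rep y l \<Longrightarrow> rep (x * y) (\<lambda>i. k i \<otimes>\<^bsub>G i\<^esub> l i)"
  by (simp add: rep_def shadow_mult Fam_def G_closed rmul_comp)

lemma rep_one: "rep 1 (\<lambda>i. \<one>\<^bsub>G i\<^esub>)"
  by (simp add: rep_def shadow_one Fam_def G_closed rmul_one)

lemma rep_inverse:
  assumes "rep x k"
  shows "rep (inverse x) (\<lambda>i. inv\<^bsub>G i\<^esub> (k i))"
proof -
  have "inv_into UNIV (rmul i (k i)) = rmul i (inv\<^bsub>G i\<^esub> (k i))" if "ok i" for i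
    using assms that by (intro inv_unique_comp rmul_inverse) (simp_all add: rep_def Fam_def)
  with assms show ?thesis by (simp add: rep_def shadow_inverse Fam_def G_closed)
qed

lemma rep_conjug: "rep x k \<Longrightarrow> rep y l \<Longrightarrow> rep (conjug x y) (\<lambda>i. gconj (G i) (k i) (l i))"
  unfolding conjug_def gconj_def by (intro rep_mult rep_inverse)

lemma rep_commut: "rep x k \<Longrightarrow> rep y l \<Longrightarrow> rep (commut x y) (\<lambda>i. gcommut (G i) (k i) (l i))"
  unfolding commut_def gcommut_def by (intro rep_mult rep_inverse)

lemma rep_kernel: "rep x k \<Longrightarrow> (\<And>i. ok i \<Longrightarrow> k i = \<one>\<^bsub>G i\<^esub>) \<Longrightarrow> x \<in> shadow_kernel"
  by (simp add: rep_def shadow_kernel_def rmul_one)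

lemma rep_commut_kernel:
  assumes "rep x k" "rep y l" "\<And>i. ok i \<Longrightarrow> gcomm (G i) (k i) (l i)"
  shows "commut x y \<in> shadow_kernel"
proof (rule rep_kernel[OF rep_commut[OF assms(1,2)]])
  fix i assume "ok i"
  then show "gcommut (G i) (k i) (l i) = \<one>\<^bsub>G i\<^esub>"
    using assms by (subst group.gcommut_eq_one_iff[OF grp]) (auto simp: rep_def Fam_def)
qed

lemma Fams_closed:
  "k \<in> Fams \<Longrightarrow> l \<in> Fams \<Longrightarrow> (\<lambda>i. k i \<otimes>\<^bsub>G i\<^esub> l i) \<in> Fams"
  "k \<in> Fams \<Longrightarrow> (\<lambda>i. inv\<^bsub>G i\<^esub> (k i)) \<in> Fams"
  "(\<lambda>i. \<one>\<^bsub>G i\<^esub>) \<in> Fams"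
  "k \<in> Fams \<Longrightarrow> (\<lambda>i. k i [^]\<^bsub>G i\<^esub> (n::nat)) \<in> Fams"
  by (simp_all add: Fam_def G_closed)

text \<open>The second components telescope: the value at \<open>h \<otimes> k\<close> occurs twice.
  So each \<open>T e\<close> is multiplicative without error for any \<open>e\<close>, and errors
  arise only when two such lifts are compared.\<close>

lemma T_mult:
  assumes "k \<in> Fams" "l \<in> Fams"
  shows "T e k * T e l = T e (\<lambda>i. k i \<otimes>\<^bsub>G i\<^esub> l i)"
proof -
  have bit: "x + y + (y + z) = x + z" for x y z :: bit
    by (metis add.assoc add_0_right bit_add_self)
  show ?thesis unfolding T_def S_mult[OF assms]
    using assms by (intro S_cong Fams_closed) (simp_all add: Fam_def G_assoc bit)
qed

lemma T_cong: "k \<in> Fams \<Longrightarrow> (\<And>i. ok i \<Longrightarrow> k i = l i) \<Longrightarrow> T e k = T e l"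
  unfolding T_def by (intro S_cong) auto

lemma S_one: "S (\<lambda>_ _. 0) (\<lambda>i. \<one>\<^bsub>G i\<^esub>) = 1"
proof -
  have "raw (\<lambda>_ _. 0) (\<lambda>i. \<one>\<^bsub>G i\<^esub>) = (\<lambda>_. (id, \<lambda>_. 0))"
    by (intro ext) (auto simp: raw_def rmul_one)
  then show ?thesis by (simp add: S_def one_lift_def)
qed

lemma T_one: "T e (\<lambda>i. \<one>\<^bsub>G i\<^esub>) = 1"
  unfolding T_def S_one[symmetric] by (intro S_cong Fams_closed) (simp_all add: G_one bit_add_self)

lemma T_inverse:
  assumes "k \<in> Fams"
  shows "inverse (T e k) = T e (\<lambda>i. inv\<^bsub>G i\<^esub> (k i))"
proof (rule inverse_unique_left)
  have "T e k * T e (\<lambda>i. inv\<^bsub>G i\<^esub> (k i)) = T e (\<lambda>i. \<one>\<^bsub>G i\<^esub>)"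
    unfolding T_mult[OF assms Fams_closed(2)[OF assms]]
    using assms by (intro T_cong Fams_closed) (simp_all add: Fam_def group.r_inv[OF grp])
  then show "T e k * T e (\<lambda>i. inv\<^bsub>G i\<^esub> (k i)) = 1" by (simp add: T_one)
qed

lemma T_conjug: "k \<in> Fams \<Longrightarrow> l \<in> Fams \<Longrightarrow> conjug (T e k) (T e l) = T e (\<lambda>i. gconj (G i) (k i) (l i))"
  unfolding conjug_def gconj_def by (simp add: T_mult T_inverse Fams_closed)

lemma T_commut: "k \<in> Fams \<Longrightarrow> l \<in> Fams \<Longrightarrow> commut (T e k) (T e l) = T e (\<lambda>i. gcommut (G i) (k i) (l i))"
  unfolding commut_def gcommut_def by (simp add: T_mult T_inverse Fams_closed)

lemma T_commutes:
  assumes "k \<in> Fams" "l \<in> Fams" "\<And>i. ok i \<Longrightarrow> gcomm (G i) (k i) (l i)"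
  shows "commutes (T e k) (T e l)"
  unfolding commutes_def T_mult[OF assms(1,2)] T_mult[OF assms(2,1)]
  using assms by (intro T_cong Fams_closed) (simp_all add: gcomm_def)

lemma T_power:
  assumes "k \<in> Fams"
  shows "T e k ^ n = T e (\<lambda>i. k i [^]\<^bsub>G i\<^esub> n)"
proof (induction n)
  case 0
  have "T e (\<lambda>i. \<one>\<^bsub>G i\<^esub>) = T e (\<lambda>i. k i [^]\<^bsub>G i\<^esub> (0::nat))"
    by (intro T_cong Fams_closed) (simp add: group.is_monoid[OF grp] monoid.nat_pow_0)
  then show ?case by (simp add: T_one)
next
  case (Suc n)
  have "T e k ^ Suc n = T e (\<lambda>i. k i [^]\<^bsub>G i\<^esub> n \<otimes>\<^bsub>G i\<^esub> k i)"
    using assms by (simp add: power_Suc2 Suc T_mult Fams_closed del: power_Suc)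
  also have "\<dots> = T e (\<lambda>i. k i [^]\<^bsub>G i\<^esub> Suc n)"
    using assms by (intro T_cong Fams_closed) (simp_all add: group.is_monoid[OF grp] monoid.nat_pow_Suc)
  finally show ?case .
qed

lemma Fam_Fams: "(\<And>i. ok i \<Longrightarrow> subgroup (U i) (G i)) \<Longrightarrow> k \<in> Fam U \<Longrightarrow> k \<in> Fams"
  unfolding Fam_def using subgroup.subset by blast

lemma FamA: "k \<in> Fam A \<Longrightarrow> k \<in> Fams" and FamB: "k \<in> Fam B \<Longrightarrow> k \<in> Fams" and FamC: "k \<in> Fam C \<Longrightarrow> k \<in> Fams"
  by (erule Fam_Fams[rotated], rule subA subB subC, assumption)+

section \<open>The three lifts of the translations and the group that they generate\<close>

abbreviation e1 :: "nat \<times> 'p \<Rightarrow> 'm \<Rightarrow> bit" where "e1 \<equiv> \<lambda>_ _. 0"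

lemma T_C: "k \<in> Fam C \<Longrightarrow> T e2 k = T e1 k"
  unfolding T_def
  by (intro S_cong FamC) (auto simp: Fam_def e2 bit_add_self)

lemma T_B: "k \<in> Fam B \<Longrightarrow> T e3 k = T e1 k"
  unfolding T_def
  by (intro S_cong FamB) (auto simp: Fam_def e3 bit_add_self)

text \<open>The only place where errors enter: on \<open>B\<close> and \<open>C\<close> the lifts
  agree exactly, whereas the sum of \<open>e2\<close> and \<open>e3\<close> is invariant under
  \<open>A\<close> only up to the exceptions counted in \<open>e23\<close>.\<close>

lemma T_A:
  assumes "k \<in> Fam A"
  shows "T e2 k = T e3 k"
  unfolding T_def
proof (rule S_eqI[where N = 2])
  fix i assume i: "ok i"
  have bit: "a + b \<noteq> c + d \<longleftrightarrow> b + d \<noteq> a + c" for a b c d :: bit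
    by (cases a; cases b; cases c; cases d) auto
  have "{h \<in> carrier (G i). e2 i h + e2 i (h \<otimes>\<^bsub>G i\<^esub> k i) \<noteq> e3 i h + e3 i (h \<otimes>\<^bsub>G i\<^esub> k i)} =
    {h \<in> carrier (G i). e2 i (h \<otimes>\<^bsub>G i\<^esub> k i) + e3 i (h \<otimes>\<^bsub>G i\<^esub> k i) \<noteq> e2 i h + e3 i h}"
    by (intro Collect_cong conj_cong refl) (rule bit)
  then show "card {h \<in> carrier (G i). e2 i h + e2 i (h \<otimes>\<^bsub>G i\<^esub> k i) \<noteq> e3 i h + e3 i (h \<otimes>\<^bsub>G i\<^esub> k i)} \<le> 2 * fst i"
    using e23[OF i, of "k i"] assms i by (simp add: Fam_def)
qed (use FamA assms in auto)

definition HA :: "('m, 'p) lift set" where "HA = T e2 ` Fam A"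
definition HB :: "('m, 'p) lift set" where "HB = T e1 ` Fam B"
definition HC :: "('m, 'p) lift set" where "HC = T e1 ` Fam C"

lemma FamD: "k \<in> Fam U \<Longrightarrow> ok i \<Longrightarrow> k i \<in> U i"
  by (simp add: Fam_def)

lemma HA_cases:
  assumes "x \<in> HA"
  obtains k where "k \<in> Fam A" "k \<in> Fams" "x = T e2 k" "x = T e3 k"
  using assms FamA T_A unfolding HA_def by blast

lemma HB_cases:
  assumes "x \<in> HB"
  obtains k where "k \<in> Fam B" "k \<in> Fams" "x = T e1 k" "x = T e3 k"
proof -
  from assms obtain k where k: "k \<in> Fam B" "x = T e1 k" unfolding HB_def by blast
  show thesis by (rule that[OF k(1) FamB[OF k(1)] k(2)]) (simp only: k(2) T_B[OF k(1)])
qed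

lemma HC_cases:
  assumes "x \<in> HC"
  obtains k where "k \<in> Fam C" "k \<in> Fams" "x = T e1 k" "x = T e2 k"
proof -
  from assms obtain k where k: "k \<in> Fam C" "x = T e1 k" unfolding HC_def by blast
  show thesis by (rule that[OF k(1) FamC[OF k(1)] k(2)]) (simp only: k(2) T_C[OF k(1)])
qed

lemma gcomm_common:
  "ok i \<Longrightarrow> x \<in> A i \<Longrightarrow> y \<in> A i \<Longrightarrow> gcomm (G i) x y" "ok i \<Longrightarrow> x \<in> B i \<Longrightarrow> y \<in> B i \<Longrightarrow> gcomm (G i) x y"
  "ok i \<Longrightarrow> x \<in> C i \<Longrightarrow> y \<in> C i \<Longrightarrow> gcomm (G i) x y" "ok i \<Longrightarrow> x \<in> A i \<Longrightarrow> y \<in> C i \<Longrightarrow> gcomm (G i) x y"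
  using common unfolding common_rel_def by blast+

lemma T_fifth:
  assumes "k \<in> Fam A \<or> k \<in> Fam B \<or> k \<in> Fam C"
  shows "T e k ^ 5 = 1"
proof -
  have k: "k \<in> Fams" using assms FamA FamB FamC by blast
  have "T e (\<lambda>i. k i [^]\<^bsub>G i\<^esub> (5::nat)) = T e (\<lambda>i. \<one>\<^bsub>G i\<^esub>)"
    using assms common k by (intro T_cong Fams_closed) (auto simp: common_rel_def dest: FamD)
  then show ?thesis using k by (simp add: T_power T_one)
qed

lemma fifth: "x \<in> HA \<union> HB \<union> HC \<Longrightarrow> x ^ 5 = 1"
  unfolding HA_def HB_def HC_def using T_fifth by blast

lemma H_commutes:
  "x \<in> HA \<Longrightarrow> y \<in> HA \<Longrightarrow> commutes x y" "x \<in> HB \<Longrightarrow> y \<in> HB \<Longrightarrow> commutes x y"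
  "x \<in> HC \<Longrightarrow> y \<in> HC \<Longrightarrow> commutes x y" "x \<in> HA \<Longrightarrow> y \<in> HC \<Longrightarrow> commutes x y"
proof -
  show "commutes x y" if mem: "x \<in> HA" "y \<in> HA"
  proof -
    obtain k where k: "k \<in> Fam A" "k \<in> Fams" "x = T e2 k" using mem(1) by (rule HA_cases)
    obtain l where l: "l \<in> Fam A" "l \<in> Fams" "y = T e2 l" using mem(2) by (rule HA_cases)
    show ?thesis unfolding k(3) l(3) by (intro T_commutes gcomm_common FamD k l)
  qed
  show "commutes x y" if mem: "x \<in> HB" "y \<in> HB"
  proof -
    obtain k where k: "k \<in> Fam B" "k \<in> Fams" "x = T e1 k" using mem(1) by (rule HB_cases)
    obtain l where l: "l \<in> Fam B" "l \<in> Fams" "y = T e1 l" using mem(2) by (rule HB_cases)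
    show ?thesis unfolding k(3) l(3) by (intro T_commutes gcomm_common(2) FamD k l)
  qed
  show "commutes x y" if mem: "x \<in> HC" "y \<in> HC"
  proof -
    obtain k where k: "k \<in> Fam C" "k \<in> Fams" "x = T e1 k" using mem(1) by (rule HC_cases)
    obtain l where l: "l \<in> Fam C" "l \<in> Fams" "y = T e1 l" using mem(2) by (rule HC_cases)
    show ?thesis unfolding k(3) l(3) by (intro T_commutes gcomm_common(3) FamD k l)
  qed
  show "commutes x y" if mem: "x \<in> HA" "y \<in> HC"
  proof -
    obtain k where k: "k \<in> Fam A" "k \<in> Fams" "x = T e2 k" using mem(1) by (rule HA_cases)
    obtain l where l: "l \<in> Fam C" "l \<in> Fams" "y = T e2 l" using mem(2) by (rule HC_cases)
    show ?thesis unfolding k(3) l(3) by (intro T_commutes gcomm_common(4) FamD k l)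
  qed
qed

lemma T_closed:
  assumes U: "\<And>i. ok i \<Longrightarrow> subgroup (U i) (G i)"
  shows "1 \<in> T e ` Fam U"
    and "x \<in> T e ` Fam U \<Longrightarrow> y \<in> T e ` Fam U \<Longrightarrow> x * y \<in> T e ` Fam U"
    and "x \<in> T e ` Fam U \<Longrightarrow> inverse x \<in> T e ` Fam U"
proof -
  have "(\<lambda>i. \<one>\<^bsub>G i\<^esub>) \<in> Fam U" using U by (simp add: Fam_def subgroup.one_closed)
  then show "1 \<in> T e ` Fam U" using T_one by (metis imageI)
  show "x \<in> T e ` Fam U \<Longrightarrow> y \<in> T e ` Fam U \<Longrightarrow> x * y \<in> T e ` Fam U"
  proof (elim imageE)
    fix k l assume *: "k \<in> Fam U" "l \<in> Fam U" "x = T e k" "y = T e l"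
    then have "(\<lambda>i. k i \<otimes>\<^bsub>G i\<^esub> l i) \<in> Fam U" using U by (simp add: Fam_def subgroup.m_closed)
    then show "x * y \<in> T e ` Fam U"
      using Fam_Fams[OF U *(1)] Fam_Fams[OF U *(2)] by (simp only: * T_mult imageI)
  qed
  show "x \<in> T e ` Fam U \<Longrightarrow> inverse x \<in> T e ` Fam U"
  proof (elim imageE)
    fix k assume *: "k \<in> Fam U" "x = T e k"
    then have "(\<lambda>i. inv\<^bsub>G i\<^esub> (k i)) \<in> Fam U" using U by (simp add: Fam_def subgroup.m_inv_closed)
    then show "inverse x \<in> T e ` Fam U"
      using Fam_Fams[OF U *(1)] by (simp only: * T_inverse imageI)
  qed
qed

lemmas HB_closed = T_closed[where U = B and e = e1, OF subB, folded HB_def]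
lemmas HC_closed = T_closed[where U = C and e = e1, OF subC, folded HC_def]

lemma HA_rep: "x \<in> HA \<Longrightarrow> \<exists>k. rep x k \<and> k \<in> Fam A"
  by (elim HA_cases) (auto intro: rep_T)

lemma HB_rep: "x \<in> HB \<Longrightarrow> \<exists>k. rep x k \<and> k \<in> Fam B"
  by (elim HB_cases) (auto intro: rep_T)

lemma HC_rep: "x \<in> HC \<Longrightarrow> \<exists>k. rep x k \<and> k \<in> Fam C"
  by (elim HC_cases) (auto intro: rep_T)

lemma gen_rep:
  assumes "h \<in> gen (HB \<union> HC)"
  shows "\<exists>k. rep h k \<and> k \<in> Fam (\<lambda>i. generate (G i) (B i \<union> C i))"
  using assms
proof induction
  case one
  show ?case by (rule exI[of _ "\<lambda>i. \<one>\<^bsub>G i\<^esub>"]) (simp add: rep_one Fam_def generate.one)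
next
  case (mult x y)
  obtain l where l: "rep y l" "l \<in> Fam (\<lambda>i. generate (G i) (B i \<union> C i))" using mult(3) by blast
  obtain k where k: "rep x k" "\<And>i. ok i \<Longrightarrow> k i \<in> B i \<union> C i"
    using mult(1) HB_rep HC_rep FamD by (metis UnE UnCI)
  have "(\<lambda>i. k i \<otimes>\<^bsub>G i\<^esub> l i) \<in> Fam (\<lambda>i. generate (G i) (B i \<union> C i))"
    using l(2) k(2) by (simp add: Fam_def generate.eng generate.incl)
  with rep_mult[OF k(1) l(1)] show ?case by blast
next
  case (inverse_mult x y)
  obtain l where l: "rep y l" "l \<in> Fam (\<lambda>i. generate (G i) (B i \<union> C i))" using inverse_mult(3) by blast
  obtain k where k: "rep x k" "\<And>i. ok i \<Longrightarrow> k i \<in> B i \<union> C i"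
    using inverse_mult(1) HB_rep HC_rep FamD by (metis UnE UnCI)
  have "(\<lambda>i. inv\<^bsub>G i\<^esub> (k i) \<otimes>\<^bsub>G i\<^esub> l i) \<in> Fam (\<lambda>i. generate (G i) (B i \<union> C i))"
    using l(2) k(2) by (simp add: Fam_def generate.eng generate.inv)
  with rep_mult[OF rep_inverse[OF k(1)] l(1)] show ?case by blast
qed

text \<open>A relation between two root groups is checked in the one lift that represents both,
  \<open>e1\<close> for \<open>B\<close> and \<open>C\<close>, \<open>e2\<close> for
  \<open>A\<close> and \<open>C\<close>, \<open>e3\<close> for \<open>A\<close> and
  \<open>B\<close>, where it holds because \<open>T\<close> is multiplicative. The others are
  checked on the translations alone, through \<open>rep\<close>.\<close>

theorem kernel_lg:
  assumes lg: "\<And>i. ok i \<Longrightarrow> lg_rel (G i) (A i) (B i) (C i)"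
    and h: "h \<in> gen (HA \<union> HB \<union> HC)" "h \<in> shadow_kernel"
  shows "h = 1"
proof (rule lift.kernel_trivial_lg[OF _ _ _ _ _ _ _ _ _ _ _ _ _ refl _ _ _ h])
  let ?V = "{conjug b c | b c. b \<in> HB \<and> c \<in> HC}"
  let ?W = "\<lambda>i. conjugates (G i) (B i) (C i)"
  have Vrep: "\<exists>k. rep v k \<and> (\<forall>i. ok i \<longrightarrow> k i \<in> ?W i)" if mem: "v \<in> ?V" for v
  proof -
    obtain b c where v: "v = conjug b c" "b \<in> HB" "c \<in> HC" using \<open>v \<in> ?V\<close> by blast
    obtain k l where k: "rep b k" "k \<in> Fam B" and l: "rep c l" "l \<in> Fam C"
      using HB_rep[OF v(2)] HC_rep[OF v(3)] by blast
    show ?thesis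
    proof (intro exI conjI allI impI)
      show "rep v (\<lambda>i. gconj (G i) (k i) (l i))" unfolding v by (rule rep_conjug[OF k(1) l(1)])
      show "gconj (G i) (k i) (l i) \<in> ?W i" if "ok i" for i
        using FamD[OF k(2) that] FamD[OF l(2) that] unfolding conjugates_def by blast
    qed
  qed
  have Arep: "\<exists>k. rep a k \<and> (\<forall>i. ok i \<longrightarrow> k i \<in> A i)" if mem: "a \<in> HA" for a
    using HA_rep[OF mem] FamD by blast
  show "commut a (conjug a' (v * w)) \<in> shadow_kernel" if mem: "a \<in> HA" "a' \<in> HA" "v \<in> ?V" "w \<in> ?V" for a a' v w
  proof -
    obtain p q r s where *: "rep a p" "rep a' q" "rep v r" "rep w s"
      "\<And>i. ok i \<Longrightarrow> p i \<in> A i \<and> q i \<in> A i \<and> r i \<in> ?W i \<and> s i \<in> ?W i"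
      using Arep[OF mem(1)] Arep[OF mem(2)] Vrep[OF mem(3)] Vrep[OF mem(4)] by blast
    show ?thesis
      by (rule rep_commut_kernel[OF *(1) rep_conjug[OF *(2) rep_mult[OF *(3,4)]]])
         (use *(5) lg_relD(5)[OF lg] in blast)
  qed
  show "commut (commut a u) (conjug (commut a u) (v * w)) \<in> shadow_kernel"
    if mem: "a \<in> HA" "u \<in> ?V" "v \<in> ?V" "w \<in> ?V" for a u v w
  proof -
    obtain p q r s where *: "rep a p" "rep u q" "rep v r" "rep w s"
      "\<And>i. ok i \<Longrightarrow> p i \<in> A i \<and> q i \<in> ?W i \<and> r i \<in> ?W i \<and> s i \<in> ?W i"
      using Arep[OF mem(1)] Vrep[OF mem(2)] Vrep[OF mem(3)] Vrep[OF mem(4)] by blast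
    show ?thesis
      by (rule rep_commut_kernel[OF rep_commut[OF *(1,2)] rep_conjug[OF rep_commut[OF *(1,2)] rep_mult[OF *(3,4)]]])
         (use *(5) lg_relD(6)[OF lg] in blast)
  qed
  show "commut (commut (commut a u) v) w \<in> shadow_kernel"
    if mem: "a \<in> HA" "u \<in> ?V" "v \<in> ?V" "w \<in> ?V" for a u v w
  proof -
    obtain p q r s where *: "rep a p" "rep u q" "rep v r" "rep w s"
      "\<And>i. ok i \<Longrightarrow> p i \<in> A i \<and> q i \<in> ?W i \<and> r i \<in> ?W i \<and> s i \<in> ?W i"
      using Arep[OF mem(1)] Vrep[OF mem(2)] Vrep[OF mem(3)] Vrep[OF mem(4)] by blast
    show ?thesis
      by (rule rep_kernel[OF rep_commut[OF rep_commut[OF rep_commut[OF *(1,2)] *(3)] *(4)]])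
         (use *(5) lg_relD(7)[OF lg] in blast)
  qed
  show "commutes a' (commut a b)" if mem: "a \<in> HA" "a' \<in> HA" "b \<in> HB" for a a' b
  proof -
    obtain p where p: "p \<in> Fam A" "p \<in> Fams" "a = T e3 p" using HA_cases[OF mem(1)] by metis
    obtain q where q: "q \<in> Fam A" "q \<in> Fams" "a' = T e3 q" using HA_cases[OF mem(2)] by metis
    obtain r where r: "r \<in> Fam B" "r \<in> Fams" "b = T e3 r" using HB_cases[OF mem(3)] by metis
    show ?thesis unfolding p(3) q(3) r(3) T_commut[OF p(2) r(2)]
    proof (rule T_commutes[OF q(2)])
      show "(\<lambda>i. gcommut (G i) (p i) (r i)) \<in> Fams"
        unfolding gcommut_def by (intro Fams_closed p r)
      show "gcomm (G i) (q i) (gcommut (G i) (p i) (r i))" if "ok i" for i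
        using lg_relD(2)[OF lg[OF that]] FamD[OF p(1) that] FamD[OF q(1) that] FamD[OF r(1) that] by blast
    qed
  qed
  show "commutes b (commut a b)" if mem: "a \<in> HA" "b \<in> HB" for a b
  proof -
    obtain p where p: "p \<in> Fam A" "p \<in> Fams" "a = T e3 p" using HA_cases[OF mem(1)] by metis
    obtain r where r: "r \<in> Fam B" "r \<in> Fams" "b = T e3 r" using HB_cases[OF mem(2)] by metis
    show ?thesis unfolding p(3) r(3) T_commut[OF p(2) r(2)]
    proof (rule T_commutes[OF r(2)])
      show "(\<lambda>i. gcommut (G i) (p i) (r i)) \<in> Fams"
        unfolding gcommut_def by (intro Fams_closed p r)
      show "gcomm (G i) (r i) (gcommut (G i) (p i) (r i))" if "ok i" for i
        using lg_relD(3)[OF lg[OF that]] FamD[OF p(1) that] FamD[OF r(1) that] by blast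
    qed
  qed
  show "commutes b (conjug b' c)" if mem: "b \<in> HB" "b' \<in> HB" "c \<in> HC" for b b' c
  proof -
    obtain p where p: "p \<in> Fam B" "p \<in> Fams" "b = T e1 p" using HB_cases[OF mem(1)] by metis
    obtain q where q: "q \<in> Fam B" "q \<in> Fams" "b' = T e1 q" using HB_cases[OF mem(2)] by metis
    obtain r where r: "r \<in> Fam C" "r \<in> Fams" "c = T e1 r" using HC_cases[OF mem(3)] by metis
    show ?thesis unfolding p(3) q(3) r(3) T_conjug[OF q(2) r(2)]
    proof (rule T_commutes[OF p(2)])
      show "(\<lambda>i. gconj (G i) (q i) (r i)) \<in> Fams"
        unfolding gconj_def by (intro Fams_closed q r)
      show "gcomm (G i) (p i) (gconj (G i) (q i) (r i))" if "ok i" for i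
        using lg_relD(4)[OF lg[OF that]] FamD[OF p(1) that] FamD[OF q(1) that] FamD[OF r(1) that] by blast
    qed
  qed
qed ((rule H_commutes HB_closed HC_closed; assumption) | (rule fifth, simp))+

theorem kernel_sm:
  assumes sm: "\<And>i. ok i \<Longrightarrow> sm_rel (G i) (A i) (B i) (C i)"
    and h: "h \<in> gen (HA \<union> HB \<union> HC)" "h \<in> shadow_kernel"
  shows "h = 1"
proof (rule lift.kernel_trivial_sm[OF _ _ _ _ _ _ _ _ _ _ _ _ _ _ _ _ refl _ _ _ h])
  let ?Z = "{commut b c | b c. b \<in> HB \<and> c \<in> HC}"
  have BCrep: "\<exists>k. rep x k \<and> (\<forall>i. ok i \<longrightarrow> k i \<in> B i)" if mem: "x \<in> HB" for x
    using HB_rep[OF mem] FamD by blast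
  have Crep: "\<exists>k. rep x k \<and> (\<forall>i. ok i \<longrightarrow> k i \<in> C i)" if mem: "x \<in> HC" for x
    using HC_rep[OF mem] FamD by blast
  have Arep: "\<exists>k. rep a k \<and> (\<forall>i. ok i \<longrightarrow> k i \<in> A i)" if mem: "a \<in> HA" for a
    using HA_rep[OF mem] FamD by blast
  show "commut (conjug a s) (conjug a' t) \<in> shadow_kernel"
    if mem: "a \<in> HA" "a' \<in> HA" "s \<in> gen (HB \<union> HC)" "t \<in> gen (HB \<union> HC)" for a a' s t
  proof -
    obtain p q u v where *: "rep a p" "rep a' q" "rep s u" "rep t v"
      "\<And>i. ok i \<Longrightarrow> p i \<in> A i \<and> q i \<in> A i \<and> u i \<in> generate (G i) (B i \<union> C i) \<and> v i \<in> generate (G i) (B i \<union> C i)"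
      using Arep[OF mem(1)] Arep[OF mem(2)] gen_rep[OF mem(3)] gen_rep[OF mem(4)] FamD by blast
    show ?thesis
      by (rule rep_commut_kernel[OF rep_conjug[OF *(1,3)] rep_conjug[OF *(2,4)]])
         (use *(5) sm_relD(6)[OF sm] in blast)
  qed
  show "commut (commut a z) z \<in> shadow_kernel" if mem: "a \<in> HA" "z \<in> ?Z" for a z
  proof -
    obtain b c where z: "z = commut b c" "b \<in> HB" "c \<in> HC" using \<open>z \<in> ?Z\<close> by blast
    obtain p q r where *: "rep a p" "rep b q" "rep c r"
      "\<And>i. ok i \<Longrightarrow> p i \<in> A i \<and> q i \<in> B i \<and> r i \<in> C i"
      using Arep[OF mem(1)] BCrep[OF z(2)] Crep[OF z(3)] by blast
    show ?thesis unfolding z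
      by (rule rep_kernel[OF rep_commut[OF rep_commut[OF *(1) rep_commut[OF *(2,3)]] rep_commut[OF *(2,3)]]])
         (use *(4) sm_relD(7)[OF sm] in blast)
  qed
  show "commut (commut a z) b' \<in> shadow_kernel" if mem: "a \<in> HA" "z \<in> ?Z" "b' \<in> HB" for a z b'
  proof -
    obtain b c where z: "z = commut b c" "b \<in> HB" "c \<in> HC" using \<open>z \<in> ?Z\<close> by blast
    obtain p q r s where *: "rep a p" "rep b q" "rep c r" "rep b' s"
      "\<And>i. ok i \<Longrightarrow> p i \<in> A i \<and> q i \<in> B i \<and> r i \<in> C i \<and> s i \<in> B i"
      using Arep[OF mem(1)] BCrep[OF z(2)] Crep[OF z(3)] BCrep[OF mem(3)] by blast
    show ?thesis unfolding z
      by (rule rep_kernel[OF rep_commut[OF rep_commut[OF *(1) rep_commut[OF *(2,3)]] *(4)]])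
         (use *(5) sm_relD(8)[OF sm] in blast)
  qed
  show "commutes b' (commut b c)" if mem: "b \<in> HB" "b' \<in> HB" "c \<in> HC" for b b' c
  proof -
    obtain p where p: "p \<in> Fam B" "p \<in> Fams" "b = T e1 p" using HB_cases[OF mem(1)] by metis
    obtain q where q: "q \<in> Fam B" "q \<in> Fams" "b' = T e1 q" using HB_cases[OF mem(2)] by metis
    obtain r where r: "r \<in> Fam C" "r \<in> Fams" "c = T e1 r" using HC_cases[OF mem(3)] by metis
    show ?thesis unfolding p(3) q(3) r(3) T_commut[OF p(2) r(2)]
    proof (rule T_commutes[OF q(2)])
      show "(\<lambda>i. gcommut (G i) (p i) (r i)) \<in> Fams"
        unfolding gcommut_def by (intro Fams_closed p r)
      show "gcomm (G i) (q i) (gcommut (G i) (p i) (r i))" if "ok i" for i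
        using sm_relD(2)[OF sm[OF that]] FamD[OF p(1) that] FamD[OF q(1) that] FamD[OF r(1) that] by blast
    qed
  qed
  show "commutes c' (commut b c)" if mem: "b \<in> HB" "c \<in> HC" "c' \<in> HC" for b c c'
  proof -
    obtain p where p: "p \<in> Fam B" "p \<in> Fams" "b = T e1 p" using HB_cases[OF mem(1)] by metis
    obtain q where q: "q \<in> Fam C" "q \<in> Fams" "c' = T e1 q" using HC_cases[OF mem(3)] by metis
    obtain r where r: "r \<in> Fam C" "r \<in> Fams" "c = T e1 r" using HC_cases[OF mem(2)] by metis
    show ?thesis unfolding p(3) q(3) r(3) T_commut[OF p(2) r(2)]
    proof (rule T_commutes[OF q(2)])
      show "(\<lambda>i. gcommut (G i) (p i) (r i)) \<in> Fams"
        unfolding gcommut_def by (intro Fams_closed p r)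
      show "gcomm (G i) (q i) (gcommut (G i) (p i) (r i))" if "ok i" for i
        using sm_relD(3)[OF sm[OF that]] FamD[OF p(1) that] FamD[OF q(1) that] FamD[OF r(1) that] by blast
    qed
  qed
  show "commutes a (conjug a' b)" if mem: "a \<in> HA" "a' \<in> HA" "b \<in> HB" for a a' b
  proof -
    obtain p where p: "p \<in> Fam A" "p \<in> Fams" "a = T e3 p" using HA_cases[OF mem(1)] by metis
    obtain q where q: "q \<in> Fam A" "q \<in> Fams" "a' = T e3 q" using HA_cases[OF mem(2)] by metis
    obtain r where r: "r \<in> Fam B" "r \<in> Fams" "b = T e3 r" using HB_cases[OF mem(3)] by metis
    show ?thesis unfolding p(3) q(3) r(3) T_conjug[OF q(2) r(2)]
    proof (rule T_commutes[OF p(2)])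
      show "(\<lambda>i. gconj (G i) (q i) (r i)) \<in> Fams"
        unfolding gconj_def by (intro Fams_closed q r)
      show "gcomm (G i) (p i) (gconj (G i) (q i) (r i))" if "ok i" for i
        using sm_relD(4)[OF sm[OF that]] FamD[OF p(1) that] FamD[OF q(1) that] FamD[OF r(1) that] by blast
    qed
  qed
  show "a * (conjug a b * conjug a (b ^ 2) * conjug a (b ^ 3) * conjug a (b ^ 4)) = 1"
    if mem: "a \<in> HA" "b \<in> HB" for a b
  proof -
    obtain p where p: "p \<in> Fam A" "p \<in> Fams" "a = T e3 p" using HA_cases[OF mem(1)] by metis
    obtain r where r: "r \<in> Fam B" "r \<in> Fams" "b = T e3 r" using HB_cases[OF mem(2)] by metis
    have cl: "(\<lambda>i. gconj (G i) (p i) (s i)) \<in> Fams" if "s \<in> Fams" for s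
      unfolding gconj_def by (intro Fams_closed p r that)
    show ?thesis unfolding p(3) r(3) T_one[of e3, symmetric]
      by (simp only: T_power T_conjug T_mult p r Fams_closed cl)
         (intro T_cong Fams_closed cl p r, use sm_relD(5)[OF sm] FamD[OF p(1)] FamD[OF r(1)] in blast)
  qed
qed ((rule H_commutes HB_closed HC_closed; assumption) | (rule fifth, simp))+

end

section \<open>From the trivial kernel to potentials with a uniform constant\<close>

definition boundedly_generated :: "nat \<Rightarrow> ('g, 'b) monoid_scheme \<Rightarrow> 'g set \<Rightarrow> 'g set \<Rightarrow> 'g set \<Rightarrow> bool" where
  "boundedly_generated n G A B C \<longleftrightarrow>
    carrier G \<subseteq> bounded_products G (A \<union> B \<union> C) n \<and>
    generate G (B \<union> C) \<subseteq> bounded_products G (B \<union> C) n \<and>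
    generate G (A \<union> C) \<subseteq> bounded_products G (A \<union> C) n \<and>
    generate G (A \<union> B) \<subseteq> bounded_products G (A \<union> B) n"

context lift_system
begin

abbreviation Hgen :: "('m, 'p) lift set" where "Hgen \<equiv> gen (HA \<union> HB \<union> HC)"

lemma T_Hgen:
  "k \<in> Fam A \<Longrightarrow> T e2 k \<in> Hgen" "k \<in> Fam A \<Longrightarrow> T e3 k \<in> Hgen"
  "k \<in> Fam B \<Longrightarrow> T e1 k \<in> Hgen" "k \<in> Fam B \<Longrightarrow> T e3 k \<in> Hgen"
  "k \<in> Fam C \<Longrightarrow> T e1 k \<in> Hgen" "k \<in> Fam C \<Longrightarrow> T e2 k \<in> Hgen"
  using T_A T_B T_C by (auto simp: HA_def HB_def HC_def intro!: gen_incl)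

lemma FamI: "(\<And>i. ok i \<Longrightarrow> k i \<in> U i) \<Longrightarrow> k \<in> Fam U"
  by (simp add: Fam_def)

text \<open>An element of \<open>Hgen\<close> is a single finite word in families. So the length of
  the products must be bounded uniformly in the index.\<close>

lemma T_bounded_products:
  assumes sub: "\<And>i. ok i \<Longrightarrow> subgroup (U i) (G i)" "\<And>i. ok i \<Longrightarrow> subgroup (Y i) (G i)"
    and T: "\<And>k. k \<in> Fam U \<Longrightarrow> T e k \<in> Hgen" "\<And>k. k \<in> Fam Y \<Longrightarrow> T e k \<in> Hgen"
    and k: "k \<in> Fam (\<lambda>i. bounded_products (G i) (U i \<union> Y i) n)"
  shows "T e k \<in> Hgen"
  using k
proof (induction n arbitrary: k)
  case 0
  have "T e (\<lambda>i. \<one>\<^bsub>G i\<^esub>) = T e k"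
    using FamD[OF 0] by (intro T_cong Fams_closed) simp
  then show ?case by (simp add: T_one gen.one[of "HA \<union> HB \<union> HC"])
next
  case (Suc n)
  have "\<exists>p s. p \<in> bounded_products (G i) (U i \<union> Y i) n \<and> s \<in> U i \<union> Y i \<and> k i = p \<otimes>\<^bsub>G i\<^esub> s"
    if "ok i" for i using FamD[OF Suc.prems that] by auto
  then obtain p s where ps: "\<And>i. ok i \<Longrightarrow> p i \<in> bounded_products (G i) (U i \<union> Y i) n"
    "\<And>i. ok i \<Longrightarrow> s i \<in> U i \<union> Y i" "\<And>i. ok i \<Longrightarrow> k i = p i \<otimes>\<^bsub>G i\<^esub> s i" by metis
  \<comment> \<open>At different indices the factor may come from different groups. A letter of
    \<open>U\<close> followed by one of \<open>Y\<close>, one of the two being 1, gives all indices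
    a word of the same shape.\<close>
  define x where "x i = (if s i \<in> U i then s i else \<one>\<^bsub>G i\<^esub>)" for i
  define y where "y i = (if s i \<in> U i then \<one>\<^bsub>G i\<^esub> else s i)" for i
  have "x i \<in> U i" "y i \<in> Y i" if i: "ok i" for i
    using ps(2)[OF i] subgroup.one_closed[OF sub(1)[OF i]] subgroup.one_closed[OF sub(2)[OF i]]
    by (auto simp: x_def y_def)
  then have x: "x \<in> Fam U" and y: "y \<in> Fam Y" by (simp_all add: Fam_def)
  have cl: "x \<in> Fams" "y \<in> Fams" using x y sub Fam_Fams by blast+
  have XY: "U i \<union> Y i \<subseteq> carrier (G i)" if "ok i" for i
    using sub[OF that] subgroup.subset by blast
  have p: "p \<in> Fams"
    using ps(1) group.bounded_products_closed[OF grp XY] by (intro FamI) blast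
  have "T e k = T e (\<lambda>i. p i \<otimes>\<^bsub>G i\<^esub> x i \<otimes>\<^bsub>G i\<^esub> y i)"
  proof (rule sym, intro T_cong Fams_closed p cl)
    fix i assume i: "ok i"
    then have "s i \<in> carrier (G i)" "p i \<in> carrier (G i)" using ps(2) XY FamD[OF p] by blast+
    then show "p i \<otimes>\<^bsub>G i\<^esub> x i \<otimes>\<^bsub>G i\<^esub> y i = k i"
      using i ps(3) by (simp add: x_def y_def G_one G_closed)
  qed
  also have "\<dots> = T e p * T e x * T e y"
    using p cl by (simp add: T_mult Fams_closed)
  also have "T e p * T e x * T e y \<in> Hgen"
    using T(1)[OF x] T(2)[OF y] Suc.IH[OF FamI[OF ps(1)]] by (intro gen_closed)
  finally show ?case .
qed

text \<open>The choice \<open>\<sigma> i g\<close> depends on the index and on the group element,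
  not on the family that contains it. This makes it possible to choose the family afterwards, as
  \<open>shift_bound\<close> does.\<close>

lemma word_section:
  "\<exists>\<sigma>. \<forall>g \<in> Fam (\<lambda>i. bounded_products (G i) (A i \<union> B i \<union> C i) n). S (\<lambda>i. \<sigma> i (g i)) g \<in> Hgen"
proof (induction n)
  case 0
  show ?case
  proof (intro exI ballI)
    fix g assume g: "g \<in> Fam (\<lambda>i. bounded_products (G i) (A i \<union> B i \<union> C i) 0)"
    have "S (\<lambda>_ _. 0) (\<lambda>i. \<one>\<^bsub>G i\<^esub>) = S (\<lambda>i. (\<lambda>_ _ _. 0) i (g i)) g"
      using FamD[OF g] by (intro S_cong Fams_closed) auto
    then show "S (\<lambda>i. (\<lambda>_ _ _. 0) i (g i)) g \<in> Hgen" by (simp add: S_one gen.one[of "HA \<union> HB \<union> HC"])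
  qed
next
  case (Suc n)
  let ?bp = "\<lambda>n i. bounded_products (G i) (A i \<union> B i \<union> C i) n"
  obtain \<sigma> where \<sigma>: "\<And>g. g \<in> Fam (?bp n) \<Longrightarrow> S (\<lambda>i. \<sigma> i (g i)) g \<in> Hgen" using Suc by blast
  have "\<exists>x. g \<in> ?bp (Suc n) i \<longrightarrow> fst x \<in> ?bp n i \<and> snd x \<in> A i \<union> B i \<union> C i \<and> g = fst x \<otimes>\<^bsub>G i\<^esub> snd x" for i g
  proof (cases "g \<in> ?bp (Suc n) i")
    case True
    then obtain p s where "p \<in> ?bp n i" "s \<in> A i \<union> B i \<union> C i" "g = p \<otimes>\<^bsub>G i\<^esub> s"
      by (simp only: bounded_products.simps mem_Collect_eq) blast
    then show ?thesis by (intro exI[of _ "(p, s)"]) simp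
  qed blast
  note ex = this
  define x where "x i g = (SOME x. g \<in> ?bp (Suc n) i \<longrightarrow>
    fst x \<in> ?bp n i \<and> snd x \<in> A i \<union> B i \<union> C i \<and> g = fst x \<otimes>\<^bsub>G i\<^esub> snd x)" for i g
  have x: "g \<in> ?bp (Suc n) i \<longrightarrow>
    fst (x i g) \<in> ?bp n i \<and> snd (x i g) \<in> A i \<union> B i \<union> C i \<and> g = fst (x i g) \<otimes>\<^bsub>G i\<^esub> snd (x i g)" for i g
    unfolding x_def by (rule someI_ex) (rule ex)
  define p where "p i g = fst (x i g)" for i g
  define s where "s i g = snd (x i g)" for i g
  have ps: "p i g \<in> ?bp n i" "s i g \<in> A i \<union> B i \<union> C i" "g = p i g \<otimes>\<^bsub>G i\<^esub> s i g"
    if "g \<in> ?bp (Suc n) i" for i g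
    using x[of g i] that by (simp_all only: p_def s_def simp_thms)
  \<comment> \<open>A letter from \<open>A\<close> contributes the second component of its lift by
    \<open>e2\<close>; letters from \<open>B\<close> and \<open>C\<close> are lifted by
    \<open>e1\<close> and contribute 0.\<close>
  define \<sigma>' where "\<sigma>' i g h = \<sigma> i (p i g) h +
    (if s i g \<in> A i then e2 i (h \<otimes>\<^bsub>G i\<^esub> p i g) + e2 i (h \<otimes>\<^bsub>G i\<^esub> g) else 0)" for i g h
  have "S (\<lambda>i. \<sigma>' i (g i)) g \<in> Hgen" if g: "g \<in> Fam (?bp (Suc n))" for g
  proof -
    define q where "q i = p i (g i)" for i
    define a where "a i = (if s i (g i) \<in> A i then s i (g i) else \<one>\<^bsub>G i\<^esub>)" for i
    define b where "b i = (if s i (g i) \<notin> A i \<and> s i (g i) \<in> B i then s i (g i) else \<one>\<^bsub>G i\<^esub>)" for i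
    define c where "c i = (if s i (g i) \<notin> A i \<and> s i (g i) \<notin> B i then s i (g i) else \<one>\<^bsub>G i\<^esub>)" for i
    have "a i \<in> A i" "b i \<in> B i" "c i \<in> C i" if i: "ok i" for i
      using ps(2)[OF FamD[OF g i]] subgroup.one_closed[OF subA[OF i]] subgroup.one_closed[OF subB[OF i]]
        subgroup.one_closed[OF subC[OF i]] by (auto simp: a_def b_def c_def)
    then have fams: "a \<in> Fam A" "b \<in> Fam B" "c \<in> Fam C" by (simp_all add: Fam_def)
    have q: "q \<in> Fam (?bp n)" using ps(1)[OF FamD[OF g]] by (intro FamI) (simp only: q_def)
    have ABC: "A i \<union> B i \<union> C i \<subseteq> carrier (G i)" if "ok i" for i
      using subA[OF that] subB[OF that] subC[OF that] subgroup.subset by blast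
    have cl: "a \<in> Fams" "b \<in> Fams" "c \<in> Fams" "q \<in> Fams" "g \<in> Fams"
      using fams FamA FamB FamC FamD[OF q] FamD[OF g] group.bounded_products_closed[OF grp ABC]
      by (blast intro: FamI)+
    have gi: "g i = q i \<otimes>\<^bsub>G i\<^esub> s i (g i)" "s i (g i) \<in> carrier (G i)" "q i \<in> carrier (G i)" if i: "ok i" for i
      using ps(3)[OF FamD[OF g i]] ps(2)[OF FamD[OF g i]] ABC[OF i] FamD[OF cl(4) i]
      by (simp only: q_def, blast, simp only:)
    have qabc: "q i \<otimes>\<^bsub>G i\<^esub> a i \<otimes>\<^bsub>G i\<^esub> b i \<otimes>\<^bsub>G i\<^esub> c i = g i" if i: "ok i" for i
      using gi[OF i] i FamD[OF cl(5) i] by (simp add: a_def b_def c_def G_one G_closed)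
    have qa: "s i (g i) \<in> A i \<Longrightarrow> q i \<otimes>\<^bsub>G i\<^esub> a i = g i" "s i (g i) \<notin> A i \<Longrightarrow> a i = \<one>\<^bsub>G i\<^esub>"
      if i: "ok i" for i using gi[OF i] i by (simp_all add: a_def)
    have shift: "\<sigma> i (q i) h + (e2 i (h \<otimes>\<^bsub>G i\<^esub> q i) + e2 i (h \<otimes>\<^bsub>G i\<^esub> q i \<otimes>\<^bsub>G i\<^esub> a i)) + (0 + 0) + (0 + 0) = \<sigma>' i (g i) h"
      if i: "ok i" and h: "h \<in> carrier (G i)" for i h
      using gi(3)[OF i] FamD[OF cl(1) i] qa[OF i] i h
      by (cases "s i (g i) \<in> A i") (simp_all add: \<sigma>'_def q_def[symmetric] G_assoc G_one G_closed bit_add_self)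
    have "S (\<lambda>i. \<sigma> i (q i)) q * T e2 a * T e1 b * T e1 c = S (\<lambda>i. \<sigma>' i (g i)) g"
      unfolding T_def
      by (simp only: S_mult cl Fams_closed)
         (intro S_cong Fams_closed cl qabc, assumption,
          rule shift, assumption+)
    moreover have "S (\<lambda>i. \<sigma> i (q i)) q * T e2 a * T e1 b * T e1 c \<in> Hgen"
      using fams by (intro gen_closed \<sigma> q T_Hgen)
    ultimately show ?thesis by simp
  qed
  then show ?case by blast
qed

text \<open>Choose at every index the pair \<open>g\<close>, \<open>k\<close> with the most errors.
  These pairs form one family, for which the two lifts of the product differ by a kernel element,
  hence not at all. The constant obtained for the worst pairs serves all pairs.\<close>

lemma shift_bound:
  assumes kernel: "\<And>h. h \<in> Hgen \<Longrightarrow> h \<in> shadow_kernel \<Longrightarrow> h = 1"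
    and \<sigma>: "\<And>g. g \<in> Fams \<Longrightarrow> S (\<lambda>i. \<sigma> i (g i)) g \<in> Hgen"
    and K: "\<And>i. ok i \<Longrightarrow> subgroup (K i) (G i)" "\<And>k. k \<in> Fam K \<Longrightarrow> T e k \<in> Hgen"
  shows "\<exists>N. \<forall>i. ok i \<longrightarrow> (\<forall>g\<in>carrier (G i). \<forall>k\<in>K i. card {h \<in> carrier (G i).
    \<sigma> i g h + (e i (h \<otimes>\<^bsub>G i\<^esub> g) + e i (h \<otimes>\<^bsub>G i\<^esub> g \<otimes>\<^bsub>G i\<^esub> k)) \<noteq> \<sigma> i (g \<otimes>\<^bsub>G i\<^esub> k) h} \<le> N * fst i)"
proof -
  define bad where "bad i g k = card {h \<in> carrier (G i).
    \<sigma> i g h + (e i (h \<otimes>\<^bsub>G i\<^esub> g) + e i (h \<otimes>\<^bsub>G i\<^esub> g \<otimes>\<^bsub>G i\<^esub> k)) \<noteq> \<sigma> i (g \<otimes>\<^bsub>G i\<^esub> k) h}" for i g k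
  have "\<exists>g\<in>carrier (G i). \<exists>k\<in>K i. \<forall>g'\<in>carrier (G i). \<forall>k'\<in>K i. bad i g' k' \<le> bad i g k" if i: "ok i" for i
  proof -
    let ?U = "(\<lambda>(g, k). bad i g k) ` (carrier (G i) \<times> K i)"
    have "finite ?U" using fin[OF i] subgroup.subset[OF K(1)[OF i]] by (auto intro: finite_subset)
    moreover have "?U \<noteq> {}" using subgroup.one_closed[OF K(1)[OF i]] G_closed(3)[OF i] by auto
    ultimately have "Max ?U \<in> ?U" "\<And>x. x \<in> ?U \<Longrightarrow> x \<le> Max ?U" by simp_all
    then show ?thesis by (smt (verit, best) SigmaE SigmaI case_prod_conv image_iff)
  qed
  then obtain g k where gk: "\<And>i. ok i \<Longrightarrow> g i \<in> carrier (G i)" "\<And>i. ok i \<Longrightarrow> k i \<in> K i"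
    "\<And>i g' k'. ok i \<Longrightarrow> g' \<in> carrier (G i) \<Longrightarrow> k' \<in> K i \<Longrightarrow> bad i g' k' \<le> bad i (g i) (k i)"
    by metis
  have g: "g \<in> Fams" and kK: "k \<in> Fam K" using gk by (auto intro: FamI)
  have k: "k \<in> Fams" using Fam_Fams[OF K(1) kK] .
  define l where "l i = g i \<otimes>\<^bsub>G i\<^esub> k i" for i
  have l: "l \<in> Fams" unfolding l_def by (intro Fams_closed g k)
  define x where "x = S (\<lambda>i. \<sigma> i (g i)) g * T e k"
  define y where "y = S (\<lambda>i. \<sigma> i (l i)) l"
  have "x * inverse y \<in> Hgen" unfolding x_def y_def by (intro gen_closed gen_inverse \<sigma> g l K kK)
  moreover have "x * inverse y \<in> shadow_kernel"
    unfolding x_def y_def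
    by (rule rep_kernel[OF rep_mult[OF rep_mult[OF rep_S[OF g] rep_T[OF k]] rep_inverse[OF rep_S[OF l]]]])
       (simp add: l_def group.r_inv[OF grp] G_closed FamD[OF g] FamD[OF k])
  ultimately have "x * inverse y = 1" by (rule kernel)
  then have "inverse (inverse y) = x"
    by (metis inverse_unique_left inverse_involutive inverse_mult_self mult_left_eq_iff mult_inverse_self mult.assoc mult_1_right mult_1_left)
  then have "x = y" by (simp add: inverse_involutive)
  then have "S (\<lambda>i h. \<sigma> i (g i) h + (e i (h \<otimes>\<^bsub>G i\<^esub> g i) + e i (h \<otimes>\<^bsub>G i\<^esub> g i \<otimes>\<^bsub>G i\<^esub> k i))) (\<lambda>i. g i \<otimes>\<^bsub>G i\<^esub> k i) =
      S (\<lambda>i. \<sigma> i (l i)) l"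
    by (simp add: x_def y_def T_def S_mult g k)
  from S_eqD[OF Fams_closed(1)[OF g k] l this] obtain N where
    "\<forall>i. ok i \<longrightarrow> bad i (g i) (k i) \<le> N * fst i" unfolding bad_def l_def by blast
  with gk(3) have "\<forall>i. ok i \<longrightarrow> (\<forall>g\<in>carrier (G i). \<forall>k\<in>K i. bad i g k \<le> N * fst i)"
    by (meson order_trans)
  then show ?thesis unfolding bad_def by blast
qed

end

lemma exists_le_average:
  fixes f :: "'a \<Rightarrow> nat"
  assumes "finite U" "U \<noteq> {}" "sum f U \<le> card U * N"
  shows "\<exists>x\<in>U. f x \<le> N"
proof (rule ccontr)
  assume "\<not> ?thesis"
  then have "Suc N \<le> f x" if "x \<in> U" for x using that by (auto simp: not_le Suc_le_eq)
  then have "card U * Suc N \<le> sum f U" using sum_bounded_below[of U "Suc N" f] by simp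
  moreover have "card U > 0" using assms(1,2) by (simp add: card_gt_0_iff)
  ultimately show False using assms(3) by simp
qed

text \<open>Double counting of the pairs that satisfy \<open>P\<close>, followed by averaging over
  \<open>U\<close>.\<close>

lemma exists_small_section:
  assumes "finite U" "U \<noteq> {}" "finite Y" "\<And>y. y \<in> Y \<Longrightarrow> card {x \<in> U. P x y} \<le> N" "card Y \<le> card U"
  shows "\<exists>x\<in>U. card {y \<in> Y. P x y} \<le> N"
proof (rule exists_le_average[OF assms(1,2)])
  have c: "card {z \<in> Z. Q z} = (\<Sum>z\<in>Z. if Q z then 1 else 0)" if "finite Z" for Z :: "'z set" and Q
    using that by (simp add: sum.If_cases Int_def)
  have "(\<Sum>x\<in>U. card {y \<in> Y. P x y}) = (\<Sum>y\<in>Y. card {x \<in> U. P x y})"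
    using assms(1,3) by (simp add: c) (rule sum.swap)
  also have "\<dots> \<le> card Y * N" using sum_bounded_above[of Y _ N] assms(4) by simp
  also have "\<dots> \<le> card U * N" using assms(5) by simp
  finally show "(\<Sum>x\<in>U. card {y \<in> Y. P x y}) \<le> card U * N" .
qed

context lift_system
begin

text \<open>Think of \<open>\<sigma> i g x\<close> as transport from \<open>x\<close> to
  \<open>x \<otimes> g\<close>. With base point \<open>x\<close>, the potential at \<open>h\<close>
  is the transport to \<open>h\<close> corrected by \<open>e\<close>. Evaluating it at a chosen
  representative of the coset of \<open>inv x \<otimes> h\<close> makes it exactly invariant under
  \<open>K\<close>; \<open>bound\<close> says that the choice matters for few base points.\<close>

lemma potentials_exist:
  fixes \<sigma> :: "nat \<times> 'p \<Rightarrow> 'm \<Rightarrow> 'm \<Rightarrow> bit" and e :: "nat \<times> 'p \<Rightarrow> 'm \<Rightarrow> bit"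
  assumes i: "ok i" and K: "subgroup K (G i)"
    and bound: "\<And>g k. g \<in> carrier (G i) \<Longrightarrow> k \<in> K \<Longrightarrow> card {h \<in> carrier (G i).
      \<sigma> i g h + (e i (h \<otimes>\<^bsub>G i\<^esub> g) + e i (h \<otimes>\<^bsub>G i\<^esub> g \<otimes>\<^bsub>G i\<^esub> k)) \<noteq> \<sigma> i (g \<otimes>\<^bsub>G i\<^esub> k) h} \<le> N"
  obtains u where "\<And>x h k. x \<in> carrier (G i) \<Longrightarrow> h \<in> carrier (G i) \<Longrightarrow> k \<in> K \<Longrightarrow> u x (h \<otimes>\<^bsub>G i\<^esub> k) = u x h"
    "\<And>g. g \<in> carrier (G i) \<Longrightarrow>
      card {x \<in> carrier (G i). u x (x \<otimes>\<^bsub>G i\<^esub> g) \<noteq> \<sigma> i g x + e i (x \<otimes>\<^bsub>G i\<^esub> g)} \<le> N"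
proof -
  interpret group "G i" using i by (rule grp)
  define r where "r C = (SOME y. y \<in> C)" for C :: "'m set"
  define u where "u x h = (let y = r ((inv\<^bsub>G i\<^esub> x \<otimes>\<^bsub>G i\<^esub> h) <#\<^bsub>G i\<^esub> K) in \<sigma> i y x + e i (x \<otimes>\<^bsub>G i\<^esub> y))" for x h
  have Kc: "K \<subseteq> carrier (G i)" using K by (rule subgroup.subset)
  have coset: "(g \<otimes>\<^bsub>G i\<^esub> k) <#\<^bsub>G i\<^esub> K = g <#\<^bsub>G i\<^esub> K" if "g \<in> carrier (G i)" "k \<in> K" for g k
    using that Kc by (simp add: lcos_m_assoc[symmetric] subgroup.lcos_module_rev coset_join3 K subsetD)
  show thesis
  proof (rule that)
    fix x h k assume *: "x \<in> carrier (G i)" "h \<in> carrier (G i)" "k \<in> K"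
    then show "u x (h \<otimes>\<^bsub>G i\<^esub> k) = u x h"
      using Kc coset[of "inv\<^bsub>G i\<^esub> x \<otimes>\<^bsub>G i\<^esub> h" k] by (simp add: u_def m_assoc subsetD)
  next
    fix g assume g: "g \<in> carrier (G i)"
    have "g <#\<^bsub>G i\<^esub> K \<noteq> {}" using subgroup.one_closed[OF K] by (auto simp: l_coset_def)
    then have "r (g <#\<^bsub>G i\<^esub> K) \<in> g <#\<^bsub>G i\<^esub> K" unfolding r_def by (simp add: some_in_eq)
    then obtain k where k: "k \<in> K" "r (g <#\<^bsub>G i\<^esub> K) = g \<otimes>\<^bsub>G i\<^esub> k" by (auto simp: l_coset_def)
    have k': "k \<in> carrier (G i)" using k Kc by blast
    have bit: "a + (b + c) \<noteq> d \<longleftrightarrow> d + c \<noteq> a + b" for a b c d :: bit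
      by (cases a; cases b; cases c; cases d) auto
    have u: "u x (x \<otimes>\<^bsub>G i\<^esub> g) = \<sigma> i (g \<otimes>\<^bsub>G i\<^esub> k) x + e i (x \<otimes>\<^bsub>G i\<^esub> g \<otimes>\<^bsub>G i\<^esub> k)" if "x \<in> carrier (G i)" for x
      using that g k k' by (simp add: u_def inv_solve_left m_assoc[symmetric])
    have "{x \<in> carrier (G i). u x (x \<otimes>\<^bsub>G i\<^esub> g) \<noteq> \<sigma> i g x + e i (x \<otimes>\<^bsub>G i\<^esub> g)} =
      {h \<in> carrier (G i). \<sigma> i g h + (e i (h \<otimes>\<^bsub>G i\<^esub> g) + e i (h \<otimes>\<^bsub>G i\<^esub> g \<otimes>\<^bsub>G i\<^esub> k)) \<noteq> \<sigma> i (g \<otimes>\<^bsub>G i\<^esub> k) h}"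
    proof (intro Collect_cong conj_cong refl)
      fix x assume x: "x \<in> carrier (G i)"
      show "(u x (x \<otimes>\<^bsub>G i\<^esub> g) \<noteq> \<sigma> i g x + e i (x \<otimes>\<^bsub>G i\<^esub> g)) \<longleftrightarrow>
        (\<sigma> i g x + (e i (x \<otimes>\<^bsub>G i\<^esub> g) + e i (x \<otimes>\<^bsub>G i\<^esub> g \<otimes>\<^bsub>G i\<^esub> k)) \<noteq> \<sigma> i (g \<otimes>\<^bsub>G i\<^esub> k) x)"
        unfolding u[OF x] by (rule bit[symmetric])
    qed
    with bound[OF g k(1)]
    show "card {x \<in> carrier (G i). u x (x \<otimes>\<^bsub>G i\<^esub> g) \<noteq> \<sigma> i g x + e i (x \<otimes>\<^bsub>G i\<^esub> g)} \<le> N" by simp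
  qed
qed

definition potentials :: "nat \<Rightarrow> nat \<times> 'p \<Rightarrow> bool" where
  "potentials N i \<longleftrightarrow> (\<exists>u1 u2 u3 :: 'm \<Rightarrow> bit.
    (\<forall>h\<in>carrier (G i). \<forall>k\<in>generate (G i) (B i \<union> C i). u1 (h \<otimes>\<^bsub>G i\<^esub> k) = u1 h) \<and>
    (\<forall>h\<in>carrier (G i). \<forall>k\<in>generate (G i) (A i \<union> C i). u2 (h \<otimes>\<^bsub>G i\<^esub> k) = u2 h) \<and>
    (\<forall>h\<in>carrier (G i). \<forall>k\<in>generate (G i) (A i \<union> B i). u3 (h \<otimes>\<^bsub>G i\<^esub> k) = u3 h) \<and>
    card {h \<in> carrier (G i). e2 i h \<noteq> u1 h + u2 h \<or> e3 i h \<noteq> u1 h + u3 h} \<le> N * fst i)"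

lemma potentials_of_kernel:
  assumes kernel: "\<And>h. h \<in> Hgen \<Longrightarrow> h \<in> shadow_kernel \<Longrightarrow> h = 1"
    and bg: "\<And>i. ok i \<Longrightarrow> boundedly_generated n (G i) (A i) (B i) (C i)"
  shows "\<exists>N. \<forall>i. ok i \<longrightarrow> potentials N i"
proof -
  obtain \<sigma> where \<sigma>: "\<And>g. g \<in> Fam (\<lambda>i. bounded_products (G i) (A i \<union> B i \<union> C i) n) \<Longrightarrow>
      S (\<lambda>i. \<sigma> i (g i)) g \<in> Hgen"
    using word_section[of n] by blast
  have sec: "S (\<lambda>i. \<sigma> i (g i)) g \<in> Hgen" if "g \<in> Fams" for g
    using bg FamD[OF that] unfolding boundedly_generated_def by (intro \<sigma> FamI) blast
  let ?K1 = "\<lambda>i. generate (G i) (B i \<union> C i)" and ?K2 = "\<lambda>i. generate (G i) (A i \<union> C i)"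
    and ?K3 = "\<lambda>i. generate (G i) (A i \<union> B i)"
  have ABC: "A i \<subseteq> carrier (G i)" "B i \<subseteq> carrier (G i)" "C i \<subseteq> carrier (G i)" if "ok i" for i
    using that subA subB subC subgroup.subset by blast+
  have K: "subgroup (?K1 i) (G i)" "subgroup (?K2 i) (G i)" "subgroup (?K3 i) (G i)" if "ok i" for i
    using ABC[OF that] by (auto intro!: group.generate_is_subgroup[OF grp[OF that]])
  have "T e1 k \<in> Hgen" if "k \<in> Fam ?K1" for k
  proof (rule T_bounded_products[OF subB subC T_Hgen(3) T_Hgen(5)])
    show "k \<in> Fam (\<lambda>i. bounded_products (G i) (B i \<union> C i) n)"
      by (rule FamI) (use bg FamD[OF that] in \<open>unfold boundedly_generated_def, blast\<close>)
  qed
  from shift_bound[OF kernel sec K(1) this] obtain N1 where N1: "\<And>i g k. ok i \<Longrightarrow> g \<in> carrier (G i) \<Longrightarrow> k \<in> ?K1 i \<Longrightarrow>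
    card {h \<in> carrier (G i). \<sigma> i g h + (0 + 0) \<noteq> \<sigma> i (g \<otimes>\<^bsub>G i\<^esub> k) h} \<le> N1 * fst i" by blast
  have "T e2 k \<in> Hgen" if "k \<in> Fam ?K2" for k
  proof (rule T_bounded_products[OF subA subC T_Hgen(1) T_Hgen(6)])
    show "k \<in> Fam (\<lambda>i. bounded_products (G i) (A i \<union> C i) n)"
      by (rule FamI) (use bg FamD[OF that] in \<open>unfold boundedly_generated_def, blast\<close>)
  qed
  from shift_bound[OF kernel sec K(2) this] obtain N2 where N2: "\<And>i g k. ok i \<Longrightarrow> g \<in> carrier (G i) \<Longrightarrow> k \<in> ?K2 i \<Longrightarrow>
    card {h \<in> carrier (G i). \<sigma> i g h + (e2 i (h \<otimes>\<^bsub>G i\<^esub> g) + e2 i (h \<otimes>\<^bsub>G i\<^esub> g \<otimes>\<^bsub>G i\<^esub> k)) \<noteq> \<sigma> i (g \<otimes>\<^bsub>G i\<^esub> k) h} \<le> N2 * fst i"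
    by blast
  have "T e3 k \<in> Hgen" if "k \<in> Fam ?K3" for k
  proof (rule T_bounded_products[OF subA subB T_Hgen(2) T_Hgen(4)])
    show "k \<in> Fam (\<lambda>i. bounded_products (G i) (A i \<union> B i) n)"
      by (rule FamI) (use bg FamD[OF that] in \<open>unfold boundedly_generated_def, blast\<close>)
  qed
  from shift_bound[OF kernel sec K(3) this] obtain N3 where N3: "\<And>i g k. ok i \<Longrightarrow> g \<in> carrier (G i) \<Longrightarrow> k \<in> ?K3 i \<Longrightarrow>
    card {h \<in> carrier (G i). \<sigma> i g h + (e3 i (h \<otimes>\<^bsub>G i\<^esub> g) + e3 i (h \<otimes>\<^bsub>G i\<^esub> g \<otimes>\<^bsub>G i\<^esub> k)) \<noteq> \<sigma> i (g \<otimes>\<^bsub>G i\<^esub> k) h} \<le> N3 * fst i"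
    by blast
  show ?thesis
  proof (intro exI allI impI)
    fix i assume i: "ok i"
    interpret group "G i" using i by (rule grp)
    have fin: "finite (carrier (G i))" using i by (rule fin)
    obtain u1 where u1: "\<And>x h k. x \<in> carrier (G i) \<Longrightarrow> h \<in> carrier (G i) \<Longrightarrow> k \<in> ?K1 i \<Longrightarrow> u1 x (h \<otimes>\<^bsub>G i\<^esub> k) = u1 x h"
      "\<And>g. g \<in> carrier (G i) \<Longrightarrow> card {x \<in> carrier (G i). u1 x (x \<otimes>\<^bsub>G i\<^esub> g) \<noteq> \<sigma> i g x + 0} \<le> N1 * fst i"
      using potentials_exist[where \<sigma> = \<sigma> and e = e1, OF i K(1)[OF i] N1[OF i]] by blast
    obtain u2 where u2: "\<And>x h k. x \<in> carrier (G i) \<Longrightarrow> h \<in> carrier (G i) \<Longrightarrow> k \<in> ?K2 i \<Longrightarrow> u2 x (h \<otimes>\<^bsub>G i\<^esub> k) = u2 x h"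
      "\<And>g. g \<in> carrier (G i) \<Longrightarrow> card {x \<in> carrier (G i). u2 x (x \<otimes>\<^bsub>G i\<^esub> g) \<noteq> \<sigma> i g x + e2 i (x \<otimes>\<^bsub>G i\<^esub> g)} \<le> N2 * fst i"
      using potentials_exist[where \<sigma> = \<sigma> and e = e2, OF i K(2)[OF i] N2[OF i]] by blast
    obtain u3 where u3: "\<And>x h k. x \<in> carrier (G i) \<Longrightarrow> h \<in> carrier (G i) \<Longrightarrow> k \<in> ?K3 i \<Longrightarrow> u3 x (h \<otimes>\<^bsub>G i\<^esub> k) = u3 x h"
      "\<And>g. g \<in> carrier (G i) \<Longrightarrow> card {x \<in> carrier (G i). u3 x (x \<otimes>\<^bsub>G i\<^esub> g) \<noteq> \<sigma> i g x + e3 i (x \<otimes>\<^bsub>G i\<^esub> g)} \<le> N3 * fst i"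
      using potentials_exist[where \<sigma> = \<sigma> and e = e3, OF i K(3)[OF i] N3[OF i]] by blast
    \<comment> \<open>In the sum of \<open>u1\<close> and \<open>u2\<close>, or of \<open>u1\<close>
      and \<open>u3\<close>, the transport \<open>\<sigma> i g x\<close> cancels and the chain
      remains. For fixed \<open>g\<close> this fails for few \<open>x\<close>; by averaging there is
      one base point \<open>x\<close> for which it fails at few \<open>g\<close>.\<close>
    define P where "P x g \<longleftrightarrow> e2 i (x \<otimes>\<^bsub>G i\<^esub> g) \<noteq> u1 x (x \<otimes>\<^bsub>G i\<^esub> g) + u2 x (x \<otimes>\<^bsub>G i\<^esub> g) \<or>
      e3 i (x \<otimes>\<^bsub>G i\<^esub> g) \<noteq> u1 x (x \<otimes>\<^bsub>G i\<^esub> g) + u3 x (x \<otimes>\<^bsub>G i\<^esub> g)" for x g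
    have "card {x \<in> carrier (G i). P x g} \<le> (N1 + N2 + N3) * fst i" if g: "g \<in> carrier (G i)" for g
    proof -
      let ?X1 = "{x \<in> carrier (G i). u1 x (x \<otimes>\<^bsub>G i\<^esub> g) \<noteq> \<sigma> i g x + 0}"
        and ?X2 = "{x \<in> carrier (G i). u2 x (x \<otimes>\<^bsub>G i\<^esub> g) \<noteq> \<sigma> i g x + e2 i (x \<otimes>\<^bsub>G i\<^esub> g)}"
        and ?X3 = "{x \<in> carrier (G i). u3 x (x \<otimes>\<^bsub>G i\<^esub> g) \<noteq> \<sigma> i g x + e3 i (x \<otimes>\<^bsub>G i\<^esub> g)}"
      have bit: "s + 0 + (s + t) = t" for s t :: bit by (cases s; cases t) auto
      have "{x \<in> carrier (G i). P x g} \<subseteq> ?X1 \<union> ?X2 \<union> ?X3"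
      proof (rule subsetI, rule ccontr)
        fix x assume "x \<in> {x \<in> carrier (G i). P x g}" "x \<notin> ?X1 \<union> ?X2 \<union> ?X3"
        then show False by (auto simp only: P_def mem_Collect_eq Un_iff bit)
      qed
      then have "card {x \<in> carrier (G i). P x g} \<le> card (?X1 \<union> ?X2 \<union> ?X3)"
        using fin by (intro card_mono) auto
      also have "\<dots> \<le> card ?X1 + card ?X2 + card ?X3"
        by (meson card_Un_le order_trans add_le_mono order_refl)
      also have "\<dots> \<le> N1 * fst i + N2 * fst i + N3 * fst i"
        by (intro add_mono u1 u2 u3 g)
      finally show ?thesis by (simp add: algebra_simps)
    qed
    from exists_small_section[where P = P, OF fin _ fin this order_refl] one_closed obtain x where
      x: "x \<in> carrier (G i)" "card {g \<in> carrier (G i). P x g} \<le> (N1 + N2 + N3) * fst i" by blast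
    have "{h \<in> carrier (G i). e2 i h \<noteq> u1 x h + u2 x h \<or> e3 i h \<noteq> u1 x h + u3 x h} \<subseteq>
      (\<lambda>g. x \<otimes>\<^bsub>G i\<^esub> g) ` {g \<in> carrier (G i). P x g}"
    proof
      fix h assume h: "h \<in> {h \<in> carrier (G i). e2 i h \<noteq> u1 x h + u2 x h \<or> e3 i h \<noteq> u1 x h + u3 x h}"
      then have "x \<otimes>\<^bsub>G i\<^esub> (inv\<^bsub>G i\<^esub> x \<otimes>\<^bsub>G i\<^esub> h) = h" using x by (simp add: m_assoc[symmetric])
      with h x show "h \<in> (\<lambda>g. x \<otimes>\<^bsub>G i\<^esub> g) ` {g \<in> carrier (G i). P x g}"
        by (intro image_eqI[of _ _ "inv\<^bsub>G i\<^esub> x \<otimes>\<^bsub>G i\<^esub> h"]) (simp_all add: P_def)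
    qed
    then have "card {h \<in> carrier (G i). e2 i h \<noteq> u1 x h + u2 x h \<or> e3 i h \<noteq> u1 x h + u3 x h} \<le>
      card {g \<in> carrier (G i). P x g}"
      using fin by (intro surj_card_le) auto
    with x show "potentials (N1 + N2 + N3) i"
      unfolding potentials_def
      by (intro exI[of _ "u1 x"] exI[of _ "u2 x"] exI[of _ "u3 x"] conjI ballI u1 u2 u3) auto
  qed
qed

end

theorem uniform_potentials:
  fixes rel :: "'m monoid \<Rightarrow> 'm set \<Rightarrow> 'm set \<Rightarrow> 'm set \<Rightarrow> bool"
  assumes rel: "rel = lg_rel \<or> rel = sm_rel"
  shows "\<exists>N. \<forall>(G :: 'm monoid) A B C (e2 :: 'm \<Rightarrow> bit) e3 w.
    rel G A B C \<longrightarrow> boundedly_generated n G A B C \<longrightarrow>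
    (\<forall>h\<in>carrier G. \<forall>x\<in>C. e2 (h \<otimes>\<^bsub>G\<^esub> x) = e2 h) \<longrightarrow>
    (\<forall>h\<in>carrier G. \<forall>x\<in>B. e3 (h \<otimes>\<^bsub>G\<^esub> x) = e3 h) \<longrightarrow>
    (\<forall>x\<in>A. card {h \<in> carrier G. e2 (h \<otimes>\<^bsub>G\<^esub> x) + e3 (h \<otimes>\<^bsub>G\<^esub> x) \<noteq> e2 h + e3 h} \<le> 2 * w) \<longrightarrow>
    (\<exists>u1 u2 u3 :: 'm \<Rightarrow> bit.
      (\<forall>h\<in>carrier G. \<forall>k\<in>generate G (B \<union> C). u1 (h \<otimes>\<^bsub>G\<^esub> k) = u1 h) \<and>
      (\<forall>h\<in>carrier G. \<forall>k\<in>generate G (A \<union> C). u2 (h \<otimes>\<^bsub>G\<^esub> k) = u2 h) \<and>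
      (\<forall>h\<in>carrier G. \<forall>k\<in>generate G (A \<union> B). u3 (h \<otimes>\<^bsub>G\<^esub> k) = u3 h) \<and>
      card {h \<in> carrier G. e2 h \<noteq> u1 h + u2 h \<or> e3 h \<noteq> u1 h + u3 h} \<le> N * w)"
proof -
  \<comment> \<open>The parameter of an index is a whole instance: group, root groups and chain. One
    lift system thus contains all instances of all weights, and its constant is the uniform
    one.\<close>
  define G where "G i = fst (snd i)" for i :: "nat \<times> 'm monoid \<times> 'm set \<times> 'm set \<times> 'm set \<times> ('m \<Rightarrow> bit) \<times> ('m \<Rightarrow> bit)"
  define A where "A i = fst (snd (snd i))" for i :: "nat \<times> 'm monoid \<times> 'm set \<times> 'm set \<times> 'm set \<times> ('m \<Rightarrow> bit) \<times> ('m \<Rightarrow> bit)"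
  define B where "B i = fst (snd (snd (snd i)))" for i :: "nat \<times> 'm monoid \<times> 'm set \<times> 'm set \<times> 'm set \<times> ('m \<Rightarrow> bit) \<times> ('m \<Rightarrow> bit)"
  define C where "C i = fst (snd (snd (snd (snd i))))" for i :: "nat \<times> 'm monoid \<times> 'm set \<times> 'm set \<times> 'm set \<times> ('m \<Rightarrow> bit) \<times> ('m \<Rightarrow> bit)"
  define e2 where "e2 i = fst (snd (snd (snd (snd (snd i)))))" for i :: "nat \<times> 'm monoid \<times> 'm set \<times> 'm set \<times> 'm set \<times> ('m \<Rightarrow> bit) \<times> ('m \<Rightarrow> bit)"
  define e3 where "e3 i = snd (snd (snd (snd (snd (snd i)))))" for i :: "nat \<times> 'm monoid \<times> 'm set \<times> 'm set \<times> 'm set \<times> ('m \<Rightarrow> bit) \<times> ('m \<Rightarrow> bit)"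
  define ok where "ok i \<longleftrightarrow> rel (G i) (A i) (B i) (C i) \<and> boundedly_generated n (G i) (A i) (B i) (C i) \<and>
    (\<forall>h\<in>carrier (G i). \<forall>x\<in>C i. e2 i (h \<otimes>\<^bsub>G i\<^esub> x) = e2 i h) \<and>
    (\<forall>h\<in>carrier (G i). \<forall>x\<in>B i. e3 i (h \<otimes>\<^bsub>G i\<^esub> x) = e3 i h) \<and>
    (\<forall>x\<in>A i. card {h \<in> carrier (G i). e2 i (h \<otimes>\<^bsub>G i\<^esub> x) + e3 i (h \<otimes>\<^bsub>G i\<^esub> x) \<noteq> e2 i h + e3 i h} \<le> 2 * fst i)" for i
  have okD: "rel (G i) (A i) (B i) (C i)" "boundedly_generated n (G i) (A i) (B i) (C i)" if "ok i" for i
    using that unfolding ok_def by (rule conjunct1, rule conjunct1[OF conjunct2])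
  interpret lift_system G A B C e2 e3 ok
  proof
    fix i assume "ok i"
    then show "common_rel (G i) (A i) (B i) (C i)"
      using rel lg_relD(1) sm_relD(1) okD(1) by metis
  qed (auto simp only: ok_def)
  have "h = 1" if "h \<in> Hgen" "h \<in> shadow_kernel" for h
    using rel that kernel_lg kernel_sm okD(1) by metis
  from potentials_of_kernel[OF this okD(2)] obtain N where N: "\<And>i. ok i \<Longrightarrow> potentials N i" by blast
  show ?thesis
  proof (intro exI[of _ N] allI impI)
    fix G' :: "'m monoid" and A' B' C' and e2' e3' :: "'m \<Rightarrow> bit" and w
    assume "rel G' A' B' C'" "boundedly_generated n G' A' B' C'"
      "\<forall>h\<in>carrier G'. \<forall>x\<in>C'. e2' (h \<otimes>\<^bsub>G'\<^esub> x) = e2' h"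
      "\<forall>h\<in>carrier G'. \<forall>x\<in>B'. e3' (h \<otimes>\<^bsub>G'\<^esub> x) = e3' h"
      "\<forall>x\<in>A'. card {h \<in> carrier G'. e2' (h \<otimes>\<^bsub>G'\<^esub> x) + e3' (h \<otimes>\<^bsub>G'\<^esub> x) \<noteq> e2' h + e3' h} \<le> 2 * w"
    then have "ok (w, G', A', B', C', e2', e3')"
      by (simp only: ok_def G_def A_def B_def C_def e2_def e3_def fst_conv snd_conv simp_thms)
    from N[OF this]
    show "\<exists>u1 u2 u3 :: 'm \<Rightarrow> bit.
      (\<forall>h\<in>carrier G'. \<forall>k\<in>generate G' (B' \<union> C'). u1 (h \<otimes>\<^bsub>G'\<^esub> k) = u1 h) \<and>
      (\<forall>h\<in>carrier G'. \<forall>k\<in>generate G' (A' \<union> C'). u2 (h \<otimes>\<^bsub>G'\<^esub> k) = u2 h) \<and>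
      (\<forall>h\<in>carrier G'. \<forall>k\<in>generate G' (A' \<union> B'). u3 (h \<otimes>\<^bsub>G'\<^esub> k) = u3 h) \<and>
      card {h \<in> carrier G'. e2' h \<noteq> u1 h + u2 h \<or> e3' h \<noteq> u1 h + u3 h} \<le> N * w"
      by (simp only: potentials_def G_def A_def B_def C_def e2_def e3_def fst_conv snd_conv)
  qed
qed

section \<open>Coset complexes of three subgroups\<close>

lemma subsets_triple:
  assumes "distinct [a, b, c]"
  shows "{\<sigma>. \<sigma> \<subseteq> {a, b, c} \<and> int (card \<sigma>) = 0 + 1} = {{a}, {b}, {c}}"
    and "{\<sigma>. \<sigma> \<subseteq> {a, b, c} \<and> int (card \<sigma>) = 1 + 1} = {{a, b}, {a, c}, {b, c}}"
    and "{\<sigma>. \<sigma> \<subseteq> {a, b, c} \<and> int (card \<sigma>) = 2 + 1} = {{a, b, c}}"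
proof -
  show "{\<sigma>. \<sigma> \<subseteq> {a, b, c} \<and> int (card \<sigma>) = 0 + 1} = {{a}, {b}, {c}}"
    by (auto simp: card_1_singleton_iff)
  have "int (card \<sigma>) = 1 + 1 \<longleftrightarrow> card \<sigma> = 2" for \<sigma> :: "'a set" by auto
  then show "{\<sigma>. \<sigma> \<subseteq> {a, b, c} \<and> int (card \<sigma>) = 1 + 1} = {{a, b}, {a, c}, {b, c}}"
    using assms by (auto simp: card_2_iff)
  have "\<sigma> = {a, b, c}" if "\<sigma> \<subseteq> {a, b, c}" "int (card \<sigma>) = 2 + 1" for \<sigma>
    using that assms by (intro card_subset_eq) auto
  then show "{\<sigma>. \<sigma> \<subseteq> {a, b, c} \<and> int (card \<sigma>) = 2 + 1} = {{a, b, c}}"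
    using assms by auto
qed

lemma pmf_of_set_image:
  assumes "finite Xs" "Xs \<noteq> {}" and fib: "\<And>x. x \<in> Xs \<Longrightarrow> card {y \<in> Xs. f y = f x} = m"
  shows "pmf_of_set (f ` Xs) = map_pmf f (pmf_of_set Xs)"
proof (rule pmf_eqI)
  fix z
  have m: "card Xs = m * card (f ` Xs)"
  proof -
    have "Xs = (\<Union>z\<in>f ` Xs. {y \<in> Xs. f y = z})" by auto
    then have "card Xs = card (\<Union>z\<in>f ` Xs. {y \<in> Xs. f y = z})" by simp
    also have "\<dots> = (\<Sum>z\<in>f ` Xs. card {y \<in> Xs. f y = z})"
      using assms(1) by (intro card_UN_disjoint) auto
    also have "\<dots> = (\<Sum>z\<in>f ` Xs. m)" using fib by (intro sum.cong) auto
    finally show ?thesis by simp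
  qed
  have m0: "m \<noteq> 0" using m assms(1,2) by (metis card_0_eq mult_is_0)
  have "pmf (map_pmf f (pmf_of_set Xs)) z = measure_pmf.prob (pmf_of_set Xs) (f -` {z})"
    by (simp add: pmf_map)
  also have "\<dots> = card {y \<in> Xs. f y = z} / card Xs"
    using assms(1,2) by (simp add: measure_pmf_of_set Int_def vimage_def conj_commute)
  also have "\<dots> = pmf (pmf_of_set (f ` Xs)) z"
  proof (cases "z \<in> f ` Xs")
    case True
    then have "card {y \<in> Xs. f y = z} = m" using fib by auto
    with True m m0 assms(1,2) show ?thesis by (simp add: pmf_of_set indicator_def)
  next
    case False
    then have "{y \<in> Xs. f y = z} = {}" by auto
    then have "card {y \<in> Xs. f y = z} = 0" by (simp only: card.empty)
    with False assms(1,2) show ?thesis by (simp add: pmf_of_set)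
  qed
  finally show "pmf (pmf_of_set (f ` Xs)) z = pmf (map_pmf f (pmf_of_set Xs)) z" by simp
qed

section \<open>Triangles of a coset complex as group elements\<close>

locale coset_triangles = group G for G :: "'g monoid" (structure) +
  fixes K :: "'i \<Rightarrow> 'g set" and p q r :: 'i
  assumes fin: "finite (carrier G)"
    and sub: "subgroup (K p) G" "subgroup (K q) G" "subgroup (K r) G"
    and dist: "distinct [p, q, r]"
begin

declare add_bit_eq_xor [simp del]

definition Cx :: "('i \<times> 'g set) set set" where
  "Cx = coset_complex G {p, q, r} K"

definition vert :: "'i \<Rightarrow> 'g \<Rightarrow> 'i \<times> 'g set" where
  "vert i g = (i, g <# K i)"

definition tri :: "'g \<Rightarrow> ('i \<times> 'g set) set" where
  "tri g = {vert p g, vert q g, vert r g}"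

lemma vert_distinct: "distinct [vert p g, vert q g, vert r g]"
  using dist by (simp add: vert_def)

lemma Cx_iff: "\<sigma> \<in> Cx \<longleftrightarrow> (\<exists>g\<in>carrier G. \<sigma> \<subseteq> tri g)"
proof -
  have "{(i, g <# K i) | i. i \<in> {p, q, r}} = tri g" for g by (auto simp: tri_def vert_def)
  then show ?thesis by (simp add: Cx_def coset_complex_def)
qed

lemma tri_finite: "finite (tri g)" "card (tri g) = 3"
  using vert_distinct[of g] by (simp_all add: tri_def)

lemma faces_iff: "\<sigma> \<in> faces Cx j \<longleftrightarrow> (\<exists>g\<in>carrier G. \<sigma> \<subseteq> tri g) \<and> int (card \<sigma>) = j + 1"
  unfolding faces_def Cx_iff using tri_finite(1) finite_subset by blast

lemma faces_2: "faces Cx 2 = tri ` carrier G"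
proof (intro equalityI subsetI)
  fix \<sigma> assume "\<sigma> \<in> faces Cx 2"
  then obtain g where g: "g \<in> carrier G" "\<sigma> \<subseteq> tri g" "int (card \<sigma>) = 2 + 1" by (auto simp: faces_iff)
  then have "\<sigma> = tri g" using tri_finite[of g] by (intro card_subset_eq) auto
  with g show "\<sigma> \<in> tri ` carrier G" by blast
next
  fix \<sigma> assume "\<sigma> \<in> tri ` carrier G"
  then show "\<sigma> \<in> faces Cx 2" by (auto simp: faces_iff tri_finite)
qed

lemma lcos_mult:
  assumes "subgroup H G" "g \<in> carrier G" "k \<in> H"
  shows "(g \<otimes> k) <# H = g <# H"
proof -
  have "H \<subseteq> carrier G" "k \<in> carrier G" using assms subgroup.subset by blast+
  then show ?thesis using assms by (simp add: lcos_m_assoc[symmetric] subgroup.lcos_module_rev coset_join3)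
qed

lemma tri_translate:
  assumes "x \<in> carrier G" "g \<in> carrier G" "h \<in> carrier G"
  shows "tri (x \<otimes> g) = tri (x \<otimes> h) \<longleftrightarrow> tri g = tri h"
proof -
  have *: "tri g = tri h \<longleftrightarrow> (\<forall>i\<in>{p, q, r}. g <# K i = h <# K i)" for g h
    using dist by (auto simp: tri_def vert_def)
  have "(x \<otimes> g) <# K i = (x \<otimes> h) <# K i \<longleftrightarrow> g <# K i = h <# K i" if "i \<in> {p, q, r}" for i
  proof -
    have Ki: "K i \<subseteq> carrier G" using that sub subgroup.subset by blast
    have "inv x <# (x <# (g <# K i)) = g <# K i" if "g \<in> carrier G" for g
      using that assms Ki by (simp add: lcos_m_assoc m_assoc[symmetric] l_coset_subset_G)
    then show ?thesis using assms Ki by (metis lcos_m_assoc)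
  qed
  then show ?thesis by (simp add: *)
qed

text \<open>Several group elements may give the same triangle, but left translation identifies the
  fibres, so the uniform distribution on the group induces the uniform one on triangles.\<close>

lemma triangle_pmf_eq: "triangle_pmf Cx = map_pmf tri (pmf_of_set (carrier G))"
  unfolding triangle_pmf_def faces_2
proof (rule pmf_of_set_image[OF fin])
  show "carrier G \<noteq> {}" using one_closed by blast
  fix g assume g: "g \<in> carrier G"
  have "{h \<in> carrier G. tri h = tri g} = (\<lambda>h. g \<otimes> h) ` {h \<in> carrier G. tri h = tri \<one>}"
  proof (intro equalityI subsetI)
    fix h assume h: "h \<in> {h \<in> carrier G. tri h = tri g}"
    then have "h = g \<otimes> (inv g \<otimes> h)" using g by (simp add: m_assoc[symmetric])
    moreover have "tri (inv g \<otimes> h) = tri \<one>"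
      using h g tri_translate[of "inv g" h g] by simp
    ultimately show "h \<in> (\<lambda>h. g \<otimes> h) ` {h \<in> carrier G. tri h = tri \<one>}" using h g by blast
  next
    fix h assume "h \<in> (\<lambda>h. g \<otimes> h) ` {h \<in> carrier G. tri h = tri \<one>}"
    then show "h \<in> {h \<in> carrier G. tri h = tri g}" using g tri_translate[of g _ \<one>] by auto
  qed
  moreover have "inj_on (\<lambda>h. g \<otimes> h) {h \<in> carrier G. tri h = tri \<one>}"
    using g by (auto intro!: inj_onI)
  ultimately show "card {h \<in> carrier G. tri h = tri g} = card {h \<in> carrier G. tri h = tri \<one>}"
    by (simp add: card_image)
qed

definition bad :: "int \<Rightarrow> (('i \<times> 'g set) set \<Rightarrow> bit) \<Rightarrow> (('i \<times> 'g set) set \<Rightarrow> bit) \<Rightarrow> 'g set" where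
  "bad j f f' = {g \<in> carrier G. \<exists>\<sigma>. \<sigma> \<subseteq> tri g \<and> int (card \<sigma>) = j + 1 \<and> f \<sigma> \<noteq> f' \<sigma>}"

lemma subfaces_card:
  assumes "j \<in> {0, 1, 2}"
  shows "finite {\<sigma>. \<sigma> \<subseteq> tri g \<and> int (card \<sigma>) = j + 1}"
    and "card {\<sigma>. \<sigma> \<subseteq> tri g \<and> int (card \<sigma>) = j + 1} \<in> {1..3}"
proof -
  have "finite {\<sigma>. \<sigma> \<subseteq> tri g \<and> int (card \<sigma>) = j + 1} \<and> card {\<sigma>. \<sigma> \<subseteq> tri g \<and> int (card \<sigma>) = j + 1} \<in> {1..3}"
  proof -
    consider "j = 0" | "j = 1" | "j = 2" using assms by auto
    then show ?thesis
      unfolding tri_def using vert_distinct[of g]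
      by cases (simp_all only: subsets_triple, auto simp: doubleton_eq_iff card_insert_if)
  qed
  then show "finite {\<sigma>. \<sigma> \<subseteq> tri g \<and> int (card \<sigma>) = j + 1}"
    "card {\<sigma>. \<sigma> \<subseteq> tri g \<and> int (card \<sigma>) = j + 1} \<in> {1..3}" by blast+
qed

text \<open>A triangle has at most three faces of each dimension considered. So the fraction of
  group elements whose triangle contains a face of disagreement lies between the distance and three
  times the distance.\<close>

lemma chain_dist_bounds:
  assumes j: "j \<in> {0, 1, 2}"
  shows "card (bad j f f') \<le> 3 * card (carrier G) * chain_dist (triangle_pmf Cx) j f f'"
    and "card (carrier G) * chain_dist (triangle_pmf Cx) j f f' \<le> card (bad j f f')"
proof -
  define F where "F g = {\<sigma>. \<sigma> \<subseteq> tri g \<and> int (card \<sigma>) = j + 1}" for g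
  define P where "P g = measure_pmf.prob (pmf_of_set (F g)) {\<sigma>. f \<sigma> \<noteq> f' \<sigma>}" for g
  have ne: "carrier G \<noteq> {}" using one_closed by blast
  then have c0: "card (carrier G) > 0" using fin by (simp add: card_gt_0_iff)
  have F: "finite (F g)" "card (F g) \<in> {1..3}" "F g \<noteq> {}" for g
    using subfaces_card[OF j, of g] unfolding F_def[symmetric] by auto
  have "chain_dist (triangle_pmf Cx) j f f' =
      measure_pmf.prob (bind_pmf (pmf_of_set (carrier G)) (\<lambda>g. pmf_of_set (F g))) {\<sigma>. f \<sigma> \<noteq> f' \<sigma>}"
    by (simp add: chain_dist_def face_pmf_def triangle_pmf_eq bind_map_pmf F_def)
  also have "\<dots> = measure_pmf.expectation (pmf_of_set (carrier G)) P"
    unfolding P_def by (simp add: measure_pmf_bind measure_pmf.measure_bind[where N = "count_space UNIV"]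
        measure_pmf_in_subprob_space)
  also have "\<dots> = sum P (carrier G) / card (carrier G)"
    using fin ne by (simp add: integral_pmf_of_set)
  finally have eq: "card (carrier G) * chain_dist (triangle_pmf Cx) j f f' = sum P (carrier G)"
    using c0 by simp
  have P: "P g = card (F g \<inter> {\<sigma>. f \<sigma> \<noteq> f' \<sigma>}) / card (F g)" for g
    unfolding P_def using F by (simp add: measure_pmf_of_set)
  have badF: "bad j f f' = {g \<in> carrier G. F g \<inter> {\<sigma>. f \<sigma> \<noteq> f' \<sigma>} \<noteq> {}}"
    by (auto simp: bad_def F_def)
  have cb: "real (card (bad j f f')) = (\<Sum>g\<in>carrier G. if g \<in> bad j f f' then 1 else 0)"
    using fin by (simp add: sum.If_cases) (simp add: bad_def Int_def)
  have "P g \<le> (if g \<in> bad j f f' then 1 else 0)" if "g \<in> carrier G" for g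
  proof (cases "g \<in> bad j f f'")
    case True
    then show ?thesis by (simp add: P_def)
  next
    case False
    then have "F g \<inter> {\<sigma>. f \<sigma> \<noteq> f' \<sigma>} = {}" using that badF by blast
    with False show ?thesis by (simp only: P) simp
  qed
  then show "card (carrier G) * chain_dist (triangle_pmf Cx) j f f' \<le> card (bad j f f')"
    unfolding eq cb by (rule sum_mono)
  have "(if g \<in> bad j f f' then 1 else 0) \<le> 3 * P g" if "g \<in> carrier G" for g
  proof (cases "g \<in> bad j f f'")
    case True
    then have "F g \<inter> {\<sigma>. f \<sigma> \<noteq> f' \<sigma>} \<noteq> {}" using badF by blast
    then have "card (F g \<inter> {\<sigma>. f \<sigma> \<noteq> f' \<sigma>}) \<ge> 1"
      using F(1)[of g] by (simp add: Suc_le_eq card_gt_0_iff)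
    moreover have "real (card (F g)) \<le> 3" "real (card (F g)) > 0" using F(2)[of g] by auto
    ultimately have "real (card (F g)) \<le> 3 * card (F g \<inter> {\<sigma>. f \<sigma> \<noteq> f' \<sigma>})" by linarith
    with True \<open>real (card (F g)) > 0\<close> show ?thesis by (simp add: P pos_le_divide_eq)
  next
    case False
    then show ?thesis by (simp add: P_def)
  qed
  then have "real (card (bad j f f')) \<le> (\<Sum>g\<in>carrier G. 3 * P g)" unfolding cb by (rule sum_mono)
  also have "\<dots> = 3 * (card (carrier G) * chain_dist (triangle_pmf Cx) j f f')"
    by (simp add: eq sum_distrib_left[symmetric])
  finally show "card (bad j f f') \<le> 3 * card (carrier G) * chain_dist (triangle_pmf Cx) j f f'"
    by (simp add: mult.assoc)
qed

lemma subfaces_eq: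
  assumes "\<tau> \<in> faces Cx (j + 1)"
  shows "{\<sigma>. \<sigma> \<in> faces Cx j \<and> \<sigma> \<subset> \<tau>} = {\<sigma>. \<sigma> \<subseteq> \<tau> \<and> int (card \<sigma>) = j + 1}"
  using assms unfolding faces_iff by (auto simp: psubset_eq)

lemma coboundary_tri:
  assumes "g \<in> carrier G"
  shows "coboundary Cx 1 f (tri g) = f {vert p g, vert q g} + f {vert p g, vert r g} + f {vert q g, vert r g}"
proof -
  have t: "tri g \<in> faces Cx (1 + 1)" using assms faces_2 by auto
  show ?thesis
    unfolding coboundary_def subfaces_eq[OF t] restrict_apply'[OF t]
    unfolding tri_def subsets_triple(2)[OF vert_distinct]
    using vert_distinct[of g] by (simp add: doubleton_eq_iff add.assoc)
qed

lemma coboundary_edge: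
  assumes "g \<in> carrier G" "a \<in> tri g" "b \<in> tri g" "a \<noteq> b"
  shows "coboundary Cx 0 f {a, b} = f {a} + f {b}"
proof -
  have t: "{a, b} \<in> faces Cx (0 + 1)" using assms by (auto simp: faces_iff)
  have "{\<sigma>. \<sigma> \<subseteq> {a, b} \<and> int (card \<sigma>) = 0 + 1} = {{a}, {b}}"
    by (auto simp: card_1_singleton_iff)
  then show ?thesis
    unfolding coboundary_def subfaces_eq[OF t] restrict_apply'[OF t] using assms(4) by simp
qed

lemma coboundary_vertex:
  assumes "g \<in> carrier G" "a \<in> tri g"
  shows "coboundary Cx (- 1) f {a} = f {}"
proof -
  have t: "{a} \<in> faces Cx (- 1 + 1)" using assms by (auto simp: faces_iff)
  have "{\<sigma>. \<sigma> \<subseteq> {a} \<and> int (card \<sigma>) = - 1 + 1} = {{}}" by (auto dest: finite_subset)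
  then show ?thesis
    unfolding coboundary_def subfaces_eq[OF t] restrict_apply'[OF t] by simp
qed

end

section \<open>From counts of violated triangles to expansion\<close>

lemma chain_setdist_le:
  assumes "z \<in> Z"
  shows "chain_setdist \<pi> j f Z \<le> chain_dist \<pi> j f z"
  unfolding chain_setdist_def
  by (rule cINF_lower[OF _ assms]) (auto simp: chain_dist_def intro!: bdd_belowI[of _ 0])

lemma coboundary_expansionI:
  assumes M: "M > 0"
    and B: "coboundaries S j \<subseteq> cocycles S j" and Z: "cocycles S j \<subseteq> coboundaries S j"
    and f: "\<And>f. f \<in> chains S j \<Longrightarrow> \<exists>z\<in>coboundaries S j.
      chain_dist \<pi> j f z \<le> M * chain_dist \<pi> (j + 1) (coboundary S j f) (zero_chain S (j + 1))"
  shows "coboundary_expansion_at_least S \<pi> j (1 / M)"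
  unfolding coboundary_expansion_at_least_def cocycle_expansion_at_least_def
proof (intro conjI allI ballI impI)
  show "cocycles S j = coboundaries S j" using B Z by blast
  fix v :: real and f assume "f \<in> chains S j" and v: "v < chain_setdist \<pi> j f (cocycles S j)"
  then obtain z where z: "z \<in> coboundaries S j"
    "chain_dist \<pi> j f z \<le> M * chain_dist \<pi> (j + 1) (coboundary S j f) (zero_chain S (j + 1))"
    using f by blast
  have "v < M * chain_dist \<pi> (j + 1) (coboundary S j f) (zero_chain S (j + 1))"
    using v chain_setdist_le[of z "cocycles S j" \<pi> j f] z B by fastforce
  with M show "1 / M * v < chain_dist \<pi> (j + 1) (coboundary S j f) (zero_chain S (j + 1))"
    by (simp add: field_simps)
qed

lemma coboundary_expansion_mono:
  assumes "coboundary_expansion_at_least S \<pi> j \<epsilon>" "\<delta> \<le> \<epsilon>"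
  shows "coboundary_expansion_at_least S \<pi> j \<delta>"
  unfolding coboundary_expansion_at_least_def cocycle_expansion_at_least_def
proof (intro conjI allI ballI impI)
  show "cocycles S j = coboundaries S j" using assms(1) by (simp add: coboundary_expansion_at_least_def)
  fix v :: real and f assume v: "0 \<le> v" "f \<in> chains S j" "v < chain_setdist \<pi> j f (cocycles S j)"
  then have "\<epsilon> * v < chain_dist \<pi> (j + 1) (coboundary S j f) (zero_chain S (j + 1))"
    using assms(1) by (simp add: coboundary_expansion_at_least_def cocycle_expansion_at_least_def)
  moreover have "\<delta> * v \<le> \<epsilon> * v" using assms(2) v(1) by (rule mult_right_mono)
  ultimately show "\<delta> * v < chain_dist \<pi> (j + 1) (coboundary S j f) (zero_chain S (j + 1))" by simp
qed

context coset_triangles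
begin

lemma vert_mult: "i \<in> {p, q, r} \<Longrightarrow> g \<in> carrier G \<Longrightarrow> k \<in> K i \<Longrightarrow> vert i (g \<otimes> k) = vert i g"
  using sub by (auto simp: vert_def lcos_mult)

lemma card_right_mult:
  assumes "x \<in> carrier G"
  shows "card {h \<in> carrier G. P (h \<otimes> x)} = card {h \<in> carrier G. P h}"
proof (rule bij_betw_same_card[of "\<lambda>h. h \<otimes> x"], rule bij_betwI')
  fix h assume h: "h \<in> {h \<in> carrier G. P h}"
  then show "\<exists>y\<in>{h \<in> carrier G. P (h \<otimes> x)}. h = y \<otimes> x"
    using assms by (intro bexI[of _ "h \<otimes> inv x"]) (simp_all add: m_assoc)
qed (use assms in auto)

lemma bad_empty_eq:
  assumes "bad j f f' = {}" "f \<in> chains Cx j" "f' \<in> chains Cx j"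
  shows "f = f'"
proof (rule PiE_ext[OF assms(2,3)[unfolded chains_def]])
  fix \<sigma> assume "\<sigma> \<in> faces Cx j"
  then show "f \<sigma> = f' \<sigma>" using assms(1) by (auto simp: faces_iff bad_def)
qed

lemma finite_bad: "finite (bad j f f')"
  using fin by (simp add: bad_def)

lemma coboundary_chain: "coboundary Cx j f \<in> chains Cx (j + 1)"
  by (simp add: coboundary_def chains_def)

lemma expansionI:
  assumes j: "j \<in> {0, 1}" and B: "coboundaries Cx j \<subseteq> cocycles Cx j"
    and f: "\<And>f. f \<in> chains Cx j \<Longrightarrow> \<exists>z\<in>coboundaries Cx j.
      card (bad j f z) \<le> M * card (bad (j + 1) (coboundary Cx j f) (zero_chain Cx (j + 1)))"
    and M: "M > 0"
  shows "coboundary_expansion_at_least Cx (triangle_pmf Cx) j (1 / (3 * real M))"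
proof (rule coboundary_expansionI[OF _ B])
  show "0 < 3 * real M" using M by simp
  have c0: "real (card (carrier G)) > 0" using fin one_closed by (simp add: card_gt_0_iff) blast
  \<comment> \<open>If no face is violated, the linear estimate leaves no room for an error. So the
    vanishing of cohomology comes from the same bound as expansion.\<close>
  show "cocycles Cx j \<subseteq> coboundaries Cx j"
  proof
    fix f assume f': "f \<in> cocycles Cx j"
    then have fc: "f \<in> chains Cx j" "coboundary Cx j f = zero_chain Cx (j + 1)" by (auto simp: cocycles_def)
    obtain z where z: "z \<in> coboundaries Cx j"
      "card (bad j f z) \<le> M * card (bad (j + 1) (coboundary Cx j f) (zero_chain Cx (j + 1)))"
      using f[OF fc(1)] by blast
    have "bad (j + 1) (coboundary Cx j f) (zero_chain Cx (j + 1)) = {}" by (simp add: fc(2) bad_def)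
    with z(2) have "bad j f z = {}" using finite_bad by simp
    moreover have "z \<in> chains Cx j" using z(1) B by (auto simp: cocycles_def)
    ultimately have "f = z" using fc(1) by (intro bad_empty_eq)
    with z(1) show "f \<in> coboundaries Cx j" by simp
  qed
  fix f assume "f \<in> chains Cx j"
  then obtain z where z: "z \<in> coboundaries Cx j"
      "card (bad j f z) \<le> M * card (bad (j + 1) (coboundary Cx j f) (zero_chain Cx (j + 1)))"
    using f by blast
  let ?d = "chain_dist (triangle_pmf Cx) (j + 1) (coboundary Cx j f) (zero_chain Cx (j + 1))"
  have "card (carrier G) * chain_dist (triangle_pmf Cx) j f z \<le> card (bad j f z)"
    using j by (intro chain_dist_bounds) auto
  also have "real (card (bad j f z)) \<le> real (M * card (bad (j + 1) (coboundary Cx j f) (zero_chain Cx (j + 1))))"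
    using z(2) by (simp only: of_nat_le_iff)
  also have "\<dots> = real M * real (card (bad (j + 1) (coboundary Cx j f) (zero_chain Cx (j + 1))))"
    by (rule of_nat_mult)
  also have "\<dots> \<le> M * (3 * card (carrier G) * ?d)"
    using j by (intro mult_left_mono chain_dist_bounds) auto
  also have "\<dots> = card (carrier G) * (3 * M * ?d)" by simp
  finally have "chain_dist (triangle_pmf Cx) j f z \<le> 3 * M * ?d"
    using c0 by (simp only: mult_le_cancel_left_pos)
  with z(1) show "\<exists>z\<in>coboundaries Cx j. chain_dist (triangle_pmf Cx) j f z \<le> 3 * real M * ?d" by auto
qed

lemma vert_tri: "vert p g \<in> tri g" "vert q g \<in> tri g" "vert r g \<in> tri g"
  "vert p g \<noteq> vert q g" "vert p g \<noteq> vert r g" "vert q g \<noteq> vert r g"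
  using vert_distinct[of g] by (simp_all add: tri_def)

lemma edges_tri:
  "\<sigma> \<subseteq> tri g \<and> int (card \<sigma>) = 1 + 1 \<longleftrightarrow>
    \<sigma> \<in> {{vert p g, vert q g}, {vert p g, vert r g}, {vert q g, vert r g}}"
  using subsets_triple(2)[OF vert_distinct[of g]] unfolding tri_def by blast

lemma vertices_tri:
  "\<sigma> \<subseteq> tri g \<and> int (card \<sigma>) = 0 + 1 \<longleftrightarrow> \<sigma> \<in> {{vert p g}, {vert q g}, {vert r g}}"
  using subsets_triple(1)[OF vert_distinct[of g]] unfolding tri_def by blast

lemma triangles_tri: "\<sigma> \<subseteq> tri g \<and> int (card \<sigma>) = 2 + 1 \<longleftrightarrow> \<sigma> = tri g"
  using subsets_triple(3)[OF vert_distinct[of g]] unfolding tri_def by blast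

lemma coboundary_coboundary_1: "coboundary Cx 1 (coboundary Cx 0 u) = zero_chain Cx 2"
proof
  fix \<sigma>
  show "coboundary Cx 1 (coboundary Cx 0 u) \<sigma> = zero_chain Cx 2 \<sigma>"
  proof (cases "\<sigma> \<in> faces Cx 2")
    case True
    then obtain g where g: "g \<in> carrier G" "\<sigma> = tri g" by (auto simp: faces_2)
    have bit: "x + y + (x + z) + (y + z) = 0" for x y z :: bit
      by (cases x; cases y; cases z) auto
    have "coboundary Cx 1 (coboundary Cx 0 u) \<sigma> = 0"
      by (simp add: g coboundary_tri coboundary_edge[of g] vert_tri bit)
    with True show ?thesis by (simp add: zero_chain_def)
  qed (simp add: coboundary_def zero_chain_def)
qed

lemma coboundary_coboundary_0: "coboundary Cx 0 (coboundary Cx (- 1) u) = zero_chain Cx 1"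
proof
  fix \<sigma>
  show "coboundary Cx 0 (coboundary Cx (- 1) u) \<sigma> = zero_chain Cx 1 \<sigma>"
  proof (cases "\<sigma> \<in> faces Cx 1")
    case True
    then obtain g where g: "g \<in> carrier G" "\<sigma> \<subseteq> tri g \<and> int (card \<sigma>) = 1 + 1" by (auto simp: faces_iff)
    then have "coboundary Cx 0 (coboundary Cx (- 1) u) \<sigma> = 0"
      unfolding edges_tri
      by (auto simp: coboundary_edge[of g] coboundary_vertex[of g] vert_tri bit_add_self)
    with True show ?thesis by (simp add: zero_chain_def)
  qed (simp add: coboundary_def zero_chain_def)
qed

lemma vertex_chain:
  fixes u :: "'i \<Rightarrow> 'g \<Rightarrow> bit"
  assumes "\<And>i h k. i \<in> {p, q, r} \<Longrightarrow> h \<in> carrier G \<Longrightarrow> k \<in> K i \<Longrightarrow> u i (h \<otimes> k) = u i h"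
  obtains c where "c \<in> chains Cx 0" "\<And>i g. i \<in> {p, q, r} \<Longrightarrow> g \<in> carrier G \<Longrightarrow> c {vert i g} = u i g"
proof
  define c where "c = (\<lambda>\<sigma>\<in>faces Cx 0. u (fst (the_elem \<sigma>)) (SOME g. g \<in> snd (the_elem \<sigma>)))"
  show "c \<in> chains Cx 0" by (simp add: c_def chains_def)
  fix i g assume i: "i \<in> {p, q, r}" and g: "g \<in> carrier G"
  have "{vert i g} \<in> faces Cx 0" using i g by (auto simp: faces_iff tri_def)
  then have "c {vert i g} = u i (SOME h. h \<in> g <# K i)" by (simp add: c_def vert_def)
  also have "g <# K i \<noteq> {}" using i sub subgroup.one_closed by (auto simp: l_coset_def)
  then have "(SOME h. h \<in> g <# K i) \<in> g <# K i" by (simp add: some_in_eq)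
  then obtain k where "k \<in> K i" "(SOME h. h \<in> g <# K i) = g \<otimes> k" by (auto simp: l_coset_def)
  then have "u i (SOME h. h \<in> g <# K i) = u i g" using assms i g by simp
  finally show "c {vert i g} = u i g" .
qed

text \<open>The potentials are constant on cosets and so define a 0-chain. Its coboundary fits the
  two edges at the vertex of type \<open>p\<close> up to \<open>N * w\<close> errors, with
  \<open>w\<close> the number of violated triangles; the third edge then fits off these triangles,
  whence \<open>Suc N\<close>.\<close>

lemma expansion_1:
  assumes ABC: "A \<subseteq> K q" "A \<subseteq> K r" "B \<subseteq> K p" "B \<subseteq> K r" "C \<subseteq> K p" "C \<subseteq> K q"
    and pot: "\<And>(e2 :: 'g \<Rightarrow> bit) e3 w.
      (\<And>h x. h \<in> carrier G \<Longrightarrow> x \<in> C \<Longrightarrow> e2 (h \<otimes> x) = e2 h) \<Longrightarrow>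
      (\<And>h x. h \<in> carrier G \<Longrightarrow> x \<in> B \<Longrightarrow> e3 (h \<otimes> x) = e3 h) \<Longrightarrow>
      (\<And>x. x \<in> A \<Longrightarrow> card {h \<in> carrier G. e2 (h \<otimes> x) + e3 (h \<otimes> x) \<noteq> e2 h + e3 h} \<le> 2 * w) \<Longrightarrow>
      \<exists>u1 u2 u3 :: 'g \<Rightarrow> bit.
        (\<forall>h\<in>carrier G. \<forall>k\<in>K p. u1 (h \<otimes> k) = u1 h) \<and>
        (\<forall>h\<in>carrier G. \<forall>k\<in>K q. u2 (h \<otimes> k) = u2 h) \<and>
        (\<forall>h\<in>carrier G. \<forall>k\<in>K r. u3 (h \<otimes> k) = u3 h) \<and>
        card {h \<in> carrier G. e2 h \<noteq> u1 h + u2 h \<or> e3 h \<noteq> u1 h + u3 h} \<le> N * w"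
  shows "coboundary_expansion_at_least Cx (triangle_pmf Cx) 1 (1 / (3 * real (Suc N)))"
proof (rule expansionI)
  show "coboundaries Cx 1 \<subseteq> cocycles Cx 1"
    using coboundary_chain[of 0] by (auto simp: coboundaries_def cocycles_def coboundary_coboundary_1)
  fix f assume "f \<in> chains Cx 1"
  define W where "W = bad 2 (coboundary Cx 1 f) (zero_chain Cx 2)"
  define e2 where "e2 g = f {vert p g, vert q g}" for g
  define e3 where "e3 g = f {vert p g, vert r g}" for g
  define e where "e g = f {vert q g, vert r g}" for g
  have W: "g \<in> W \<longleftrightarrow> e2 g + e3 g + e g \<noteq> 0" if "g \<in> carrier G" for g
    using that faces_2 unfolding W_def bad_def triangles_tri[unfolded conj_assoc[symmetric]]
    by (simp add: triangles_tri[simplified] coboundary_tri zero_chain_def e2_def e3_def e_def conj_assoc[symmetric])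
  have eW: "e2 g + e3 g = e g" if "g \<in> carrier G" "g \<notin> W" for g
  proof -
    have "x = y" if "x + y = 0" for x y :: bit using that by (cases x; cases y) auto
    then show ?thesis using W that by blast
  qed
  have inv: "e2 (h \<otimes> x) = e2 h" if "h \<in> carrier G" "x \<in> C" for h x
    using that ABC by (simp add: e2_def vert_mult subsetD)
  have inv': "e3 (h \<otimes> x) = e3 h" if "h \<in> carrier G" "x \<in> B" for h x
    using that ABC by (simp add: e3_def vert_mult subsetD)
  \<comment> \<open>Off \<open>W\<close> the sum of \<open>e2\<close> and \<open>e3\<close> is the
    value \<open>e\<close> on the third edge, which \<open>A\<close> preserves. The factor 2 stands
    for the triangles of \<open>h\<close> and of \<open>h \<otimes> x\<close>.\<close>
  have near: "card {h \<in> carrier G. e2 (h \<otimes> x) + e3 (h \<otimes> x) \<noteq> e2 h + e3 h} \<le> 2 * card W" if x: "x \<in> A" for x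
  proof -
    have xG: "x \<in> carrier G" using x ABC sub subgroup.subset by blast
    have "{h \<in> carrier G. e2 (h \<otimes> x) + e3 (h \<otimes> x) \<noteq> e2 h + e3 h} \<subseteq>
      {h \<in> carrier G. h \<in> W} \<union> {h \<in> carrier G. h \<otimes> x \<in> W}"
    proof (rule subsetI, rule ccontr)
      fix h assume h: "h \<in> {h \<in> carrier G. e2 (h \<otimes> x) + e3 (h \<otimes> x) \<noteq> e2 h + e3 h}"
        "h \<notin> {h \<in> carrier G. h \<in> W} \<union> {h \<in> carrier G. h \<otimes> x \<in> W}"
      then have "e (h \<otimes> x) = e h" using ABC x by (simp add: e_def vert_mult subsetD)
      moreover have "e2 h + e3 h = e h" "e2 (h \<otimes> x) + e3 (h \<otimes> x) = e (h \<otimes> x)"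
        using h xG by (auto intro!: eW)
      ultimately show False using h(1) by simp
    qed
    then have "card {h \<in> carrier G. e2 (h \<otimes> x) + e3 (h \<otimes> x) \<noteq> e2 h + e3 h} \<le>
      card ({h \<in> carrier G. h \<in> W} \<union> {h \<in> carrier G. h \<otimes> x \<in> W})"
      using fin by (intro card_mono) auto
    also have "\<dots> \<le> card {h \<in> carrier G. h \<in> W} + card {h \<in> carrier G. h \<otimes> x \<in> W}" by (rule card_Un_le)
    also have "\<dots> = 2 * card {h \<in> carrier G. h \<in> W}" by (simp add: card_right_mult[OF xG, of "\<lambda>h. h \<in> W"])
    also have "{h \<in> carrier G. h \<in> W} = W" by (auto simp: W_def bad_def)
    finally show ?thesis .
  qed
  obtain u1 u2 u3 :: "'g \<Rightarrow> bit" where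
    u1: "\<And>h k. h \<in> carrier G \<Longrightarrow> k \<in> K p \<Longrightarrow> u1 (h \<otimes> k) = u1 h" and
    u2: "\<And>h k. h \<in> carrier G \<Longrightarrow> k \<in> K q \<Longrightarrow> u2 (h \<otimes> k) = u2 h" and
    u3: "\<And>h k. h \<in> carrier G \<Longrightarrow> k \<in> K r \<Longrightarrow> u3 (h \<otimes> k) = u3 h" and
    u: "card {h \<in> carrier G. e2 h \<noteq> u1 h + u2 h \<or> e3 h \<noteq> u1 h + u3 h} \<le> N * card W"
    using pot[OF inv inv' near] by blast
  define v where "v i = (if i = p then u1 else if i = q then u2 else u3)" for i
  have v: "v p = u1" "v q = u2" "v r = u3" using dist by (auto simp: v_def)
  obtain c where c: "c \<in> chains Cx 0" "\<And>i g. i \<in> {p, q, r} \<Longrightarrow> g \<in> carrier G \<Longrightarrow> c {vert i g} = v i g"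
    by (rule vertex_chain[of v]) (use v u1 u2 u3 in auto)
  define E where "E = {h \<in> carrier G. e2 h \<noteq> u1 h + u2 h \<or> e3 h \<noteq> u1 h + u3 h}"
  have "bad 1 f (coboundary Cx 0 c) \<subseteq> E \<union> W"
  proof (rule subsetI, rule ccontr)
    fix g assume g: "g \<in> bad 1 f (coboundary Cx 0 c)" "g \<notin> E \<union> W"
    then have gG: "g \<in> carrier G" by (simp add: bad_def)
    have d: "coboundary Cx 0 c {vert p g, vert q g} = u1 g + u2 g"
      "coboundary Cx 0 c {vert p g, vert r g} = u1 g + u3 g"
      "coboundary Cx 0 c {vert q g, vert r g} = u2 g + u3 g"
      using gG by (simp_all add: coboundary_edge[of g] vert_tri c v)
    have eq: "e2 g = u1 g + u2 g" "e3 g = u1 g + u3 g" using g gG by (auto simp: E_def)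
    have eq3: "e2 g + e3 g = e g" using g gG by (intro eW) auto
    have bit: "x + y + (x + z) = y + z" for x y z :: bit by (cases x; cases y; cases z) auto
    have "e g = u2 g + u3 g" using eq3[symmetric] unfolding eq bit .
    with d eq have "f \<sigma> = coboundary Cx 0 c \<sigma>" if "\<sigma> \<subseteq> tri g \<and> int (card \<sigma>) = 1 + 1" for \<sigma>
      using that unfolding edges_tri by (auto simp: e2_def e3_def e_def)
    with g(1) show False by (auto simp: bad_def)
  qed
  then have "card (bad 1 f (coboundary Cx 0 c)) \<le> card (E \<union> W)"
    using fin by (intro card_mono) (auto simp: E_def W_def finite_bad)
  also have "\<dots> \<le> card E + card W" by (rule card_Un_le)
  also have "\<dots> \<le> Suc N * card W" using u unfolding E_def by simp
  finally have "card (bad 1 f (coboundary Cx 0 c)) \<le>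
    Suc N * card (bad (1 + 1) (coboundary Cx 1 f) (zero_chain Cx (1 + 1)))" by (simp add: W_def)
  moreover have "coboundary Cx 0 c \<in> coboundaries Cx 1" using c(1) by (simp add: coboundaries_def)
  ultimately show "\<exists>z\<in>coboundaries Cx 1. card (bad 1 f z) \<le>
    Suc N * card (bad (1 + 1) (coboundary Cx 1 f) (zero_chain Cx (1 + 1)))" by blast
qed simp_all

text \<open>The value at the vertex of type \<open>p\<close> changes rarely under right
  multiplication by a letter, hence by any word of length \<open>n\<close>. A base point chosen by
  averaging then has the same value as most group elements.\<close>

lemma expansion_0:
  assumes ABC: "A \<subseteq> K q" "A \<subseteq> K r" "B \<subseteq> K p" "B \<subseteq> K r" "C \<subseteq> K p" "C \<subseteq> K q"
    and gen: "carrier G \<subseteq> bounded_products G (A \<union> B \<union> C) n"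
  shows "coboundary_expansion_at_least Cx (triangle_pmf Cx) 0 (1 / (3 * real (Suc (2 * n))))"
proof (rule expansionI)
  show "coboundaries Cx 0 \<subseteq> cocycles Cx 0"
    using coboundary_chain[of "- 1"] by (auto simp: coboundaries_def cocycles_def coboundary_coboundary_0)
  fix f assume "f \<in> chains Cx 0"
  define W where "W = bad 1 (coboundary Cx 0 f) (zero_chain Cx 1)"
  define F where "F g = f {vert p g}" for g
  have WG: "{h \<in> carrier G. h \<in> W} = W" by (auto simp: W_def bad_def)
  have W: "f {vert q g} = F g" "f {vert r g} = F g" if g: "g \<in> carrier G" "g \<notin> W" for g
  proof -
    have *: "coboundary Cx 0 f \<sigma> = 0" if "\<sigma> \<subseteq> tri g \<and> int (card \<sigma>) = 1 + 1" for \<sigma>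
    proof -
      have "\<sigma> \<in> faces Cx 1" using that g(1) by (auto simp: faces_iff)
      then have "zero_chain Cx 1 \<sigma> = 0" by (simp add: zero_chain_def)
      then show ?thesis using g that unfolding W_def bad_def by auto
    qed
    have bit: "y = x" if "x + y = 0" for x y :: bit using that by (cases x; cases y) auto
    show "f {vert q g} = F g"
    proof -
      have "{vert p g, vert q g} \<subseteq> tri g \<and> int (card {vert p g, vert q g}) = 1 + 1" unfolding edges_tri by simp
      from *[OF this] have "f {vert p g} + f {vert q g} = 0"
        using g(1) by (simp add: coboundary_edge[of g] vert_tri)
      then show ?thesis unfolding F_def by (rule bit)
    qed
    show "f {vert r g} = F g"
    proof -
      have "{vert p g, vert r g} \<subseteq> tri g \<and> int (card {vert p g, vert r g}) = 1 + 1" unfolding edges_tri by simp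
      from *[OF this] have "f {vert p g} + f {vert r g} = 0"
        using g(1) by (simp add: coboundary_edge[of g] vert_tri)
      then show ?thesis unfolding F_def by (rule bit)
    qed
  qed
  have letters: "A \<union> B \<union> C \<subseteq> carrier G" using ABC sub subgroup.subset by blast
  have letter: "card {h \<in> carrier G. F (h \<otimes> s) \<noteq> F h} \<le> 2 * card W" if s: "s \<in> A \<union> B \<union> C" for s
  proof (cases "s \<in> A")
    case False
    then have "{h \<in> carrier G. F (h \<otimes> s) \<noteq> F h} = {}" using s ABC by (auto simp: F_def vert_mult subsetD)
    then show ?thesis by (simp only: card.empty)
  next
    case True
    have sG: "s \<in> carrier G" using s letters by blast
    have "{h \<in> carrier G. F (h \<otimes> s) \<noteq> F h} \<subseteq> {h \<in> carrier G. h \<in> W} \<union> {h \<in> carrier G. h \<otimes> s \<in> W}"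
    proof (rule subsetI, rule ccontr)
      fix h assume h: "h \<in> {h \<in> carrier G. F (h \<otimes> s) \<noteq> F h}"
        "h \<notin> {h \<in> carrier G. h \<in> W} \<union> {h \<in> carrier G. h \<otimes> s \<in> W}"
      \<comment> \<open>A letter from \<open>A\<close> moves the vertex of type \<open>p\<close> but
        fixes the one of type \<open>q\<close>, which off \<open>W\<close> has the same
        value.\<close>
      have "f {vert q (h \<otimes> s)} = f {vert q h}" using True h ABC by (simp add: vert_mult subsetD)
      with h sG W(1) show False by simp
    qed
    then have "card {h \<in> carrier G. F (h \<otimes> s) \<noteq> F h} \<le>
      card ({h \<in> carrier G. h \<in> W} \<union> {h \<in> carrier G. h \<otimes> s \<in> W})"
      using fin by (intro card_mono) auto
    also have "\<dots> \<le> card {h \<in> carrier G. h \<in> W} + card {h \<in> carrier G. h \<otimes> s \<in> W}" by (rule card_Un_le)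
    also have "\<dots> = 2 * card W" by (simp add: card_right_mult[OF sG, of "\<lambda>h. h \<in> W"] WG)
    finally show ?thesis .
  qed
  have word: "card {h \<in> carrier G. F (h \<otimes> g) \<noteq> F h} \<le> 2 * m * card W"
    if "g \<in> bounded_products G (A \<union> B \<union> C) m" for g m
    using that
  proof (induction m arbitrary: g)
    case 0
    then have "{h \<in> carrier G. F (h \<otimes> g) \<noteq> F h} = {}" by auto
    then show ?case by (simp only: card.empty)
  next
    case (Suc m)
    then obtain x s where g: "g = x \<otimes> s" "x \<in> bounded_products G (A \<union> B \<union> C) m" "s \<in> A \<union> B \<union> C"
      by (simp only: bounded_products.simps mem_Collect_eq) blast
    have xs: "x \<in> carrier G" "s \<in> carrier G"
      using g letters bounded_products_closed[OF letters] by blast+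
    have "{h \<in> carrier G. F (h \<otimes> g) \<noteq> F h} \<subseteq>
      {h \<in> carrier G. F (h \<otimes> x) \<noteq> F h} \<union> {h \<in> carrier G. F ((h \<otimes> x) \<otimes> s) \<noteq> F (h \<otimes> x)}"
      using xs by (auto simp: g(1) m_assoc)
    then have "card {h \<in> carrier G. F (h \<otimes> g) \<noteq> F h} \<le>
      card ({h \<in> carrier G. F (h \<otimes> x) \<noteq> F h} \<union> {h \<in> carrier G. F ((h \<otimes> x) \<otimes> s) \<noteq> F (h \<otimes> x)})"
      using fin by (intro card_mono) auto
    also have "\<dots> \<le> card {h \<in> carrier G. F (h \<otimes> x) \<noteq> F h} +
      card {h \<in> carrier G. F ((h \<otimes> x) \<otimes> s) \<noteq> F (h \<otimes> x)}" by (rule card_Un_le)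
    also have "card {h \<in> carrier G. F ((h \<otimes> x) \<otimes> s) \<noteq> F (h \<otimes> x)} = card {h \<in> carrier G. F (h \<otimes> s) \<noteq> F h}"
      using card_right_mult[OF xs(1), of "\<lambda>h. F (h \<otimes> s) \<noteq> F h"] .
    also have "card {h \<in> carrier G. F (h \<otimes> x) \<noteq> F h} + \<dots> \<le> 2 * m * card W + 2 * card W"
      by (intro add_mono Suc.IH g letter)
    finally show ?case by (simp add: algebra_simps)
  qed
  have "carrier G \<noteq> {}" using one_closed by blast
  then have "\<exists>h\<in>carrier G. card {g \<in> carrier G. F (h \<otimes> g) \<noteq> F h} \<le> 2 * n * card W"
    by (intro exists_small_section[where P = "\<lambda>h g. F (h \<otimes> g) \<noteq> F h", OF fin _ fin word order_refl])
       (use gen in auto)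
  then obtain h where h: "h \<in> carrier G" "card {g \<in> carrier G. F (h \<otimes> g) \<noteq> F h} \<le> 2 * n * card W"
    by blast
  \<comment> \<open>The empty set is the only face of dimension -1, so the approximating coboundary
    is the constant with the value at the base point.\<close>
  define c where "c = (\<lambda>\<sigma>\<in>faces Cx (- 1). F h)"
  have "{} \<in> faces Cx (- 1)" using h(1) by (auto simp: faces_iff)
  then have ce: "c {} = F h" by (simp add: c_def)
  define E where "E = {g \<in> carrier G. F g \<noteq> F h}"
  have "E = (\<lambda>g. h \<otimes> g) ` {g \<in> carrier G. F (h \<otimes> g) \<noteq> F h}"
  proof (intro equalityI subsetI)
    fix g assume "g \<in> E"
    then show "g \<in> (\<lambda>g. h \<otimes> g) ` {g \<in> carrier G. F (h \<otimes> g) \<noteq> F h}"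
      using h(1) by (intro image_eqI[of _ _ "inv h \<otimes> g"]) (simp_all add: E_def m_assoc[symmetric])
  qed (use h(1) in \<open>auto simp: E_def\<close>)
  then have "card E \<le> card {g \<in> carrier G. F (h \<otimes> g) \<noteq> F h}" using fin by (simp add: card_image_le)
  with h(2) have E: "card E \<le> 2 * n * card W" by simp
  have "bad 0 f (coboundary Cx (- 1) c) \<subseteq> E \<union> W"
  proof (rule subsetI, rule ccontr)
    fix g assume g: "g \<in> bad 0 f (coboundary Cx (- 1) c)" "g \<notin> E \<union> W"
    then have gG: "g \<in> carrier G" by (simp add: bad_def)
    have "f \<sigma> = coboundary Cx (- 1) c \<sigma>" if "\<sigma> \<subseteq> tri g \<and> int (card \<sigma>) = 0 + 1" for \<sigma>
      using that g(2) gG W unfolding vertices_tri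
      by (auto simp: coboundary_vertex[of g] vert_tri ce E_def F_def)
    with g(1) show False by (auto simp: bad_def)
  qed
  then have "card (bad 0 f (coboundary Cx (- 1) c)) \<le> card (E \<union> W)"
    using fin by (intro card_mono) (auto simp: E_def W_def finite_bad)
  also have "\<dots> \<le> card E + card W" by (rule card_Un_le)
  also have "\<dots> \<le> Suc (2 * n) * card W" using E by simp
  finally have "card (bad 0 f (coboundary Cx (- 1) c)) \<le>
    Suc (2 * n) * card (bad (0 + 1) (coboundary Cx 0 f) (zero_chain Cx (0 + 1)))" by (simp add: W_def)
  moreover have "coboundary Cx (- 1) c \<in> coboundaries Cx 0"
    unfolding coboundaries_def by (rule image_eqI[of _ _ c]) (simp_all add: c_def chains_def)
  ultimately show "\<exists>z\<in>coboundaries Cx 0. card (bad 0 f z) \<le>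
    Suc (2 * n) * card (bad (0 + 1) (coboundary Cx 0 f) (zero_chain Cx (0 + 1)))" by blast
qed simp_all

end

theorem uniform_expansion:
  fixes rel :: "'m monoid \<Rightarrow> 'm set \<Rightarrow> 'm set \<Rightarrow> 'm set \<Rightarrow> bool"
  assumes rel: "rel = lg_rel \<or> rel = sm_rel"
  shows "\<exists>\<delta>>0. \<forall>(G :: 'm monoid) A B C (p :: 'i) q r K. \<forall>j\<in>{0, 1}.
    rel G A B C \<longrightarrow> boundedly_generated n G A B C \<longrightarrow> distinct [p, q, r] \<longrightarrow>
    K p = generate G (B \<union> C) \<longrightarrow> K q = generate G (A \<union> C) \<longrightarrow> K r = generate G (A \<union> B) \<longrightarrow>
    coboundary_expansion_at_least (coset_complex G {p, q, r} K) (triangle_pmf (coset_complex G {p, q, r} K)) j \<delta>"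
proof -
  obtain N where N: "\<forall>(G :: 'm monoid) A B C (e2 :: 'm \<Rightarrow> bit) e3 w.
    rel G A B C \<longrightarrow> boundedly_generated n G A B C \<longrightarrow>
    (\<forall>h\<in>carrier G. \<forall>x\<in>C. e2 (h \<otimes>\<^bsub>G\<^esub> x) = e2 h) \<longrightarrow>
    (\<forall>h\<in>carrier G. \<forall>x\<in>B. e3 (h \<otimes>\<^bsub>G\<^esub> x) = e3 h) \<longrightarrow>
    (\<forall>x\<in>A. card {h \<in> carrier G. e2 (h \<otimes>\<^bsub>G\<^esub> x) + e3 (h \<otimes>\<^bsub>G\<^esub> x) \<noteq> e2 h + e3 h} \<le> 2 * w) \<longrightarrow>
    (\<exists>u1 u2 u3 :: 'm \<Rightarrow> bit.
      (\<forall>h\<in>carrier G. \<forall>k\<in>generate G (B \<union> C). u1 (h \<otimes>\<^bsub>G\<^esub> k) = u1 h) \<and>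
      (\<forall>h\<in>carrier G. \<forall>k\<in>generate G (A \<union> C). u2 (h \<otimes>\<^bsub>G\<^esub> k) = u2 h) \<and>
      (\<forall>h\<in>carrier G. \<forall>k\<in>generate G (A \<union> B). u3 (h \<otimes>\<^bsub>G\<^esub> k) = u3 h) \<and>
      card {h \<in> carrier G. e2 h \<noteq> u1 h + u2 h \<or> e3 h \<noteq> u1 h + u3 h} \<le> N * w)"
    using uniform_potentials[OF rel, of n] by (rule exE)
  define \<delta> where "\<delta> = min (1 / (3 * real (Suc N))) (1 / (3 * real (Suc (2 * n))))"
  show ?thesis
  proof (intro exI[of _ \<delta>] conjI allI ballI impI)
    show "\<delta> > 0" by (simp add: \<delta>_def)
    fix G :: "'m monoid" and A B C and p q r :: 'i and K and j :: int
    assume j: "j \<in> {0, 1}" and G: "rel G A B C" "boundedly_generated n G A B C" and d: "distinct [p, q, r]"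
      and K: "K p = generate G (B \<union> C)" "K q = generate G (A \<union> C)" "K r = generate G (A \<union> B)"
    have c: "common_rel G A B C" using G(1) rel lg_relD(1) sm_relD(1) by metis
    then have grp: "Group.group G" and fin: "finite (carrier G)"
      and sub: "A \<subseteq> carrier G" "B \<subseteq> carrier G" "C \<subseteq> carrier G"
      unfolding common_rel_def using subgroup.subset by blast+
    interpret coset_triangles G K p q r
    proof (intro coset_triangles.intro coset_triangles_axioms.intro grp fin d)
      show "subgroup (K p) G" "subgroup (K q) G" "subgroup (K r) G"
        unfolding K using sub by (auto intro!: group.generate_is_subgroup[OF grp])
    qed
    have ABC: "A \<subseteq> K q" "A \<subseteq> K r" "B \<subseteq> K p" "B \<subseteq> K r" "C \<subseteq> K p" "C \<subseteq> K q"
      unfolding K by (auto intro: generate.incl)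
    show "coboundary_expansion_at_least (coset_complex G {p, q, r} K) (triangle_pmf (coset_complex G {p, q, r} K)) j \<delta>"
    proof (cases "j = 0")
      case True
      have "coboundary_expansion_at_least Cx (triangle_pmf Cx) 0 (1 / (3 * real (Suc (2 * n))))"
        using G(2) by (intro expansion_0[OF ABC]) (simp add: boundedly_generated_def)
      then show ?thesis unfolding True Cx_def[symmetric]
        by (rule coboundary_expansion_mono) (simp add: \<delta>_def)
    next
      case False
      have "coboundary_expansion_at_least Cx (triangle_pmf Cx) 1 (1 / (3 * real (Suc N)))"
        by (rule expansion_1[OF ABC], unfold K) (rule N[rule_format, OF G]; blast)
      moreover have "j = 1" using False j by simp
      ultimately show ?thesis unfolding Cx_def[symmetric]
        by (auto intro: coboundary_expansion_mono simp: \<delta>_def)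
    qed
  qed
qed

section \<open>Matrices graded by a weight\<close>

definition mat_ring :: "('a, 'b) ring_scheme \<Rightarrow> 'i set \<Rightarrow> ('i \<times> 'i \<Rightarrow> 'a) ring" where
  "mat_ring R W =
     \<lparr>carrier = carrier (mat_monoid R W), monoid.mult = (\<otimes>\<^bsub>mat_monoid R W\<^esub>), monoid.one = \<one>\<^bsub>mat_monoid R W\<^esub>,
      ring.zero = (\<lambda>_\<in>W \<times> W. \<zero>\<^bsub>R\<^esub>), ring.add = (\<lambda>A B. \<lambda>x\<in>W \<times> W. A x \<oplus>\<^bsub>R\<^esub> B x)\<rparr>"

lemma mat_ring_simps:
  "carrier (mat_ring R W) = W \<times> W \<rightarrow>\<^sub>E carrier R"
  "(\<otimes>\<^bsub>mat_ring R W\<^esub>) = (\<lambda>A B. \<lambda>(i, j)\<in>W \<times> W. \<Oplus>\<^bsub>R\<^esub>k\<in>W. A (i, k) \<otimes>\<^bsub>R\<^esub> B (k, j))"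
  "\<one>\<^bsub>mat_ring R W\<^esub> = (\<lambda>(i, j)\<in>W \<times> W. if i = j then \<one>\<^bsub>R\<^esub> else \<zero>\<^bsub>R\<^esub>)"
  "\<zero>\<^bsub>mat_ring R W\<^esub> = (\<lambda>_\<in>W \<times> W. \<zero>\<^bsub>R\<^esub>)"
  "(\<oplus>\<^bsub>mat_ring R W\<^esub>) = (\<lambda>A B. \<lambda>x\<in>W \<times> W. A x \<oplus>\<^bsub>R\<^esub> B x)"
  by (simp_all add: mat_ring_def mat_monoid_def)

lemma units_of_mat_ring: "units_of (mat_ring R W) = GL R W"
  by (simp add: GL_def units_of_def Units_def mat_ring_def)

lemma (in abelian_monoid) finsum_swap:
  assumes "finite A" "finite B" "\<And>x y. x \<in> A \<Longrightarrow> y \<in> B \<Longrightarrow> f x y \<in> carrier G"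
  shows "(\<Oplus>x\<in>A. \<Oplus>y\<in>B. f x y) = (\<Oplus>y\<in>B. \<Oplus>x\<in>A. f x y)"
  using assms(1,3)
proof (induction A)
  case empty
  then show ?case by simp
next
  case (insert a A)
  have "(\<Oplus>x\<in>insert a A. \<Oplus>y\<in>B. f x y) = (\<Oplus>y\<in>B. f a y) \<oplus> (\<Oplus>y\<in>B. \<Oplus>x\<in>A. f x y)"
    using insert by (simp add: Pi_def)
  also have "\<dots> = (\<Oplus>y\<in>B. f a y \<oplus> (\<Oplus>x\<in>A. f x y))"
    using insert by (subst finsum_addf) (auto simp: Pi_def)
  also have "\<dots> = (\<Oplus>y\<in>B. \<Oplus>x\<in>insert a A. f x y)"
    using insert by (intro finsum_cong') (auto simp: Pi_def)
  finally show ?case .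
qed

locale mat_algebra = cring R for R :: "('a, 'b) ring_scheme" (structure) +
  fixes W :: "'i set"
  assumes finW: "finite W"
begin

abbreviation M :: "('i \<times> 'i \<Rightarrow> 'a) ring" where "M \<equiv> mat_ring R W"

lemma mat_closed: "N \<in> carrier M \<Longrightarrow> i \<in> W \<Longrightarrow> j \<in> W \<Longrightarrow> N (i, j) \<in> carrier R"
  by (auto simp: mat_ring_simps)

lemma mat_eqI:
  assumes "N \<in> carrier M" "N' \<in> carrier M" "\<And>i j. i \<in> W \<Longrightarrow> j \<in> W \<Longrightarrow> N (i, j) = N' (i, j)"
  shows "N = N'"
  using assms by (intro PiE_ext[of N "W \<times> W" "\<lambda>_. carrier R" N']) (auto simp: mat_ring_simps)

lemma mat_entry:
  "i \<in> W \<Longrightarrow> j \<in> W \<Longrightarrow> (N \<otimes>\<^bsub>M\<^esub> N') (i, j) = (\<Oplus>k\<in>W. N (i, k) \<otimes> N' (k, j))"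
  "i \<in> W \<Longrightarrow> j \<in> W \<Longrightarrow> (N \<oplus>\<^bsub>M\<^esub> N') (i, j) = N (i, j) \<oplus> N' (i, j)"
  "i \<in> W \<Longrightarrow> j \<in> W \<Longrightarrow> \<one>\<^bsub>M\<^esub> (i, j) = (if i = j then \<one> else \<zero>)"
  "i \<in> W \<Longrightarrow> j \<in> W \<Longrightarrow> \<zero>\<^bsub>M\<^esub> (i, j) = \<zero>"
  by (simp_all add: mat_ring_simps)

lemma mat_closed':
  "N \<in> carrier M \<Longrightarrow> N' \<in> carrier M \<Longrightarrow> N \<otimes>\<^bsub>M\<^esub> N' \<in> carrier M"
  "N \<in> carrier M \<Longrightarrow> N' \<in> carrier M \<Longrightarrow> N \<oplus>\<^bsub>M\<^esub> N' \<in> carrier M"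
  "\<one>\<^bsub>M\<^esub> \<in> carrier M" "\<zero>\<^bsub>M\<^esub> \<in> carrier M"
  by (auto simp: mat_ring_simps intro!: finsum_closed)

lemma mat_ring_ring: "ring M"
proof (rule ringI)
  show "abelian_group M"
  proof (rule abelian_groupI)
    fix x assume x: "x \<in> carrier M"
    let ?y = "\<lambda>p\<in>W \<times> W. \<ominus> x p"
    have y: "?y \<in> carrier M" using x by (auto simp: mat_ring_simps)
    have "?y \<oplus>\<^bsub>M\<^esub> x = \<zero>\<^bsub>M\<^esub>"
      using x y by (intro mat_eqI mat_closed') (simp_all add: mat_entry mat_closed l_neg)
    with y show "\<exists>y\<in>carrier M. y \<oplus>\<^bsub>M\<^esub> x = \<zero>\<^bsub>M\<^esub>" by blast
  qed (auto intro!: mat_eqI mat_closed' simp: mat_entry mat_closed a_ac)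
  have one: "(\<Oplus>k\<in>W. (if i = k then \<one> else \<zero>) \<otimes> f k) = f i" if "i \<in> W" "f \<in> W \<rightarrow> carrier R" for f i
  proof -
    have "(\<Oplus>k\<in>W. (if i = k then \<one> else \<zero>) \<otimes> f k) = (\<Oplus>k\<in>W. if i = k then f k else \<zero>)"
      using that by (intro finsum_cong') (auto simp: Pi_def)
    also have "\<dots> = f i" using that finW by (intro finsum_singleton) auto
    finally show ?thesis .
  qed
  show "Group.monoid M"
  proof (rule monoidI)
    fix x y z assume xyz: "x \<in> carrier M" "y \<in> carrier M" "z \<in> carrier M"
    show "(x \<otimes>\<^bsub>M\<^esub> y) \<otimes>\<^bsub>M\<^esub> z = x \<otimes>\<^bsub>M\<^esub> (y \<otimes>\<^bsub>M\<^esub> z)"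
    proof (intro mat_eqI mat_closed' xyz)
      fix i j assume ij: "i \<in> W" "j \<in> W"
      have "((x \<otimes>\<^bsub>M\<^esub> y) \<otimes>\<^bsub>M\<^esub> z) (i, j) = (\<Oplus>k\<in>W. (\<Oplus>l\<in>W. x (i, l) \<otimes> y (l, k)) \<otimes> z (k, j))"
        using ij xyz by (simp add: mat_entry cong: finsum_cong)
          (intro finsum_cong', auto intro!: finsum_closed simp: mat_closed mat_entry)
      also have "\<dots> = (\<Oplus>k\<in>W. \<Oplus>l\<in>W. x (i, l) \<otimes> y (l, k) \<otimes> z (k, j))"
        using ij xyz finW by (intro finsum_cong') (auto intro!: finsum_closed finsum_ldistr simp: mat_closed)
      also have "\<dots> = (\<Oplus>l\<in>W. \<Oplus>k\<in>W. x (i, l) \<otimes> y (l, k) \<otimes> z (k, j))"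
        using ij xyz finW by (intro finsum_swap) (auto simp: mat_closed)
      also have "\<dots> = (\<Oplus>l\<in>W. x (i, l) \<otimes> (\<Oplus>k\<in>W. y (l, k) \<otimes> z (k, j)))"
        using ij xyz finW
        by (intro finsum_cong') (auto intro!: finsum_closed simp: mat_closed finsum_rdistr m_assoc Pi_def cong: finsum_cong)
      also have "\<dots> = (x \<otimes>\<^bsub>M\<^esub> (y \<otimes>\<^bsub>M\<^esub> z)) (i, j)"
        using ij xyz by (simp add: mat_entry)
          (intro finsum_cong', auto intro!: finsum_closed simp: mat_closed mat_entry)
      finally show "((x \<otimes>\<^bsub>M\<^esub> y) \<otimes>\<^bsub>M\<^esub> z) (i, j) = (x \<otimes>\<^bsub>M\<^esub> (y \<otimes>\<^bsub>M\<^esub> z)) (i, j)" .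
    qed
  next
    fix x assume x: "x \<in> carrier M"
    show "\<one>\<^bsub>M\<^esub> \<otimes>\<^bsub>M\<^esub> x = x"
    proof (intro mat_eqI mat_closed' x)
      fix i j assume ij: "i \<in> W" "j \<in> W"
      have "(\<one>\<^bsub>M\<^esub> \<otimes>\<^bsub>M\<^esub> x) (i, j) = (\<Oplus>k\<in>W. (if i = k then \<one> else \<zero>) \<otimes> x (k, j))"
        using ij x by (simp add: mat_entry) (intro finsum_cong', auto simp: mat_closed mat_entry)
      also have "\<dots> = x (i, j)" using ij x by (intro one) (auto simp: mat_closed)
      finally show "(\<one>\<^bsub>M\<^esub> \<otimes>\<^bsub>M\<^esub> x) (i, j) = x (i, j)" .
    qed
    show "x \<otimes>\<^bsub>M\<^esub> \<one>\<^bsub>M\<^esub> = x"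
    proof (intro mat_eqI mat_closed' x)
      fix i j assume ij: "i \<in> W" "j \<in> W"
      have "(x \<otimes>\<^bsub>M\<^esub> \<one>\<^bsub>M\<^esub>) (i, j) = (\<Oplus>k\<in>W. (if j = k then \<one> else \<zero>) \<otimes> x (i, k))"
        using ij x by (simp add: mat_entry) (intro finsum_cong', auto simp: mat_closed mat_entry)
      also have "\<dots> = x (i, j)" using ij x by (intro one) (auto simp: mat_closed)
      finally show "(x \<otimes>\<^bsub>M\<^esub> \<one>\<^bsub>M\<^esub>) (i, j) = x (i, j)" .
    qed
  qed (auto intro: mat_closed')
  fix x y z assume xyz: "x \<in> carrier M" "y \<in> carrier M" "z \<in> carrier M"
  show "(x \<oplus>\<^bsub>M\<^esub> y) \<otimes>\<^bsub>M\<^esub> z = (x \<otimes>\<^bsub>M\<^esub> z) \<oplus>\<^bsub>M\<^esub> (y \<otimes>\<^bsub>M\<^esub> z)"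
  proof (intro mat_eqI mat_closed' xyz)
    fix i j assume ij: "i \<in> W" "j \<in> W"
    have "((x \<oplus>\<^bsub>M\<^esub> y) \<otimes>\<^bsub>M\<^esub> z) (i, j) = (\<Oplus>k\<in>W. x (i, k) \<otimes> z (k, j) \<oplus> y (i, k) \<otimes> z (k, j))"
      using ij xyz by (simp add: mat_entry) (intro finsum_cong', auto simp: mat_closed mat_entry l_distr)
    also have "\<dots> = ((x \<otimes>\<^bsub>M\<^esub> z) \<oplus>\<^bsub>M\<^esub> (y \<otimes>\<^bsub>M\<^esub> z)) (i, j)"
      using ij xyz by (simp add: mat_entry) (subst finsum_addf, auto simp: mat_closed)
    finally show "((x \<oplus>\<^bsub>M\<^esub> y) \<otimes>\<^bsub>M\<^esub> z) (i, j) = ((x \<otimes>\<^bsub>M\<^esub> z) \<oplus>\<^bsub>M\<^esub> (y \<otimes>\<^bsub>M\<^esub> z)) (i, j)" .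
  qed
  show "z \<otimes>\<^bsub>M\<^esub> (x \<oplus>\<^bsub>M\<^esub> y) = (z \<otimes>\<^bsub>M\<^esub> x) \<oplus>\<^bsub>M\<^esub> (z \<otimes>\<^bsub>M\<^esub> y)"
  proof (intro mat_eqI mat_closed' xyz)
    fix i j assume ij: "i \<in> W" "j \<in> W"
    have "(z \<otimes>\<^bsub>M\<^esub> (x \<oplus>\<^bsub>M\<^esub> y)) (i, j) = (\<Oplus>k\<in>W. z (i, k) \<otimes> x (k, j) \<oplus> z (i, k) \<otimes> y (k, j))"
      using ij xyz by (simp add: mat_entry) (intro finsum_cong', auto simp: mat_closed mat_entry r_distr)
    also have "\<dots> = ((z \<otimes>\<^bsub>M\<^esub> x) \<oplus>\<^bsub>M\<^esub> (z \<otimes>\<^bsub>M\<^esub> y)) (i, j)"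
      using ij xyz by (simp add: mat_entry) (subst finsum_addf, auto simp: mat_closed)
    finally show "(z \<otimes>\<^bsub>M\<^esub> (x \<oplus>\<^bsub>M\<^esub> y)) (i, j) = ((z \<otimes>\<^bsub>M\<^esub> x) \<oplus>\<^bsub>M\<^esub> (z \<otimes>\<^bsub>M\<^esub> y)) (i, j)" .
  qed
qed

sublocale M: ring M by (rule mat_ring_ring)

lemma mat_minus_entry:
  assumes "N \<in> carrier M" "i \<in> W" "j \<in> W"
  shows "(\<ominus>\<^bsub>M\<^esub> N) (i, j) = \<ominus> N (i, j)"
proof -
  have "(\<ominus>\<^bsub>M\<^esub> N \<oplus>\<^bsub>M\<^esub> N) (i, j) = \<zero>" using assms by (simp add: M.l_neg mat_entry(4))
  then show ?thesis using assms by (simp add: mat_entry mat_closed minus_equality)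
qed

text \<open>
  The matrices in \<open>Fl \<phi> k\<close> raise the functional \<open>\<phi>\<close> by at least \<open>k\<close>. If \<open>\<phi>\<close> is \<open>\<plusminus>1\<close> on the indices, then
  \<open>Fl \<phi> 3\<close> is trivial, so the elements \<open>1 + N\<close> with \<open>N \<in> Fl \<phi> 2\<close> form an abelian group.
\<close>

definition Fl :: "('i \<Rightarrow> int) \<Rightarrow> int \<Rightarrow> ('i \<times> 'i \<Rightarrow> 'a) set" where
  "Fl \<phi> k = {N \<in> carrier M. \<forall>i\<in>W. \<forall>j\<in>W. N (i, j) \<noteq> \<zero> \<longrightarrow> \<phi> j + k \<le> \<phi> i}"

lemma Fl_carrier: "N \<in> Fl \<phi> k \<Longrightarrow> N \<in> carrier M"
  by (simp add: Fl_def)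

lemma Fl_mono: "N \<in> Fl \<phi> k \<Longrightarrow> l \<le> k \<Longrightarrow> N \<in> Fl \<phi> l"
  by (fastforce simp: Fl_def)

lemma Fl_add: "N \<in> Fl \<phi> k \<Longrightarrow> N' \<in> Fl \<phi> k \<Longrightarrow> N \<oplus>\<^bsub>M\<^esub> N' \<in> Fl \<phi> k"
  unfolding Fl_def by (auto simp: mat_entry) (metis zero_closed l_zero)

lemma Fl_minus: "N \<in> Fl \<phi> k \<Longrightarrow> \<ominus>\<^bsub>M\<^esub> N \<in> Fl \<phi> k"
  unfolding Fl_def by (auto simp: mat_minus_entry) (metis local.minus_zero)

lemma Fl_mult:
  assumes "N \<in> Fl \<phi> k" "N' \<in> Fl \<phi> l"
  shows "N \<otimes>\<^bsub>M\<^esub> N' \<in> Fl \<phi> (k + l)"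
  unfolding Fl_def
proof (intro CollectI conjI ballI impI)
  show "N \<otimes>\<^bsub>M\<^esub> N' \<in> carrier M" using assms by (simp add: Fl_def)
  fix i j assume ij: "i \<in> W" "j \<in> W" and nz: "(N \<otimes>\<^bsub>M\<^esub> N') (i, j) \<noteq> \<zero>"
  have "\<exists>m\<in>W. N (i, m) \<otimes> N' (m, j) \<noteq> \<zero>"
  proof (rule ccontr)
    assume "\<not> ?thesis"
    then have "(N \<otimes>\<^bsub>M\<^esub> N') (i, j) = (\<Oplus>m\<in>W. \<zero>)"
      using ij by (subst mat_entry(1)[OF ij]) (intro finsum_cong', auto)
    with nz show False by simp
  qed
  then obtain m where m: "m \<in> W" "N (i, m) \<otimes> N' (m, j) \<noteq> \<zero>" by blast
  then have "N (i, m) \<noteq> \<zero>" "N' (m, j) \<noteq> \<zero>"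
    using assms ij by (auto simp: Fl_def mat_closed)
  with m ij assms have "\<phi> m + k \<le> \<phi> i" "\<phi> j + l \<le> \<phi> m" by (auto simp: Fl_def)
  then show "\<phi> j + (k + l) \<le> \<phi> i" by simp
qed

lemma Fl_one: "\<one>\<^bsub>M\<^esub> \<in> Fl \<phi> 0"
  by (simp add: Fl_def mat_entry)

lemma Fl_eq_zero:
  assumes "\<And>i. i \<in> W \<Longrightarrow> \<phi> i \<in> {-1, 1}" "k > 2" "N \<in> Fl \<phi> k"
  shows "N = \<zero>\<^bsub>M\<^esub>"
proof (intro mat_eqI mat_closed' Fl_carrier[OF assms(3)])
  fix i j assume ij: "i \<in> W" "j \<in> W"
  have "\<not> \<phi> j + k \<le> \<phi> i" using assms(1)[OF ij(1)] assms(1)[OF ij(2)] assms(2) by auto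
  then show "N (i, j) = \<zero>\<^bsub>M\<^esub> (i, j)" using assms(3) ij by (auto simp: Fl_def mat_entry(4))
qed

section \<open>Block triangular groups and their abelian unipotent radicals\<close>

abbreviation GM :: "('i \<times> 'i \<Rightarrow> 'a) monoid" where "GM \<equiv> units_of M"

sublocale GM: group GM by (rule M.units_group)

lemmas GM_simps = units_of_carrier units_of_mult units_of_one

definition sign_weight :: "('i \<Rightarrow> int) \<Rightarrow> bool" where
  "sign_weight \<phi> \<longleftrightarrow> (\<forall>i\<in>W. \<phi> i \<in> {-1, 1})"

lemma Fl_zero: "sign_weight \<phi> \<Longrightarrow> k > 2 \<Longrightarrow> N \<in> Fl \<phi> k \<Longrightarrow> N = \<zero>\<^bsub>M\<^esub>"
  using Fl_eq_zero[of \<phi> k N] by (simp add: sign_weight_def)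

lemma Fl_mult_zero: "sign_weight \<phi> \<Longrightarrow> N \<in> Fl \<phi> 2 \<Longrightarrow> N' \<in> Fl \<phi> 2 \<Longrightarrow> N \<otimes>\<^bsub>M\<^esub> N' = \<zero>\<^bsub>M\<^esub>"
  using Fl_zero[of \<phi> "2 + 2" "N \<otimes>\<^bsub>M\<^esub> N'"] Fl_mult[of N \<phi> 2 N' 2] by simp

definition unip :: "('i \<times> 'i \<Rightarrow> 'a) \<Rightarrow> 'i \<times> 'i \<Rightarrow> 'a" where
  "unip N = \<one>\<^bsub>M\<^esub> \<oplus>\<^bsub>M\<^esub> N"

text \<open>The block triangular group of the functional; \<open>Ug\<close> is its unipotent
  radical, abelian for a functional with values \<plusminus>1.\<close>

definition Dg :: "('i \<Rightarrow> int) \<Rightarrow> ('i \<times> 'i \<Rightarrow> 'a) set" where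
  "Dg \<phi> = {x \<in> carrier GM. x \<in> Fl \<phi> 0 \<and> inv\<^bsub>GM\<^esub> x \<in> Fl \<phi> 0}"

definition Ug :: "('i \<Rightarrow> int) \<Rightarrow> ('i \<times> 'i \<Rightarrow> 'a) set" where
  "Ug \<phi> = unip ` Fl \<phi> 2"

lemma unip_mult:
  assumes "N \<in> carrier M" "N' \<in> carrier M" "N \<otimes>\<^bsub>M\<^esub> N' = \<zero>\<^bsub>M\<^esub>"
  shows "unip N \<otimes>\<^bsub>M\<^esub> unip N' = unip (N \<oplus>\<^bsub>M\<^esub> N')"
  using assms by (simp add: unip_def M.l_distr M.r_distr M.a_ac)

lemma unip_zero: "unip \<zero>\<^bsub>M\<^esub> = \<one>\<^bsub>M\<^esub>"
  by (simp add: unip_def)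

lemma unip_closed: "N \<in> carrier M \<Longrightarrow> unip N \<in> carrier M"
  by (simp add: unip_def)

lemma unip_units:
  assumes N: "N \<in> carrier M" "N \<otimes>\<^bsub>M\<^esub> N = \<zero>\<^bsub>M\<^esub>"
  shows "unip N \<in> carrier GM" "inv\<^bsub>GM\<^esub> (unip N) = unip (\<ominus>\<^bsub>M\<^esub> N)"
proof -
  have 1: "unip N \<otimes>\<^bsub>M\<^esub> unip (\<ominus>\<^bsub>M\<^esub> N) = \<one>\<^bsub>M\<^esub>" "unip (\<ominus>\<^bsub>M\<^esub> N) \<otimes>\<^bsub>M\<^esub> unip N = \<one>\<^bsub>M\<^esub>"
    using N by (simp_all add: unip_mult M.r_minus M.l_minus M.r_neg M.l_neg unip_zero)
  then have "unip N \<in> Units M" "unip (\<ominus>\<^bsub>M\<^esub> N) \<in> Units M"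
    using N unip_closed unfolding Units_def by auto
  then show "unip N \<in> carrier GM" "inv\<^bsub>GM\<^esub> (unip N) = unip (\<ominus>\<^bsub>M\<^esub> N)"
    using 1 by (auto simp: GM_simps intro!: GM.inv_equality)
qed

lemma unip_Fl: "N \<in> Fl \<phi> k \<Longrightarrow> 0 \<le> k \<Longrightarrow> unip N \<in> Fl \<phi> 0"
  unfolding unip_def by (intro Fl_add Fl_one) (rule Fl_mono)

lemma Ug_Dg:
  assumes "sign_weight \<phi>" "x \<in> Ug \<phi>"
  shows "x \<in> Dg \<phi>"
proof -
  obtain N where N: "x = unip N" "N \<in> Fl \<phi> 2" using assms(2) by (auto simp: Ug_def)
  note u = unip_units[OF Fl_carrier[OF N(2)] Fl_mult_zero[OF assms(1) N(2) N(2)]]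
  show ?thesis
    using u N unip_Fl[OF N(2)] unip_Fl[OF Fl_minus[OF N(2)]] by (simp add: Dg_def)
qed

lemma Dg_subgroup: "subgroup (Dg \<phi>) GM"
proof (rule GM.subgroupI)
  show "Dg \<phi> \<noteq> {}" using Fl_one GM.one_closed GM.inv_one by (auto simp: Dg_def units_of_one intro!: exI[of _ "\<one>\<^bsub>M\<^esub>"])
  fix a assume a: "a \<in> Dg \<phi>"
  then show "inv\<^bsub>GM\<^esub> a \<in> Dg \<phi>" by (simp add: Dg_def)
  fix b assume b: "b \<in> Dg \<phi>"
  have "a \<otimes>\<^bsub>M\<^esub> b \<in> Fl \<phi> 0" "inv\<^bsub>GM\<^esub> b \<otimes>\<^bsub>M\<^esub> inv\<^bsub>GM\<^esub> a \<in> Fl \<phi> 0"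
    using a b Fl_mult[of _ \<phi> 0 _ 0] by (auto simp: Dg_def)
  then show "a \<otimes>\<^bsub>GM\<^esub> b \<in> Dg \<phi>"
    using a b GM.m_closed[of a b] GM.inv_mult_group[of a b] by (simp add: Dg_def units_of_mult)
qed (auto simp: Dg_def)

lemma Dg_carrier: "x \<in> Dg \<phi> \<Longrightarrow> x \<in> carrier GM"
  by (simp add: Dg_def)

lemma gconj_unip:
  assumes "N \<in> carrier M" "N \<otimes>\<^bsub>M\<^esub> N = \<zero>\<^bsub>M\<^esub>" "y \<in> carrier GM"
  shows "gconj GM (unip N) y = unip (inv\<^bsub>GM\<^esub> y \<otimes>\<^bsub>M\<^esub> N \<otimes>\<^bsub>M\<^esub> y)"
proof -
  have y: "y \<in> carrier M" "inv\<^bsub>GM\<^esub> y \<in> carrier M"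
    using assms(3) GM.inv_closed[of y] by (auto simp: GM_simps)
  have "inv\<^bsub>GM\<^esub> y \<otimes>\<^bsub>M\<^esub> y = \<one>\<^bsub>M\<^esub>" using GM.l_inv[OF assms(3)] by (simp add: GM_simps)
  then show ?thesis using assms(1) y
    by (simp add: gconj_def units_of_mult unip_def M.r_distr M.l_distr)
qed

lemma gconj_Ug:
  assumes \<phi>: "sign_weight \<phi>" and x: "x \<in> Ug \<phi>" and y: "y \<in> Dg \<phi>"
  shows "gconj GM x y \<in> Ug \<phi>"
proof -
  obtain N where N: "x = unip N" "N \<in> Fl \<phi> 2" using x by (auto simp: Ug_def)
  have "inv\<^bsub>GM\<^esub> y \<otimes>\<^bsub>M\<^esub> N \<otimes>\<^bsub>M\<^esub> y \<in> Fl \<phi> (0 + 2 + 0)"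
    using y N(2) by (intro Fl_mult) (auto simp: Dg_def)
  then show ?thesis
    unfolding N(1) using Fl_mult_zero[OF \<phi> N(2) N(2)]
    by (subst gconj_unip) (auto simp: Ug_def Fl_carrier[OF N(2)] Dg_carrier[OF y])
qed

lemma Ug_mult:
  assumes \<phi>: "sign_weight \<phi>" and x: "x \<in> Ug \<phi>" "y \<in> Ug \<phi>"
  shows "x \<otimes>\<^bsub>GM\<^esub> y \<in> Ug \<phi>"
proof -
  obtain N N' where N: "x = unip N" "N \<in> Fl \<phi> 2" "y = unip N'" "N' \<in> Fl \<phi> 2" using x by (auto simp: Ug_def)
  then show ?thesis
    using Fl_mult_zero[OF \<phi>] Fl_add by (auto simp: Ug_def units_of_mult unip_mult Fl_carrier)
qed

lemma Ug_inv:
  assumes \<phi>: "sign_weight \<phi>" and x: "x \<in> Ug \<phi>"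
  shows "inv\<^bsub>GM\<^esub> x \<in> Ug \<phi>"
proof -
  obtain N where N: "x = unip N" "N \<in> Fl \<phi> 2" using x by (auto simp: Ug_def)
  then show ?thesis
    using unip_units(2)[OF Fl_carrier[OF N(2)] Fl_mult_zero[OF \<phi> N(2) N(2)]] Fl_minus by (auto simp: Ug_def)
qed

lemma Ug_gcomm:
  assumes \<phi>: "sign_weight \<phi>" and x: "x \<in> Ug \<phi>" "y \<in> Ug \<phi>"
  shows "gcomm GM x y"
proof -
  obtain N N' where N: "x = unip N" "N \<in> Fl \<phi> 2" "y = unip N'" "N' \<in> Fl \<phi> 2" using x by (auto simp: Ug_def)
  then show ?thesis
    using Fl_mult_zero[OF \<phi>] by (simp add: gcomm_def units_of_mult unip_mult Fl_carrier M.a_comm)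
qed

lemma gcommut_Ug:
  assumes \<phi>: "sign_weight \<phi>"
  shows "x \<in> Ug \<phi> \<Longrightarrow> y \<in> Dg \<phi> \<Longrightarrow> gcommut GM x y \<in> Ug \<phi>"
    and "x \<in> Dg \<phi> \<Longrightarrow> y \<in> Ug \<phi> \<Longrightarrow> gcommut GM x y \<in> Ug \<phi>"
proof -
  show "gcommut GM x y \<in> Ug \<phi>" if x: "x \<in> Ug \<phi>" and y: "y \<in> Dg \<phi>"
  proof -
    have "gcommut GM x y = inv\<^bsub>GM\<^esub> x \<otimes>\<^bsub>GM\<^esub> gconj GM x y"
      using Dg_carrier[OF Ug_Dg[OF \<phi> x]] Dg_carrier[OF y] by (simp add: gcommut_def gconj_def GM.m_assoc)
    then show ?thesis using Ug_mult[OF \<phi> Ug_inv[OF \<phi> x] gconj_Ug[OF \<phi> x y]] by simp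
  qed
  show "gcommut GM x y \<in> Ug \<phi>" if x: "x \<in> Dg \<phi>" and y: "y \<in> Ug \<phi>"
  proof -
    have "gcommut GM x y = gconj GM (inv\<^bsub>GM\<^esub> y) x \<otimes>\<^bsub>GM\<^esub> y"
      using Dg_carrier[OF Ug_Dg[OF \<phi> y]] Dg_carrier[OF x] by (simp add: gcommut_def gconj_def GM.m_assoc)
    then show ?thesis using Ug_mult[OF \<phi> gconj_Ug[OF \<phi> Ug_inv[OF \<phi> y] x] y] by simp
  qed
qed

text \<open>With v = 1 + Q, every term of the difference between \<open>N\<close> and its conjugate
  contains \<open>Q\<close>, so the level for \<open>\<psi>\<close> rises by 2, whereas
  \<open>\<phi>\<close> keeps everything in its abelian radical.\<close>

lemma gcommut_filtration:
  assumes \<phi>: "sign_weight \<phi>" and \<psi>: "sign_weight \<psi>"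
    and N: "N \<in> Fl \<phi> 2" "N \<in> Fl \<psi> k" and v: "v \<in> Dg \<phi>" "v \<in> Ug \<psi>"
  shows "\<exists>N'. N' \<in> Fl \<phi> 2 \<and> N' \<in> Fl \<psi> (k + 2) \<and> gcommut GM (unip N) v = unip N' \<and>
    gconj GM (unip N) v = unip (N \<oplus>\<^bsub>M\<^esub> N')"
proof -
  obtain Q where Q: "v = unip Q" "Q \<in> Fl \<psi> 2" using v(2) by (auto simp: Ug_def)
  have Nc: "N \<in> carrier M" and Qc: "Q \<in> carrier M" using N Q Fl_carrier by blast+
  have NN: "N \<otimes>\<^bsub>M\<^esub> N = \<zero>\<^bsub>M\<^esub>" using Fl_mult_zero[OF \<phi> N(1) N(1)] .
  have QQ: "Q \<otimes>\<^bsub>M\<^esub> Q = \<zero>\<^bsub>M\<^esub>" using Fl_mult_zero[OF \<psi> Q(2) Q(2)] .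
  have vc: "v \<in> carrier GM" using v(1) by (rule Dg_carrier)
  define L where "L = inv\<^bsub>GM\<^esub> v \<otimes>\<^bsub>M\<^esub> N \<otimes>\<^bsub>M\<^esub> v"
  define N' where "N' = (N \<otimes>\<^bsub>M\<^esub> Q \<oplus>\<^bsub>M\<^esub> \<ominus>\<^bsub>M\<^esub> (Q \<otimes>\<^bsub>M\<^esub> N)) \<oplus>\<^bsub>M\<^esub> \<ominus>\<^bsub>M\<^esub> (Q \<otimes>\<^bsub>M\<^esub> N \<otimes>\<^bsub>M\<^esub> Q)"
  have L: "L = N \<oplus>\<^bsub>M\<^esub> N'"
    unfolding L_def N'_def Q(1) unip_units(2)[OF Qc QQ]
    using Nc Qc by (simp add: unip_def M.l_distr M.r_distr M.l_minus M.r_minus M.m_assoc M.a_ac)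
  have Lphi: "L \<in> Fl \<phi> 2" unfolding L_def
    using Fl_mult[OF Fl_mult[of "inv\<^bsub>GM\<^esub> v" \<phi> 0 N 2] , of v 0] v(1) N(1) by (simp add: Dg_def)
  have "N' = \<ominus>\<^bsub>M\<^esub> N \<oplus>\<^bsub>M\<^esub> L" using Nc Qc by (simp add: L N'_def M.r_neg1)
  then have 1: "N' \<in> Fl \<phi> 2" using Fl_add[OF Fl_minus[OF N(1)] Lphi] by simp
  have 2: "N' \<in> Fl \<psi> (k + 2)" unfolding N'_def
  proof (intro Fl_add Fl_minus)
    show "N \<otimes>\<^bsub>M\<^esub> Q \<in> Fl \<psi> (k + 2)" using N(2) Q(2) by (rule Fl_mult)
    show "Q \<otimes>\<^bsub>M\<^esub> N \<in> Fl \<psi> (k + 2)" using Fl_mult[OF Q(2) N(2)] by (simp add: add.commute)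
    have "Q \<otimes>\<^bsub>M\<^esub> N \<otimes>\<^bsub>M\<^esub> Q \<in> Fl \<psi> (2 + k + 2)" by (intro Fl_mult N Q)
    then show "Q \<otimes>\<^bsub>M\<^esub> N \<otimes>\<^bsub>M\<^esub> Q \<in> Fl \<psi> (k + 2)" by (rule Fl_mono) simp
  qed
  have cj: "gconj GM (unip N) v = unip L" unfolding L_def by (rule gconj_unip[OF Nc NN vc])
  have u: "unip N \<in> carrier GM" using unip_units(1)[OF Nc NN] .
  have "gcommut GM (unip N) v = inv\<^bsub>GM\<^esub> (unip N) \<otimes>\<^bsub>GM\<^esub> gconj GM (unip N) v"
    using u vc by (simp add: gcommut_def gconj_def GM.m_assoc)
  also have "\<dots> = unip (\<ominus>\<^bsub>M\<^esub> N) \<otimes>\<^bsub>M\<^esub> unip L"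
    by (simp add: cj unip_units(2)[OF Nc NN] units_of_mult)
  also have "\<dots> = unip (\<ominus>\<^bsub>M\<^esub> N \<oplus>\<^bsub>M\<^esub> L)"
    using Fl_mult_zero[OF \<phi> Fl_minus[OF N(1)] Lphi] Nc Lphi by (intro unip_mult) (auto simp: Fl_carrier)
  finally have "gcommut GM (unip N) v = unip N'" using \<open>N' = \<ominus>\<^bsub>M\<^esub> N \<oplus>\<^bsub>M\<^esub> L\<close> by simp
  with 1 2 cj L show ?thesis by blast
qed

text \<open>The levels for \<open>\<psi>\<close> are -2, 0, 2, 4, and nothing nonzero has a level
  above 2.\<close>

lemma gcommut_triple:
  assumes \<phi>: "sign_weight \<phi>" and \<psi>: "sign_weight \<psi>"
    and N: "N \<in> Fl \<phi> 2" "N \<in> Fl \<psi> (- 2)"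
    and u: "u \<in> Dg \<phi>" "u \<in> Ug \<psi>" and v: "v \<in> Dg \<phi>" "v \<in> Ug \<psi>" and w: "w \<in> Dg \<phi>" "w \<in> Ug \<psi>"
  shows "gcommut GM (gcommut GM (gcommut GM (unip N) u) v) w = \<one>\<^bsub>GM\<^esub>"
proof -
  obtain N1 where N1: "N1 \<in> Fl \<phi> 2" "N1 \<in> Fl \<psi> (- 2 + 2)" "gcommut GM (unip N) u = unip N1"
    using gcommut_filtration[OF \<phi> \<psi> N u] by blast
  obtain N2 where N2: "N2 \<in> Fl \<phi> 2" "N2 \<in> Fl \<psi> (- 2 + 2 + 2)" "gcommut GM (unip N1) v = unip N2"
    using gcommut_filtration[OF \<phi> \<psi> N1(1,2) v] by blast
  obtain N3 where N3: "N3 \<in> Fl \<psi> (- 2 + 2 + 2 + 2)" "gcommut GM (unip N2) w = unip N3"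
    using gcommut_filtration[OF \<phi> \<psi> N2(1,2) w] by blast
  have "N3 = \<zero>\<^bsub>M\<^esub>" using Fl_zero[OF \<psi> _ N3(1)] by simp
  with N1 N2 N3 show ?thesis by (simp add: unip_zero units_of_one)
qed

text \<open>Conjugation by \<open>b\<close> is unipotent with three levels: N goes to N + P, P to P
  + Q, and Q is fixed. So the j-th power takes N to N + j P + (j choose 2) Q. Summing over j = 0,
  ..., 4 gives 5 N + 10 P + 10 Q, which vanishes in characteristic 5.\<close>

lemma conj_product:
  assumes \<phi>: "sign_weight \<phi>" and \<psi>: "sign_weight \<psi>"
    and N: "N \<in> Fl \<phi> 2" "N \<in> Fl \<psi> (- 2)" and b: "b \<in> Dg \<phi>" "b \<in> Ug \<psi>"
    and five: "\<And>L. L \<in> carrier M \<Longrightarrow> L \<oplus>\<^bsub>M\<^esub> (L \<oplus>\<^bsub>M\<^esub> (L \<oplus>\<^bsub>M\<^esub> (L \<oplus>\<^bsub>M\<^esub> L))) = \<zero>\<^bsub>M\<^esub>"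
  shows "unip N \<otimes>\<^bsub>GM\<^esub> (gconj GM (unip N) b \<otimes>\<^bsub>GM\<^esub> gconj GM (unip N) (b [^]\<^bsub>GM\<^esub> (2::nat)) \<otimes>\<^bsub>GM\<^esub>
    gconj GM (unip N) (b [^]\<^bsub>GM\<^esub> (3::nat)) \<otimes>\<^bsub>GM\<^esub> gconj GM (unip N) (b [^]\<^bsub>GM\<^esub> (4::nat))) = \<one>\<^bsub>GM\<^esub>"
proof -
  obtain P where P: "P \<in> Fl \<phi> 2" "P \<in> Fl \<psi> (- 2 + 2)" "gconj GM (unip N) b = unip (N \<oplus>\<^bsub>M\<^esub> P)"
    using gcommut_filtration[OF \<phi> \<psi> N b] by blast
  obtain Q where Q: "Q \<in> Fl \<phi> 2" "Q \<in> Fl \<psi> (- 2 + 2 + 2)" "gconj GM (unip P) b = unip (P \<oplus>\<^bsub>M\<^esub> Q)"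
    using gcommut_filtration[OF \<phi> \<psi> P(1,2) b] by blast
  obtain N3 where N3: "N3 \<in> Fl \<psi> (- 2 + 2 + 2 + 2)" "gconj GM (unip Q) b = unip (Q \<oplus>\<^bsub>M\<^esub> N3)"
    using gcommut_filtration[OF \<phi> \<psi> Q(1,2) b] by blast
  have "N3 = \<zero>\<^bsub>M\<^esub>" using Fl_zero[OF \<psi> _ N3(1)] by simp
  then have Qb: "gconj GM (unip Q) b = unip Q" using N3 Q Fl_carrier by simp
  have bc: "b \<in> carrier GM" using b(1) by (rule Dg_carrier)
  have cl: "N \<in> carrier M" "P \<in> carrier M" "Q \<in> carrier M" using N P Q Fl_carrier by blast+
  have add: "unip (x \<oplus>\<^bsub>M\<^esub> y) = unip x \<otimes>\<^bsub>GM\<^esub> unip y" if "x \<in> Fl \<phi> 2" "y \<in> Fl \<phi> 2" for x y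
    using that Fl_mult_zero[OF \<phi>] by (simp add: units_of_mult unip_mult Fl_carrier)
  have U: "unip x \<in> carrier GM" if "x \<in> Fl \<phi> 2" for x
    using that Dg_carrier Ug_Dg[OF \<phi>] by (auto simp: Ug_def)
  have hom: "gconj GM (x \<otimes>\<^bsub>GM\<^esub> y) b = gconj GM x b \<otimes>\<^bsub>GM\<^esub> gconj GM y b" if "x \<in> carrier GM" "y \<in> carrier GM" for x y
  proof -
    have "gconj GM x b \<otimes>\<^bsub>GM\<^esub> gconj GM y b = inv\<^bsub>GM\<^esub> b \<otimes>\<^bsub>GM\<^esub> x \<otimes>\<^bsub>GM\<^esub> (b \<otimes>\<^bsub>GM\<^esub> inv\<^bsub>GM\<^esub> b) \<otimes>\<^bsub>GM\<^esub> y \<otimes>\<^bsub>GM\<^esub> b"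
      using that bc by (simp add: gconj_def GM.m_assoc del: GM.r_inv)
    then show ?thesis using that bc by (simp add: gconj_def GM.m_assoc)
  qed
  have step: "gconj GM (unip (x \<oplus>\<^bsub>M\<^esub> y)) b = unip (x' \<oplus>\<^bsub>M\<^esub> y')"
    if "x \<in> Fl \<phi> 2" "y \<in> Fl \<phi> 2" "x' \<in> Fl \<phi> 2" "y' \<in> Fl \<phi> 2"
      "gconj GM (unip x) b = unip x'" "gconj GM (unip y) b = unip y'" for x y x' y'
    using that by (simp add: add hom U)
  have pow: "gconj GM x (b [^]\<^bsub>GM\<^esub> Suc n) = gconj GM (gconj GM x (b [^]\<^bsub>GM\<^esub> n)) b" if "x \<in> carrier GM" for x and n :: nat
    using that bc by (simp add: gconj_def GM.inv_mult_group GM.m_assoc)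
  define N1 where "N1 = N \<oplus>\<^bsub>M\<^esub> P"
  define P1 where "P1 = P \<oplus>\<^bsub>M\<^esub> Q"
  define P2 where "P2 = P1 \<oplus>\<^bsub>M\<^esub> Q"
  define P3 where "P3 = P2 \<oplus>\<^bsub>M\<^esub> Q"
  define N2 where "N2 = N1 \<oplus>\<^bsub>M\<^esub> P1"
  define N3 where "N3 = N2 \<oplus>\<^bsub>M\<^esub> P2"
  define N4 where "N4 = N3 \<oplus>\<^bsub>M\<^esub> P3"
  note defs = N1_def P1_def P2_def P3_def N2_def N3_def N4_def
  have F: "N1 \<in> Fl \<phi> 2" "N2 \<in> Fl \<phi> 2" "N3 \<in> Fl \<phi> 2" "N4 \<in> Fl \<phi> 2"
      "P1 \<in> Fl \<phi> 2" "P2 \<in> Fl \<phi> 2" "P3 \<in> Fl \<phi> 2"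
    unfolding defs using N(1) P(1) Q(1) by (simp_all add: Fl_add)
  have p: "gconj GM (unip N) b = unip N1" "gconj GM (unip P) b = unip P1"
    using P(3) Q(3) by (simp_all add: N1_def P1_def)
  have p1: "gconj GM (unip P1) b = unip P2"
    unfolding P2_def P1_def using F P Q p Qb by (intro step) (auto simp: P1_def)
  have p2: "gconj GM (unip P2) b = unip P3"
    unfolding P2_def P3_def using F P Q p p1 Qb by (intro step) (auto simp: P2_def)
  have n1: "gconj GM (unip N1) b = unip N2"
    unfolding N1_def N2_def using F P N p by (intro step) (auto simp: N1_def)
  have n2: "gconj GM (unip N2) b = unip N3"
    unfolding N2_def N3_def using F n1 p1 by (intro step) (auto simp: N2_def)
  have n3: "gconj GM (unip N3) b = unip N4"
    unfolding N3_def N4_def using F n2 p2 by (intro step) (auto simp: N3_def)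
  have b2: "gconj GM (unip N) (b [^]\<^bsub>GM\<^esub> (2::nat)) = unip N2"
    using pow[OF U[OF N(1)], of 1] bc by (simp add: numeral_2_eq_2 p n1)
  have b3: "gconj GM (unip N) (b [^]\<^bsub>GM\<^esub> (3::nat)) = unip N3"
    using pow[OF U[OF N(1)], of 2] b2 n2 by (simp add: numeral_3_eq_3 numeral_2_eq_2 del: GM.nat_pow_Suc)
  have b4: "gconj GM (unip N) (b [^]\<^bsub>GM\<^esub> (4::nat)) = unip N4"
    using pow[OF U[OF N(1)], of 3] b3 n3 by (simp add: eval_nat_numeral del: GM.nat_pow_Suc)
  have "unip N \<otimes>\<^bsub>GM\<^esub> (unip N1 \<otimes>\<^bsub>GM\<^esub> unip N2 \<otimes>\<^bsub>GM\<^esub> unip N3 \<otimes>\<^bsub>GM\<^esub> unip N4) =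
      unip (N \<oplus>\<^bsub>M\<^esub> (N1 \<oplus>\<^bsub>M\<^esub> N2 \<oplus>\<^bsub>M\<^esub> N3 \<oplus>\<^bsub>M\<^esub> N4))"
    using N(1) F by (simp add: add Fl_add)
  also have "N \<oplus>\<^bsub>M\<^esub> (N1 \<oplus>\<^bsub>M\<^esub> N2 \<oplus>\<^bsub>M\<^esub> N3 \<oplus>\<^bsub>M\<^esub> N4) =
      (N \<oplus>\<^bsub>M\<^esub> (N \<oplus>\<^bsub>M\<^esub> (N \<oplus>\<^bsub>M\<^esub> (N \<oplus>\<^bsub>M\<^esub> N)))) \<oplus>\<^bsub>M\<^esub>
      ((P \<oplus>\<^bsub>M\<^esub> (P \<oplus>\<^bsub>M\<^esub> (P \<oplus>\<^bsub>M\<^esub> (P \<oplus>\<^bsub>M\<^esub> P)))) \<oplus>\<^bsub>M\<^esub> (P \<oplus>\<^bsub>M\<^esub> (P \<oplus>\<^bsub>M\<^esub> (P \<oplus>\<^bsub>M\<^esub> (P \<oplus>\<^bsub>M\<^esub> P))))) \<oplus>\<^bsub>M\<^esub>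
      ((Q \<oplus>\<^bsub>M\<^esub> (Q \<oplus>\<^bsub>M\<^esub> (Q \<oplus>\<^bsub>M\<^esub> (Q \<oplus>\<^bsub>M\<^esub> Q)))) \<oplus>\<^bsub>M\<^esub> (Q \<oplus>\<^bsub>M\<^esub> (Q \<oplus>\<^bsub>M\<^esub> (Q \<oplus>\<^bsub>M\<^esub> (Q \<oplus>\<^bsub>M\<^esub> Q)))))"
    unfolding defs using cl by (simp add: M.a_ac)
  also have "\<dots> = \<zero>\<^bsub>M\<^esub>" using cl by (simp add: five)
  finally show ?thesis by (simp add: p b2 b3 b4 unip_zero units_of_one)
qed

end

section \<open>Bounded generation\<close>

lemma (in group) bounded_products_append:
  assumes "S \<subseteq> carrier G" "x \<in> bounded_products G S m" "y \<in> bounded_products G S n"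
  shows "x \<otimes> y \<in> bounded_products G S (m + n)"
  using assms(3)
proof (induction n arbitrary: y)
  case 0
  then show ?case using assms(2) subsetD[OF bounded_products_closed[OF assms(1)] assms(2)] by simp
next
  case (Suc n)
  then obtain z s where z: "y = z \<otimes> s" "z \<in> bounded_products G S n" "s \<in> S" by auto
  have "x \<otimes> y = (x \<otimes> z) \<otimes> s"
    using z assms bounded_products_closed[OF assms(1)] by (metis m_assoc subsetD)
  then show ?case using Suc.IH[OF z(2)] z(3) by auto
qed

lemma (in group) bounded_products_mono:
  assumes "S \<subseteq> carrier G" "\<one> \<in> S" "m \<le> n"
  shows "bounded_products G S m \<subseteq> bounded_products G S n"
  using assms(3)
proof (induction n rule: dec_induct)
  case (step n)
  have "x \<in> bounded_products G S (Suc n)" if "x \<in> bounded_products G S n" for x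
    using subsetD[OF bounded_products_closed[OF assms(1)] that] that assms(2) by simp (metis r_one)
  with step show ?case by blast
qed simp

lemma bounded_products_mono_set: "S \<subseteq> S' \<Longrightarrow> bounded_products G S n \<subseteq> bounded_products G S' n"
  by (induction n) auto

lemma (in group) generate_subset_of_mult_closed:
  assumes "S \<subseteq> carrier G" "Q \<subseteq> carrier G" "\<And>s. s \<in> S \<Longrightarrow> inv s \<in> S" "\<one> \<in> Q"
    and Q: "\<And>x s. x \<in> Q \<Longrightarrow> s \<in> S \<Longrightarrow> x \<otimes> s \<in> Q"
  shows "generate G S \<subseteq> Q"
proof -
  have "\<forall>x\<in>Q. x \<otimes> g \<in> Q" if "g \<in> generate G S" for g
    using that
  proof induction
    case one
    then show ?case using assms(2) by auto
  next
    case (eng g h)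
    have "x \<otimes> (g \<otimes> h) = (x \<otimes> g) \<otimes> h" if "x \<in> Q" for x
      using that eng.hyps assms(2) generate_in_carrier[OF assms(1)] by (simp add: m_assoc subsetD)
    with eng.IH show ?case by simp
  qed (use Q assms(3) in auto)
  with \<open>\<one> \<in> Q\<close> show ?thesis using generate_in_carrier[OF assms(1)] by fastforce
qed

text \<open>The first two factors bound the dimension of the space of d by d matrices with entries
  in \<open>L (2 * l + 1)\<close>, which is the number of spanning conjugates. Each is a word of
  length \<open>2 * l + 1\<close>, and the old group needs \<open>l\<close> further letters.\<close>

definition layer_bound :: "nat \<Rightarrow> nat \<Rightarrow> nat" where
  "layer_bound d l = (2 * l + 2) * (d * d) * (2 * l + 1) + l"

text \<open>\<open>L n\<close> stands for the classes of polynomials of degree at most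
  \<open>n\<close>, with \<open>L 0\<close> the field of constants. Only upper bounds for their
  sizes are required, so the bounds do not involve the degree of the modulus.\<close>

locale graded_matrices = mat_algebra R W for R :: "('a, 'b) ring_scheme" (structure) and W :: "'i set" +
  fixes L :: "nat \<Rightarrow> 'a set"
  assumes L_carrier: "L n \<subseteq> carrier R"
    and L_zero: "\<zero> \<in> L n"
    and L_add: "x \<in> L n \<Longrightarrow> y \<in> L n \<Longrightarrow> x \<oplus> y \<in> L n"
    and L_minus: "x \<in> L n \<Longrightarrow> \<ominus> x \<in> L n"
    and L_one: "\<one> \<in> L 0"
    and L_mult: "x \<in> L m \<Longrightarrow> y \<in> L n \<Longrightarrow> x \<otimes> y \<in> L (m + n)"
    and L_mono: "m \<le> n \<Longrightarrow> L m \<subseteq> L n"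
    and L_inverse: "x \<in> L 0 \<Longrightarrow> x \<noteq> \<zero> \<Longrightarrow> \<exists>y\<in>L 0. y \<otimes> x = \<one>"
    and L_finite: "finite (L n)"
    and L_card: "card (L n) \<le> card (L 0) ^ (n + 1)"
    and one_not_zero: "\<one> \<noteq> \<zero>"
begin

definition smul :: "'a \<Rightarrow> ('i \<times> 'i \<Rightarrow> 'a) \<Rightarrow> 'i \<times> 'i \<Rightarrow> 'a" where
  "smul c N = (\<lambda>x\<in>W \<times> W. c \<otimes> N x)"

definition Ent :: "nat \<Rightarrow> ('i \<times> 'i \<Rightarrow> 'a) set" where
  "Ent n = W \<times> W \<rightarrow>\<^sub>E L n"

lemma Ent_carrier: "N \<in> Ent n \<Longrightarrow> N \<in> carrier M"
  unfolding Ent_def mat_ring_simps using PiE_mono[of "W \<times> W" "\<lambda>_. L n" "\<lambda>_. carrier R"] L_carrier[of n] by blast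

lemma Ent_iff: "N \<in> Ent n \<longleftrightarrow> N \<in> carrier M \<and> (\<forall>i\<in>W. \<forall>j\<in>W. N (i, j) \<in> L n)"
  using Ent_carrier[of N n] by (auto simp: Ent_def mat_ring_simps PiE_iff)

lemma finsum_L: "f \<in> Y \<rightarrow> L n \<Longrightarrow> finsum R f Y \<in> L n"
proof (induction Y rule: infinite_finite_induct)
  case (insert y Y)
  then have "f y \<in> carrier R" "f \<in> Y \<rightarrow> carrier R" using L_carrier[of n] by auto
  with insert show ?case by (auto intro!: L_add)
qed (auto simp: L_zero)

lemma Ent_mult:
  assumes "N \<in> Ent m" "N' \<in> Ent n"
  shows "N \<otimes>\<^bsub>M\<^esub> N' \<in> Ent (m + n)"
  using assms unfolding Ent_iff by (auto simp: mat_entry intro!: finsum_L L_mult)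

lemma Ent_add: "N \<in> Ent n \<Longrightarrow> N' \<in> Ent n \<Longrightarrow> N \<oplus>\<^bsub>M\<^esub> N' \<in> Ent n"
  unfolding Ent_iff by (auto simp: mat_entry intro!: L_add)

lemma Ent_zero: "\<zero>\<^bsub>M\<^esub> \<in> Ent n"
  by (auto simp: Ent_iff mat_entry L_zero)

lemma Ent_one: "\<one>\<^bsub>M\<^esub> \<in> Ent n"
  using L_mono[of 0 n] by (auto simp: Ent_iff mat_entry L_zero intro: subsetD[OF _ L_one])

lemma Ent_finite: "finite (Ent n)"
  unfolding Ent_def using finW L_finite by (intro finite_PiE) auto

lemma Ent_card: "card (Ent n) \<le> card (L 0) ^ ((n + 1) * (card W * card W))"
proof -
  have "card (Ent n) = card (L n) ^ (card W * card W)"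
    unfolding Ent_def using finW by (simp add: card_PiE card_cartesian_product)
  also have "\<dots> \<le> (card (L 0) ^ (n + 1)) ^ (card W * card W)" by (intro power_mono L_card) simp
  finally show ?thesis by (simp only: power_mult)
qed

lemma smul_entry: "i \<in> W \<Longrightarrow> j \<in> W \<Longrightarrow> smul c N (i, j) = c \<otimes> N (i, j)"
  by (simp add: smul_def)

lemma L0: "c \<in> L 0 \<Longrightarrow> c \<in> carrier R"
  using L_carrier by blast

lemma smul_closed: "c \<in> carrier R \<Longrightarrow> N \<in> carrier M \<Longrightarrow> smul c N \<in> carrier M"
  by (auto simp: smul_def mat_ring_simps)

lemma smul_Ent: "c \<in> L 0 \<Longrightarrow> N \<in> Ent n \<Longrightarrow> smul c N \<in> Ent n"
  using L_mult[of c 0 _ n] by (auto simp: Ent_iff smul_entry smul_closed L0)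

lemma smul_simps:
  "c \<in> carrier R \<Longrightarrow> d \<in> carrier R \<Longrightarrow> N \<in> carrier M \<Longrightarrow> smul (c \<oplus> d) N = smul c N \<oplus>\<^bsub>M\<^esub> smul d N"
  "c \<in> carrier R \<Longrightarrow> N \<in> carrier M \<Longrightarrow> N' \<in> carrier M \<Longrightarrow> smul c (N \<oplus>\<^bsub>M\<^esub> N') = smul c N \<oplus>\<^bsub>M\<^esub> smul c N'"
  "c \<in> carrier R \<Longrightarrow> d \<in> carrier R \<Longrightarrow> N \<in> carrier M \<Longrightarrow> smul c (smul d N) = smul (c \<otimes> d) N"
  "c \<in> carrier R \<Longrightarrow> smul c \<zero>\<^bsub>M\<^esub> = \<zero>\<^bsub>M\<^esub>"
  "N \<in> carrier M \<Longrightarrow> smul \<zero> N = \<zero>\<^bsub>M\<^esub>"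
  "N \<in> carrier M \<Longrightarrow> smul \<one> N = N"
  "N \<in> carrier M \<Longrightarrow> smul (\<ominus> \<one>) N = \<ominus>\<^bsub>M\<^esub> N"
  by (auto intro!: mat_eqI smul_closed mat_closed' M.a_inv_closed
      simp: smul_entry mat_entry mat_closed l_distr r_distr m_assoc smul_closed mat_minus_entry l_minus)

lemma smul_mult:
  assumes [simp]: "c \<in> carrier R" "N \<in> carrier M" "N' \<in> carrier M"
  shows "smul c (N \<otimes>\<^bsub>M\<^esub> N') = smul c N \<otimes>\<^bsub>M\<^esub> N'" "smul c (N \<otimes>\<^bsub>M\<^esub> N') = N \<otimes>\<^bsub>M\<^esub> smul c N'"
proof -
  have 1: "c \<otimes> (\<Oplus>k\<in>W. N (i, k) \<otimes> N' (k, j)) = (\<Oplus>k\<in>W. c \<otimes> (N (i, k) \<otimes> N' (k, j)))"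
    if "i \<in> W" "j \<in> W" for i j
    using that finW by (intro finsum_rdistr) (auto simp: mat_closed)
  have 2: "smul c (N \<otimes>\<^bsub>M\<^esub> N') (i, j) = (\<Oplus>k\<in>W. c \<otimes> (N (i, k) \<otimes> N' (k, j)))"
    if "i \<in> W" "j \<in> W" for i j
    using that by (simp add: smul_entry mat_entry 1)
  show "smul c (N \<otimes>\<^bsub>M\<^esub> N') = smul c N \<otimes>\<^bsub>M\<^esub> N'"
  proof (intro mat_eqI smul_closed mat_closed' assms)
    fix i j assume ij: "i \<in> W" "j \<in> W"
    show "smul c (N \<otimes>\<^bsub>M\<^esub> N') (i, j) = (smul c N \<otimes>\<^bsub>M\<^esub> N') (i, j)"
      unfolding 2[OF ij] mat_entry(1)[OF ij] using ij
      by (intro finsum_cong') (simp_all add: smul_entry mat_closed m_assoc Pi_def)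
  qed
  show "smul c (N \<otimes>\<^bsub>M\<^esub> N') = N \<otimes>\<^bsub>M\<^esub> smul c N'"
  proof (intro mat_eqI smul_closed mat_closed' assms)
    fix i j assume ij: "i \<in> W" "j \<in> W"
    show "smul c (N \<otimes>\<^bsub>M\<^esub> N') (i, j) = (N \<otimes>\<^bsub>M\<^esub> smul c N') (i, j)"
      unfolding 2[OF ij] mat_entry(1)[OF ij] using ij
      by (intro finsum_cong') (simp_all add: smul_entry mat_closed m_lcomm Pi_def)
  qed
qed

text \<open>The span of a list over \<open>L 0\<close>.\<close>

primrec combos :: "('i \<times> 'i \<Rightarrow> 'a) list \<Rightarrow> ('i \<times> 'i \<Rightarrow> 'a) set" where
  "combos [] = {\<zero>\<^bsub>M\<^esub>}"
| "combos (t # ts) = {smul c t \<oplus>\<^bsub>M\<^esub> x | c x. c \<in> L 0 \<and> x \<in> combos ts}"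

lemma combos_Ent: "set ts \<subseteq> Ent n \<Longrightarrow> combos ts \<subseteq> Ent n"
  by (induction ts) (auto intro!: Ent_zero Ent_add smul_Ent)

lemma combos_carrier: "set ts \<subseteq> carrier M \<Longrightarrow> combos ts \<subseteq> carrier M"
  by (induction ts) (auto intro!: smul_closed L0)

lemma zero_combos: "set ts \<subseteq> carrier M \<Longrightarrow> \<zero>\<^bsub>M\<^esub> \<in> combos ts"
proof (induction ts)
  case (Cons t ts)
  then show ?case using smul_simps(5)[of t] by (auto intro!: exI[of _ \<zero>] exI[of _ "\<zero>\<^bsub>M\<^esub>"] simp: L_zero)
qed simp

lemma combos_add: "set ts \<subseteq> carrier M \<Longrightarrow> x \<in> combos ts \<Longrightarrow> y \<in> combos ts \<Longrightarrow> x \<oplus>\<^bsub>M\<^esub> y \<in> combos ts"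
proof (induction ts arbitrary: x y)
  case (Cons t ts)
  then obtain c x' d y' where x: "x = smul c t \<oplus>\<^bsub>M\<^esub> x'" "y = smul d t \<oplus>\<^bsub>M\<^esub> y'" "c \<in> L 0" "d \<in> L 0"
    "x' \<in> combos ts" "y' \<in> combos ts" by auto
  have "x' \<in> carrier M" "y' \<in> carrier M" "t \<in> carrier M"
    using x Cons.prems combos_carrier[of ts] by auto
  then have "x \<oplus>\<^bsub>M\<^esub> y = smul (c \<oplus> d) t \<oplus>\<^bsub>M\<^esub> (x' \<oplus>\<^bsub>M\<^esub> y')"
    using x by (simp add: smul_simps smul_closed L0 M.a_ac)
  moreover have "x' \<oplus>\<^bsub>M\<^esub> y' \<in> combos ts" using Cons x by auto
  ultimately show ?case using L_add[OF x(3,4)] by auto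
qed simp

lemma combos_smul: "set ts \<subseteq> carrier M \<Longrightarrow> x \<in> combos ts \<Longrightarrow> c \<in> L 0 \<Longrightarrow> smul c x \<in> combos ts"
proof (induction ts arbitrary: x)
  case (Cons t ts)
  then obtain d x' where x: "x = smul d t \<oplus>\<^bsub>M\<^esub> x'" "d \<in> L 0" "x' \<in> combos ts" by auto
  have "x' \<in> carrier M" "t \<in> carrier M"
    using x Cons.prems combos_carrier[of ts] by auto
  then have "smul c x = smul (c \<otimes> d) t \<oplus>\<^bsub>M\<^esub> smul c x'"
    using x Cons.prems by (simp add: smul_simps smul_closed L0)
  moreover have "smul c x' \<in> combos ts" using Cons x by auto
  ultimately show ?case using x L_mult[of c 0 d 0] Cons.prems by auto
qed (simp add: smul_simps L0)

text \<open>If two combinations coincide and their coefficients of \<open>t\<close> differ, the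
  difference of these is invertible in \<open>L 0\<close>, and \<open>t\<close> would lie in the
  span of \<open>ts\<close>. Linear independence can thus be expressed by cardinalities.\<close>

lemma card_combos_Cons:
  assumes ts: "set ts \<subseteq> carrier M" and t: "t \<in> carrier M" "t \<notin> combos ts"
  shows "card (combos (t # ts)) = card (L 0) * card (combos ts)"
proof -
  let ?f = "\<lambda>(c, x). smul c t \<oplus>\<^bsub>M\<^esub> x"
  have "inj_on ?f (L 0 \<times> combos ts)"
  proof (rule inj_onI, clarify)
    fix c x d y
    assume c: "c \<in> L 0" "d \<in> L 0" and x: "x \<in> combos ts" "y \<in> combos ts"
      and eq: "smul c t \<oplus>\<^bsub>M\<^esub> x = smul d t \<oplus>\<^bsub>M\<^esub> y"
    have xc: "x \<in> carrier M" "y \<in> carrier M" using x combos_carrier[OF ts] by auto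
    note [simp] = xc t(1) c[THEN L0] smul_closed
    have m1: "\<ominus> \<one> \<in> L 0" using L_minus L_one by blast
    have neg: "smul (\<ominus> c) t \<oplus>\<^bsub>M\<^esub> smul c t = \<zero>\<^bsub>M\<^esub>"
      using smul_simps(1)[of "\<ominus> c" c t] smul_simps(5)[of t] by (simp add: l_neg)
    have negx: "x \<oplus>\<^bsub>M\<^esub> smul (\<ominus> \<one>) x = \<zero>\<^bsub>M\<^esub>"
      using smul_simps(1)[of \<one> "\<ominus> \<one>" x] smul_simps(5,6)[of x] by (simp add: r_neg)
    show "c = d \<and> x = y"
    proof (cases "c = d")
      case True
      then show ?thesis using eq by (simp add: M.add.l_cancel)
    next
      case False
      have nz: "\<ominus> d \<oplus> c \<noteq> \<zero>"
      proof
        assume "\<ominus> d \<oplus> c = \<zero>"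
        then have "d \<oplus> (\<ominus> d \<oplus> c) = d" by simp
        then show False using False by (simp add: r_neg2)
      qed
      have dc: "\<ominus> d \<oplus> c \<in> L 0" using c L_add L_minus by blast
      obtain e where e: "e \<in> L 0" "e \<otimes> (\<ominus> d \<oplus> c) = \<one>" using L_inverse[OF dc nz] by blast
      have "smul (\<ominus> d \<oplus> c) t = smul (\<ominus> d) t \<oplus>\<^bsub>M\<^esub> (smul c t \<oplus>\<^bsub>M\<^esub> x) \<oplus>\<^bsub>M\<^esub> smul (\<ominus> \<one>) x"
        using negx by (simp add: smul_simps M.a_assoc)
      also have "\<dots> = (smul (\<ominus> d) t \<oplus>\<^bsub>M\<^esub> smul d t) \<oplus>\<^bsub>M\<^esub> (y \<oplus>\<^bsub>M\<^esub> smul (\<ominus> \<one>) x)"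
        unfolding eq by (simp add: M.a_assoc)
      also have "smul (\<ominus> d) t \<oplus>\<^bsub>M\<^esub> smul d t = \<zero>\<^bsub>M\<^esub>"
        using smul_simps(1)[of "\<ominus> d" d t] smul_simps(5)[of t] by (simp add: l_neg)
      finally have "smul (\<ominus> d \<oplus> c) t = y \<oplus>\<^bsub>M\<^esub> smul (\<ominus> \<one>) x" by simp
      then have "smul (\<ominus> d \<oplus> c) t \<in> combos ts"
        using combos_add[OF ts x(2) combos_smul[OF ts x(1) m1]] by simp
      from combos_smul[OF ts this e(1)] have "t \<in> combos ts"
        using e dc t(1) by (subst (asm) smul_simps(3)) (simp_all add: smul_simps(6) L0)
      with t(2) show ?thesis by simp
    qed
  qed
  moreover have "combos (t # ts) = ?f ` (L 0 \<times> combos ts)" by auto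
  ultimately show ?thesis by (simp add: card_image card_cartesian_product)
qed

lemma card_L0: "2 \<le> card (L 0)"
proof -
  have "card {\<zero>, \<one>} \<le> card (L 0)" using L_zero L_one L_finite by (intro card_mono) auto
  then show ?thesis using one_not_zero by auto
qed

text \<open>A longest list whose span has the maximal size q^k must span \<open>T\<close>, or it
  could be extended; and k is bounded by the size of \<open>Ent n\<close>, with q the size of
  \<open>L 0\<close>.\<close>

lemma small_spanning_list:
  assumes T: "T \<subseteq> Ent n"
  shows "\<exists>ts. set ts \<subseteq> T \<and> length ts \<le> (n + 1) * (card W * card W) \<and> T \<subseteq> combos ts"
proof -
  define P where "P k \<longleftrightarrow> (\<exists>ts. set ts \<subseteq> T \<and> length ts = k \<and> card (combos ts) = card (L 0) ^ k)" for k
  have bound: "k \<le> (n + 1) * (card W * card W)" if Pk: "P k" for k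
  proof -
    obtain ts where ts: "set ts \<subseteq> T" "card (combos ts) = card (L 0) ^ k" using Pk unfolding P_def by blast
    have "card (combos ts) \<le> card (Ent n)" using ts T by (intro card_mono combos_Ent Ent_finite) auto
    also note Ent_card
    finally show ?thesis using card_L0 ts(2) by (simp add: power_increasing_iff)
  qed
  have "P 0" by (auto simp: P_def)
  then obtain k where k: "P k" "\<And>l. P l \<Longrightarrow> l \<le> k"
    using bound GreatestI_nat[of P] Greatest_le_nat[of P] by metis
  then obtain ts where ts: "set ts \<subseteq> T" "length ts = k" "card (combos ts) = card (L 0) ^ k" using k(1) by (auto simp: P_def)
  have "t \<in> combos ts" if "t \<in> T" for t
  proof (rule ccontr)
    assume "t \<notin> combos ts"
    then have "card (combos (t # ts)) = card (L 0) ^ Suc k"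
      using card_combos_Cons[of ts t] ts T that Ent_carrier by (auto simp: subset_eq)
    then have "P (Suc k)" using ts that unfolding P_def by (intro exI[of _ "t # ts"]) auto
    from k(2)[OF this] show False by simp
  qed
  with ts bound[OF k(1)] show ?thesis by blast
qed

lemma bounded_products_Ent:
  assumes "S \<subseteq> Ent 1"
  shows "bounded_products GM S n \<subseteq> Ent n"
proof (induction n)
  case 0
  then show ?case by (simp add: units_of_one Ent_one)
next
  case (Suc n)
  then show ?case using assms Ent_mult[of _ n _ 1] by (force simp: units_of_mult)
qed

text \<open>
  The conjugates of the elements of \<open>\<N>\<close> by the group generated by \<open>S\<close> have entries in \<open>L (2 * l + 1)\<close>, so
  boundedly many of them span all of them over \<open>L 0\<close>.
\<close>

lemma layer_bounded_generation:
  assumes \<phi>: "sign_weight \<phi>"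
    and S: "S \<subseteq> Dg \<phi>" "S \<subseteq> Ent 1" "\<one>\<^bsub>GM\<^esub> \<in> S" "\<And>s. s \<in> S \<Longrightarrow> inv\<^bsub>GM\<^esub> s \<in> S"
    and gen: "generate GM S \<subseteq> bounded_products GM S l"
    and N: "\<N> \<subseteq> Fl \<phi> 2" "\<N> \<subseteq> Ent 1" "\<And>c N. c \<in> L 0 \<Longrightarrow> N \<in> \<N> \<Longrightarrow> smul c N \<in> \<N>"
  shows "generate GM (unip ` \<N> \<union> S) \<subseteq> bounded_products GM (unip ` \<N> \<union> S) (layer_bound (card W) l)"
proof -
  let ?H = "generate GM S" and ?Y = "unip ` \<N> \<union> S"
  define T where "T = {inv\<^bsub>GM\<^esub> h \<otimes>\<^bsub>M\<^esub> N \<otimes>\<^bsub>M\<^esub> h | h N. h \<in> ?H \<and> N \<in> \<N>}"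
  have Sc: "S \<subseteq> carrier GM" using S(1) Dg_carrier by blast
  have H: "subgroup ?H GM" using GM.generate_is_subgroup[OF Sc] .
  have HD: "?H \<subseteq> Dg \<phi>" using GM.generate_subgroup_incl[OF S(1) Dg_subgroup] .
  have HE: "?H \<subseteq> Ent l" using gen bounded_products_Ent[OF S(2)] by blast
  have Hc: "h \<in> carrier GM" "inv\<^bsub>GM\<^esub> h \<in> ?H" if "h \<in> ?H" for h
    using that H by (auto simp: subgroup.m_inv_closed subgroup.mem_carrier)
  have Yc: "?Y \<subseteq> carrier GM"
    using Sc image_mono[OF N(1), of unip] Dg_carrier Ug_Dg[OF \<phi>] unfolding Ug_def[symmetric] by blast
  have TF: "T \<subseteq> Fl \<phi> 2"
  proof
    fix x assume "x \<in> T"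
    then obtain h N where h: "x = inv\<^bsub>GM\<^esub> h \<otimes>\<^bsub>M\<^esub> N \<otimes>\<^bsub>M\<^esub> h" "h \<in> ?H" "N \<in> \<N>" by (auto simp: T_def)
    have "x \<in> Fl \<phi> (0 + 2 + 0)" unfolding h(1) using h HD N by (intro Fl_mult) (auto simp: Dg_def)
    then show "x \<in> Fl \<phi> 2" by simp
  qed
  have "T \<subseteq> Ent (2 * l + 1)"
  proof
    fix x assume "x \<in> T"
    then obtain h N where h: "x = inv\<^bsub>GM\<^esub> h \<otimes>\<^bsub>M\<^esub> N \<otimes>\<^bsub>M\<^esub> h" "h \<in> ?H" "N \<in> \<N>" by (auto simp: T_def)
    have "x \<in> Ent (l + 1 + l)" unfolding h(1) using h HE N Hc by (intro Ent_mult) auto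
    then show "x \<in> Ent (2 * l + 1)" by (simp add: mult_2)
  qed
  from small_spanning_list[OF this] obtain ts
    where ts: "set ts \<subseteq> T" "length ts \<le> (2 * l + 2) * (card W * card W)" "T \<subseteq> combos ts" by auto
  have tsM: "set ts \<subseteq> carrier M" using ts(1) TF Fl_carrier by blast
  have TS: "smul c t \<in> T" if "c \<in> L 0" "t \<in> T" for c t
  proof -
    obtain h N where h: "t = inv\<^bsub>GM\<^esub> h \<otimes>\<^bsub>M\<^esub> N \<otimes>\<^bsub>M\<^esub> h" "h \<in> ?H" "N \<in> \<N>" using \<open>t \<in> T\<close> by (auto simp: T_def)
    have cl: "h \<in> carrier M" "inv\<^bsub>GM\<^esub> h \<in> carrier M" "N \<in> carrier M"
      using h(2,3) HE Hc N(2) Ent_carrier by blast+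
    have "smul c t = inv\<^bsub>GM\<^esub> h \<otimes>\<^bsub>M\<^esub> smul c N \<otimes>\<^bsub>M\<^esub> h"
      unfolding h(1) using cl that L0 by (simp add: smul_mult(1)[of c _ h] smul_mult(2)[of c _ N])
    then show ?thesis using h N(3) that by (auto simp: T_def)
  qed
  have lists: "combos ts' \<subseteq> Fl \<phi> 2 \<and> unip ` combos ts' \<subseteq> bounded_products GM ?Y (length ts' * (2 * l + 1))"
    if "set ts' \<subseteq> T" for ts'
    using that
  proof (induction ts')
    case Nil
    have "\<zero>\<^bsub>M\<^esub> \<in> Fl \<phi> 2" by (simp add: Fl_def mat_entry)
    then show ?case by (simp add: unip_zero units_of_one)
  next
    case (Cons t ts')
    have "smul c t \<oplus>\<^bsub>M\<^esub> x \<in> Fl \<phi> 2 \<and> unip (smul c t \<oplus>\<^bsub>M\<^esub> x) \<in> bounded_products GM ?Y (length (t # ts') * (2 * l + 1))"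
      if "c \<in> L 0" "x \<in> combos ts'" for c x
    proof -
      have t': "smul c t \<in> T" using TS that Cons.prems by auto
      have x: "x \<in> Fl \<phi> 2" "unip x \<in> bounded_products GM ?Y (length ts' * (2 * l + 1))" using Cons that by auto
      have t'F: "smul c t \<in> Fl \<phi> 2" using t' TF by blast
      obtain h N where h: "smul c t = inv\<^bsub>GM\<^esub> h \<otimes>\<^bsub>M\<^esub> N \<otimes>\<^bsub>M\<^esub> h" "h \<in> ?H" "N \<in> \<N>" using t' by (auto simp: T_def)
      have "unip (smul c t) = gconj GM (unip N) h"
        unfolding h(1) using h N Hc Fl_carrier Fl_mult_zero[OF \<phi>] by (subst gconj_unip) auto
      also have "\<dots> = inv\<^bsub>GM\<^esub> h \<otimes>\<^bsub>GM\<^esub> (\<one>\<^bsub>GM\<^esub> \<otimes>\<^bsub>GM\<^esub> unip N) \<otimes>\<^bsub>GM\<^esub> h"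
        using Yc h Hc by (auto simp: gconj_def)
      also have "\<dots> \<in> bounded_products GM ?Y (l + Suc 0 + l)"
      proof (intro GM.bounded_products_append Yc)
        show "h \<in> bounded_products GM ?Y l" "inv\<^bsub>GM\<^esub> h \<in> bounded_products GM ?Y l"
          using h Hc gen bounded_products_mono_set[of S ?Y GM l] by blast+
        show "\<one>\<^bsub>GM\<^esub> \<otimes>\<^bsub>GM\<^esub> unip N \<in> bounded_products GM ?Y (Suc 0)" using h by auto
      qed
      finally have "unip (smul c t) \<in> bounded_products GM ?Y (2 * l + 1)" by (simp add: mult_2)
      from GM.bounded_products_append[OF Yc this x(2)]
      have "unip (smul c t) \<otimes>\<^bsub>GM\<^esub> unip x \<in> bounded_products GM ?Y (length (t # ts') * (2 * l + 1))" by (simp only: length_Cons mult_Suc)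
      moreover have "unip (smul c t) \<otimes>\<^bsub>GM\<^esub> unip x = unip (smul c t \<oplus>\<^bsub>M\<^esub> x)"
        using t'F x(1) Fl_mult_zero[OF \<phi>] by (simp add: units_of_mult unip_mult Fl_carrier)
      ultimately show ?thesis using Fl_add[OF t'F x(1)] by simp
    qed
    then show ?case by auto
  qed
  \<comment> \<open>The new group is the product of an abelian normal part, described by
    combinations of conjugates, and the old group.\<close>
  define Q where "Q = {unip x \<otimes>\<^bsub>GM\<^esub> h | x h. x \<in> combos ts \<and> h \<in> ?H}"
  have uc: "unip x \<in> carrier GM" if "x \<in> Fl \<phi> 2" for x using that Dg_carrier Ug_Dg[OF \<phi>] by (auto simp: Ug_def)
  have cF: "combos ts \<subseteq> Fl \<phi> 2" using lists[OF ts(1)] by blast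
  have "generate GM ?Y \<subseteq> Q"
  proof (rule GM.generate_subset_of_mult_closed[OF Yc])
    show "Q \<subseteq> carrier GM" using cF uc Hc by (auto simp: Q_def)
    show "inv\<^bsub>GM\<^esub> s \<in> ?Y" if sY: "s \<in> ?Y" for s
    proof (cases "s \<in> S")
      case False
      then obtain N where N': "s = unip N" "N \<in> \<N>" using sY by auto
      have c: "N \<in> carrier M" "N \<otimes>\<^bsub>M\<^esub> N = \<zero>\<^bsub>M\<^esub>" using N' N(1) Fl_carrier Fl_mult_zero[OF \<phi>] by blast+
      have "smul (\<ominus> \<one>) N = \<ominus>\<^bsub>M\<^esub> N" using c(1) by (rule smul_simps)
      moreover have "smul (\<ominus> \<one>) N \<in> \<N>" using N(3) N'(2) L_minus L_one by blast
      ultimately show ?thesis using unip_units(2)[OF c] N' by auto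
    qed (use S in auto)
    show "\<one>\<^bsub>GM\<^esub> \<in> Q"
      unfolding Q_def using zero_combos[OF tsM] subgroup.one_closed[OF H] GM.r_one[OF GM.one_closed]
      by (intro CollectI exI[of _ "\<zero>\<^bsub>M\<^esub>"] exI[of _ "\<one>\<^bsub>GM\<^esub>"]) (auto simp: unip_zero units_of_one)
    fix y s assume y: "y \<in> Q" and s: "s \<in> ?Y"
    from y obtain x h where x: "y = unip x \<otimes>\<^bsub>GM\<^esub> h" "x \<in> combos ts" "h \<in> ?H" by (auto simp: Q_def)
    have xF: "x \<in> Fl \<phi> 2" using x cF by blast
    show "y \<otimes>\<^bsub>GM\<^esub> s \<in> Q"
    proof (cases "s \<in> S")
      case True
      then have "y \<otimes>\<^bsub>GM\<^esub> s = unip x \<otimes>\<^bsub>GM\<^esub> (h \<otimes>\<^bsub>GM\<^esub> s)" using x xF uc Hc Sc by (auto simp: GM.m_assoc)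
      moreover have "h \<otimes>\<^bsub>GM\<^esub> s \<in> ?H" using x True by (auto intro: generate.eng generate.incl)
      ultimately show ?thesis using x by (auto simp: Q_def)
    next
      case False
      then obtain N where N': "s = unip N" "N \<in> \<N>" using s by auto
      have NF: "N \<in> Fl \<phi> 2" using N' N by blast
      \<comment> \<open>A new generator is moved to the left past \<open>h\<close> at the price of a
        conjugation; the conjugate belongs to \<open>T\<close> and is absorbed into the
        combination.\<close>
      define t where "t = inv\<^bsub>GM\<^esub> (inv\<^bsub>GM\<^esub> h) \<otimes>\<^bsub>M\<^esub> N \<otimes>\<^bsub>M\<^esub> inv\<^bsub>GM\<^esub> h"
      have tT: "t \<in> T" unfolding t_def T_def using Hc x N' by blast
      have tF: "t \<in> Fl \<phi> 2" using tT TF by blast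
      have "gconj GM s (inv\<^bsub>GM\<^esub> h) = unip t"
        unfolding t_def N'(1) using NF Hc x Fl_carrier Fl_mult_zero[OF \<phi>] by (subst gconj_unip) auto
      then have "unip t = h \<otimes>\<^bsub>GM\<^esub> s \<otimes>\<^bsub>GM\<^esub> inv\<^bsub>GM\<^esub> h" using Hc x by (simp add: gconj_def)
      then have "y \<otimes>\<^bsub>GM\<^esub> s = unip x \<otimes>\<^bsub>GM\<^esub> unip t \<otimes>\<^bsub>GM\<^esub> h"
        using x xF uc Hc NF N' by (simp add: GM.m_assoc)
      also have "unip x \<otimes>\<^bsub>GM\<^esub> unip t = unip (x \<oplus>\<^bsub>M\<^esub> t)"
        using tF xF Fl_mult_zero[OF \<phi>] by (simp add: units_of_mult unip_mult Fl_carrier)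
      finally show ?thesis using x combos_add[OF tsM x(2)] ts(3) tT by (auto simp: Q_def)
    qed
  qed
  also have "Q \<subseteq> bounded_products GM ?Y (layer_bound (card W) l)"
  proof
    fix y assume "y \<in> Q"
    then obtain x h where x: "y = unip x \<otimes>\<^bsub>GM\<^esub> h" "x \<in> combos ts" "h \<in> ?H" by (auto simp: Q_def)
    have "y \<in> bounded_products GM ?Y (length ts * (2 * l + 1) + l)"
      unfolding x(1) using x lists[OF ts(1)] gen bounded_products_mono_set[of S ?Y GM l]
      by (intro GM.bounded_products_append Yc) blast+
    moreover have "length ts * (2 * l + 1) + l \<le> layer_bound (card W) l"
      unfolding layer_bound_def using ts(2) by (intro add_right_mono mult_right_mono) auto
    ultimately show "y \<in> bounded_products GM ?Y (layer_bound (card W) l)"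
      using GM.bounded_products_mono[OF Yc, of "length ts * (2 * l + 1) + l" "layer_bound (card W) l"] S(3) by blast
  qed
  finally show ?thesis .
qed

end

section \<open>Root elements\<close>

context cring
begin

lemma add_pow_int:
  fixes k l :: int
  shows "x \<in> carrier R \<Longrightarrow> [k] \<cdot> x \<in> carrier R"
    "x \<in> carrier R \<Longrightarrow> y \<in> carrier R \<Longrightarrow> [k] \<cdot> (x \<oplus> y) = [k] \<cdot> x \<oplus> [k] \<cdot> y"
    "x \<in> carrier R \<Longrightarrow> [(k + l)] \<cdot> x = [k] \<cdot> x \<oplus> [l] \<cdot> x"
    "x \<in> carrier R \<Longrightarrow> [k] \<cdot> ([l] \<cdot> x) = [(k * l)] \<cdot> x"
    "x \<in> carrier R \<Longrightarrow> y \<in> carrier R \<Longrightarrow> [k] \<cdot> x \<otimes> [l] \<cdot> y = [(k * l)] \<cdot> (x \<otimes> y)"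
    "x \<in> carrier R \<Longrightarrow> [(1 :: int)] \<cdot> x = x" "[(0 :: int)] \<cdot> x = \<zero>" "x \<in> carrier R \<Longrightarrow> [(- 1 :: int)] \<cdot> x = \<ominus> x"
proof -
  note A = group.int_pow_closed[OF a_group] group.int_pow_mult[OF a_group] group.int_pow_pow[OF a_group]
    group.int_pow_1[OF a_group] group.int_pow_neg[OF a_group] comm_group.int_pow_distrib[OF a_comm_group]
  show c: "x \<in> carrier R \<Longrightarrow> [k] \<cdot> x \<in> carrier R" for k :: int and x using A(1)[of x k] by (simp add: add_pow_def)
  show "x \<in> carrier R \<Longrightarrow> y \<in> carrier R \<Longrightarrow> [k] \<cdot> (x \<oplus> y) = [k] \<cdot> x \<oplus> [k] \<cdot> y"
    using A(6)[of x y k] by (simp add: add_pow_def)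
  show "x \<in> carrier R \<Longrightarrow> [(k + l)] \<cdot> x = [k] \<cdot> x \<oplus> [l] \<cdot> x" using A(2)[of x k l] by (simp add: add_pow_def)
  show kl: "x \<in> carrier R \<Longrightarrow> [k] \<cdot> ([l] \<cdot> x) = [(k * l)] \<cdot> x" for k l :: int and x
    using A(3)[of x l k] by (simp add: add_pow_def mult.commute)
  show "x \<in> carrier R \<Longrightarrow> y \<in> carrier R \<Longrightarrow> [k] \<cdot> x \<otimes> [l] \<cdot> y = [(k * l)] \<cdot> (x \<otimes> y)"
    using c[of y l] by (simp add: add_pow_ldistr_int add_pow_rdistr_int kl mult.commute)
  show "x \<in> carrier R \<Longrightarrow> [(1 :: int)] \<cdot> x = x" using A(4)[of x] by (simp add: add_pow_def)
  show "[(0 :: int)] \<cdot> x = \<zero>" using int_pow_0[of "add_monoid R" x] by (simp add: add_pow_def)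
  show "x \<in> carrier R \<Longrightarrow> [(- 1 :: int)] \<cdot> x = \<ominus> x" using A(5)[of x 1] A(4)[of x] by (simp add: add_pow_def a_inv_def)
qed

lemma finsum_add_pow_int:
  fixes f :: "'c \<Rightarrow> int"
  assumes "x \<in> carrier R" "finite Y"
  shows "(\<Oplus>k\<in>Y. [f k] \<cdot> x) = [sum f Y] \<cdot> x"
  using assms(2)
  by (induction Y) (simp_all add: assms(1) add_pow_int)

end

lemma finite_bounded_products: "finite S \<Longrightarrow> finite (bounded_products G S n)"
proof (induction n)
  case (Suc n)
  have "bounded_products G S (Suc n) = (\<lambda>(x, s). x \<otimes>\<^bsub>G\<^esub> s) ` (bounded_products G S n \<times> S)" by auto
  then show ?case using Suc by simp
qed simp

lemma bounded_products_carrier_update: "bounded_products (G\<lparr>carrier := H\<rparr>) S n = bounded_products G S n"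
  by (induction n) auto

lemma ip_add: "ip e (x + y) = ip e x + ip e y"
  by (cases e, cases x, cases y) (simp add: algebra_simps)

lemma finite_spin_weights: "finite spin_weights"
  by (simp add: spin_weights_def)

lemma card_spin_weights: "card spin_weights = 8"
  by (simp add: spin_weights_def card_cartesian_product)

lemma root_vector_values: "\<nu> \<in> spin_weights \<Longrightarrow> root_vector \<zeta> \<mu> \<nu> \<in> {0, 1, -1}"
  by (cases \<zeta>, cases \<nu>) (auto simp: root_vector_def spin_weights_def)

section \<open>Root elements of the spin representation\<close>

locale spin_matrices = graded_matrices R spin_weights L for R :: "('a, 'b) ring_scheme" (structure) and L +
  assumes five: "x \<in> carrier R \<Longrightarrow> x \<oplus> (x \<oplus> (x \<oplus> (x \<oplus> x))) = \<zero>"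
begin

definition E :: "vec3 \<Rightarrow> 'a \<Rightarrow> vec3 \<times> vec3 \<Rightarrow> 'a" where
  "E \<zeta> t = (\<lambda>(\<mu>, \<nu>)\<in>spin_weights \<times> spin_weights. [root_vector \<zeta> \<mu> \<nu>] \<cdot> t)"

definition Xg :: "vec3 \<Rightarrow> (vec3 \<times> vec3 \<Rightarrow> 'a) set" where
  "Xg \<zeta> = (\<lambda>t. unip (E \<zeta> t)) ` L 1"

lemma root_elem_eq: "root_elem R \<zeta> t = unip (E \<zeta> t)"
  by (rule ext) (auto simp: root_elem_def unip_def E_def mat_ring_simps)

lemma E_entry: "\<mu> \<in> spin_weights \<Longrightarrow> \<nu> \<in> spin_weights \<Longrightarrow> E \<zeta> t (\<mu>, \<nu>) = [root_vector \<zeta> \<mu> \<nu>] \<cdot> t"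
  by (simp add: E_def)

lemma E_closed [simp]: "t \<in> carrier R \<Longrightarrow> E \<zeta> t \<in> carrier M"
  by (auto simp: E_def mat_ring_simps add_pow_int)

lemma L1 [simp]: "t \<in> L 1 \<Longrightarrow> t \<in> carrier R"
  using L_carrier by blast

text \<open>Weights are stored multiplied by 2, so the root vector raises \<open>ip e\<close> by
  twice \<open>ip e \<zeta>\<close>. Value 1 on a root thus means level 2.\<close>

lemma E_Fl:
  assumes "t \<in> carrier R" "k \<le> 2 * ip e \<zeta>"
  shows "E \<zeta> t \<in> Fl (ip e) k"
  using assms by (auto simp: Fl_def E_entry root_vector_def ip_add add_pow_int split: if_splits)

lemma E_add: "t \<in> carrier R \<Longrightarrow> u \<in> carrier R \<Longrightarrow> E \<zeta> (t \<oplus> u) = E \<zeta> t \<oplus>\<^bsub>M\<^esub> E \<zeta> u"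
  by (intro mat_eqI) (simp_all add: E_entry mat_entry add_pow_int)

lemma E_smul: "c \<in> carrier R \<Longrightarrow> t \<in> carrier R \<Longrightarrow> smul c (E \<zeta> t) = E \<zeta> (c \<otimes> t)"
  by (intro mat_eqI smul_closed) (simp_all add: E_entry smul_entry add_pow_rdistr_int)

lemma E_minus: "t \<in> carrier R \<Longrightarrow> \<ominus>\<^bsub>M\<^esub> E \<zeta> t = E \<zeta> (\<ominus> t)"
  using smul_simps(7)[of "E \<zeta> t"] E_smul[of "\<ominus> \<one>" t \<zeta>] by (simp add: l_minus)

lemma E_zero: "E \<zeta> \<zero> = \<zero>\<^bsub>M\<^esub>"
  using E_smul[of \<zero> \<zero> \<zeta>] smul_simps(5)[of "E \<zeta> \<zero>"] by simp

lemma E_Ent: "t \<in> L n \<Longrightarrow> E \<zeta> t \<in> Ent n"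
proof -
  assume t: "t \<in> L n"
  then have tc: "t \<in> carrier R" using L_carrier by blast
  have "[root_vector \<zeta> \<mu> \<nu>] \<cdot> t \<in> L n" if "\<nu> \<in> spin_weights" for \<mu> \<nu>
    using root_vector_values[OF that, of \<zeta> \<mu>] t tc L_zero[of n] L_minus[of t n] by (auto simp: add_pow_int)
  then show ?thesis using tc by (auto simp: Ent_iff E_entry)
qed

lemma E_mult:
  assumes "t \<in> carrier R" "u \<in> carrier R" "\<mu> \<in> spin_weights" "\<nu> \<in> spin_weights"
  shows "(E \<zeta> t \<otimes>\<^bsub>M\<^esub> E \<eta> u) (\<mu>, \<nu>) = [rv_prod \<zeta> \<eta> \<mu> \<nu>] \<cdot> (t \<otimes> u)"
proof -
  have "(E \<zeta> t \<otimes>\<^bsub>M\<^esub> E \<eta> u) (\<mu>, \<nu>) = (\<Oplus>\<kappa>\<in>spin_weights. [(root_vector \<zeta> \<mu> \<kappa> * root_vector \<eta> \<kappa> \<nu>)] \<cdot> (t \<otimes> u))"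
    unfolding mat_entry(1)[OF assms(3,4)] using assms
    by (intro finsum_cong') (simp_all add: E_entry add_pow_int Pi_def)
  then show ?thesis using assms by (simp add: finsum_add_pow_int finite_spin_weights rv_prod_def)
qed

lemma E_square:
  assumes "\<zeta> \<in> B3_roots" "t \<in> carrier R" "u \<in> carrier R"
  shows "E \<zeta> t \<otimes>\<^bsub>M\<^esub> E \<zeta> u = \<zero>\<^bsub>M\<^esub>"
  using assms by (intro mat_eqI) (simp_all add: E_mult root_vector_square mat_entry(4) add_pow_int)

lemma E_bracket:
  assumes "t \<in> carrier R" "u \<in> carrier R" "\<mu> \<in> spin_weights" "\<nu> \<in> spin_weights"
  shows "(E \<zeta> t \<otimes>\<^bsub>M\<^esub> E \<eta> u) (\<mu>, \<nu>) = (E \<eta> u \<otimes>\<^bsub>M\<^esub> E \<zeta> t) (\<mu>, \<nu>) \<oplus> [rv_bracket \<zeta> \<eta> \<mu> \<nu>] \<cdot> (t \<otimes> u)"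
  using add_pow_int(3)[of "t \<otimes> u" "rv_prod \<eta> \<zeta> \<mu> \<nu>" "rv_bracket \<zeta> \<eta> \<mu> \<nu>"] assms
  by (simp add: E_mult rv_bracket_def m_comm[of u t])

lemma E_commute:
  assumes "\<zeta> \<in> B3_roots" "\<eta> \<in> B3_roots" "\<zeta> + \<eta> \<notin> B3_roots" "\<zeta> + \<eta> \<noteq> 0" "t \<in> carrier R" "u \<in> carrier R"
  shows "E \<zeta> t \<otimes>\<^bsub>M\<^esub> E \<eta> u = E \<eta> u \<otimes>\<^bsub>M\<^esub> E \<zeta> t"
  using assms by (intro mat_eqI) (simp_all add: E_bracket[of t u _ _ \<zeta> \<eta>] root_vector_commute add_pow_int mat_closed del: mat_entry)

lemma x_closed [simp]: "\<zeta> \<in> B3_roots \<Longrightarrow> t \<in> carrier R \<Longrightarrow> unip (E \<zeta> t) \<in> carrier GM"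
  using unip_units(1)[OF E_closed E_square] by simp

lemma x_inv: "\<zeta> \<in> B3_roots \<Longrightarrow> t \<in> carrier R \<Longrightarrow> inv\<^bsub>GM\<^esub> unip (E \<zeta> t) = unip (E \<zeta> (\<ominus> t))"
  using unip_units(2)[OF E_closed E_square] by (simp add: E_minus)

lemma x_mult:
  "\<zeta> \<in> B3_roots \<Longrightarrow> t \<in> carrier R \<Longrightarrow> u \<in> carrier R \<Longrightarrow> unip (E \<zeta> t) \<otimes>\<^bsub>GM\<^esub> unip (E \<zeta> u) = unip (E \<zeta> (t \<oplus> u))"
  by (simp add: units_of_mult unip_mult E_square E_add)

lemma x_gcomm:
  assumes "\<zeta> \<in> B3_roots" "\<eta> \<in> B3_roots" "\<zeta> + \<eta> \<notin> B3_roots" "\<zeta> + \<eta> \<noteq> 0" "t \<in> carrier R" "u \<in> carrier R"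
  shows "gcomm GM (unip (E \<zeta> t)) (unip (E \<eta> u))"
  using E_commute[OF assms] assms
  by (simp add: gcomm_def units_of_mult unip_def M.l_distr M.r_distr M.a_ac)

lemma x_gcomm_self:
  assumes "\<zeta> \<in> B3_roots" "t \<in> carrier R" "u \<in> carrier R"
  shows "gcomm GM (unip (E \<zeta> t)) (unip (E \<zeta> u))"
  using assms by (simp add: gcomm_def x_mult a_comm)

lemma gcommut_unip:
  assumes "N \<in> carrier M" "Y \<in> carrier M" "N \<otimes>\<^bsub>M\<^esub> N = \<zero>\<^bsub>M\<^esub>" "Y \<otimes>\<^bsub>M\<^esub> Y = \<zero>\<^bsub>M\<^esub>"
    "N \<otimes>\<^bsub>M\<^esub> (Y \<otimes>\<^bsub>M\<^esub> N) = \<zero>\<^bsub>M\<^esub>" "Y \<otimes>\<^bsub>M\<^esub> (N \<otimes>\<^bsub>M\<^esub> Y) = \<zero>\<^bsub>M\<^esub>"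
  shows "gcommut GM (unip N) (unip Y) = unip (N \<otimes>\<^bsub>M\<^esub> Y \<oplus>\<^bsub>M\<^esub> \<ominus>\<^bsub>M\<^esub> (Y \<otimes>\<^bsub>M\<^esub> N))"
proof -
  have z: "N \<otimes>\<^bsub>M\<^esub> (N \<otimes>\<^bsub>M\<^esub> Z) = \<zero>\<^bsub>M\<^esub>" "Y \<otimes>\<^bsub>M\<^esub> (Y \<otimes>\<^bsub>M\<^esub> Z) = \<zero>\<^bsub>M\<^esub>" if "Z \<in> carrier M" for Z
    using assms that by (simp_all add: M.m_assoc[symmetric])
  have u: "unip N \<in> carrier M" "unip Y \<in> carrier M" using assms by (simp_all add: unip_closed)
  have "unip N \<otimes>\<^bsub>M\<^esub> unip Y = \<one>\<^bsub>M\<^esub> \<oplus>\<^bsub>M\<^esub> (N \<oplus>\<^bsub>M\<^esub> (Y \<oplus>\<^bsub>M\<^esub> N \<otimes>\<^bsub>M\<^esub> Y))"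
    using assms(1,2) by (simp add: unip_def M.l_distr M.r_distr M.a_ac)
  moreover have "unip (\<ominus>\<^bsub>M\<^esub> N) \<otimes>\<^bsub>M\<^esub> unip (\<ominus>\<^bsub>M\<^esub> Y) = \<one>\<^bsub>M\<^esub> \<oplus>\<^bsub>M\<^esub> (\<ominus>\<^bsub>M\<^esub> N \<oplus>\<^bsub>M\<^esub> (\<ominus>\<^bsub>M\<^esub> Y \<oplus>\<^bsub>M\<^esub> N \<otimes>\<^bsub>M\<^esub> Y))"
    using assms(1,2) by (simp add: unip_def M.l_distr M.r_distr M.a_ac M.l_minus M.r_minus M.minus_add)
  ultimately have "gcommut GM (unip N) (unip Y) =
      (\<one>\<^bsub>M\<^esub> \<oplus>\<^bsub>M\<^esub> (\<ominus>\<^bsub>M\<^esub> N \<oplus>\<^bsub>M\<^esub> (\<ominus>\<^bsub>M\<^esub> Y \<oplus>\<^bsub>M\<^esub> N \<otimes>\<^bsub>M\<^esub> Y))) \<otimes>\<^bsub>M\<^esub> (\<one>\<^bsub>M\<^esub> \<oplus>\<^bsub>M\<^esub> (N \<oplus>\<^bsub>M\<^esub> (Y \<oplus>\<^bsub>M\<^esub> N \<otimes>\<^bsub>M\<^esub> Y)))"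
    using assms u unip_closed by (simp add: gcommut_def unip_units(2) units_of_mult M.m_assoc)
  also have "\<dots> = (\<ominus>\<^bsub>M\<^esub> N \<oplus>\<^bsub>M\<^esub> N) \<oplus>\<^bsub>M\<^esub> ((\<ominus>\<^bsub>M\<^esub> Y \<oplus>\<^bsub>M\<^esub> Y) \<oplus>\<^bsub>M\<^esub> ((N \<otimes>\<^bsub>M\<^esub> Y \<oplus>\<^bsub>M\<^esub> \<ominus>\<^bsub>M\<^esub> (N \<otimes>\<^bsub>M\<^esub> Y)) \<oplus>\<^bsub>M\<^esub>
      (\<one>\<^bsub>M\<^esub> \<oplus>\<^bsub>M\<^esub> (N \<otimes>\<^bsub>M\<^esub> Y \<oplus>\<^bsub>M\<^esub> \<ominus>\<^bsub>M\<^esub> (Y \<otimes>\<^bsub>M\<^esub> N)))))"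
    using assms by (simp add: M.l_distr M.r_distr M.l_minus M.r_minus M.m_assoc z M.a_ac)
  also have "\<dots> = unip (N \<otimes>\<^bsub>M\<^esub> Y \<oplus>\<^bsub>M\<^esub> \<ominus>\<^bsub>M\<^esub> (Y \<otimes>\<^bsub>M\<^esub> N))"
    using assms by (simp add: M.l_neg M.r_neg unip_def)
  finally show ?thesis .
qed

text \<open>\<open>e\<close> sees only the first root and \<open>f\<close> only the second, so a
  product with one of them twice raises \<open>e\<close> or \<open>f\<close> by 4 and vanishes. Only
  the linear bracket survives, and the commutator formula has a single factor.\<close>

lemma x_gcommut:
  assumes \<zeta>: "\<zeta> \<in> B3_roots" and \<eta>: "\<eta> \<in> B3_roots" and sum: "\<zeta> + \<eta> \<in> B3_roots"
    and e: "sign_weight (ip e)" "ip e \<zeta> = 1" "ip e \<eta> = 0"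
    and f: "sign_weight (ip f)" "ip f \<zeta> = 0" "ip f \<eta> = 1"
    and t: "t \<in> carrier R" "u \<in> carrier R"
  shows "\<exists>r\<in>carrier R. gcommut GM (unip (E \<zeta> t)) (unip (E \<eta> u)) = unip (E (\<zeta> + \<eta>) r)"
proof -
  obtain s where s: "\<forall>\<mu>\<in>spin_weights. \<forall>\<nu>\<in>spin_weights. rv_bracket \<zeta> \<eta> \<mu> \<nu> =
    s * (if ip \<zeta> \<zeta> = 1 \<and> ip \<eta> \<eta> = 1 then 2 else 1) * root_vector (\<zeta> + \<eta>) \<mu> \<nu>"
    using root_vector_bracket[OF \<zeta> \<eta> sum] by blast
  define c where "c = s * (if ip \<zeta> \<zeta> = 1 \<and> ip \<eta> \<eta> = 1 then 2 else 1)"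
  define r where "r = [c] \<cdot> (t \<otimes> u)"
  have rc: "r \<in> carrier R" using t by (simp add: r_def add_pow_int)
  have F: "E \<zeta> t \<in> Fl (ip e) 2" "E \<eta> u \<in> Fl (ip e) 0" "E \<eta> u \<in> Fl (ip f) 2" "E \<zeta> t \<in> Fl (ip f) 0"
    using e f t by (auto intro!: E_Fl)
  have "E \<zeta> t \<otimes>\<^bsub>M\<^esub> (E \<eta> u \<otimes>\<^bsub>M\<^esub> E \<zeta> t) \<in> Fl (ip e) (2 + (0 + 2))"
    "E \<eta> u \<otimes>\<^bsub>M\<^esub> (E \<zeta> t \<otimes>\<^bsub>M\<^esub> E \<eta> u) \<in> Fl (ip f) (2 + (0 + 2))" by (intro Fl_mult F)+
  then have z: "E \<zeta> t \<otimes>\<^bsub>M\<^esub> (E \<eta> u \<otimes>\<^bsub>M\<^esub> E \<zeta> t) = \<zero>\<^bsub>M\<^esub>" "E \<eta> u \<otimes>\<^bsub>M\<^esub> (E \<zeta> t \<otimes>\<^bsub>M\<^esub> E \<eta> u) = \<zero>\<^bsub>M\<^esub>"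
    using Fl_zero[OF e(1), of "2 + (0 + 2)"] Fl_zero[OF f(1), of "2 + (0 + 2)"] by simp_all
  have "E \<zeta> t \<otimes>\<^bsub>M\<^esub> E \<eta> u \<oplus>\<^bsub>M\<^esub> \<ominus>\<^bsub>M\<^esub> (E \<eta> u \<otimes>\<^bsub>M\<^esub> E \<zeta> t) = E (\<zeta> + \<eta>) r"
  proof (intro mat_eqI M.a_closed M.a_inv_closed M.m_closed E_closed t rc)
    fix \<mu> \<nu> assume mn: "\<mu> \<in> spin_weights" "\<nu> \<in> spin_weights"
    have cl: "(E \<eta> u \<otimes>\<^bsub>M\<^esub> E \<zeta> t) (\<mu>, \<nu>) \<in> carrier R" using mn t by (simp add: mat_closed)
    have "[rv_bracket \<zeta> \<eta> \<mu> \<nu>] \<cdot> (t \<otimes> u) = E (\<zeta> + \<eta>) r (\<mu>, \<nu>)"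
      using mn t s by (simp add: E_entry c_def[symmetric] r_def add_pow_int mult.commute)
    then show "(E \<zeta> t \<otimes>\<^bsub>M\<^esub> E \<eta> u \<oplus>\<^bsub>M\<^esub> \<ominus>\<^bsub>M\<^esub> (E \<eta> u \<otimes>\<^bsub>M\<^esub> E \<zeta> t)) (\<mu>, \<nu>) = E (\<zeta> + \<eta>) r (\<mu>, \<nu>)"
      using mn t cl E_bracket[OF t mn, of \<zeta> \<eta>] rc
      by (simp add: mat_entry(2) mat_minus_entry mat_closed a_assoc r_neg1 a_comm[of _ "\<ominus> _"] r_neg2)
  qed
  then show ?thesis using gcommut_unip[OF E_closed E_closed E_square E_square z] t \<zeta> \<eta> rc by auto
qed

lemma x_Ug: "t \<in> carrier R \<Longrightarrow> ip e \<zeta> = 1 \<Longrightarrow> unip (E \<zeta> t) \<in> Ug (ip e)"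
  unfolding Ug_def by (intro imageI E_Fl) auto

lemma x_Dg:
  assumes "\<zeta> \<in> B3_roots" "t \<in> carrier R" "ip e \<zeta> \<ge> 0"
  shows "unip (E \<zeta> t) \<in> Dg (ip e)"
  unfolding Dg_def using assms by (auto simp: x_inv intro!: unip_Fl[of _ _ 0] E_Fl)

lemma Xg_subgroup:
  assumes "\<zeta> \<in> B3_roots"
  shows "subgroup (Xg \<zeta>) GM"
proof (rule GM.subgroupI)
  show "Xg \<zeta> \<noteq> {}" using L_zero by (auto simp: Xg_def)
qed (use assms in \<open>auto simp: Xg_def x_inv x_mult intro!: imageI L_add L_minus\<close>)

lemma Xg_finite: "finite (Xg \<zeta>)"
  by (simp add: Xg_def L_finite)

lemma x_five:
  assumes "\<zeta> \<in> B3_roots" "t \<in> carrier R"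
  shows "unip (E \<zeta> t) [^]\<^bsub>GM\<^esub> (5::nat) = \<one>\<^bsub>GM\<^esub>"
proof -
  have "unip (E \<zeta> t) [^]\<^bsub>GM\<^esub> (5::nat) = unip (E \<zeta> (t \<oplus> t \<oplus> t \<oplus> t \<oplus> t))"
    using assms by (simp add: eval_nat_numeral x_mult)
  also have "t \<oplus> t \<oplus> t \<oplus> t \<oplus> t = \<zero>" using five[OF assms(2)] assms(2) by (simp add: a_assoc)
  finally show ?thesis by (simp add: E_zero unip_zero units_of_one)
qed

lemma Xg_layer:
  assumes \<zeta>: "\<zeta> \<in> B3_roots" and e: "sign_weight (ip e)" "ip e \<zeta> = 1"
    and J: "J \<subseteq> B3_roots" "J \<noteq> {}" "\<And>\<eta>. \<eta> \<in> J \<Longrightarrow> ip e \<eta> = 0"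
    and gen: "generate GM (\<Union> (Xg ` J)) \<subseteq> bounded_products GM (\<Union> (Xg ` J)) l"
  shows "generate GM (Xg \<zeta> \<union> \<Union> (Xg ` J)) \<subseteq> bounded_products GM (Xg \<zeta> \<union> \<Union> (Xg ` J)) (layer_bound 8 l)"
proof -
  have "Xg \<zeta> = unip ` (E \<zeta> ` L 1)" by (auto simp: Xg_def)
  have sub: "subgroup (Xg \<eta>) GM" if "\<eta> \<in> J" for \<eta> using Xg_subgroup J that by blast
  have "generate GM (unip ` (E \<zeta> ` L 1) \<union> \<Union> (Xg ` J)) \<subseteq>
    bounded_products GM (unip ` (E \<zeta> ` L 1) \<union> \<Union> (Xg ` J)) (layer_bound (card spin_weights) l)"
  proof (rule layer_bounded_generation[OF e(1) _ _ _ _ gen])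
    show "\<Union> (Xg ` J) \<subseteq> Dg (ip e)" using J(1,3) by (auto simp: Xg_def intro!: x_Dg)
    show "\<Union> (Xg ` J) \<subseteq> Ent 1"
      by (auto simp: Xg_def unip_def intro!: Ent_add Ent_one E_Ent)
    show "\<one>\<^bsub>GM\<^esub> \<in> \<Union> (Xg ` J)" using J(2) sub subgroup.one_closed by blast
    show "inv\<^bsub>GM\<^esub> s \<in> \<Union> (Xg ` J)" if "s \<in> \<Union> (Xg ` J)" for s using that sub subgroup.m_inv_closed by fast
    show "E \<zeta> ` L 1 \<subseteq> Fl (ip e) 2" using e by (auto intro!: E_Fl)
    show "E \<zeta> ` L 1 \<subseteq> Ent 1" by (auto intro!: E_Ent)
    show "smul c N \<in> E \<zeta> ` L 1" if "c \<in> L 0" "N \<in> E \<zeta> ` L 1" for c N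
      using that L_mult[of c 0 _ 1] by (auto simp: E_smul L0)
  qed
  then show ?thesis by (simp add: \<open>Xg \<zeta> = _\<close> card_spin_weights)
qed

section \<open>The group generated by three root groups\<close>

context
  fixes \<alpha> \<beta> \<gamma> :: vec3
  assumes roots: "\<alpha> \<in> B3_roots" "\<beta> \<in> B3_roots" "\<gamma> \<in> B3_roots"
begin

definition Hg :: "(vec3 \<times> vec3 \<Rightarrow> 'a) set" where
  "Hg = generate GM (Xg \<alpha> \<union> Xg \<beta> \<union> Xg \<gamma>)"

abbreviation LG :: "(vec3 \<times> vec3 \<Rightarrow> 'a) monoid" where
  "LG \<equiv> GM\<lparr>carrier := Hg\<rparr>"

lemma Xg_subset: "Xg \<alpha> \<subseteq> carrier GM" "Xg \<beta> \<subseteq> carrier GM" "Xg \<gamma> \<subseteq> carrier GM"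
  using Xg_subgroup roots subgroup.subset by blast+

lemma Hg_subgroup: "subgroup Hg GM"
  unfolding Hg_def using Xg_subset by (intro GM.generate_is_subgroup) blast

lemma LG_group: "group LG"
  using Hg_subgroup by (rule GM.subgroup_imp_group)

lemma Xg_Hg: "Xg \<alpha> \<subseteq> Hg" "Xg \<beta> \<subseteq> Hg" "Xg \<gamma> \<subseteq> Hg"
  unfolding Hg_def by (auto intro: generate.incl)

lemma gconj_LG: "y \<in> Hg \<Longrightarrow> gconj LG x y = gconj GM x y"
  by (simp add: gconj_def GM.m_inv_consistent[OF Hg_subgroup])

lemma gcommut_LG: "x \<in> Hg \<Longrightarrow> y \<in> Hg \<Longrightarrow> gcommut LG x y = gcommut GM x y"
  by (simp add: gcommut_def GM.m_inv_consistent[OF Hg_subgroup])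

lemma gcomm_LG: "gcomm LG x y = gcomm GM x y"
  by (simp add: gcomm_def)

lemma pow_LG: "x [^]\<^bsub>LG\<^esub> (n::nat) = x [^]\<^bsub>GM\<^esub> n"
  by (simp add: nat_pow_def)

lemma Hg_closed:
  "x \<in> Hg \<Longrightarrow> y \<in> Hg \<Longrightarrow> gconj GM x y \<in> Hg" "x \<in> Hg \<Longrightarrow> y \<in> Hg \<Longrightarrow> gcommut GM x y \<in> Hg"
  "x \<in> Hg \<Longrightarrow> y \<in> Hg \<Longrightarrow> x \<otimes>\<^bsub>GM\<^esub> y \<in> Hg" "x \<in> Hg \<Longrightarrow> x [^]\<^bsub>GM\<^esub> (n::nat) \<in> Hg"
proof -
  show m: "x \<in> Hg \<Longrightarrow> y \<in> Hg \<Longrightarrow> x \<otimes>\<^bsub>GM\<^esub> y \<in> Hg" for x y by (rule subgroup.m_closed[OF Hg_subgroup])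
  have i: "x \<in> Hg \<Longrightarrow> inv\<^bsub>GM\<^esub> x \<in> Hg" for x by (rule subgroup.m_inv_closed[OF Hg_subgroup])
  show "x \<in> Hg \<Longrightarrow> y \<in> Hg \<Longrightarrow> gconj GM x y \<in> Hg" "x \<in> Hg \<Longrightarrow> y \<in> Hg \<Longrightarrow> gcommut GM x y \<in> Hg"
    unfolding gconj_def gcommut_def by (intro m i; assumption)+
  show "x \<in> Hg \<Longrightarrow> x [^]\<^bsub>GM\<^esub> n \<in> Hg"
    using subgroup.one_closed[OF Hg_subgroup] m by (induction n) auto
qed

lemma Xg_LG_subgroup: "subgroup (Xg \<alpha>) LG" "subgroup (Xg \<beta>) LG" "subgroup (Xg \<gamma>) LG"
  using GM.subgroup_incl[OF _ Hg_subgroup] Xg_subgroup roots Xg_Hg by blast+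

lemma generate_LG: "S \<subseteq> Hg \<Longrightarrow> generate LG S = generate GM S"
  using GM.generate_consistent[OF _ Hg_subgroup] by simp

text \<open>The group of \<gamma> needs one letter. \<open>f\<close> makes \<beta> a layer above it,
  and \<open>e\<close> makes \<alpha> a layer above the rest, so the layer bound is applied twice; 8
  is the dimension of the spin representation.\<close>

lemma Xg_boundedly_generated:
  assumes e: "sign_weight (ip e)" "ip e \<alpha> = 1" "ip e \<beta> = 0" "ip e \<gamma> = 0"
    and f: "sign_weight (ip f)" "ip f \<beta> = 1" "ip f \<gamma> = 0"
  shows "boundedly_generated (layer_bound 8 (layer_bound 8 1)) LG (Xg \<alpha>) (Xg \<beta>) (Xg \<gamma>)"
    and "finite (carrier LG)"
proof -
  let ?l = "layer_bound 8 1"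
  have ge: "k \<le> layer_bound 8 k" for k by (simp add: layer_bound_def)
  have one: "generate GM (Xg \<zeta>) \<subseteq> bounded_products GM (Xg \<zeta>) 1" if "\<zeta> \<in> B3_roots" for \<zeta>
    using GM.generate_subgroup_incl[OF subset_refl Xg_subgroup[OF that]] subgroup.subset[OF Xg_subgroup[OF that]]
    by force
  have mono: "bounded_products GM S k \<subseteq> bounded_products GM S (layer_bound 8 k)"
    if "S \<subseteq> carrier GM" "subgroup U GM" "U \<subseteq> S" for S U k
    using that by (intro GM.bounded_products_mono ge) (auto dest: subgroup.one_closed)
  have bc: "generate GM (Xg \<beta> \<union> Xg \<gamma>) \<subseteq> bounded_products GM (Xg \<beta> \<union> Xg \<gamma>) ?l"
    using Xg_layer[OF roots(2) f(1,2), of "{\<gamma>}"] roots f(3) one by simp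
  have ab: "generate GM (Xg \<alpha> \<union> Xg \<beta>) \<subseteq> bounded_products GM (Xg \<alpha> \<union> Xg \<beta>) ?l"
    using Xg_layer[OF roots(1) e(1,2), of "{\<beta>}"] roots e one by simp
  have ac: "generate GM (Xg \<alpha> \<union> Xg \<gamma>) \<subseteq> bounded_products GM (Xg \<alpha> \<union> Xg \<gamma>) ?l"
    using Xg_layer[OF roots(1) e(1,2), of "{\<gamma>}"] roots e one by simp
  have abc: "Hg \<subseteq> bounded_products GM (Xg \<alpha> \<union> Xg \<beta> \<union> Xg \<gamma>) (layer_bound 8 ?l)"
    using Xg_layer[OF roots(1) e(1,2), of "{\<beta>, \<gamma>}"] roots e bc by (auto simp: Hg_def Un_assoc)
  show "boundedly_generated (layer_bound 8 ?l) LG (Xg \<alpha>) (Xg \<beta>) (Xg \<gamma>)"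
    unfolding boundedly_generated_def bounded_products_carrier_update
  proof (intro conjI)
    show "carrier LG \<subseteq> bounded_products GM (Xg \<alpha> \<union> Xg \<beta> \<union> Xg \<gamma>) (layer_bound 8 ?l)" using abc by simp
    show "generate LG (Xg \<beta> \<union> Xg \<gamma>) \<subseteq> bounded_products GM (Xg \<beta> \<union> Xg \<gamma>) (layer_bound 8 ?l)"
      using bc mono[of "Xg \<beta> \<union> Xg \<gamma>" "Xg \<beta>" ?l] Xg_subset Xg_Hg Xg_subgroup roots by (simp add: generate_LG; blast)
    show "generate LG (Xg \<alpha> \<union> Xg \<gamma>) \<subseteq> bounded_products GM (Xg \<alpha> \<union> Xg \<gamma>) (layer_bound 8 ?l)"
      using ac mono[of "Xg \<alpha> \<union> Xg \<gamma>" "Xg \<alpha>" ?l] Xg_subset Xg_Hg Xg_subgroup roots by (simp add: generate_LG; blast)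
    show "generate LG (Xg \<alpha> \<union> Xg \<beta>) \<subseteq> bounded_products GM (Xg \<alpha> \<union> Xg \<beta>) (layer_bound 8 ?l)"
      using ab mono[of "Xg \<alpha> \<union> Xg \<beta>" "Xg \<alpha>" ?l] Xg_subset Xg_Hg Xg_subgroup roots by (simp add: generate_LG; blast)
  qed
  show "finite (carrier LG)"
    using finite_subset[OF abc finite_bounded_products] by (simp add: Xg_finite)
qed

lemma Xg_common_rel:
  assumes "finite (carrier LG)" "\<alpha> + \<gamma> \<notin> B3_roots" "\<alpha> + \<gamma> \<noteq> 0"
  shows "common_rel LG (Xg \<alpha>) (Xg \<beta>) (Xg \<gamma>)"
  unfolding common_rel_def
proof (intro conjI LG_group Xg_LG_subgroup ballI)
  fix x assume "x \<in> Xg \<alpha> \<union> Xg \<beta> \<union> Xg \<gamma>"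
  then show "x [^]\<^bsub>LG\<^esub> (5::nat) = \<one>\<^bsub>LG\<^esub>" using roots by (auto simp: pow_LG Xg_def x_five)
qed (use assms roots in \<open>auto simp: gcomm_LG Xg_def intro: x_gcomm x_gcomm_self\<close>)

lemma Xg_gcommut:
  assumes "\<zeta> \<in> B3_roots" "\<eta> \<in> B3_roots" "\<zeta> + \<eta> \<in> B3_roots" "x \<in> Xg \<zeta>" "y \<in> Xg \<eta>"
    "sign_weight (ip e)" "ip e \<zeta> = 1" "ip e \<eta> = 0" "sign_weight (ip f)" "ip f \<zeta> = 0" "ip f \<eta> = 1"
  shows "\<exists>r\<in>carrier R. gcommut GM x y = unip (E (\<zeta> + \<eta>) r)"
  using assms x_gcommut[OF assms(1-3,6-11)] by (auto simp: Xg_def)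

end

lemma sign_weight_unit:
  "sign_weight (ip (1, 0, 0))" "sign_weight (ip (0, 1, 0))" "sign_weight (ip (0, 0, 1))"
  "sign_weight (ip (-1, 0, 0))" "sign_weight (ip (0, -1, 0))" "sign_weight (ip (0, 0, -1))"
  unfolding sign_weight_def by (auto simp: spin_weights_def)

lemma Dg_gconj: "x \<in> Dg \<phi> \<Longrightarrow> y \<in> Dg \<phi> \<Longrightarrow> gconj GM x y \<in> Dg \<phi>"
  unfolding gconj_def
  by (intro subgroup.m_closed[OF Dg_subgroup] subgroup.m_inv_closed[OF Dg_subgroup])

lemma Dg_mult: "x \<in> Dg \<phi> \<Longrightarrow> y \<in> Dg \<phi> \<Longrightarrow> x \<otimes>\<^bsub>GM\<^esub> y \<in> Dg \<phi>"
  by (rule subgroup.m_closed[OF Dg_subgroup])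

lemma five_M: "N \<in> carrier M \<Longrightarrow> N \<oplus>\<^bsub>M\<^esub> (N \<oplus>\<^bsub>M\<^esub> (N \<oplus>\<^bsub>M\<^esub> (N \<oplus>\<^bsub>M\<^esub> N))) = \<zero>\<^bsub>M\<^esub>"
  by (intro mat_eqI) (simp_all add: mat_entry mat_closed five)

section \<open>Verification of the relations for the two links\<close>

lemma lg_spin:
  defines "G \<equiv> LG root_alpha root_beta root_psi"
  shows "lg_rel G (Xg root_alpha) (Xg root_beta) (Xg root_psi)"
    "boundedly_generated (layer_bound 8 (layer_bound 8 1)) G (Xg root_alpha) (Xg root_beta) (Xg root_psi)"
proof -
  define a b c where abc: "a = root_alpha" "b = root_beta" "c = root_psi"
  note dd = abc root_alpha_def root_beta_def root_psi_def
  have roots: "a \<in> B3_roots" "b \<in> B3_roots" "c \<in> B3_roots" by (simp_all add: dd B3_roots_def)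
  have s: "a + b \<in> B3_roots" "a + c \<notin> B3_roots" "a + c \<noteq> 0" by (simp_all add: dd B3_roots_def zero_prod_def)
  \<comment> \<open>\<open>?e\<close> puts the group of \<open>a\<close> into an abelian radical
    that \<open>b\<close> and \<open>c\<close> normalize. \<open>?f\<close> makes the conjugates of
    \<open>b\<close> by \<open>c\<close> abelian; as it is -1 on \<open>a\<close>, three commutators
    with such conjugates leave its range. \<open>?g\<close> separates \<open>b\<close> from
    \<open>a\<close>, as \<open>Xg_gcommut\<close> demands.\<close>
  let ?e = "(1, 0, 0) :: vec3" and ?f = "(0, 1, 0) :: vec3" and ?g = "(0, 0, -1) :: vec3"
  have e: "ip ?e a = 1" "ip ?e b = 0" "ip ?e c = 0" "ip ?f a = -1" "ip ?f b = 1" "ip ?f c = 0"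
    "ip ?g a = 0" "ip ?g b = 1" by (simp_all add: dd)
  note bg = Xg_boundedly_generated[OF roots sign_weight_unit(1) e(1-3) sign_weight_unit(2) e(5,6)]
  have G: "G = LG a b c" by (simp add: G_def abc)
  show "boundedly_generated (layer_bound 8 (layer_bound 8 1)) G (Xg root_alpha) (Xg root_beta) (Xg root_psi)"
    using bg(1) by (simp add: G abc)
  note H = Xg_Hg[OF roots] Xg_Hg[OF roots, THEN subsetD]
  note T = G gconj_LG[OF roots] gcommut_LG[OF roots] gcomm_LG[OF roots]
  have com: "\<exists>r\<in>carrier R. gcommut GM x y = unip (E (a + b) r)" if "x \<in> Xg a" "y \<in> Xg b" for x y
    using that roots s e by (intro Xg_gcommut[where e = ?e and f = ?g] sign_weight_unit)
  have AU: "x \<in> Ug (ip ?e)" if "x \<in> Xg a" for x using that e by (auto simp: Xg_def intro: x_Ug)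
  have AD: "x \<in> Dg (ip ?e)" if "x \<in> Xg a" for x using that e roots by (auto simp: Xg_def intro!: x_Dg)
  have BD: "x \<in> Dg (ip ?e)" if "x \<in> Xg b \<union> Xg c" for x using that e roots by (auto simp: Xg_def intro!: x_Dg)
  have BU: "x \<in> Ug (ip ?f)" if "x \<in> Xg b" for x using that e by (auto simp: Xg_def intro: x_Ug)
  have CD: "x \<in> Dg (ip ?f)" if "x \<in> Xg c" for x using that e roots by (auto simp: Xg_def intro!: x_Dg)
  have conj: "v \<in> Dg (ip ?e) \<and> v \<in> Ug (ip ?f) \<and> v \<in> Hg a b c" if "v \<in> conjugates G (Xg b) (Xg c)" for v
  proof -
    from that obtain x y where v: "v = gconj GM x y" "x \<in> Xg b" "y \<in> Xg c"
      using H by (auto simp: conjugates_def T)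
    then show ?thesis
      using Dg_gconj BD gconj_Ug[OF sign_weight_unit(2) BU CD] Hg_closed(1)[OF roots] H by auto
  qed
  show "lg_rel G (Xg root_alpha) (Xg root_beta) (Xg root_psi)"
    unfolding lg_rel_def abc[symmetric]
  proof (intro conjI ballI)
    show "common_rel G (Xg a) (Xg b) (Xg c)" unfolding G by (intro Xg_common_rel roots s bg(2))
    fix x assume x: "x \<in> Xg a"
    {
      fix x' y assume x': "x' \<in> Xg a" and y: "y \<in> Xg b"
      have "a + (a + b) \<notin> B3_roots" "a + (a + b) \<noteq> 0" by (simp_all add: dd B3_roots_def zero_prod_def)
      then have "gcomm GM x' (gcommut GM x y)"
        using com[OF x y] x' x_gcomm[OF roots(1) s(1)] by (auto simp: Xg_def)
      then show "gcomm G x' (gcommut G x y)" using x y H by (auto simp: T)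
    }
    {
      fix y assume y: "y \<in> Xg b"
      have "b + (a + b) \<notin> B3_roots" "b + (a + b) \<noteq> 0" by (simp_all add: dd B3_roots_def zero_prod_def)
      then have "gcomm GM y (gcommut GM x y)"
        using com[OF x y] y x_gcomm[OF roots(2) s(1)] by (auto simp: Xg_def)
      then show "gcomm G y (gcommut G x y)" using x y H by (auto simp: T)
    }
    fix x' v w assume x': "x' \<in> Xg a" and vw: "v \<in> conjugates G (Xg b) (Xg c)" "w \<in> conjugates G (Xg b) (Xg c)"
    note v = conj[OF vw(1)] and w = conj[OF vw(2)]
    have vw': "v \<otimes>\<^bsub>GM\<^esub> w \<in> Dg (ip ?e)" "v \<otimes>\<^bsub>GM\<^esub> w \<in> Hg a b c"
      using v w Dg_mult Hg_closed(3)[OF roots] by auto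
    have "gcomm GM x (gconj GM x' (v \<otimes>\<^bsub>GM\<^esub> w))"
      using gconj_Ug[OF sign_weight_unit(1) AU[OF x'] vw'(1)] AU[OF x] by (intro Ug_gcomm[OF sign_weight_unit(1)])
    then show "gcomm G x (gconj G x' (v \<otimes>\<^bsub>G\<^esub> w))" using vw'(2) by (simp add: T)
  next
    fix y y' z assume y: "y \<in> Xg b" "y' \<in> Xg b" "z \<in> Xg c"
    have "gcomm GM y (gconj GM y' z)"
      using gconj_Ug[OF sign_weight_unit(2) BU[OF y(2)] CD[OF y(3)]] BU[OF y(1)]
      by (intro Ug_gcomm[OF sign_weight_unit(2)])
    then show "gcomm G y (gconj G y' z)" using H y by (auto simp: T)
  next
    fix x u v w assume x: "x \<in> Xg a" and
      uvw: "u \<in> conjugates G (Xg b) (Xg c)" "v \<in> conjugates G (Xg b) (Xg c)" "w \<in> conjugates G (Xg b) (Xg c)"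
    note u = conj[OF uvw(1)] and v = conj[OF uvw(2)] and w = conj[OF uvw(3)]
    have xH: "x \<in> Hg a b c" using x H by blast
    have xu: "gcommut GM x u \<in> Ug (ip ?e)" using gcommut_Ug(1)[OF sign_weight_unit(1) AU[OF x]] u by blast
    have vw': "v \<otimes>\<^bsub>GM\<^esub> w \<in> Dg (ip ?e)" "v \<otimes>\<^bsub>GM\<^esub> w \<in> Hg a b c"
      using v w Dg_mult Hg_closed(3)[OF roots] by auto
    have "gcomm GM (gcommut GM x u) (gconj GM (gcommut GM x u) (v \<otimes>\<^bsub>GM\<^esub> w))"
      using gconj_Ug[OF sign_weight_unit(1) xu vw'(1)] xu by (intro Ug_gcomm[OF sign_weight_unit(1)])
    then show "gcomm G (gcommut G x u) (gconj G (gcommut G x u) (v \<otimes>\<^bsub>G\<^esub> w))"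
      using vw'(2) xH u by (simp add: T)
    obtain t where t: "t \<in> carrier R" "x = unip (E a t)" using x L1 unfolding Xg_def by blast
    have "gcommut GM (gcommut GM (gcommut GM x u) v) w = \<one>\<^bsub>GM\<^esub>"
      unfolding t(2) using t(1) e u v w
      by (intro gcommut_triple[OF sign_weight_unit(1) sign_weight_unit(2)] E_Fl) auto
    then show "gcommut G (gcommut G (gcommut G x u) v) w = \<one>\<^bsub>G\<^esub>"
      using xH u v w Hg_closed(2)[OF roots] by (simp add: T)
  qed
qed

lemma sm_spin:
  defines "G \<equiv> LG root_beta root_psi root_omega"
  shows "sm_rel G (Xg root_beta) (Xg root_psi) (Xg root_omega)"
    "boundedly_generated (layer_bound 8 (layer_bound 8 1)) G (Xg root_beta) (Xg root_psi) (Xg root_omega)"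
proof -
  define a b c where abc: "a = root_beta" "b = root_psi" "c = root_omega"
  note dd = abc root_alpha_def root_beta_def root_psi_def root_omega_def
  have roots: "a \<in> B3_roots" "b \<in> B3_roots" "c \<in> B3_roots" by (simp_all add: dd B3_roots_def)
  have s: "b + c \<in> B3_roots" "a + c \<notin> B3_roots" "a + c \<noteq> 0" "a + (b + c) \<in> B3_roots"
    by (simp_all add: dd B3_roots_def zero_prod_def)
  \<comment> \<open>\<open>?e\<close> makes all conjugates of \<open>a\<close> by the group of
    \<open>b\<close> and \<open>c\<close> abelian. \<open>?f\<close> is -1 on \<open>a\<close> and 1
    on \<open>b\<close>, which provides the three levels of \<open>conj_product\<close>.
    \<open>?g\<close> is 1 on \<open>c\<close> and 0 on the other two, so together with
    \<open>?f\<close> it serves the commutator of \<open>b\<close> and \<open>c\<close>.\<close>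
  let ?e = "(0, 1, 0) :: vec3" and ?f = "(0, 0, 1) :: vec3" and ?g = "(-1, 0, 0) :: vec3"
  have e: "ip ?e a = 1" "ip ?e b = 0" "ip ?e c = 0" "ip ?f a = -1" "ip ?f b = 1" "ip ?f c = 0"
    "ip ?g a = 0" "ip ?g b = 0" "ip ?g c = 1" by (simp_all add: dd)
  note bg = Xg_boundedly_generated[OF roots sign_weight_unit(2) e(1-3) sign_weight_unit(3) e(5,6)]
  have G: "G = LG a b c" by (simp add: G_def abc)
  show "boundedly_generated (layer_bound 8 (layer_bound 8 1)) G (Xg root_beta) (Xg root_psi) (Xg root_omega)"
    using bg(1) by (simp add: G abc)
  note H = Xg_Hg[OF roots] Xg_Hg[OF roots, THEN subsetD]
  note T = G gconj_LG[OF roots] gcommut_LG[OF roots] gcomm_LG[OF roots] pow_LG[OF roots]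
  have com: "\<exists>r\<in>carrier R. gcommut GM x y = unip (E (b + c) r)" if "x \<in> Xg b" "y \<in> Xg c" for x y
    using that roots s e by (intro Xg_gcommut[where e = ?f and f = ?g] sign_weight_unit)
  have AU: "x \<in> Ug (ip ?e)" if "x \<in> Xg a" for x using that e by (auto simp: Xg_def intro: x_Ug)
  have BCD: "Xg b \<union> Xg c \<subseteq> Dg (ip ?e)" using e roots by (auto simp: Xg_def intro!: x_Dg)
  have genD: "x \<in> Dg (ip ?e)" "x \<in> Hg a b c" if "x \<in> generate G (Xg b \<union> Xg c)" for x
  proof -
    have x: "x \<in> generate GM (Xg b \<union> Xg c)" using that H by (simp add: G generate_LG[OF roots])
    show "x \<in> Dg (ip ?e)" using x GM.generate_subgroup_incl[OF BCD Dg_subgroup] by blast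
    show "x \<in> Hg a b c" using x GM.generate_subgroup_incl[OF _ Hg_subgroup[OF roots], of "Xg b \<union> Xg c"] H by blast
  qed
  show "sm_rel G (Xg root_beta) (Xg root_psi) (Xg root_omega)"
    unfolding sm_rel_def abc[symmetric]
  proof (intro conjI ballI)
    show "common_rel G (Xg a) (Xg b) (Xg c)" unfolding G by (intro Xg_common_rel roots s bg(2))
  next
    fix y y' z assume y: "y \<in> Xg b" "y' \<in> Xg b" "z \<in> Xg c"
    have "b + (b + c) \<notin> B3_roots" "b + (b + c) \<noteq> 0" by (simp_all add: dd B3_roots_def zero_prod_def)
    then have "gcomm GM y' (gcommut GM y z)"
      using com[OF y(1,3)] y(2) x_gcomm[OF roots(2) s(1)] by (auto simp: Xg_def)
    then show "gcomm G y' (gcommut G y z)" using y H by (auto simp: T)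
  next
    fix y z z' assume y: "y \<in> Xg b" "z \<in> Xg c" "z' \<in> Xg c"
    have "c + (b + c) \<notin> B3_roots" "c + (b + c) \<noteq> 0" by (simp_all add: dd B3_roots_def zero_prod_def)
    then have "gcomm GM z' (gcommut GM y z)"
      using com[OF y(1,2)] y(3) x_gcomm[OF roots(3) s(1)] by (auto simp: Xg_def)
    then show "gcomm G z' (gcommut G y z)" using y H by (auto simp: T)
  next
    fix x x' y assume x: "x \<in> Xg a" "x' \<in> Xg a" and y: "y \<in> Xg b"
    have "gcomm GM x (gconj GM x' y)"
      using gconj_Ug[OF sign_weight_unit(2) AU[OF x(2)]] AU[OF x(1)] BCD y
      by (intro Ug_gcomm[OF sign_weight_unit(2)]) auto
    then show "gcomm G x (gconj G x' y)" using y H by (auto simp: T)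
  next
    fix x y assume x: "x \<in> Xg a" and y: "y \<in> Xg b"
    obtain t where t: "t \<in> carrier R" "x = unip (E a t)" using x L1 unfolding Xg_def by blast
    have "y \<in> Ug (ip ?f)" using y e by (auto simp: Xg_def intro: x_Ug)
    moreover have "E a t \<in> Fl (ip ?e) 2" "E a t \<in> Fl (ip ?f) (- 2)" using t(1) e by (auto intro!: E_Fl)
    moreover have "y \<in> Dg (ip ?e)" using y BCD by blast
    ultimately have "x \<otimes>\<^bsub>GM\<^esub> (gconj GM x y \<otimes>\<^bsub>GM\<^esub> gconj GM x (y [^]\<^bsub>GM\<^esub> (2::nat)) \<otimes>\<^bsub>GM\<^esub>
      gconj GM x (y [^]\<^bsub>GM\<^esub> (3::nat)) \<otimes>\<^bsub>GM\<^esub> gconj GM x (y [^]\<^bsub>GM\<^esub> (4::nat))) = \<one>\<^bsub>GM\<^esub>"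
      unfolding t(2) by (intro conj_product[OF sign_weight_unit(2,3)] five_M)
    moreover have "y \<in> Hg a b c" using y H by blast
    ultimately show "x \<otimes>\<^bsub>G\<^esub> (gconj G x y \<otimes>\<^bsub>G\<^esub> gconj G x (y [^]\<^bsub>G\<^esub> (2::nat)) \<otimes>\<^bsub>G\<^esub>
      gconj G x (y [^]\<^bsub>G\<^esub> (3::nat)) \<otimes>\<^bsub>G\<^esub> gconj G x (y [^]\<^bsub>G\<^esub> (4::nat))) = \<one>\<^bsub>G\<^esub>"
      using Hg_closed(4)[OF roots] by (simp add: T)
  next
    fix x x' g h assume x: "x \<in> Xg a" "x' \<in> Xg a"
      and g: "g \<in> generate G (Xg b \<union> Xg c)" "h \<in> generate G (Xg b \<union> Xg c)"
    have "gcomm GM (gconj GM x g) (gconj GM x' h)"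
      using gconj_Ug[OF sign_weight_unit(2) AU] genD g x by (intro Ug_gcomm[OF sign_weight_unit(2)]) auto
    then show "gcomm G (gconj G x g) (gconj G x' h)" using genD g by (simp add: T)
  next
    fix x y z assume x: "x \<in> Xg a" and y: "y \<in> Xg b" and z: "z \<in> Xg c"
    obtain t where t: "t \<in> carrier R" "x = unip (E a t)" using x L1 unfolding Xg_def by blast
    obtain r where r: "r \<in> carrier R" "gcommut GM y z = unip (E (b + c) r)" using com[OF y z] by blast
    have eb: "ip ?e (b + c) = 0" "ip ?g (b + c) = 1" by (simp_all add: ip_add e)
    obtain u where u: "u \<in> carrier R" "gcommut GM x (gcommut GM y z) = unip (E (a + (b + c)) u)"
      using x_gcommut[OF roots(1) s(1,4) sign_weight_unit(2) e(1) eb(1) sign_weight_unit(4) e(7) eb(2) t(1) r(1)]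
      unfolding t(2) r(2) by blast
    have H': "x \<in> Hg a b c" "y \<in> Hg a b c" "z \<in> Hg a b c" using x y z H by auto
    have yz: "gcommut GM y z \<in> Hg a b c" "gcommut GM x (gcommut GM y z) \<in> Hg a b c"
      using H' Hg_closed(2)[OF roots] by auto
    have comm_one: "gcommut GM g h = \<one>\<^bsub>GM\<^esub>" if "gcomm GM g h" "g \<in> Hg a b c" "h \<in> Hg a b c" for g h
      using GM.gcommut_eq_one_iff that subgroup.mem_carrier[OF Hg_subgroup[OF roots]] by blast
    have n: "(a + (b + c)) + (b + c) \<notin> B3_roots" "(a + (b + c)) + (b + c) \<noteq> 0"
      "(a + (b + c)) + b \<notin> B3_roots" "(a + (b + c)) + b \<noteq> 0"
      by (simp_all add: dd B3_roots_def zero_prod_def)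
    have "gcomm GM (gcommut GM x (gcommut GM y z)) (gcommut GM y z)"
      using x_gcomm[OF s(4,1) n(1,2) u(1) r(1)] by (simp only: u(2)[symmetric] r(2)[symmetric])
    from comm_one[OF this yz(2,1)]
    show "gcommut G (gcommut G x (gcommut G y z)) (gcommut G y z) = \<one>\<^bsub>G\<^esub>"
      using H' yz by (simp add: T)
    fix y' assume y': "y' \<in> Xg b"
    have "gcomm GM (gcommut GM x (gcommut GM y z)) y'"
      unfolding u(2) using y' x_gcomm[OF s(4) roots(2) n(3,4) u(1)] by (auto simp: Xg_def)
    then show "gcommut G (gcommut G x (gcommut G y z)) y' = \<one>\<^bsub>G\<^esub>"
      using H' yz y' H comm_one[of "gcommut GM x (gcommut GM y z)" y'] by (auto simp: T)
  qed
qed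

text \<open>Generation does not depend on the ambient group, so all matrices as well as the
  Chevalley group may serve.\<close>

lemma generate_chevalley:
  assumes "I \<subseteq> B3_roots"
  shows "generate (chevalley_B3 R) {root_elem R \<zeta> t | \<zeta> t. \<zeta> \<in> I \<and> t \<in> L 1} = generate GM (\<Union> (Xg ` I))"
proof -
  let ?S = "{root_elem R \<zeta> t | \<zeta> t. \<zeta> \<in> B3_roots \<and> t \<in> carrier R}"
  have S: "?S \<subseteq> carrier GM" by (auto simp: root_elem_eq)
  have eq: "{root_elem R \<zeta> t | \<zeta> t. \<zeta> \<in> I \<and> t \<in> L 1} = \<Union> (Xg ` I)"
    by (auto simp: root_elem_eq Xg_def)
  have "\<Union> (Xg ` I) \<subseteq> ?S" using assms L1 unfolding eq[symmetric] by blast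
  then have "\<Union> (Xg ` I) \<subseteq> generate GM ?S" using generate.incl by (metis (no_types, lifting) subset_iff)
  then show ?thesis
    unfolding chevalley_B3_def units_of_mat_ring[symmetric] eq
    by (intro GM.generate_consistent GM.generate_is_subgroup S)
qed

lemma link_complex_eq:
  assumes roots: "a \<in> B3_roots" "b \<in> B3_roots" "c \<in> B3_roots"
  defines "U \<equiv> \<lambda>I. generate (chevalley_B3 R) {root_elem R \<zeta> t | \<zeta> t. \<zeta> \<in> I \<and> t \<in> L 1}"
  assumes d: "distinct [a, b, c]"
  shows "(chevalley_B3 R)\<lparr>carrier := U {a, b, c}\<rparr> = LG a b c"
    and "U ({a, b, c} - {a}) = generate (LG a b c) (Xg b \<union> Xg c)"
    and "U ({a, b, c} - {b}) = generate (LG a b c) (Xg a \<union> Xg c)"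
    and "U ({a, b, c} - {c}) = generate (LG a b c) (Xg a \<union> Xg b)"
proof -
  have g: "U I = generate GM (\<Union> (Xg ` I))" if "I \<subseteq> {a, b, c}" for I
    unfolding U_def using that roots by (intro generate_chevalley) auto
  show "(chevalley_B3 R)\<lparr>carrier := U {a, b, c}\<rparr> = LG a b c"
    by (simp add: g chevalley_B3_def Hg_def[OF roots] units_of_mat_ring Un_assoc)
  have r: "{a, b, c} - {a} = {b, c}" "{a, b, c} - {b} = {a, c}" "{a, b, c} - {c} = {a, b}" using d by auto
  note H = Xg_Hg[OF roots]
  show "U ({a, b, c} - {a}) = generate (LG a b c) (Xg b \<union> Xg c)"
    "U ({a, b, c} - {b}) = generate (LG a b c) (Xg a \<union> Xg c)"
    "U ({a, b, c} - {c}) = generate (LG a b c) (Xg a \<union> Xg b)"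
    unfolding r using H by (simp_all add: g generate_LG[OF roots])
qed

end

section \<open>The field F[x]/(p) graded by the degree of polynomials\<close>

lemma (in field) five_times_zero:
  assumes "finite (carrier R)" "card (carrier R) = 5 ^ k"
  shows "\<one> \<oplus> (\<one> \<oplus> (\<one> \<oplus> (\<one> \<oplus> \<one>))) = \<zero>"
proof -
  define z where "z = [(5::nat)] \<cdot> \<one>"
  have z: "z \<in> carrier R" by (simp add: z_def)
  have pow: "z [^] n = [((5::nat) ^ n)] \<cdot> \<one>" for n :: nat
  proof (induction n)
    case (Suc n)
    have "z [^] Suc n = [((5::nat) ^ n)] \<cdot> z" using z by (simp add: Suc add_pow_ldistr)
    also have "\<dots> = [((5::nat) ^ Suc n)] \<cdot> \<one>"
      unfolding z_def using add.nat_pow_pow[of \<one> "5 ^ n" 5] by (simp add: mult.commute)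
    finally show ?case .
  qed (simp add: add_pow_def)
  \<comment> \<open>The order of the additive group annihilates 1. As a power of 5 times 1 is the
    power of 5 times 1 and a field has no nilpotent elements, 5 times 1 is zero.\<close>
  have "[((5::nat) ^ k)] \<cdot> \<one> = \<zero>"
    using group.pow_order_eq_1[OF a_group, of \<one>] assms by (simp add: Coset.order_def add_pow_def)
  then have "z [^] k = \<zero>" by (simp add: pow)
  moreover have "z [^] n \<noteq> \<zero>" if "z \<noteq> \<zero>" for n :: nat
    using that z by (induction n) (auto simp: integral_iff)
  ultimately have "z = \<zero>" by blast
  then show ?thesis by (simp add: z_def eval_nat_numeral add_pow_def a_ac nat_pow_def)
qed

lemma (in field) card_low_degree:
  assumes "finite (carrier R)"
  shows "finite {f \<in> carrier ((carrier R)[X]). degree f \<le> n}"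
    and "card {f \<in> carrier ((carrier R)[X]). degree f \<le> n} \<le> card (carrier R) ^ (n + 1)"
proof -
  let ?P = "{f \<in> carrier ((carrier R)[X]). degree f \<le> n}"
  let ?g = "\<lambda>f. restrict (coeff f) {..n}"
  have inj: "inj_on ?g ?P"
  proof (rule inj_onI)
    fix f h assume f: "f \<in> ?P" and h: "h \<in> ?P" and eq: "?g f = ?g h"
    have "coeff f i = coeff h i" for i
    proof (cases "i \<le> n")
      case True
      then show ?thesis using fun_cong[OF eq, of i] by simp
    next
      case False
      then show ?thesis using f h coeff_degree[of f i] coeff_degree[of h i] by simp
    qed
    then show "f = h" using f h coeff_iff_polynomial_cond[of "carrier R" f h]
      by (auto simp: univ_poly_carrier[symmetric])
  qed
  have sub: "?g ` ?P \<subseteq> {..n} \<rightarrow>\<^sub>E carrier R"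
  proof (intro image_subsetI)
    fix f assume "f \<in> ?P"
    then have "polynomial (carrier R) f" by (simp add: univ_poly_carrier)
    then show "?g f \<in> {..n} \<rightarrow>\<^sub>E carrier R" using poly_coeff_in_carrier[OF carrier_is_subring] by simp
  qed
  have fin: "finite ({..n} \<rightarrow>\<^sub>E carrier R)" using assms by (intro finite_PiE) auto
  show "finite ?P" using finite_subset[OF sub fin] inj by (rule finite_imageD)
  have "card ?P \<le> card ({..n} \<rightarrow>\<^sub>E carrier R)" using inj sub fin by (rule card_inj_on_le)
  then show "card ?P \<le> card (carrier R) ^ (n + 1)" by (simp add: card_PiE)
qed

text \<open>Constants embed into the quotient, as a nonzero homomorphism of fields is injective. So
  the classes of degree 0 form a copy of the base field, with inverses and with its number of
  elements.\<close>

lemma (in field) rupture_spin_matrices: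
  assumes fin: "finite (carrier R)" and card: "card (carrier R) = 5 ^ k"
    and p: "p \<in> carrier ((carrier R)[X])" "pirreducible (carrier R) p"
  shows "spin_matrices (Rupt (carrier R) p)
    (\<lambda>n. rupture_surj (carrier R) p ` {f \<in> carrier ((carrier R)[X]). degree f \<le> n})"
proof -
  let ?P = "(carrier R)[X]" and ?Q = "Rupt (carrier R) p" and ?h = "rupture_surj (carrier R) p"
  let ?D = "\<lambda>n. {f \<in> carrier ((carrier R)[X]). degree f \<le> n}"
  interpret P: domain ?P using univ_poly_is_domain[OF carrier_is_subring] .
  interpret Q: field ?Q using rupture_is_field_iff_pirreducible[OF carrier_is_subfield p(1)] p(2) by simp
  interpret h: ring_hom_ring ?P ?Q ?h using rupture_surj_hom(2)[OF carrier_is_subring p(1)] .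
  let ?c = "?h \<circ> poly_of_const"
  have "?c \<in> ring_hom R ?Q" using rupture_surj_norm_is_hom[OF carrier_is_subring p(1)] by simp
  then interpret c: ring_hom_ring R ?Q ?c by (rule ring_hom_ringI2[OF ring_axioms Q.ring_axioms])
  have "\<one>\<^bsub>?Q\<^esub> \<in> ?c ` carrier R" using c.hom_one by (metis image_eqI one_closed)
  then have "?c ` carrier R \<noteq> {\<zero>\<^bsub>?Q\<^esub>}" using Q.one_not_zero by blast
  then have c_inj: "inj_on ?c (carrier R)"
    by (rule c.non_trivial_field_hom_imp_inj[OF field_axioms])
  have const: "?D 0 = poly_of_const ` carrier R"
  proof
    show "?D 0 \<subseteq> poly_of_const ` carrier R"
    proof
      fix f assume f: "f \<in> ?D 0"
      show "f \<in> poly_of_const ` carrier R"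
      proof (cases f)
        case Nil
        then show ?thesis by (auto simp: poly_of_const_def intro!: image_eqI[of _ _ \<zero>])
      next
        case (Cons x xs)
        then have "f = [x]" "x \<in> carrier R" "x \<noteq> \<zero>" using f by (auto simp: univ_poly_carrier[symmetric] polynomial_def)
        then show ?thesis by (auto simp: poly_of_const_def intro!: image_eqI[of _ _ x])
      qed
    qed
    show "poly_of_const ` carrier R \<subseteq> ?D 0"
      by (auto simp: poly_of_const_def univ_poly_carrier[symmetric] polynomial_def)
  qed
  then have L0: "?h ` ?D 0 = ?c ` carrier R" by (simp add: image_comp)
  then have card0: "card (?h ` ?D 0) = card (carrier R)" using card_image[OF c_inj] by simp
  have add: "f \<oplus>\<^bsub>?P\<^esub> g \<in> ?D n" if "f \<in> ?D n" "g \<in> ?D n" for f g n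
    using that poly_add_degree[of f g] P.a_closed[of f g]
    by (auto simp: univ_poly_add max_def simp del: poly_add.simps split: if_splits)
  have mult: "f \<otimes>\<^bsub>?P\<^esub> g \<in> ?D (m + n)" if "f \<in> ?D m" "g \<in> ?D n" for f g m n
    using that poly_mult_degree_eq[OF carrier_is_subring, of f g]
      P.m_closed[of f g]
    by (auto simp: univ_poly_mult univ_poly_carrier split: if_splits)
  have mono: "?D m \<subseteq> ?D n" if "m \<le> n" for m n using that by auto
  have minus: "\<ominus>\<^bsub>?P\<^esub> f \<in> ?D n" if "f \<in> ?D n" for f n
    using that univ_poly_a_inv_degree[OF carrier_is_subring, of f] by simp
  show ?thesis
  proof
    show "finite spin_weights" by (rule finite_spin_weights)
    fix n
    show "?h ` ?D n \<subseteq> carrier ?Q" by auto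
    show "\<zero>\<^bsub>?Q\<^esub> \<in> ?h ` ?D n"
      using h.hom_zero by (intro image_eqI[of _ _ "\<zero>\<^bsub>?P\<^esub>"]) (auto simp: univ_poly_zero)
    show "finite (?h ` ?D n)" using card_low_degree(1)[OF fin] by blast
    show "card (?h ` ?D n) \<le> card (?h ` ?D 0) ^ (n + 1)"
      unfolding card0 using card_image_le[OF card_low_degree(1)[OF fin], of ?h n] card_low_degree(2)[OF fin, of n]
      by simp
    fix x
    show "\<ominus>\<^bsub>?Q\<^esub> x \<in> ?h ` ?D n" if x: "x \<in> ?h ` ?D n"
    proof -
      obtain f where f: "x = ?h f" "f \<in> ?D n" using x by blast
      then show ?thesis using minus[OF f(2)] by (intro image_eqI[of _ _ "\<ominus>\<^bsub>?P\<^esub> f"]) auto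
    qed
    show "\<exists>y\<in>?h ` ?D 0. y \<otimes>\<^bsub>?Q\<^esub> x = \<one>\<^bsub>?Q\<^esub>" if x: "x \<in> ?h ` ?D 0" "x \<noteq> \<zero>\<^bsub>?Q\<^esub>"
    proof -
      obtain a where a: "x = ?c a" "a \<in> carrier R" using x(1) unfolding L0 by blast
      have "a \<noteq> \<zero>" using x(2) a c.hom_zero by auto
      then have i: "inv a \<in> carrier R" "inv a \<otimes> a = \<one>" using a(2) field_Units by auto
      have "?c (inv a) \<otimes>\<^bsub>?Q\<^esub> x = \<one>\<^bsub>?Q\<^esub>"
        using c.hom_mult[OF i(1) a(2)] c.hom_one unfolding i(2) a(1) by simp
      then show ?thesis unfolding L0 using i(1) by blast
    qed
    show "x \<oplus>\<^bsub>?Q\<^esub> (x \<oplus>\<^bsub>?Q\<^esub> (x \<oplus>\<^bsub>?Q\<^esub> (x \<oplus>\<^bsub>?Q\<^esub> x))) = \<zero>\<^bsub>?Q\<^esub>" if x: "x \<in> carrier ?Q"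
    proof -
      have "x \<oplus>\<^bsub>?Q\<^esub> (x \<oplus>\<^bsub>?Q\<^esub> (x \<oplus>\<^bsub>?Q\<^esub> (x \<oplus>\<^bsub>?Q\<^esub> x))) = ?c (\<one> \<oplus> (\<one> \<oplus> (\<one> \<oplus> (\<one> \<oplus> \<one>)))) \<otimes>\<^bsub>?Q\<^esub> x"
        using x by (simp add: c.hom_add c.hom_one Q.l_distr del: comp_apply)
      then show ?thesis using x c.hom_zero unfolding five_times_zero[OF fin card] by simp
    qed
    fix y
    show "x \<oplus>\<^bsub>?Q\<^esub> y \<in> ?h ` ?D n" if xy: "x \<in> ?h ` ?D n" "y \<in> ?h ` ?D n"
    proof -
      obtain f g where f: "x = ?h f" "f \<in> ?D n" "y = ?h g" "g \<in> ?D n" using xy by blast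
      then show ?thesis using add[OF f(2,4)] by (intro image_eqI[of _ _ "f \<oplus>\<^bsub>?P\<^esub> g"]) auto
    qed
    fix m
    show "x \<otimes>\<^bsub>?Q\<^esub> y \<in> ?h ` ?D (m + n)" if xy: "x \<in> ?h ` ?D m" "y \<in> ?h ` ?D n"
    proof -
      obtain f g where f: "x = ?h f" "f \<in> ?D m" "y = ?h g" "g \<in> ?D n" using xy by blast
      then show ?thesis using mult[OF f(2,4)] by (intro image_eqI[of _ _ "f \<otimes>\<^bsub>?P\<^esub> g"]) auto
    qed
    show "?h ` ?D m \<subseteq> ?h ` ?D n" if "m \<le> n" using mono[OF that] by blast
  next
    show "\<one>\<^bsub>?Q\<^esub> \<in> ?h ` ?D 0"
      using h.hom_one P.one_closed by (intro image_eqI[of _ _ "\<one>\<^bsub>?P\<^esub>"]) (auto simp: univ_poly_one)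
  qed (use Q.one_not_zero in auto)
qed

section \<open>The uniform constant for the two families of links\<close>

lemma link_complex_expansion:
  fixes rel :: "(vec3 \<times> vec3 \<Rightarrow> 'a list set) monoid \<Rightarrow> _"
  assumes rel: "rel = lg_rel \<or> rel = sm_rel"
    and roots: "a \<in> B3_roots" "b \<in> B3_roots" "c \<in> B3_roots" "distinct [a, b, c]"
    and spin: "\<And>(R :: 'a list set ring) L. spin_matrices R L \<Longrightarrow> rel (spin_matrices.LG R L a b c)
        (spin_matrices.Xg R L a) (spin_matrices.Xg R L b) (spin_matrices.Xg R L c) \<and>
      boundedly_generated n (spin_matrices.LG R L a b c)
        (spin_matrices.Xg R L a) (spin_matrices.Xg R L b) (spin_matrices.Xg R L c)"
  shows "\<exists>\<delta>>0. \<forall>k (F :: 'a ring) p. \<forall>j\<in>{0, 1}. field F \<and> finite (carrier F) \<and> card (carrier F) = 5 ^ k \<and>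
    p \<in> carrier ((carrier F)[X]\<^bsub>F\<^esub>) \<and> pirreducible\<^bsub>F\<^esub> (carrier F) p \<longrightarrow>
    coboundary_expansion_at_least (link_complex F p {a, b, c}) (triangle_pmf (link_complex F p {a, b, c})) j \<delta>"
proof -
  \<comment> \<open>No field and no polynomial are fixed yet; the constant comes from the relations
    and the length \<open>n\<close> alone.\<close>
  obtain \<delta> where \<delta>: "\<delta> > 0" and expansion: "\<forall>G A B C (p :: vec3) q r K. \<forall>j\<in>{0, 1}.
    rel G A B C \<longrightarrow> boundedly_generated n G A B C \<longrightarrow> distinct [p, q, r] \<longrightarrow>
    K p = generate G (B \<union> C) \<longrightarrow> K q = generate G (A \<union> C) \<longrightarrow> K r = generate G (A \<union> B) \<longrightarrow>
    coboundary_expansion_at_least (coset_complex G {p, q, r} K) (triangle_pmf (coset_complex G {p, q, r} K)) j \<delta>"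
    using uniform_expansion[OF rel, of n] by (elim exE conjE) (rule that)
  show ?thesis
  proof (intro exI[of _ \<delta>] conjI \<delta> allI ballI impI, elim conjE)
    fix k and F :: "'a ring" and p and j :: int
    assume j: "j \<in> {0, 1}" and F: "field F" "finite (carrier F)" "card (carrier F) = 5 ^ k"
      and p: "p \<in> carrier ((carrier F)[X]\<^bsub>F\<^esub>)" "pirreducible\<^bsub>F\<^esub> (carrier F) p"
    interpret F: field F by fact
    let ?R = "Rupt\<^bsub>F\<^esub> (carrier F) p"
    let ?L = "\<lambda>n. F.rupture_surj (carrier F) p ` {f \<in> carrier ((carrier F)[X]\<^bsub>F\<^esub>). degree f \<le> n}"
    interpret s: spin_matrices ?R ?L using F.rupture_spin_matrices[OF F(2,3) p] .
    have lin: "?L 1 = linear_classes F p" by (auto simp: linear_classes_def)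
    have sub: "root_subgroup F p I = generate (chevalley_B3 ?R) {root_elem ?R \<zeta> t | \<zeta> t. \<zeta> \<in> I \<and> t \<in> ?L 1}" for I
      unfolding root_subgroup_def lin ..
    note eqs = s.link_complex_eq[OF roots, folded sub]
    have "link_complex F p {a, b, c} =
        coset_complex (s.LG a b c) {a, b, c} (\<lambda>\<zeta>. root_subgroup F p ({a, b, c} - {\<zeta>}))"
      unfolding link_complex_def eqs(1) ..
    then show "coboundary_expansion_at_least (link_complex F p {a, b, c}) (triangle_pmf (link_complex F p {a, b, c})) j \<delta>"
      using expansion[rule_format, of j "s.LG a b c" "s.Xg a" "s.Xg b" "s.Xg c", OF j _ _ roots(4) eqs(2-4)]
        spin[OF s.spin_matrices_axioms] by simp
  qed
qed

theorem theorem1p6: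
  shows "\<exists>\<delta>0 :: real. \<delta>0 > 0 \<and>
    (\<forall>(k :: nat) (F :: nat ring) (m :: nat) (p :: nat list).
       k \<ge> 1 \<and> field F \<and> finite (carrier F) \<and> card (carrier F) = 5 ^ k \<and>
       m \<ge> 6 \<and> p \<in> carrier ((carrier F)[X]\<^bsub>F\<^esub>) \<and> pirreducible\<^bsub>F\<^esub> (carrier F) p \<and>
       Polynomials.degree p = m \<longrightarrow>
       (\<forall>S \<in> {LB3_sm F p, LB3_lg F p}. \<forall>j \<in> {0, 1}.
          coboundary_expansion_at_least S (triangle_pmf S) j \<delta>0))"
proof -
  have roots: "root_alpha \<in> B3_roots" "root_beta \<in> B3_roots" "root_psi \<in> B3_roots" "root_omega \<in> B3_roots"
    "distinct [root_alpha, root_beta, root_psi]" "distinct [root_beta, root_psi, root_omega]"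
    by (simp_all add: B3_roots_def root_alpha_def root_beta_def root_psi_def root_omega_def)
  obtain \<delta>1 where d1: "\<delta>1 > 0" "\<And>k (F :: nat ring) p j. j \<in> {0, 1} \<Longrightarrow>
    field F \<and> finite (carrier F) \<and> card (carrier F) = 5 ^ k \<and>
    p \<in> carrier ((carrier F)[X]\<^bsub>F\<^esub>) \<and> pirreducible\<^bsub>F\<^esub> (carrier F) p \<Longrightarrow>
    coboundary_expansion_at_least (LB3_lg F p) (triangle_pmf (LB3_lg F p)) j \<delta>1"
    using link_complex_expansion[OF disjI1[OF refl] roots(1,2,3,5) conjI[OF spin_matrices.lg_spin]]
    unfolding LB3_lg_def by meson
  obtain \<delta>2 where d2: "\<delta>2 > 0" "\<And>k (F :: nat ring) p j. j \<in> {0, 1} \<Longrightarrow>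
    field F \<and> finite (carrier F) \<and> card (carrier F) = 5 ^ k \<and>
    p \<in> carrier ((carrier F)[X]\<^bsub>F\<^esub>) \<and> pirreducible\<^bsub>F\<^esub> (carrier F) p \<Longrightarrow>
    coboundary_expansion_at_least (LB3_sm F p) (triangle_pmf (LB3_sm F p)) j \<delta>2"
    using link_complex_expansion[OF disjI2[OF refl] roots(2,3,4,6) conjI[OF spin_matrices.sm_spin]]
    unfolding LB3_sm_def by meson
  show ?thesis
  proof (intro exI[of _ "min \<delta>1 \<delta>2"] conjI allI impI ballI)
    show "min \<delta>1 \<delta>2 > 0" using d1(1) d2(1) by simp
    fix k m and F :: "nat ring" and p S and j :: int
    assume h: "k \<ge> 1 \<and> field F \<and> finite (carrier F) \<and> card (carrier F) = 5 ^ k \<and>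
       m \<ge> 6 \<and> p \<in> carrier ((carrier F)[X]\<^bsub>F\<^esub>) \<and> pirreducible\<^bsub>F\<^esub> (carrier F) p \<and>
       Polynomials.degree p = m"
      and S: "S \<in> {LB3_sm F p, LB3_lg F p}" and j: "j \<in> {0, 1}"
    have "coboundary_expansion_at_least (LB3_lg F p) (triangle_pmf (LB3_lg F p)) j \<delta>1"
      "coboundary_expansion_at_least (LB3_sm F p) (triangle_pmf (LB3_sm F p)) j \<delta>2"
      using d1(2)[OF j, of F k p] d2(2)[OF j, of F k p] h by blast+
    then show "coboundary_expansion_at_least S (triangle_pmf S) j (min \<delta>1 \<delta>2)"
      using S by (auto intro: coboundary_expansion_mono)
  qed
qed

end
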